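(* Assume: (D-a) $(U_1,X_1),\dots,(U_n,X_n)$ are independent draws from a random vector $(U,X)\in L^2[0,1]\times L^2[0,1]$ with $\mathbb{E}\|U\|^8<\infty$, and there exists $\varrho>0$ such that $\mathbb{E}[\exp(\varrho\|X\|)]<\infty$. (D-b) For any $p\ge1$ and any $\gamma\in\mathcal{S}^p$, the distribution function $F_\gamma$ is continuous. (D-c) There exist $\underline{\sigma}^2,C_1,C_2>0$ and $\nu>2$ such that (i) $0<\underline{\sigma}^2\le\mathbb{E}(\langle U_1,U_2\rangle^2\,\mathbb{I}_{\{|\langle U_1,U_2\rangle|\le C_1\}}\mid X_1,X_2)$ a.s.; (ii) $\mathbb{E}[\|U\|^\nu\mid X]\le C_2$. (D-d) For any $p\ge1$, $\gamma_0^{(p)}\in B_p\subset\mathcal{S}^p$, the $B_p$ are open subsets of $\mathcal{S}^p$, and $B_p\times 0_{p'-p}\subset B_{p'}$ for all $1\le p<p'$, where $0_k$ is the null vector of $\mathbb{R}^k$. (K-a) The kernel $K$ is a continuous density on the real line with $K(x)=K(-x)$, $K$ is non-increasing on $[0,\infty)$, and the Fourier transform of $K$ is integrable. (K-b) $h\to0$ and $nh^2\to\infty$. (K-c) $p\ge1$ increases to infinity with $n$ and there exists a constant $\lambda>0$ such that $p\ln^{-\lambda}n$ is bounded. Let $\alpha_n$, $n\ge1$, be a positive sequence such that $\alpha_np^{-1}\ln^{-1}n\to\infty$. If $\mathbb{E}(U\mid X)=0$ a.s., then the test statistic $T_n$ converges in law to a standard normal variable. Consequently, the test given by $\mathbb{I}(T_n\ge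 z_{1-a})$, with $z_{1-a}$ the $(1-a)$-quantile of the standard normal distribution, has asymptotic level $a$.
   Context: $\langle\cdot,\cdot\rangle$, $\|\cdot\|$: inner product and norm of $L^2[0,1]$. $\{\psi_1,\psi_2,\dots\}$ is a fixed orthonormal basis of $L^2[0,1]$. It is supposed (normalization) that $\mathbb{E}[X(t)]=0$ for all $t$. $\mathcal{S}^p=\{\gamma\in\mathbb{R}^p:\|\gamma\|=1\}$. For $\gamma\in\mathbb{R}^p$, $\langle X,\gamma\rangle=\sum_{j=1}^p\langle X,\psi_j\rangle\gamma_j$, $F_\gamma$ is the distribution function of $\langle X,\gamma\rangle$, and $F_{\gamma,n}$ is the empirical distribution function of $\langle X_1,\gamma\rangle,\dots,\langle X_n,\gamma\rangle$; ties are broken by comparing indices (if $\langle X_i,\gamma\rangle=\langle X_j,\gamma\rangle$ and $i<j$, then $F_{\gamma,n}(\langle X_i,\gamma\rangle)<F_{\gamma,n}(\langle X_j,\gamma\rangle)$), so the values $F_{\gamma,n}(\langle X_i,\gamma\rangle)$, $1\le i\le n$, are a permutation of $1/n,\dots,n/n$. The bandwidth $h=h_n>0$ and dimension $p=p_n$ depend on $n$; $K_h(\cdot)=K(\cdot/h)$. For $\gamma\in\mathcal{S}^p$, $$Q_n(\gamma)=\frac{1}{n(n-1)}\sum_{1\le i\ne j\le n}\langle U_i,U_j\rangle\frac1hK_h\big(F_{\gamma,n}(\langle X_i,\gamma\rangle)-F_{\gamma,n}(\langle X_j,\gamma\rangle)\big),$$ $$\widehat v_n^2(\gamma)=\frac{2}{n(n-1)h}\sum_{j\ne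 i}\langle U_i,U_j\rangle^2K_h^2\big(F_{\gamma,n}(\langle X_i,\gamma\rangle)-F_{\gamma,n}(\langle X_j,\gamma\rangle)\big).$$ A sequence $(b_{01},b_{02},\dots)$ of reals with $\sum_jb_{0j}^2<\infty$ is fixed, and for $p$ with $\sum_{j=1}^pb_{0j}^2>0$ (which holds for the $p$ considered), $\gamma_0^{(p)}=(b_{01},\dots,b_{0p})/\|(b_{01},\dots,b_{0p})\|\in\mathcal{S}^p$. The selected direction and test statistic are $$\widehat\gamma_n=\arg\max_{\gamma\in B_p}\Big[nh^{1/2}Q_n(\gamma)/\widehat v_n(\gamma)-\alpha_n\mathbb{I}_{\{\gamma\ne\gamma_0^{(p)}\}}\Big],\qquad T_n=nh^{1/2}\frac{Q_n(\widehat\gamma_n)}{\widehat v_n(\widehat\gamma_n)}.$$ *)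

theory Defs
  imports "HOL-Probability.Probability"
begin

section \<open>The Hilbert space $L^2[0,1]$\<close>

text \<open>Lebesgue measure on $[0,1]$, carried by the Borel sets. Every Lebesgue measurable function
  agrees almost everywhere with a Borel measurable one, so the space of classes is the usual one.\<close>

abbreviation unit_interval_measure :: "real measure" where
  "unit_interval_measure \<equiv> restrict_space lborel {0..1}"

definition square_integrable :: "(real \<Rightarrow> real) \<Rightarrow> bool" where
  "square_integrable f \<longleftrightarrow>
     f \<in> borel_measurable unit_interval_measure \<and> integrable unit_interval_measure (\<lambda>t. (f t)\<^sup>2)"

definition L2_eq :: "(real \<Rightarrow> real) \<Rightarrow> (real \<Rightarrow> real) \<Rightarrow> bool" where
  "L2_eq f g \<longleftrightarrow> square_integrable f \<and> square_integrable g \<and>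
     (AE t in unit_interval_measure. f t = g t)"

lemma square_integrable_measurable [measurable_dest]:
  "square_integrable f \<Longrightarrow> f \<in> borel_measurable unit_interval_measure"
  by (simp add: square_integrable_def)

lemma square_integrable_const [simp]: "square_integrable (\<lambda>_. c)"
proof -
  have "finite_measure unit_interval_measure"
    by (rule finite_measureI) (simp add: emeasure_restrict_space space_restrict_space)
  then show ?thesis
    by (simp add: square_integrable_def finite_measure.integrable_const)
qed

lemma square_integrable_mult_integrable:
  assumes "square_integrable f" "square_integrable g"
  shows "integrable unit_interval_measure (\<lambda>t. f t * g t)"
proof (rule Bochner_Integration.integrable_bound)
  show "integrable unit_interval_measure (\<lambda>t. (f t)\<^sup>2 + (g t)\<^sup>2)"
    using assms by (simp add: square_integrable_def)
  show "(\<lambda>t. f t * g t) \<in> borel_measurable unit_interval_measure"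
    using assms by measurable
  show "AE t in unit_interval_measure. norm (f t * g t) \<le> norm ((f t)\<^sup>2 + (g t)\<^sup>2)"
  proof (rule AE_I2)
    fix t
    have "2 * (\<bar>f t\<bar> * \<bar>g t\<bar>) \<le> \<bar>f t\<bar>\<^sup>2 + \<bar>g t\<bar>\<^sup>2"
      using sum_squares_bound[of "\<bar>f t\<bar>" "\<bar>g t\<bar>"] by (simp add: mult.assoc)
    moreover have "0 \<le> \<bar>f t\<bar> * \<bar>g t\<bar>" by simp
    ultimately have "\<bar>f t\<bar> * \<bar>g t\<bar> \<le> (f t)\<^sup>2 + (g t)\<^sup>2"
      unfolding power2_abs by linarith
    then show "norm (f t * g t) \<le> norm ((f t)\<^sup>2 + (g t)\<^sup>2)"
      by (simp add: abs_mult)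
  qed
qed

lemma square_integrable_add:
  assumes "square_integrable f" "square_integrable g"
  shows "square_integrable (\<lambda>t. f t + g t)"
  using assms square_integrable_mult_integrable[OF assms]
  by (auto simp: square_integrable_def power2_sum mult.assoc)

lemma square_integrable_cmult:
  "square_integrable f \<Longrightarrow> square_integrable (\<lambda>t. c * f t)"
  by (auto simp: square_integrable_def power_mult_distrib)

lemma square_integrable_uminus:
  "square_integrable f \<Longrightarrow> square_integrable (\<lambda>t. - f t)"
  by (auto simp: square_integrable_def)

lemma square_integrable_diff:
  "square_integrable f \<Longrightarrow> square_integrable g \<Longrightarrow> square_integrable (\<lambda>t. f t - g t)"
  using square_integrable_add[OF _ square_integrable_uminus[of g]] by simp

lemma square_integrable_bound:
  assumes "square_integrable g" "f \<in> borel_measurable unit_interval_measure"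
    and "AE t in unit_interval_measure. \<bar>f t\<bar> \<le> \<bar>g t\<bar>"
  shows "square_integrable f"
  unfolding square_integrable_def
proof
  show "integrable unit_interval_measure (\<lambda>t. (f t)\<^sup>2)"
  proof (rule Bochner_Integration.integrable_bound)
    show "integrable unit_interval_measure (\<lambda>t. (g t)\<^sup>2)"
      using assms by (simp add: square_integrable_def)
    show "(\<lambda>t. (f t)\<^sup>2) \<in> borel_measurable unit_interval_measure"
      using assms by measurable
    show "AE t in unit_interval_measure. norm ((f t)\<^sup>2) \<le> norm ((g t)\<^sup>2)"
      using assms(3) by eventually_elim (simp add: abs_le_square_iff)
  qed
qed fact

quotient_type L2 = "real \<Rightarrow> real" / partial: L2_eq
proof (rule part_equivpI)
  show "\<exists>f. L2_eq f f"
    by (rule exI[of _ "\<lambda>_. 0"]) (simp add: L2_eq_def)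
  show "symp L2_eq"
    by (auto simp: symp_def L2_eq_def)
  show "transp L2_eq"
    by (auto simp: transp_def L2_eq_def elim: eventually_elim2)
qed

instantiation L2 :: real_inner
begin

lift_definition zero_L2 :: L2 is "\<lambda>_. 0"
  by (simp add: L2_eq_def)

lift_definition plus_L2 :: "L2 \<Rightarrow> L2 \<Rightarrow> L2" is "\<lambda>f g t. f t + g t"
  by (auto simp: L2_eq_def intro: square_integrable_add elim: eventually_elim2)

lift_definition minus_L2 :: "L2 \<Rightarrow> L2 \<Rightarrow> L2" is "\<lambda>f g t. f t - g t"
  by (auto simp: L2_eq_def intro: square_integrable_diff elim: eventually_elim2)

lift_definition uminus_L2 :: "L2 \<Rightarrow> L2" is "\<lambda>f t. - f t"
  by (auto simp: L2_eq_def intro: square_integrable_uminus)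

lift_definition scaleR_L2 :: "real \<Rightarrow> L2 \<Rightarrow> L2" is "\<lambda>c f t. c * f t"
  by (auto simp: L2_eq_def intro: square_integrable_cmult elim: eventually_mono)

lift_definition inner_L2 :: "L2 \<Rightarrow> L2 \<Rightarrow> real" is
  "\<lambda>f g. \<integral>t. f t * g t \<partial>unit_interval_measure"
  by (rule integral_cong_AE) (auto simp: L2_eq_def square_integrable_measurable elim: eventually_elim2)

definition norm_L2 :: "L2 \<Rightarrow> real" where
  "norm_L2 x = sqrt (inner x x)"

definition sgn_L2 :: "L2 \<Rightarrow> L2" where
  "sgn_L2 x = inverse (norm x) *\<^sub>R x"

definition dist_L2 :: "L2 \<Rightarrow> L2 \<Rightarrow> real" where
  "dist_L2 x y = norm (x - y)"

definition [code del]: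
  "(uniformity :: (L2 \<times> L2) filter) = (INF e\<in>{0<..}. principal {(x, y). dist x y < e})"

definition [code del]:
  "open (S :: L2 set) \<longleftrightarrow> (\<forall>x\<in>S. \<forall>\<^sub>F (x', y) in uniformity. x' = x \<longrightarrow> y \<in> S)"

instance
proof
  fix x y z :: L2 and a b :: real
  show "x + y + z = x + (y + z)"
    by transfer (auto simp: L2_eq_def add.assoc intro!: square_integrable_add)
  show "x + y = y + x"
    by transfer (auto simp: L2_eq_def add.commute intro!: square_integrable_add)
  show "0 + x = x"
    by transfer (auto simp: L2_eq_def)
  show "- x + x = 0"
    by transfer (auto simp: L2_eq_def)
  show "x - y = x + - y"
    by transfer (auto simp: L2_eq_def intro: square_integrable_diff)
  show "a *\<^sub>R (x + y) = a *\<^sub>R x + a *\<^sub>R y"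
    by transfer (auto simp: L2_eq_def distrib_left intro!: square_integrable_add square_integrable_cmult)
  show "(a + b) *\<^sub>R x = a *\<^sub>R x + b *\<^sub>R x"
    by transfer (auto simp: L2_eq_def distrib_right intro!: square_integrable_add square_integrable_cmult)
  show "a *\<^sub>R b *\<^sub>R x = (a * b) *\<^sub>R x"
    by transfer (auto simp: L2_eq_def mult.assoc intro!: square_integrable_cmult)
  show "1 *\<^sub>R x = x"
    by transfer (auto simp: L2_eq_def)
  show "inner x y = inner y x"
    by transfer (simp add: mult.commute)
  show "inner (x + y) z = inner x z + inner y z"
    by transfer (simp add: L2_eq_def distrib_right square_integrable_mult_integrable)
  show "inner (a *\<^sub>R x) y = a * inner x y"
    by transfer (simp add: mult.assoc)
  show "0 \<le> inner x x"
    by transfer simp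
  show "inner x x = 0 \<longleftrightarrow> x = 0"
    by transfer
      (auto simp: L2_eq_def integral_nonneg_eq_0_iff_AE square_integrable_mult_integrable)
qed (simp_all add: norm_L2_def sgn_L2_def dist_L2_def uniformity_L2_def open_L2_def)

end


subsection \<open>Completeness and separability\<close>

lemma ex_rep_L2: "\<exists>f. square_integrable f \<and> x = abs_L2 f"
  by (metis L2_eq_def Quotient3_L2 Quotient3_def)

lemma abs_L2_eqI:
  assumes "square_integrable f" "square_integrable g" "AE t in unit_interval_measure. f t = g t"
  shows "abs_L2 f = abs_L2 g"
  using assms by (metis L2_eq_def Quotient3_L2 Quotient3_rel)

lemma abs_L2_arith:
  assumes "square_integrable f" "square_integrable g"
  shows "abs_L2 f + abs_L2 g = abs_L2 (\<lambda>t. f t + g t)"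
    and "abs_L2 f - abs_L2 g = abs_L2 (\<lambda>t. f t - g t)"
    and "c *\<^sub>R abs_L2 f = abs_L2 (\<lambda>t. c * f t)"
    and "inner (abs_L2 f) (abs_L2 g) = (\<integral>t. f t * g t \<partial>unit_interval_measure)"
  using assms
  by (auto simp: plus_L2.abs_eq minus_L2.abs_eq scaleR_L2.abs_eq inner_L2.abs_eq L2_eq_def)

lemma norm_abs_L2:
  assumes "square_integrable f"
  shows "(norm (abs_L2 f))\<^sup>2 = (\<integral>t. (f t)\<^sup>2 \<partial>unit_interval_measure)"
  unfolding power2_norm_eq_inner abs_L2_arith(4)[OF assms assms] by (simp add: power2_eq_square)

lemma norm_abs_L2_nn:
  assumes "square_integrable f"
  shows "ennreal ((norm (abs_L2 f))\<^sup>2) = (\<integral>\<^sup>+t. ennreal ((f t)\<^sup>2) \<partial>unit_interval_measure)"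
  using assms by (simp add: norm_abs_L2 nn_integral_eq_integral square_integrable_def)

lemma tendsto_abs_L2:
  assumes g: "square_integrable g"
    and [measurable]: "\<And>k. f k \<in> borel_measurable unit_interval_measure"
    and [measurable]: "f' \<in> borel_measurable unit_interval_measure"
    and bound: "\<And>k. AE t in unit_interval_measure. \<bar>f k t\<bar> \<le> \<bar>g t\<bar>"
    and lim: "AE t in unit_interval_measure. (\<lambda>k. f k t) \<longlonglongrightarrow> f' t"
  shows "(\<lambda>k. abs_L2 (f k)) \<longlonglongrightarrow> abs_L2 f'"
proof -
  have fk: "square_integrable (f k)" for k
    by (rule square_integrable_bound[OF g _ bound]) measurable
  have "AE t in unit_interval_measure. \<forall>k. \<bar>f k t\<bar> \<le> \<bar>g t\<bar>"
    using bound by (simp add: AE_all_countable)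
  then have bound': "AE t in unit_interval_measure. \<bar>f' t\<bar> \<le> \<bar>g t\<bar>"
    using lim
    by eventually_elim (rule LIMSEQ_le_const2[OF tendsto_rabs], auto)
  have f': "square_integrable f'"
    by (rule square_integrable_bound[OF g _ bound']) measurable
  have "(\<lambda>k. \<integral>t. (f k t - f' t)\<^sup>2 \<partial>unit_interval_measure) \<longlonglongrightarrow>
      (\<integral>t. 0 \<partial>unit_interval_measure)"
  proof (rule integral_dominated_convergence)
    show "integrable unit_interval_measure (\<lambda>t. (2 * g t)\<^sup>2)"
      using square_integrable_cmult[OF g, of 2] by (simp add: square_integrable_def)
    show "AE t in unit_interval_measure. (\<lambda>k. (f k t - f' t)\<^sup>2) \<longlonglongrightarrow> 0"
      using lim by eventually_elim (auto intro!: tendsto_eq_intros)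
    show "AE t in unit_interval_measure. norm ((f k t - f' t)\<^sup>2) \<le> (2 * g t)\<^sup>2" for k
      using bound[of k] bound'
    proof eventually_elim
      fix t assume "\<bar>f k t\<bar> \<le> \<bar>g t\<bar>" "\<bar>f' t\<bar> \<le> \<bar>g t\<bar>"
      then have "\<bar>f k t - f' t\<bar> \<le> \<bar>2 * g t\<bar>" by (simp add: abs_mult)
      then show "norm ((f k t - f' t)\<^sup>2) \<le> (2 * g t)\<^sup>2"
        by (simp only: abs_le_square_iff) simp
    qed
  qed simp_all
  then have "(\<lambda>k. (norm (abs_L2 (f k) - abs_L2 f'))\<^sup>2) \<longlonglongrightarrow> 0"
    by (simp add: abs_L2_arith fk f' norm_abs_L2 square_integrable_diff)
  then have "(\<lambda>k. sqrt ((norm (abs_L2 (f k) - abs_L2 f'))\<^sup>2)) \<longlonglongrightarrow> sqrt 0"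
    by (rule tendsto_real_sqrt)
  then have "(\<lambda>k. norm (abs_L2 (f k) - abs_L2 f')) \<longlonglongrightarrow> 0"
    by simp
  then show ?thesis
    by (simp add: tendsto_norm_zero_iff LIM_zero_iff)
qed

lemma integral_abs_le_norm_L2:
  assumes f: "square_integrable f"
  shows "(\<integral>\<^sup>+t. ennreal \<bar>f t\<bar> \<partial>unit_interval_measure) \<le> ennreal (norm (abs_L2 f))"
proof -
  have af: "square_integrable (\<lambda>t. \<bar>f t\<bar>)"
    using f by (auto simp: square_integrable_def)
  have int: "integrable unit_interval_measure (\<lambda>t. \<bar>f t\<bar>)"
    using square_integrable_mult_integrable[OF af square_integrable_const[of 1]] by simp
  have "(\<integral>\<^sup>+t. ennreal \<bar>f t\<bar> \<partial>unit_interval_measure) =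
      ennreal (\<integral>t. \<bar>f t\<bar> * 1 \<partial>unit_interval_measure)"
    using int by (simp add: nn_integral_eq_integral)
  also have "\<dots> = ennreal (inner (abs_L2 (\<lambda>t. \<bar>f t\<bar>)) (abs_L2 (\<lambda>_. 1)))"
    using af by (simp only: abs_L2_arith square_integrable_const)
  also have "\<dots> \<le> ennreal (norm (abs_L2 (\<lambda>t. \<bar>f t\<bar>)) * norm (abs_L2 (\<lambda>_. 1)))"
    by (intro ennreal_leI norm_cauchy_schwarz)
  also have "norm (abs_L2 (\<lambda>_. 1)) = 1"
  proof -
    have "(norm (abs_L2 (\<lambda>_. 1)))\<^sup>2 = measure unit_interval_measure (space unit_interval_measure)"
      by (subst norm_abs_L2) simp_all
    also have "\<dots> = 1"
      by (simp add: measure_restrict_space space_restrict_space)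
    finally show ?thesis
      using power2_eq_imp_eq[of "norm (abs_L2 (\<lambda>_. 1))" 1] by simp
  qed
  also have "norm (abs_L2 (\<lambda>t. \<bar>f t\<bar>)) = norm (abs_L2 f)"
    by (rule power2_eq_imp_eq) (use af f in \<open>simp_all add: norm_abs_L2\<close>)
  finally show ?thesis by simp
qed

instance L2 :: complete_space
proof
  fix X :: "nat \<Rightarrow> L2"
  assume X: "Cauchy X"
  have "\<exists>N. \<forall>m\<ge>N. \<forall>n\<ge>N. norm (X m - X n) < (1/2)^k" for k
    using CauchyD[OF X, of "(1/2)^k"] by simp
  then obtain N where N: "\<And>k m n. N k \<le> m \<Longrightarrow> N k \<le> n \<Longrightarrow> norm (X m - X n) < (1/2)^k"
    by metis
  define r where "r k = k + (\<Sum>i\<le>k. N i)" for k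
  have r: "strict_mono r"
    by (rule strict_monoI_Suc) (simp add: r_def)
  have rN: "N k \<le> r k" for k
    using member_le_sum[of k "{..k}" N] by (simp add: r_def trans_le_add2)
  have rd: "norm (X (r m) - X (r k)) < (1/2)^k" if "k \<le> m" for k m
  proof (rule N[OF _ rN])
    have "r k \<le> r m" using r that by (simp add: strict_mono_less_eq)
    with rN[of k] show "N k \<le> r m" by simp
  qed
  have "\<forall>k. \<exists>f. square_integrable f \<and> X (r k) = abs_L2 f"
    using ex_rep_L2 by blast
  then obtain f where f: "\<And>k. square_integrable (f k)" and Xf: "\<And>k. X (r k) = abs_L2 (f k)"
    by metis
  have [measurable]: "f k \<in> borel_measurable unit_interval_measure" for k
    using f by measurable
  have "(\<integral>\<^sup>+t. (\<Sum>k. ennreal \<bar>f (Suc k) t - f k t\<bar>) \<partial>unit_interval_measure) =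
      (\<Sum>k. \<integral>\<^sup>+t. ennreal \<bar>f (Suc k) t - f k t\<bar> \<partial>unit_interval_measure)"
    by (rule nn_integral_suminf) measurable
  also have "\<dots> \<le> (\<Sum>k. ennreal ((1/2)^k))"
  proof (rule suminf_le)
    fix k
    have "(\<integral>\<^sup>+t. ennreal \<bar>f (Suc k) t - f k t\<bar> \<partial>unit_interval_measure) \<le>
        ennreal (norm (abs_L2 (\<lambda>t. f (Suc k) t - f k t)))"
      by (rule integral_abs_le_norm_L2) (intro square_integrable_diff f)
    also have "\<dots> = ennreal (norm (X (r (Suc k)) - X (r k)))"
      by (simp add: Xf abs_L2_arith f)
    also have "\<dots> \<le> ennreal ((1/2)^k)"
      by (rule ennreal_leI) (use rd[of k "Suc k"] in simp)
    finally show "(\<integral>\<^sup>+t. ennreal \<bar>f (Suc k) t - f k t\<bar> \<partial>unit_interval_measure) \<le> ennreal ((1/2)^k)" .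
  qed simp_all
  also have "\<dots> = ennreal (\<Sum>k. (1/2)^k)"
    by (rule suminf_ennreal2) (simp_all add: summable_geometric)
  also have "\<dots> < \<infinity>" by simp
  finally have "AE t in unit_interval_measure. (\<Sum>k. ennreal \<bar>f (Suc k) t - f k t\<bar>) \<noteq> \<infinity>"
    by (intro nn_integral_PInf_AE) auto
  then have conv: "AE t in unit_interval_measure. convergent (\<lambda>k. f k t)"
  proof eventually_elim
    fix t assume "(\<Sum>k. ennreal \<bar>f (Suc k) t - f k t\<bar>) \<noteq> \<infinity>"
    then have "summable (\<lambda>k. \<bar>f (Suc k) t - f k t\<bar>)"
      by (intro summable_suminf_not_top) auto
    then have "summable (\<lambda>k. f (Suc k) t - f k t)"
      by (rule summable_rabs_cancel)
    then have "convergent (\<lambda>n. (\<Sum>k<n. f (Suc k) t - f k t))"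
      by (simp add: summable_iff_convergent)
    then have "convergent (\<lambda>n. f n t - f 0 t)"
      by (simp only: sum_lessThan_telescope[of "\<lambda>k. f k t"])
    then have "convergent (\<lambda>n. (f n t - f 0 t) + f 0 t)"
      by (intro convergent_add convergent_const)
    then show "convergent (\<lambda>k. f k t)" by simp
  qed
  define F where "F t = lim (\<lambda>k. f k t)" for t
  have [measurable]: "F \<in> borel_measurable unit_interval_measure"
    unfolding F_def by measurable
  have bd: "(\<integral>\<^sup>+t. ennreal ((F t - f k t)\<^sup>2) \<partial>unit_interval_measure) \<le> ennreal (((1/2)^k)\<^sup>2)" for k
  proof -
    have "(\<integral>\<^sup>+t. ennreal ((F t - f k t)\<^sup>2) \<partial>unit_interval_measure) =
        (\<integral>\<^sup>+t. liminf (\<lambda>m. ennreal ((f m t - f k t)\<^sup>2)) \<partial>unit_interval_measure)"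
    proof (rule nn_integral_cong_AE)
      show "AE t in unit_interval_measure.
          ennreal ((F t - f k t)\<^sup>2) = liminf (\<lambda>m. ennreal ((f m t - f k t)\<^sup>2))"
        using conv
      proof eventually_elim
        fix t assume "convergent (\<lambda>k. f k t)"
        then have "(\<lambda>k. f k t) \<longlonglongrightarrow> F t"
          by (simp add: convergent_LIMSEQ_iff F_def)
        then have "(\<lambda>m. ennreal ((f m t - f k t)\<^sup>2)) \<longlonglongrightarrow> ennreal ((F t - f k t)\<^sup>2)"
          by (intro tendsto_intros tendsto_ennrealI)
        then show "ennreal ((F t - f k t)\<^sup>2) = liminf (\<lambda>m. ennreal ((f m t - f k t)\<^sup>2))"
          by (intro lim_imp_Liminf[symmetric]) auto
      qed
    qed
    also have "\<dots> \<le> liminf (\<lambda>m. \<integral>\<^sup>+t. ennreal ((f m t - f k t)\<^sup>2) \<partial>unit_interval_measure)"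
      by (rule nn_integral_liminf) measurable
    also have "\<dots> = liminf (\<lambda>m. ennreal ((norm (X (r m) - X (r k)))\<^sup>2))"
      by (simp add: Xf abs_L2_arith f norm_abs_L2_nn square_integrable_diff)
    also have "\<dots> \<le> liminf (\<lambda>m. ennreal (((1/2)^k)\<^sup>2))"
    proof (rule Liminf_mono)
      show "\<forall>\<^sub>F m in sequentially. ennreal ((norm (X (r m) - X (r k)))\<^sup>2) \<le> ennreal (((1/2)^k)\<^sup>2)"
        using eventually_ge_at_top[of k]
      proof eventually_elim
        fix m assume "k \<le> m"
        from rd[OF this] show "ennreal ((norm (X (r m) - X (r k)))\<^sup>2) \<le> ennreal (((1/2)^k)\<^sup>2)"
          by (intro ennreal_leI power_mono) auto
      qed
    qed
    finally show ?thesis by (simp add: Liminf_const)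
  qed
  have Ff: "square_integrable (\<lambda>t. F t - f k t)" for k
    unfolding square_integrable_def
  proof
    show "integrable unit_interval_measure (\<lambda>t. (F t - f k t)\<^sup>2)"
    proof (rule integrableI_nonneg)
      show "(\<integral>\<^sup>+t. ennreal ((F t - f k t)\<^sup>2) \<partial>unit_interval_measure) < \<infinity>"
        using bd[of k] by (rule order_le_less_trans) simp
    qed simp_all
  qed measurable
  have F: "square_integrable F"
    using square_integrable_add[OF Ff[of 0] f[of 0]] by simp
  have "norm (abs_L2 F - X (r k)) \<le> (1/2)^k" for k
  proof -
    have "ennreal ((norm (abs_L2 F - X (r k)))\<^sup>2) \<le> ennreal (((1/2)^k)\<^sup>2)"
      using bd[of k] by (simp add: Xf abs_L2_arith F f norm_abs_L2_nn Ff)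
    then have "(norm (abs_L2 F - X (r k)))\<^sup>2 \<le> ((1/2)^k)\<^sup>2"
      by (subst (asm) ennreal_le_iff) simp_all
    then show ?thesis
      by (rule power2_le_imp_le) simp
  qed
  then have lim: "\<forall>k. norm (X (r k) - abs_L2 F) \<le> (1/2)^k"
    by (simp only: norm_minus_commute simp_thms)
  have "(\<lambda>k. X (r k) - abs_L2 F) \<longlonglongrightarrow> 0"
  proof (rule Lim_null_comparison)
    show "\<forall>\<^sub>F k in sequentially. norm (X (r k) - abs_L2 F) \<le> (1/2)^k"
      using lim by (intro eventuallyI) simp
    show "(\<lambda>k. (1/2)^k :: real) \<longlonglongrightarrow> 0"
      by (rule LIMSEQ_power_zero) simp
  qed
  then have "(X \<circ> r) \<longlonglongrightarrow> abs_L2 F"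
    by (simp only: LIM_zero_iff comp_def)
  then show "convergent X"
    using Cauchy_converges_subseq[OF X r] by (auto simp: convergent_def)
qed

instance L2 :: banach ..

instance L2 :: second_countable_topology
proof
  define e where "e a = abs_L2 (indicator {..a})" for a :: real
  define comb where "comb l = (\<Sum>(c, a)\<leftarrow>l. real_of_rat c *\<^sub>R e (real_of_rat a))" for l :: "(rat \<times> rat) list"
  define D where "D = range comb"
  have "countable D"
    unfolding D_def by (rule countable_image) simp
  have sqA: "square_integrable (indicator A)" if "A \<in> sets borel" for A
    by (rule square_integrable_bound[OF square_integrable_const[of 1]])
      (use that in \<open>auto simp: measurable_restrict_space1 split: split_indicator\<close>)

  have add_D: "x + y \<in> D" if "x \<in> D" "y \<in> D" for x y
  proof -
    obtain l l' where "x = comb l" "y = comb l'" using \<open>x \<in> D\<close> \<open>y \<in> D\<close> by (auto simp: D_def)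
    then have "x + y = comb (l @ l')" by (simp add: comb_def)
    then show ?thesis by (simp add: D_def)
  qed
  have scale_D: "real_of_rat q *\<^sub>R x \<in> D" if "x \<in> D" for q x
  proof -
    obtain l where "x = comb l" using \<open>x \<in> D\<close> by (auto simp: D_def)
    moreover have "real_of_rat q *\<^sub>R comb l = comb (map (\<lambda>(c, a). (q * c, a)) l)"
      by (induction l) (auto simp: comb_def scaleR_add_right of_rat_mult)
    ultimately show ?thesis by (simp add: D_def)
  qed
  define V where "V = closure D"
  have add_V: "x + y \<in> V" if x: "x \<in> V" and y: "y \<in> V" for x y
  proof -
    obtain X where X: "\<And>n. X n \<in> D" "X \<longlonglongrightarrow> x"
      using x unfolding V_def closure_sequential by blast
    obtain Y where Y: "\<And>n. Y n \<in> D" "Y \<longlonglongrightarrow> y"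
      using y unfolding V_def closure_sequential by blast
    from X Y show ?thesis
      unfolding V_def closure_sequential
      by (intro exI[of _ "\<lambda>n. X n + Y n"]) (auto intro: add_D tendsto_add)
  qed
  have scale_V: "c *\<^sub>R x \<in> V" if x: "x \<in> V" for c x
  proof -
    obtain X where X: "\<And>n. X n \<in> D" "X \<longlonglongrightarrow> x"
      using x unfolding V_def closure_sequential by blast
    have "\<forall>n. \<exists>q. c < real_of_rat q \<and> real_of_rat q < c + 1 / real (Suc n)"
      by (intro allI of_rat_dense) simp
    then obtain q where q: "\<And>n. c < real_of_rat (q n)" "\<And>n. real_of_rat (q n) < c + 1 / real (Suc n)"
      by metis
    have "(\<lambda>n. c + 1 / real (Suc n)) \<longlonglongrightarrow> c + 0"
      by (intro tendsto_add tendsto_const LIMSEQ_Suc[OF lim_1_over_n])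
    then have lim: "(\<lambda>n. c + 1 / real (Suc n)) \<longlonglongrightarrow> c"
      by simp
    have "(\<lambda>n. real_of_rat (q n)) \<longlonglongrightarrow> c"
    proof (rule tendsto_sandwich[OF _ _ tendsto_const lim])
      show "\<forall>\<^sub>F n in sequentially. c \<le> real_of_rat (q n)"
        using q(1) by (simp add: less_imp_le)
      show "\<forall>\<^sub>F n in sequentially. real_of_rat (q n) \<le> c + 1 / real (Suc n)"
        by (rule always_eventually) (metis q(2) less_imp_le)
    qed
    then show ?thesis
      unfolding V_def closure_sequential
      by (intro exI[of _ "\<lambda>n. real_of_rat (q n) *\<^sub>R X n"]) (auto intro: scale_D tendsto_scaleR X)
  qed
  have diff_V: "x - y \<in> V" if x: "x \<in> V" and y: "y \<in> V" for x y
    using add_V[OF x scale_V[OF y, of "-1"]] by simp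
  have lim_V: "x \<in> V" if "\<And>n. X n \<in> V" "X \<longlonglongrightarrow> x" for X x
    using closed_sequentially[of V X x] that by (simp add: V_def)
  have zero_V: "0 \<in> V"
  proof -
    have "comb [] \<in> D" by (simp add: D_def)
    then show ?thesis using closure_subset[of D] by (auto simp: comb_def V_def)
  qed
  have sum_V: "(\<Sum>i\<in>I. X i) \<in> V" if "\<And>i. i \<in> I \<Longrightarrow> X i \<in> V" for I and X :: "'i \<Rightarrow> L2"
    using that by (induction I rule: infinite_finite_induct) (auto intro: add_V zero_V)
  have ind_lim: "abs_L2 (indicator A) \<in> V"
    if A: "A \<in> sets borel" and "\<And>k. B k \<in> sets borel" "\<And>k. abs_L2 (indicator (B k)) \<in> V"
      and "\<And>t. (\<lambda>k. indicator (B k) t :: real) \<longlonglongrightarrow> indicator A t" for A B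
  proof (rule lim_V)
    show "(\<lambda>k. abs_L2 (indicator (B k))) \<longlonglongrightarrow> abs_L2 (indicator A)"
      by (rule tendsto_abs_L2[OF square_integrable_const[of 1]])
        (use that in \<open>auto simp: measurable_restrict_space1 split: split_indicator\<close>)
  qed fact
  have e_V: "abs_L2 (indicator {..a}) \<in> V" for a :: real
  proof -
    have "\<forall>n. \<exists>q. a < real_of_rat q \<and> real_of_rat q < a + 1 / real (Suc n)"
      by (intro allI of_rat_dense) simp
    then obtain q where q: "\<And>n. a < real_of_rat (q n)" "\<And>n. real_of_rat (q n) < a + 1 / real (Suc n)"
      by metis
    show ?thesis
    proof (rule ind_lim[of _ "\<lambda>n. {..real_of_rat (q n)}"])
      fix n
      have "comb [(1, q n)] \<in> D" by (simp add: D_def)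
      then show "abs_L2 (indicator {..real_of_rat (q n)}) \<in> V"
        using closure_subset[of D] by (auto simp: comb_def e_def V_def)
    next
      fix t
      show "(\<lambda>n. indicator {..real_of_rat (q n)} t :: real) \<longlonglongrightarrow> indicator {..a} t"
      proof (cases "t \<le> a")
        case True
        then have "t \<le> real_of_rat (q n)" for n using q(1)[of n] by simp
        with True show ?thesis by simp
      next
        case False
        then have "\<forall>\<^sub>F n in sequentially. 1 / real (Suc n) < t - a"
          using order_tendstoD(2)[OF LIMSEQ_Suc[OF lim_1_over_n], of "t - a"] by simp
        then have "\<forall>\<^sub>F n in sequentially. indicator {..real_of_rat (q n)} t = (0 :: real)"
        proof eventually_elim
          fix n assume "1 / real (Suc n) < t - a"
          with q(2)[of n] show "indicator {..real_of_rat (q n)} t = (0 :: real)" by simp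
        qed
        with False show ?thesis by (simp add: tendsto_eventually)
      qed
    qed auto
  qed
  have ind_V: "abs_L2 (indicator A) \<in> V" if "A \<in> sets borel" for A :: "real set"
  proof -
    have "Int_stable (range (\<lambda>a::real. {..a}))"
      by (auto simp: Int_stable_def)
    moreover have "range (\<lambda>a::real. {..a}) \<subseteq> Pow UNIV"
      by simp
    moreover have "A \<in> sigma_sets UNIV (range (\<lambda>a. {..a}))"
      using that by (simp add: borel_eq_atMost)
    ultimately show ?thesis
    proof (induction rule: sigma_sets_induct_disjoint)
      case (basic A)
      then show ?case using e_V by auto
    next
      case empty
      then show ?case using zero_V by (simp add: indicator_def zero_L2_def)
    next
      case (compl A)
      then have A: "A \<in> sets borel" by (simp add: borel_eq_atMost)
      have "abs_L2 (indicator (UNIV - A)) = abs_L2 (\<lambda>t. indicator {..1} t - indicator A t)"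
      proof (rule abs_L2_eqI)
        show "AE t in unit_interval_measure. indicator (UNIV - A) t = indicator {..1} t - (indicator A t :: real)"
          by (rule AE_I2) (auto simp: space_restrict_space split: split_indicator)
      qed (use A in \<open>auto intro!: sqA square_integrable_diff\<close>)
      also have "\<dots> = abs_L2 (indicator {..1}) - abs_L2 (indicator A)"
        by (rule abs_L2_arith(2)[symmetric]) (use A in \<open>auto intro: sqA\<close>)
      finally show ?case
        using compl by (simp add: diff_V e_V)
    next
      case (union A)
      then have A: "A i \<in> sets borel" for i by (auto simp: borel_eq_atMost)
      have *: "abs_L2 (indicator (\<Union>i<n. A i)) = (\<Sum>i<n. abs_L2 (indicator (A i)))" for n
      proof (induction n)
        case 0
        show ?case by (simp add: indicator_def zero_L2_def)
      next
        case (Suc n)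
        have disj: "t \<notin> A n" if "t \<in> A i" "i < n" for t i
          using disjoint_family_onD[OF union(1), of i n] that by auto
        have "indicator (\<Union>i<Suc n. A i) t = indicator (\<Union>i<n. A i) t + (indicator (A n) t :: real)" for t
          by (auto simp: less_Suc_eq dest: disj split: split_indicator)
        then have "abs_L2 (indicator (\<Union>i<Suc n. A i)) =
            abs_L2 (\<lambda>t. indicator (\<Union>i<n. A i) t + indicator (A n) t)"
          by presburger
        also have "\<dots> = abs_L2 (indicator (\<Union>i<n. A i)) + abs_L2 (indicator (A n))"
          by (rule abs_L2_arith(1)[symmetric]) (use A in \<open>auto intro!: sqA\<close>)
        finally show ?case using Suc by simp
      qed
      show ?case
      proof (rule ind_lim[of _ "\<lambda>n. \<Union>i<n. A i"])
        show "(\<lambda>n. indicator (\<Union>i<n. A i) t :: real) \<longlonglongrightarrow> indicator (\<Union>i. A i) t" for t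
          by (rule LIMSEQ_indicator_UN)
      qed (use A union(3) in \<open>auto simp: * intro!: sum_V\<close>)
    qed
  qed
  have V: "x \<in> V" for x
  proof -
    obtain f where f: "square_integrable f" and x: "x = abs_L2 f"
      using ex_rep_L2 by blast
    have fm: "f \<in> borel_measurable unit_interval_measure" using f by measurable
    obtain s where "\<forall>i. simple_function unit_interval_measure (s i)"
        "\<forall>t\<in>space unit_interval_measure. (\<lambda>i. s i t) \<longlonglongrightarrow> f t"
        "\<forall>i. \<forall>t\<in>space unit_interval_measure. dist (s i t) 0 \<le> 2 * dist (f t) 0"
      using borel_measurable_implies_sequence_metric[OF fm, of 0] by blast
    then have s: "simple_function unit_interval_measure (s i)"
        "t \<in> space unit_interval_measure \<Longrightarrow> (\<lambda>i. s i t) \<longlonglongrightarrow> f t"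
        "t \<in> space unit_interval_measure \<Longrightarrow> \<bar>s i t\<bar> \<le> 2 * \<bar>f t\<bar>" for i t
      by auto
    have sm: "s i \<in> borel_measurable unit_interval_measure" for i
      using s(1) by (rule borel_measurable_simple_function)
    show ?thesis
    proof (rule lim_V)
      show "(\<lambda>i. abs_L2 (s i)) \<longlonglongrightarrow> x"
        unfolding x
        by (rule tendsto_abs_L2[OF square_integrable_cmult[OF f, of 2] sm fm])
          (use s in \<open>auto simp: abs_mult\<close>)
      fix i
      define A where "A y = s i -` {y} \<inter> {0..1}" for y
      have A: "A y \<in> sets borel" for y
      proof -
        have "s i -` {y} \<inter> space unit_interval_measure \<in> sets unit_interval_measure"
          using s(1) by (rule simple_functionD)
        then show ?thesis
          by (auto simp: A_def space_restrict_space sets_restrict_space)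
      qed
      have fin: "finite (s i ` {0..1})"
        using simple_functionD(1)[OF s(1)[of i]] by (simp add: space_restrict_space)
      have sumA: "square_integrable (\<lambda>t. \<Sum>y\<in>I. y * indicator (A y) t)" 
        "abs_L2 (\<lambda>t. \<Sum>y\<in>I. y * indicator (A y) t) = (\<Sum>y\<in>I. y *\<^sub>R abs_L2 (indicator (A y)))"
        if "finite I" for I :: "real set"
      proof -
        have "square_integrable (\<lambda>t. \<Sum>y\<in>I. y * indicator (A y) t) \<and>
          abs_L2 (\<lambda>t. \<Sum>y\<in>I. y * indicator (A y) t) = (\<Sum>y\<in>I. y *\<^sub>R abs_L2 (indicator (A y)))"
          using that
        proof (induction I)
          case empty
          show ?case by (simp add: zero_L2_def)
        next
          case (insert y I)
          have "square_integrable (\<lambda>t. y * indicator (A y) t)"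
            by (intro square_integrable_cmult sqA A)
          note y = this
          have I: "square_integrable (\<lambda>t. \<Sum>y\<in>I. y * indicator (A y) t)"
            using insert by blast
          have "abs_L2 (\<lambda>t. y * indicator (A y) t + (\<Sum>y\<in>I. y * indicator (A y) t)) =
              abs_L2 (\<lambda>t. y * indicator (A y) t) + abs_L2 (\<lambda>t. \<Sum>y\<in>I. y * indicator (A y) t)"
            by (rule abs_L2_arith(1)[OF y I, symmetric])
          also have "\<dots> = y *\<^sub>R abs_L2 (indicator (A y)) + (\<Sum>y\<in>I. y *\<^sub>R abs_L2 (indicator (A y)))"
            using insert abs_L2_arith(3)[OF sqA[OF A] sqA[OF A]] by metis
          finally show ?case
            unfolding sum.insert[OF insert(1,2)] using square_integrable_add[OF y I] by blast
        qed
        then show "square_integrable (\<lambda>t. \<Sum>y\<in>I. y * indicator (A y) t)" 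
          "abs_L2 (\<lambda>t. \<Sum>y\<in>I. y * indicator (A y) t) = (\<Sum>y\<in>I. y *\<^sub>R abs_L2 (indicator (A y)))"
          by auto
      qed
      have "abs_L2 (s i) = abs_L2 (\<lambda>t. \<Sum>y\<in>s i ` {0..1}. y * indicator (A y) t)"
      proof (rule abs_L2_eqI)
        show "square_integrable (s i)"
          by (rule square_integrable_bound[OF square_integrable_cmult[OF f, of 2] sm])
            (use s in \<open>auto simp: abs_mult\<close>)
        show "AE t in unit_interval_measure. s i t = (\<Sum>y\<in>s i ` {0..1}. y * indicator (A y) t)"
        proof (rule AE_I2)
          fix t assume "t \<in> space unit_interval_measure"
          then have t: "t \<in> {0..1}" by (simp add: space_restrict_space)
          have "(\<Sum>y\<in>s i ` {0..1}. y * indicator (A y) t) =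
              (\<Sum>y\<in>s i ` {0..1}. if y = s i t then y else 0)"
            using t by (intro sum.cong) (auto simp: A_def)
          also have "\<dots> = s i t" using fin t by simp
          finally show "s i t = (\<Sum>y\<in>s i ` {0..1}. y * indicator (A y) t)" ..
        qed
      qed (rule sumA[OF fin])
      then show "abs_L2 (s i) \<in> V"
        by (simp add: sumA[OF fin] sum_V scale_V ind_V A)
    qed
  qed
  define B where "B = (\<lambda>(d, n). ball d (1 / real (Suc n))) ` (D \<times> UNIV)"
  have "countable B"
    unfolding B_def using \<open>countable D\<close> by (intro countable_image countable_SIGMA) auto
  moreover have "topological_basis B"
  proof (rule topological_basisI)
    fix S :: "L2 set" and x
    assume "open S" "x \<in> S"
    then obtain r where r: "r > 0" "ball x r \<subseteq> S"
      by (auto simp: open_contains_ball)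
    obtain n where n: "1 / real (Suc n) < r / 2"
      using nat_approx_posE[of "r / 2"] r by auto
    have "x \<in> closure D" using V by (simp add: V_def)
    then obtain d where d: "d \<in> D" "dist d x < 1 / real (Suc n)"
      by (metis closure_approachable of_nat_0_less_iff zero_less_Suc zero_less_divide_1_iff)
    have "ball d (1 / real (Suc n)) \<subseteq> ball x r"
    proof
      fix y assume "y \<in> ball d (1 / real (Suc n))"
      then show "y \<in> ball x r"
        using d n dist_triangle[of x y d] by (auto simp: dist_commute)
    qed
    moreover have "x \<in> ball d (1 / real (Suc n))" "ball d (1 / real (Suc n)) \<in> B"
      using d by (auto simp: B_def)
    ultimately show "\<exists>b\<in>B. x \<in> b \<and> b \<subseteq> S" using r by blast
  qed (auto simp: B_def)
  ultimately show "\<exists>B :: L2 set set. countable B \<and> open = generate_topology B"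
    by (auto intro: topological_basis_imp_subbasis)
qed

section \<open>Random elements and kernels\<close>

definition orthonormal_basis :: "(nat \<Rightarrow> 'h::real_inner) \<Rightarrow> bool" where
  "orthonormal_basis \<psi> \<longleftrightarrow>
     (\<forall>i\<ge>1. \<forall>j\<ge>1. \<psi> i \<bullet> \<psi> j = (if i = j then 1 else 0)) \<and>
     closure (span (\<psi> ` {1..})) = UNIV"

text \<open>\<open>g\<close> is a version of the conditional expectation of the Banach-space valued \<open>f\<close> given \<open>F\<close>; the
  integrals are Bochner integrals. In the library only the real-valued case is available.\<close>

definition is_cond_exp ::
  "'a measure \<Rightarrow> 'a measure \<Rightarrow> ('a \<Rightarrow> 'b::{banach, second_countable_topology}) \<Rightarrow> ('a \<Rightarrow> 'b) \<Rightarrow> bool" where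
  "is_cond_exp M F f g \<longleftrightarrow>
     subalgebra M F \<and> integrable M f \<and> integrable M g \<and> g \<in> borel_measurable F \<and>
     (\<forall>A\<in>sets F. (\<integral>\<omega>\<in>A. f \<omega> \<partial>M) = (\<integral>\<omega>\<in>A. g \<omega> \<partial>M))"

definition fourier_transform :: "(real \<Rightarrow> real) \<Rightarrow> real \<Rightarrow> complex" where
  "fourier_transform K t = (CLINT x|lborel. iexp (- (t * x)) * complex_of_real (K x))"

definition quantile :: "real measure \<Rightarrow> real \<Rightarrow> real" where
  "quantile \<mu> q = Inf {x. q \<le> cdf \<mu> x}"

section \<open>Directions and the test statistic\<close>

text \<open>Vectors of $R^p$ are the functions on the naturals that vanish off $\{1,\dots,p\}$. Padding with
  zeros is then the identity, so $B_p \times 0_{p'-p} \subset B_{p'}$ reads \<open>B p \<subseteq> B p'\<close>, and the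
  product topology of the function type induces the Euclidean topology on these vectors.\<close>

definition unit_sphere :: "nat \<Rightarrow> (nat \<Rightarrow> real) set" where
  "unit_sphere p = {\<gamma>. (\<forall>j. j \<notin> {1..p} \<longrightarrow> \<gamma> j = 0) \<and> L2_set \<gamma> {1..p} = 1}"

definition normalized_direction :: "(nat \<Rightarrow> real) \<Rightarrow> nat \<Rightarrow> nat \<Rightarrow> real" where
  "normalized_direction b p j = (if j \<in> {1..p} then b j / L2_set b {1..p} else 0)"

definition projection :: "(nat \<Rightarrow> L2) \<Rightarrow> nat \<Rightarrow> L2 \<Rightarrow> (nat \<Rightarrow> real) \<Rightarrow> real" where
  "projection \<psi> p x \<gamma> = (\<Sum>j=1..p. (x \<bullet> \<psi> j) * \<gamma> j)"

text \<open>The value of the empirical distribution function of \<open>y 1, \<dots>, y n\<close> at \<open>y i\<close>, ties being broken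
  by comparing indices.\<close>

definition empirical_df :: "nat \<Rightarrow> (nat \<Rightarrow> real) \<Rightarrow> nat \<Rightarrow> real" where
  "empirical_df n y i = real (card {j \<in> {1..n}. y j < y i \<or> (y j = y i \<and> j \<le> i)}) / real n"

definition scaled_kernel :: "(real \<Rightarrow> real) \<Rightarrow> real \<Rightarrow> real \<Rightarrow> real" where
  "scaled_kernel K h u = K (u / h)"

definition kernel_weight ::
  "(nat \<Rightarrow> L2) \<Rightarrow> (real \<Rightarrow> real) \<Rightarrow> real \<Rightarrow> nat \<Rightarrow> nat \<Rightarrow> (nat \<Rightarrow> L2) \<Rightarrow> (nat \<Rightarrow> real) \<Rightarrow> nat \<Rightarrow> nat \<Rightarrow> real" where
  "kernel_weight \<psi> K h p n X \<gamma> i j = scaled_kernel K h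
     (empirical_df n (\<lambda>k. projection \<psi> p (X k) \<gamma>) i - empirical_df n (\<lambda>k. projection \<psi> p (X k) \<gamma>) j)"

definition Q_stat ::
  "(nat \<Rightarrow> L2) \<Rightarrow> (real \<Rightarrow> real) \<Rightarrow> real \<Rightarrow> nat \<Rightarrow> nat \<Rightarrow> (nat \<Rightarrow> L2) \<Rightarrow> (nat \<Rightarrow> L2) \<Rightarrow> (nat \<Rightarrow> real) \<Rightarrow> real" where
  "Q_stat \<psi> K h p n U X \<gamma> = 1 / (real n * (real n - 1)) *
     (\<Sum>(i, j)\<in>{(i, j). i \<in> {1..n} \<and> j \<in> {1..n} \<and> i \<noteq> j}.
        (U i \<bullet> U j) * (1 / h) * kernel_weight \<psi> K h p n X \<gamma> i j)"

definition v2_stat ::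
  "(nat \<Rightarrow> L2) \<Rightarrow> (real \<Rightarrow> real) \<Rightarrow> real \<Rightarrow> nat \<Rightarrow> nat \<Rightarrow> (nat \<Rightarrow> L2) \<Rightarrow> (nat \<Rightarrow> L2) \<Rightarrow> (nat \<Rightarrow> real) \<Rightarrow> real" where
  "v2_stat \<psi> K h p n U X \<gamma> = 2 / (real n * (real n - 1) * h) *
     (\<Sum>(i, j)\<in>{(i, j). i \<in> {1..n} \<and> j \<in> {1..n} \<and> i \<noteq> j}.
        (U i \<bullet> U j)\<^sup>2 * (kernel_weight \<psi> K h p n X \<gamma> i j)\<^sup>2)"

text \<open>If the variance estimate vanishes then so does \<open>Q_stat\<close>, because
  every term of both sums is then zero; the quotient is then $0/0 = 0$.\<close>

definition studentized_Q ::
  "(nat \<Rightarrow> L2) \<Rightarrow> (real \<Rightarrow> real) \<Rightarrow> real \<Rightarrow> nat \<Rightarrow> nat \<Rightarrow> (nat \<Rightarrow> L2) \<Rightarrow> (nat \<Rightarrow> L2) \<Rightarrow> (nat \<Rightarrow> real) \<Rightarrow> real" where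
  "studentized_Q \<psi> K h p n U X \<gamma> =
     real n * sqrt h * Q_stat \<psi> K h p n U X \<gamma> / sqrt (v2_stat \<psi> K h p n U X \<gamma>)"

end

theory Submission
  imports Defs
begin

text \<open>Under the null hypothesis the noise \<open>U\<close> is centred given the covariate \<open>X\<close>. Writing $u_i$ for the noise
  of the $i$-th observation and $a_{ij}$ for its kernel weights, which depend on the covariates only through
  ranks, the statistic in a fixed direction is \<open>sqrt (n / (n - 1)) * W / sqrt V\<close> with
  $W = \sum_{i \ne j} a_{ij} \langle u_i, u_j \rangle$ and $V = 2 \sum_{i \ne j} a_{ij}^2 \langle u_i, u_j \rangle^2$.

  The direction is selected correctly with probability tending to one. The directions realise at most
  $(2n^2+1)^{p+1}$ rankings, so symmetrisation and moments of Rademacher chaoses of order $\ln$ of that number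
  bound the expected supremum of $|W|$ over all directions by a multiple of $p \ln n \cdot n \sqrt h$. On the other hand
  $V$ is at least of order $n^2 h$ uniformly: $\langle u, v \rangle^2$ is a positive semidefinite kernel, so the
  blocks of observations of similar rank carry at least the fraction $1/\#$blocks of its total sum. Hence the
  statistics differ by less than the penalty $\alpha_n$.

  In the direction $\gamma_0$, $W$ is a sum of martingale differences $2 \sum_{i<j} a_{ij} \langle u_i, u_j \rangle$. They are
  normalised by their conditional variance given the covariates, which is measurable in the past and close to $V$ by
  second moment bounds in terms of the row sums of the weights; McLeish's argument gives convergence of the
  characteristic functions.\<close>

section \<open>Rankings and sign patterns\<close>

text \<open>Through the ranks the weight of a pair depends on all covariates, so the weighted terms
  are never independent. Every cancellation therefore has the same form: all covariates and all
  other noises are frozen, and one noise (or a pair of noises) is integrated against its conditional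
  law. The weights enter only through two deterministic bounds, entries at most \<open>K 0\<close>
  and row sums at most \<open>K 0 + n h\<close>. Both hold for every permutation of the ranks, which
  is what makes the estimates uniform in the direction. V itself cannot normalise the martingale
  because it contains future noises. Relative to n^2 h, the variance of the off-diagonal part of the
  squared increments is of order h, and that of V minus the conditional variance of order 1/n; this
  is where h \<rightarrow> 0 enters. A supremum over uncountably many directions need not be
  measurable. It is dominated by a maximum over all permutations of the ranks, in which only those
  realised by the sample count. The price is the logarithm of their number, p ln n, hence the growth
  required of the penalty.\<close>

definition sign_patterns :: "('j \<Rightarrow> 'k \<Rightarrow> real) \<Rightarrow> 'j set \<Rightarrow> 'k set \<Rightarrow> ('j \<Rightarrow> real) set" where
  "sign_patterns A J K = range (\<lambda>t. restrict (\<lambda>j. sgn (\<Sum>k\<in>K. A j k * t k)) J)"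

lemma sgn_positive_combination:
  fixes x y a b :: real
  assumes "a > 0" "b > 0" "sgn x = sgn y"
  shows "sgn (a * x + b * y) = sgn x"
proof -
  consider "x > 0" "y > 0" | "x = 0" "y = 0" | "x < 0" "y < 0"
    using assms(3) by (cases "x > 0"; cases "x = 0"; cases "y > 0"; cases "y = 0") (auto simp: sgn_if split: if_splits)
  then show ?thesis
  proof cases
    case 1
    then have "a * x + b * y > 0" using assms by (simp add: add_pos_pos)
    then show ?thesis using 1 by simp
  next
    case 3
    then have "a * x + b * y < 0" using assms by (simp add: add_neg_neg mult_pos_neg)
    then show ?thesis using 3 by simp
  qed auto
qed

lemma opposite_signs:
  fixes x y :: real
  assumes "x \<noteq> 0" "y \<noteq> 0" "sgn x \<noteq> sgn y"
  shows "x > 0 \<and> y < 0 \<or> y > 0 \<and> x < 0"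
  using assms by (auto simp: sgn_if split: if_splits)

text \<open>Where form \<open>j\<close> vanishes, the coordinate \<open>k0\<close> is a linear
  combination of the others; substituting it leaves forms in one variable fewer. This is the descent
  in dimension for the induction below.\<close>

lemma hyperplane_sign_patterns:
  fixes A :: "'j \<Rightarrow> 'k \<Rightarrow> real"
  assumes K: "finite K" "k0 \<in> K" and nz: "A j k0 \<noteq> 0" and t: "(\<Sum>k\<in>K. A j k * t k) = 0"
  shows "restrict (\<lambda>i. sgn (\<Sum>k\<in>K. A i k * t k)) J \<in>
    sign_patterns (\<lambda>i k. A i k - A i k0 * A j k / A j k0) J (K - {k0})"
proof -
  have t0: "t k0 = - (\<Sum>k\<in>K - {k0}. A j k * t k) / A j k0"
    using t nz sum.remove[OF K, of "\<lambda>k. A j k * t k"] by (simp add: field_simps)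
  have "(\<Sum>k\<in>K. A i k * t k) = (\<Sum>k\<in>K - {k0}. (A i k - A i k0 * A j k / A j k0) * t k)" for i
  proof -
    have "(\<Sum>k\<in>K. A i k * t k) = A i k0 * t k0 + (\<Sum>k\<in>K - {k0}. A i k * t k)"
      by (rule sum.remove[OF K])
    also have "\<dots> = (\<Sum>k\<in>K - {k0}. A i k * t k - A i k0 * A j k / A j k0 * t k)"
      unfolding t0 sum_subtractf
      by (simp add: sum_distrib_left sum_divide_distrib mult.assoc)
    finally show ?thesis by (simp add: algebra_simps)
  qed
  then show ?thesis unfolding sign_patterns_def by auto
qed

text \<open>Zero signs are recorded, so all faces of a central hyperplane arrangement are counted,
  not only the open cells. Adding the hyperplane of \<open>j\<close> splits an old face only if the
  face meets it, and then into at most three. For the number N(m, d) of faces of m hyperplanes in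
  dimension d this yields N(m+1, d+1) \<le> N(m, d+1) + 2 N(m, d), a recursion respected by
  (2m+1)^d.\<close>

theorem card_sign_patterns:
  fixes A :: "'j \<Rightarrow> 'k \<Rightarrow> real"
  assumes "finite J" "finite K"
  shows "finite (sign_patterns A J K) \<and> card (sign_patterns A J K) \<le> (2 * card J + 1) ^ card K"
  using assms
proof (induction J arbitrary: A K rule: finite_induct)
  case empty
  have "sign_patterns A {} K = {\<lambda>_. undefined}"
    by (auto simp: sign_patterns_def restrict_def)
  then show ?case by simp
next
  case (insert j J)
  let ?l = "\<lambda>i t. \<Sum>k\<in>K. A i k * t k"
  let ?S = "sign_patterns A J K" and ?T = "sign_patterns A (insert j J) K"
  have S: "finite ?S" "card ?S \<le> (2 * card J + 1) ^ card K"
    using insert.IH[OF insert.prems] by auto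
  have ext: "restrict (\<lambda>i. sgn (?l i t)) (insert j J) = (restrict (\<lambda>i. sgn (?l i t)) J)(j := sgn (?l j t))" for t
    using insert.hyps by (auto simp: restrict_def)
  show ?case
  proof (cases "\<forall>k\<in>K. A j k = 0")
    case True
    then have "?l j t = 0" for t by simp
    then have "?T \<subseteq> (\<lambda>s. s(j := 0)) ` ?S"
      unfolding sign_patterns_def using ext by auto
    then have fin: "finite ?T" and "card ?T \<le> card ((\<lambda>s. s(j := 0)) ` ?S)"
      using S(1) by (auto intro: finite_subset card_mono)
    then have "card ?T \<le> card ?S" using card_image_le[OF S(1)] le_trans by blast
    also have "\<dots> \<le> (2 * card (insert j J) + 1) ^ card K"
      using S(2) by (rule le_trans) (use insert.hyps in \<open>auto intro!: power_mono\<close>)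
    finally show ?thesis using fin by simp
  next
    case False
    then obtain k0 where k0: "k0 \<in> K" "A j k0 \<noteq> 0" by auto
    let ?Hyp = "sign_patterns (\<lambda>i k. A i k - A i k0 * A j k / A j k0) J (K - {k0})"
    obtain d where d: "card K = Suc d" "card (K - {k0}) = d"
      using k0 insert.prems by (metis card_Suc_Diff1)
    have S0: "finite ?Hyp" "card ?Hyp \<le> (2 * card J + 1) ^ d"
      using insert.IH[of "K - {k0}"] insert.prems d by auto
    note hyp = hyperplane_sign_patterns[where A = A and j = j and K = K, OF insert.prems k0]
    \<comment> \<open>One extension of each old pattern is charged to \<open>?S\<close>: the value 0
      if the pattern occurs on the hyperplane, otherwise the only value possible. The extensions by
      1 and -1 of patterns on the hyperplane are charged to \<open>?Hyp\<close>.\<close>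
    define f where "f s = (if s \<in> ?Hyp then 0 else (SOME \<sigma>. s(j := \<sigma>) \<in> ?T))" for s
    have unique: "restrict (\<lambda>i. sgn (?l i t)) J \<in> ?Hyp"
      if eq: "restrict (\<lambda>i. sgn (?l i t)) J = restrict (\<lambda>i. sgn (?l i t')) J" and ne: "?l j t > 0" "?l j t' < 0" for t t'
    proof -
      \<comment> \<open>The segment between points on opposite sides crosses the hyperplane. This
        positive combination annihilates form \<open>j\<close> and keeps all signs on
        \<open>J\<close>.\<close>
      define t'' where "t'' k = ?l j t * t' k + (- ?l j t') * t k" for k
      have "(\<Sum>k\<in>K. A i k * (c * t' k + d * t k)) = c * ?l i t' + d * ?l i t" for i c d
        unfolding sum_distrib_left sum.distrib[symmetric] by (intro sum.cong) (auto simp: algebra_simps)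
      then have l'': "?l i t'' = ?l j t * ?l i t' + (- ?l j t') * ?l i t" for i
        unfolding t''_def .
      have "restrict (\<lambda>i. sgn (?l i t'')) J = restrict (\<lambda>i. sgn (?l i t)) J"
      proof (rule restrict_ext)
        fix i assume i: "i \<in> J"
        have "sgn (?l i t) = sgn (?l i t')" using fun_cong[OF eq, of i] i by simp
        then show "sgn (?l i t'') = sgn (?l i t)"
          unfolding l'' using ne sgn_positive_combination[of "?l j t" "- ?l j t'" "?l i t'" "?l i t"] by simp
      qed
      moreover have "?l j t'' = 0" unfolding l'' by simp
      ultimately show ?thesis
        using hyp[of t'' J] by simp
    qed
    have sub: "?T \<subseteq> (\<lambda>s. s(j := f s)) ` ?S \<union> ((\<lambda>s. s(j := 1)) ` ?Hyp \<union> (\<lambda>s. s(j := -1)) ` ?Hyp)"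
    proof
      fix r assume "r \<in> ?T"
      then obtain t where "r = restrict (\<lambda>i. sgn (?l i t)) (insert j J)"
        unfolding sign_patterns_def by (rule rangeE)
      then have r: "r = (restrict (\<lambda>i. sgn (?l i t)) J)(j := sgn (?l j t))"
        using ext by (rule trans)
      define s where "s = restrict (\<lambda>i. sgn (?l i t)) J"
      have sS: "s \<in> ?S" unfolding s_def sign_patterns_def by (rule rangeI)
      show "r \<in> (\<lambda>s. s(j := f s)) ` ?S \<union> ((\<lambda>s. s(j := 1)) ` ?Hyp \<union> (\<lambda>s. s(j := -1)) ` ?Hyp)"
      proof (cases "s \<in> ?Hyp")
        case True
        consider "sgn (?l j t) = 0" | "sgn (?l j t) = 1" | "sgn (?l j t) = -1"
          by (cases "?l j t > 0"; cases "?l j t = 0") auto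
        then show ?thesis
        proof cases
          case 1
          then have "r = s(j := f s)" using True by (simp add: r s_def f_def)
          then show ?thesis using sS by auto
        qed (use True in \<open>auto simp: r s_def\<close>)
      next
        case False
        have lnz: "?l j t \<noteq> 0"
          using hyp[of t J] False unfolding s_def by blast
        have "s(j := f s) \<in> ?T"
          unfolding f_def using False \<open>r \<in> ?T\<close> r s_def by (auto intro: someI)
        then obtain t' where "s(j := f s) = restrict (\<lambda>i. sgn (?l i t')) (insert j J)"
          unfolding sign_patterns_def by (rule rangeE)
        then have t': "s(j := f s) = (restrict (\<lambda>i. sgn (?l i t')) J)(j := sgn (?l j t'))"
          using ext by (rule trans)
        define s' where "s' = restrict (\<lambda>i. sgn (?l i t')) J"
        have "s = s'"
        proof (rule HOL.ext)
          fix i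
          show "s i = s' i"
          proof (cases "i = j")
            case True
            then show ?thesis using insert.hyps(2) by (simp add: s_def s'_def)
          next
            case False
            then show ?thesis using fun_cong[OF t'[folded s'_def], of i] by simp
          qed
        qed
        then have js: "restrict (\<lambda>i. sgn (?l i t)) J = restrict (\<lambda>i. sgn (?l i t')) J"
          unfolding s_def s'_def .
        have fs: "f s = sgn (?l j t')" using fun_cong[OF t', of j] by simp
        have l'nz: "?l j t' \<noteq> 0"
          using hyp[of t' J] False unfolding s_def js by blast
        have "sgn (?l j t) = sgn (?l j t')"
        proof (rule ccontr)
          assume "sgn (?l j t) \<noteq> sgn (?l j t')"
          from opposite_signs[OF lnz l'nz this] show False
            using unique[OF js] unique[OF js[symmetric]] False unfolding s_def js by blast
        qed
        then have "r = s(j := f s)" unfolding r s_def[symmetric] fs by simp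
        then show ?thesis using sS by auto
      qed
    qed
    have fin3: "finite ((\<lambda>s. s(j := f s)) ` ?S \<union> ((\<lambda>s. s(j := 1)) ` ?Hyp \<union> (\<lambda>s. s(j := -1)) ` ?Hyp))"
      using S(1) S0(1) by simp
    have fin: "finite ?T" by (rule finite_subset[OF sub fin3])
    note card_mono[OF fin3 sub]
    also have "card ((\<lambda>s. s(j := f s)) ` ?S \<union> ((\<lambda>s. s(j := 1)) ` ?Hyp \<union> (\<lambda>s. s(j := -1)) ` ?Hyp))
        \<le> card ?S + (card ?Hyp + card ?Hyp)"
      by (intro order.trans[OF card_Un_le] add_mono card_image_le S S0)
    also have "\<dots> \<le> (2 * card J + 1) ^ Suc d + 2 * (2 * card J + 1) ^ d"
      using S(2) S0(2) d by simp
    also have "\<dots> = (2 * card J + 1) ^ d * (2 * card J + 3)" by (simp add: algebra_simps)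
    also have "\<dots> \<le> (2 * card J + 3) ^ d * (2 * card J + 3)"
      by (intro mult_right_mono power_mono) auto
    also have "\<dots> = (2 * card (insert j J) + 1) ^ card K"
    proof -
      have "2 * card (insert j J) + 1 = 2 * card J + 3" using insert.hyps by simp
      then show ?thesis by (simp only: d power_Suc mult.commute)
    qed
    finally show ?thesis using fin by simp
  qed
qed

section \<open>Ranks with ties broken by index\<close>

lemma eventually_less_of_tendsto:
  fixes f g :: "'a \<Rightarrow> real"
  assumes "(f \<longlongrightarrow> a) F" "(g \<longlongrightarrow> b) F" "a < b"
  shows "\<forall>\<^sub>F x in F. f x < g x"
  using order_tendstoD(1)[OF tendsto_diff[OF assms(2,1)], of 0] assms(3) by (auto elim: eventually_mono)

lemma ex_strict_comparisons:
  fixes f :: "'b \<Rightarrow> 'a \<Rightarrow> real"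
  assumes "finite A" "F \<noteq> bot"
    and "\<And>i j. i \<in> A \<Longrightarrow> j \<in> A \<Longrightarrow> L j i \<Longrightarrow> \<forall>\<^sub>F e in F. f e j < f e i"
  shows "\<exists>e. \<forall>i\<in>A. \<forall>j\<in>A. L j i \<longrightarrow> f e j < f e i"
proof -
  have "\<forall>\<^sub>F e in F. \<forall>i\<in>A. \<forall>j\<in>A. L j i \<longrightarrow> f e j < f e i"
    using assms by (intro eventually_ball_finite ballI) (auto intro: eventually_mono)
  then show ?thesis using eventually_happens'[OF assms(2)] by blast
qed

text \<open>The numerator of \<open>empirical_df\<close>; integer values make rankings a finite set
  that can be enumerated.\<close>

definition rank_of :: "nat \<Rightarrow> (nat \<Rightarrow> real) \<Rightarrow> nat \<Rightarrow> nat" where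
  "rank_of n y i = card {j \<in> {1..n}. y j < y i \<or> (y j = y i \<and> j \<le> i)}"

lemma rank_of_in: 
  assumes "i \<in> {1..n}" shows "rank_of n y i \<in> {1..n}"
proof -
  have "i \<in> {j \<in> {1..n}. y j < y i \<or> (y j = y i \<and> j \<le> i)}" using assms by auto
  then have "rank_of n y i > 0" unfolding rank_of_def by (subst card_gt_0_iff) auto
  moreover have "rank_of n y i \<le> card {1..n}" unfolding rank_of_def by (intro card_mono) auto
  ultimately show ?thesis by auto
qed

lemma rank_of_less:
  assumes "i \<in> {1..n}" "j \<in> {1..n}" "y j < y i \<or> (y j = y i \<and> j < i)"
  shows "rank_of n y j < rank_of n y i"
  unfolding rank_of_def
proof (rule psubset_card_mono)
  show "{k \<in> {1..n}. y k < y j \<or> y k = y j \<and> k \<le> j} \<subset> {j \<in> {1..n}. y j < y i \<or> y j = y i \<and> j \<le> i}"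
  proof (rule psubsetI)
    show "{k \<in> {1..n}. y k < y j \<or> y k = y j \<and> k \<le> j} \<subseteq> {j \<in> {1..n}. y j < y i \<or> y j = y i \<and> j \<le> i}"
      using assms by auto
    have "i \<notin> {k \<in> {1..n}. y k < y j \<or> y k = y j \<and> k \<le> j}" using assms by auto
    then show "{k \<in> {1..n}. y k < y j \<or> y k = y j \<and> k \<le> j} \<noteq> {j \<in> {1..n}. y j < y i \<or> y j = y i \<and> j \<le> i}"
      using assms(1) by blast
  qed
qed simp

lemma inj_on_rank_of: "inj_on (rank_of n y) {1..n}"
proof (rule inj_onI)
  fix i j assume ij: "i \<in> {1..n}" "j \<in> {1..n}" "rank_of n y i = rank_of n y j"
  show "i = j"
  proof (rule ccontr)
    assume "i \<noteq> j"
    then have "(y j < y i \<or> (y j = y i \<and> j < i)) \<or> (y i < y j \<or> (y i = y j \<and> i < j))" by linarith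
    then show False using rank_of_less[of i n j y] rank_of_less[of j n i y] ij by auto
  qed
qed

lemma rank_of_cong_sgn:
  assumes "\<And>i j. i \<in> {1..n} \<Longrightarrow> j \<in> {1..n} \<Longrightarrow> sgn (y i - y j) = sgn (y' i - y' j)" and i: "i \<in> {1..n}"
  shows "rank_of n y i = rank_of n y' i"
proof -
  have "(y j < y i \<longleftrightarrow> y' j < y' i) \<and> (y j = y i \<longleftrightarrow> y' j = y' i)" if "j \<in> {1..n}" for j
    using assms(1)[OF i that] by (auto simp: sgn_if split: if_splits)
  then show ?thesis unfolding rank_of_def by (intro arg_cong[where f = card]) blast
qed

text \<open>Breaking ties by index amounts to adding an infinitesimal multiple of the index, after which
  all comparisons are strict and hence stable under small changes of the direction.\<close>

lemma rank_of_perturb: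
  fixes c :: "nat \<Rightarrow> nat \<Rightarrow> real" and \<gamma> :: "nat \<Rightarrow> real"
  shows "\<exists>\<theta> \<in> PiE {0..p} (\<lambda>_. \<rat>). \<forall>i\<in>{1..n}.
    rank_of n (\<lambda>i. \<Sum>k=1..p. c i k * \<gamma> k) i = rank_of n (\<lambda>i. (\<Sum>k=1..p. c i k * \<theta> k) + \<theta> 0 * real i) i"
proof -
  let ?y = "\<lambda>i. \<Sum>k=1..p. c i k * \<gamma> k"
  let ?z = "\<lambda>\<theta> i. (\<Sum>k=1..p. c i k * \<theta> k) + \<theta> 0 * real i"
  let ?less = "\<lambda>j i. ?y j < ?y i \<or> (?y j = ?y i \<and> j < i)"
  have pert: "\<forall>\<^sub>F e in at_right 0. ?y j + e * real j < ?y i + e * real i" if "?less j i" for i j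
  proof (cases "?y j < ?y i")
    case True
    have "((\<lambda>e. ?y j + e * real j) \<longlongrightarrow> ?y j + 0 * real j) (at_right 0)"
      and "((\<lambda>e. ?y i + e * real i) \<longlongrightarrow> ?y i + 0 * real i) (at_right 0)"
      by (intro tendsto_intros)+
    then show ?thesis using True by (intro eventually_less_of_tendsto) auto
  next
    case False
    then have "?y j = ?y i" "real j < real i" using that by auto
    then show ?thesis
      using eventually_at_right_less[of "0::real"] by (auto elim!: eventually_mono)
  qed
  have "\<exists>e. \<forall>i\<in>{1..n}. \<forall>j\<in>{1..n}. ?less j i \<longrightarrow> ?y j + e * real j < ?y i + e * real i"
  proof (rule ex_strict_comparisons[where F = "at_right 0"])
    fix i j assume "?less j i"
    then show "\<forall>\<^sub>F e in at_right 0. ?y j + e * real j < ?y i + e * real i" by (rule pert)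
  qed simp_all
  then obtain e where e: "\<And>i j. i \<in> {1..n} \<Longrightarrow> j \<in> {1..n} \<Longrightarrow> ?less j i \<Longrightarrow> ?y j + e * real j < ?y i + e * real i"
    by blast
  \<comment> \<open>Directions use the coordinates 1 to p, so coordinate 0 is free to carry the
    coefficient of the index. Tie breaking thus becomes part of a linear form in p + 1
    variables.\<close>
  define \<theta>0 where "\<theta>0 k = (if k = 0 then e else \<gamma> k)" for k :: nat
  have z0: "?z \<theta>0 i = ?y i + e * real i" for i
    by (auto simp: \<theta>0_def intro!: sum.cong)
  have "\<exists>q :: nat \<Rightarrow> real. (\<forall>m. q m \<in> \<rat>) \<and> q \<longlonglongrightarrow> x" for x
  proof -
    have "x \<in> closure \<rat>" by (simp add: Rats_closure_real)
    then show ?thesis unfolding closure_sequential by blast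
  qed
  then obtain q :: "real \<Rightarrow> nat \<Rightarrow> real" where q: "\<And>x m. q x m \<in> \<rat>" "\<And>x. q x \<longlonglongrightarrow> x"
    by metis
  define \<theta> where "\<theta> m = restrict (\<lambda>k. q (\<theta>0 k) m) {0..p}" for m
  have lim: "(\<lambda>m. ?z (\<theta> m) i) \<longlonglongrightarrow> ?z \<theta>0 i" for i
    unfolding \<theta>_def by (auto intro!: tendsto_intros q)
  have "\<exists>m. \<forall>i\<in>{1..n}. \<forall>j\<in>{1..n}. ?less j i \<longrightarrow> ?z (\<theta> m) j < ?z (\<theta> m) i"
  proof (rule ex_strict_comparisons[where F = sequentially])
    fix i j assume "i \<in> {1..n}" "j \<in> {1..n}" "?less j i"
    then have "?z \<theta>0 j < ?z \<theta>0 i" unfolding z0 by (rule e)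
    then show "\<forall>\<^sub>F m in sequentially. ?z (\<theta> m) j < ?z (\<theta> m) i"
      by (rule eventually_less_of_tendsto[OF lim lim])
  qed simp_all
  then obtain m where m: "\<And>i j. i \<in> {1..n} \<Longrightarrow> j \<in> {1..n} \<Longrightarrow> ?less j i \<Longrightarrow> ?z (\<theta> m) j < ?z (\<theta> m) i"
    by blast
  have "rank_of n ?y i = rank_of n (?z (\<theta> m)) i" if i: "i \<in> {1..n}" for i
  proof -
    have "(?y j < ?y i \<or> (?y j = ?y i \<and> j \<le> i)) \<longleftrightarrow> (?z (\<theta> m) j < ?z (\<theta> m) i \<or> (?z (\<theta> m) j = ?z (\<theta> m) i \<and> j \<le> i))"
      if j: "j \<in> {1..n}" for j
    proof (cases "?less j i")
      case True
      then show ?thesis using m[OF i j] by auto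
    next
      case False
      then have "i = j \<or> ?less i j" by linarith
      then show ?thesis using m[OF j i] False by auto
    qed
    then show ?thesis unfolding rank_of_def by (intro arg_cong[where f = card]) blast
  qed
  moreover have "\<theta> m \<in> PiE {0..p} (\<lambda>_. \<rat>)" by (auto simp: \<theta>_def q)
  ultimately show ?thesis by blast
qed

section \<open>Block sums of squared inner products\<close>

lemma sum_swap_triple:
  "(\<Sum>i\<in>I. \<Sum>j\<in>J. \<Sum>c\<in>C. f i j c) = (\<Sum>c\<in>C. \<Sum>i\<in>I. \<Sum>j\<in>J. f i j c)"
proof -
  have "(\<Sum>i\<in>I. \<Sum>j\<in>J. \<Sum>c\<in>C. f i j c) = (\<Sum>i\<in>I. \<Sum>c\<in>C. \<Sum>j\<in>J. f i j c)"
    by (intro sum.cong refl sum.swap)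
  also have "\<dots> = (\<Sum>c\<in>C. \<Sum>i\<in>I. \<Sum>j\<in>J. f i j c)" by (rule sum.swap)
  finally show ?thesis .
qed

text \<open>In an orthogonal basis of the span the squared inner product is a sum of rank-one
  kernels \<open>\<phi> c d i * \<phi> c d j\<close> (the Hadamard square of a Gram matrix is
  positive semidefinite). For a rank-one kernel the claim is the Cauchy-Schwarz inequality for the
  block sums.\<close>

lemma sum_inner_square_blocks:
  fixes v :: "'i \<Rightarrow> 'h::real_inner" and \<beta> :: "'i \<Rightarrow> 'b"
  assumes I: "finite I" and B: "finite B" "\<beta> ` I \<subseteq> B"
  shows "(\<Sum>i\<in>I. \<Sum>j\<in>I. (v i \<bullet> v j)\<^sup>2) \<le> real (card B) * (\<Sum>i\<in>I. \<Sum>j\<in>I. of_bool (\<beta> i = \<beta> j) * (v i \<bullet> v j)\<^sup>2)"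
proof -
  obtain C where C: "finite C" "span C = span (v ` I)" "pairwise orthogonal C"
    using basis_orthogonal[of "v ` I"] I by blast
  \<comment> \<open>The basis vectors are orthogonal but not normalised; without 0 the divisions by
    their norms are legitimate.\<close>
  define C' where "C' = C - {0}"
  have C': "finite C'" using C by (simp add: C'_def)
  define \<phi> where "\<phi> c d i = (v i \<bullet> c) * (v i \<bullet> d) / (norm c * norm d)" for c d i
  have inner: "v i \<bullet> v j = (\<Sum>c\<in>C'. (v i \<bullet> c) * (v j \<bullet> c) / (norm c)\<^sup>2)" if "i \<in> I" "j \<in> I" for i j
  proof -
    have "v j \<in> span C" using that C by (auto intro: span_base)
    then obtain a where a: "v j = (\<Sum>c\<in>C. a c *\<^sub>R c)" using span_finite[OF C(1)] by auto
    then have a': "v j = (\<Sum>c\<in>C'. a c *\<^sub>R c)"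
      unfolding C'_def using C(1) by (simp add: sum_diff1)
    have "v j \<bullet> c = a c * (norm c)\<^sup>2" if c: "c \<in> C'" for c
    proof -
      have "v j \<bullet> c = (\<Sum>d\<in>C'. a d * (d \<bullet> c))" unfolding a' by (simp add: inner_sum_left)
      also have "\<dots> = (\<Sum>d\<in>C'. if d = c then a c * (c \<bullet> c) else 0)"
        using C(3) c by (intro sum.cong) (auto simp: C'_def pairwise_def orthogonal_def)
      also have "\<dots> = a c * (norm c)\<^sup>2" using c C' by (simp add: power2_norm_eq_inner)
      finally show ?thesis .
    qed
    then have "(\<Sum>c\<in>C'. (v i \<bullet> c) * (v j \<bullet> c) / (norm c)\<^sup>2) = (\<Sum>c\<in>C'. a c * (v i \<bullet> c))"
      by (intro sum.cong) (auto simp: C'_def)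
    also have "\<dots> = v i \<bullet> v j" unfolding a' by (simp add: inner_sum_right)
    finally show ?thesis ..
  qed
  have sq: "(v i \<bullet> v j)\<^sup>2 = (\<Sum>(c, d)\<in>C' \<times> C'. \<phi> c d i * \<phi> c d j)" if "i \<in> I" "j \<in> I" for i j
  proof -
    have "(v i \<bullet> v j)\<^sup>2 = (\<Sum>c\<in>C'. \<Sum>d\<in>C'. ((v i \<bullet> c) * (v j \<bullet> c) / (norm c)\<^sup>2) * ((v i \<bullet> d) * (v j \<bullet> d) / (norm d)\<^sup>2))"
      unfolding inner[OF that] power2_eq_square[of "sum _ _"] sum_product ..
    also have "\<dots> = (\<Sum>c\<in>C'. \<Sum>d\<in>C'. \<phi> c d i * \<phi> c d j)"
      by (intro sum.cong refl) (simp add: \<phi>_def power2_eq_square mult_ac)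
    finally show ?thesis by (simp add: sum.cartesian_product)
  qed
  have scalar: "(\<Sum>i\<in>I. \<Sum>j\<in>I. f i * f j) \<le> real (card B) * (\<Sum>i\<in>I. \<Sum>j\<in>I. of_bool (\<beta> i = \<beta> j) * (f i * f j))"
    for f :: "'i \<Rightarrow> real"
  proof -
    define g where "g b = (\<Sum>i\<in>{i\<in>I. \<beta> i = b}. f i)" for b
    have "(\<Sum>i\<in>I. f i) = (\<Sum>b\<in>B. g b)"
      unfolding g_def using I B by (intro sum.group[symmetric]) auto
    then have "(\<Sum>i\<in>I. \<Sum>j\<in>I. f i * f j) = (\<Sum>b\<in>B. g b)\<^sup>2"
      unfolding power2_eq_square sum_product[symmetric] by simp
    also have "\<dots> \<le> real (card B) * (\<Sum>b\<in>B. (g b)\<^sup>2)"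
      using sum_squared_le_sum_of_squares[of g B] B by (cases "B = {}") (auto simp: mult.commute)
    also have "(\<Sum>b\<in>B. (g b)\<^sup>2) = (\<Sum>b\<in>B. \<Sum>i\<in>{i\<in>I. \<beta> i = b}. \<Sum>j\<in>I. of_bool (\<beta> i = \<beta> j) * (f i * f j))"
    proof (intro sum.cong refl)
      fix b
      have "(g b)\<^sup>2 = (\<Sum>i\<in>{i\<in>I. \<beta> i = b}. \<Sum>j\<in>{j\<in>I. \<beta> j = b}. f i * f j)"
        by (simp add: g_def power2_eq_square sum_product)
      also have "\<dots> = (\<Sum>i\<in>{i\<in>I. \<beta> i = b}. \<Sum>j\<in>I. of_bool (\<beta> i = \<beta> j) * (f i * f j))"
        using I by (intro sum.cong refl sum.mono_neutral_cong_left) auto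
      finally show "(g b)\<^sup>2 = (\<Sum>i\<in>{i\<in>I. \<beta> i = b}. \<Sum>j\<in>I. of_bool (\<beta> i = \<beta> j) * (f i * f j))" .
    qed
    also have "\<dots> = (\<Sum>i\<in>I. \<Sum>j\<in>I. of_bool (\<beta> i = \<beta> j) * (f i * f j))"
      using I B by (intro sum.group) auto
    finally show ?thesis .
  qed
  have "(\<Sum>i\<in>I. \<Sum>j\<in>I. (v i \<bullet> v j)\<^sup>2) = (\<Sum>cd\<in>C' \<times> C'. \<Sum>i\<in>I. \<Sum>j\<in>I. \<phi> (fst cd) (snd cd) i * \<phi> (fst cd) (snd cd) j)"
    by (subst sum_swap_triple[symmetric]) (simp add: sq case_prod_unfold)
  also have "\<dots> \<le> (\<Sum>cd\<in>C' \<times> C'. real (card B) * (\<Sum>i\<in>I. \<Sum>j\<in>I. of_bool (\<beta> i = \<beta> j) * (\<phi> (fst cd) (snd cd) i * \<phi> (fst cd) (snd cd) j)))"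
    by (intro sum_mono scalar)
  also have "\<dots> = real (card B) * (\<Sum>i\<in>I. \<Sum>j\<in>I. of_bool (\<beta> i = \<beta> j) * (v i \<bullet> v j)\<^sup>2)"
    unfolding sum_distrib_left[symmetric]
    by (subst sum_swap_triple[symmetric]) (simp add: sq case_prod_unfold sum_distrib_left)
  finally show ?thesis .
qed

section \<open>Rademacher chaoses\<close>

text \<open>Termwise comparison of the power series: 2^k k! \<le> (2k)!.\<close>

lemma cosh_le_exp_half_square: "cosh x \<le> exp (x\<^sup>2 / 2)" for x :: real
proof (rule sums_le)
  have "strict_mono (\<lambda>k::nat. 2 * k)" by (rule strict_monoI) simp
  moreover have "(if even n then x ^ n /\<^sub>R fact n else 0) = 0" if "n \<notin> range (\<lambda>k::nat. 2 * k)" for n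
    using that by (auto elim!: evenE)
  ultimately show "(\<lambda>k. if even (2 * k) then x ^ (2 * k) /\<^sub>R fact (2 * k) else 0) sums cosh x"
    using cosh_converges[of x] by (subst sums_mono_reindex[where g = "\<lambda>k. 2 * k"]) auto
  show "(\<lambda>k. (x\<^sup>2 / 2) ^ k /\<^sub>R fact k) sums exp (x\<^sup>2 / 2)" by (rule exp_converges)
  have fact2: "2 ^ k * fact k \<le> (fact (2 * k) :: real)" for k
  proof (induction k)
    case (Suc k)
    have "2 ^ Suc k * fact (Suc k) = (2 * real k + 2) * (2 ^ k * fact k)" by (simp add: algebra_simps)
    also have "\<dots> \<le> (2 * real k + 2) * (1 * fact (2 * k))" using Suc by (intro mult_left_mono) auto
    also have "\<dots> \<le> (2 * real k + 2) * ((2 * real k + 1) * fact (2 * k))"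
      by (intro mult_left_mono mult_right_mono) auto
    also have "\<dots> = fact (2 * Suc k)" by (simp add: algebra_simps)
    finally show ?case .
  qed simp
  fix k
  have "x ^ (2 * k) / fact (2 * k) \<le> x ^ (2 * k) / (2 ^ k * fact k)"
    using fact2[of k] by (intro divide_left_mono) (auto simp: power_mult)
  then show "(if even (2 * k) then x ^ (2 * k) /\<^sub>R fact (2 * k) else 0) \<le> (x\<^sup>2 / 2) ^ k /\<^sub>R fact k"
  proof -
    have "(x\<^sup>2 / 2) ^ k = x ^ (2 * k) / 2 ^ k" by (simp add: power_divide power_mult)
    then have "(x\<^sup>2 / 2) ^ k /\<^sub>R fact k = x ^ (2 * k) / (2 ^ k * fact k)" by (simp add: field_simps)
    moreover have "x ^ (2 * k) /\<^sub>R fact (2 * k) = x ^ (2 * k) / fact (2 * k)" by (simp add: field_simps)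
    ultimately show ?thesis using \<open>_ / fact (2 * k) \<le> _\<close> by simp
  qed
qed

lemma power_le_fact_exp:
  fixes x :: real assumes "x \<ge> 0" shows "x ^ m \<le> fact m * exp x"
proof -
  have "(\<Sum>n\<in>{m}. x ^ n /\<^sub>R fact n) \<le> (\<Sum>n. x ^ n /\<^sub>R fact n)"
    using assms by (intro sum_le_suminf summable_exp_generic) auto
  also have "\<dots> = exp x" using exp_converges[of x] by (simp add: sums_iff)
  finally show ?thesis by (simp add: field_simps)
qed

text \<open>A sum over this set is 2^n times the expectation over n independent Rademacher signs;
  all probabilistic statements about signs are phrased as such finite sums.\<close>

definition signs :: "nat \<Rightarrow> (nat \<Rightarrow> real) set" where
  "signs n = PiE {1..n} (\<lambda>_. {-1, 1})"

lemma card_signs: "card (signs n) = 2 ^ n"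
proof -
  have "card {-1, 1 :: real} = 2" by simp
  then show ?thesis unfolding signs_def card_PiE[OF finite_atLeastAtMost] by (simp only: prod_constant) simp
qed

text \<open>Independence of the signs factorises the sum into terms 2 cosh(c i), each of which is
  sub-Gaussian.\<close>

lemma sum_signs_exp_le:
  "(\<Sum>\<epsilon>\<in>signs n. exp (\<Sum>i=1..n. c i * \<epsilon> i)) \<le> 2 ^ n * exp ((\<Sum>i=1..n. (c i)\<^sup>2) / 2)"
proof -
  have "(\<Sum>\<epsilon>\<in>signs n. exp (\<Sum>i=1..n. c i * \<epsilon> i)) = (\<Sum>\<epsilon>\<in>signs n. \<Prod>i\<in>{1..n}. exp (c i * \<epsilon> i))"
    by (simp add: exp_sum)
  also have "\<dots> = (\<Prod>i\<in>{1..n}. \<Sum>s\<in>{-1, 1}. exp (c i * s))"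
    unfolding signs_def by (rule prod_sum_PiE[symmetric]) auto
  also have "\<dots> \<le> (\<Prod>i\<in>{1..n}. 2 * exp ((c i)\<^sup>2 / 2))"
  proof (rule prod_mono)
    fix i
    show "0 \<le> (\<Sum>s\<in>{-1, 1}. exp (c i * s)) \<and> (\<Sum>s\<in>{-1, 1}. exp (c i * s)) \<le> 2 * exp ((c i)\<^sup>2 / 2)"
      using cosh_le_exp_half_square[of "c i"] by (simp add: cosh_def)
  qed
  also have "\<dots> = 2 ^ n * exp ((\<Sum>i=1..n. (c i)\<^sup>2) / 2)"
    by (simp add: prod.distrib exp_sum sum_divide_distrib)
  finally show ?thesis .
qed

text \<open>Khintchine's inequality for even moments with the growth q^q made explicit. It follows
  from the exponential moment through x^(2q) \<le> (2q)! (e^x + e^(-x)), applied to a rescaled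
  sum.\<close>

lemma sum_signs_power_le:
  assumes q: "q \<ge> 1"
  shows "(\<Sum>\<epsilon>\<in>signs n. (\<Sum>i=1..n. c i * \<epsilon> i) ^ (2 * q)) \<le> 2 ^ n * 2 * (2 * exp 1 * real q) ^ q * (\<Sum>i=1..n. (c i)\<^sup>2) ^ q"
proof (cases "(\<Sum>i=1..n. (c i)\<^sup>2) = 0")
  case True
  then have "\<forall>i\<in>{1..n}. (c i)\<^sup>2 = 0" by (subst (asm) sum_nonneg_eq_0_iff) auto
  then have "(\<Sum>i=1..n. c i * \<epsilon> i) = 0" for \<epsilon> by (intro sum.neutral) auto
  then have "(\<Sum>\<epsilon>\<in>signs n. (\<Sum>i=1..n. c i * \<epsilon> i) ^ (2 * q)) = 0"
    using q by (simp only: zero_power) simp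
  then show ?thesis by (simp add: sum_nonneg)
next
  case False
  define \<sigma> where "\<sigma> = (\<Sum>i=1..n. (c i)\<^sup>2)"
  have \<sigma>: "\<sigma> > 0" using False sum_nonneg[of "{1..n}" "\<lambda>i. (c i)\<^sup>2"] unfolding \<sigma>_def by simp
  \<comment> \<open>The minimiser of l^(-2q) exp(l^2 \<sigma> / 2); it turns the exponent into
    q.\<close>
  define l where "l = sqrt (2 * real q / \<sigma>)"
  have l2: "l\<^sup>2 = 2 * real q / \<sigma>" using \<sigma> by (simp add: l_def)
  let ?S = "\<lambda>\<epsilon>. \<Sum>i=1..n. c i * \<epsilon> i"
  have "(l * ?S \<epsilon>) ^ (2 * q) \<le> fact (2 * q) * (exp (\<Sum>i=1..n. l * c i * \<epsilon> i) + exp (\<Sum>i=1..n. - l * c i * \<epsilon> i))" for \<epsilon>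
  proof -
    have "(l * ?S \<epsilon>) ^ (2 * q) = \<bar>l * ?S \<epsilon>\<bar> ^ (2 * q)" by (simp add: power_even_abs)
    also have "\<dots> \<le> fact (2 * q) * exp \<bar>l * ?S \<epsilon>\<bar>" by (rule power_le_fact_exp) simp
    also have "\<dots> \<le> fact (2 * q) * (exp (l * ?S \<epsilon>) + exp (- (l * ?S \<epsilon>)))"
      by (intro mult_left_mono) (auto simp: abs_if)
    finally show ?thesis by (simp add: sum_distrib_left sum_negf mult.assoc)
  qed
  then have "(\<Sum>\<epsilon>\<in>signs n. (l * ?S \<epsilon>) ^ (2 * q)) \<le> (\<Sum>\<epsilon>\<in>signs n. fact (2 * q) * (exp (\<Sum>i=1..n. l * c i * \<epsilon> i) + exp (\<Sum>i=1..n. - l * c i * \<epsilon> i)))"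
    by (rule sum_mono)
  also have "\<dots> = fact (2 * q) * ((\<Sum>\<epsilon>\<in>signs n. exp (\<Sum>i=1..n. l * c i * \<epsilon> i)) + (\<Sum>\<epsilon>\<in>signs n. exp (\<Sum>i=1..n. - l * c i * \<epsilon> i)))"
    by (simp only: sum_distrib_left[symmetric] sum.distrib)
  also have "\<dots> \<le> fact (2 * q) * (2 ^ n * exp ((\<Sum>i=1..n. (l * c i)\<^sup>2) / 2) + 2 ^ n * exp ((\<Sum>i=1..n. (- l * c i)\<^sup>2) / 2))"
    by (intro mult_left_mono add_mono sum_signs_exp_le) auto
  also have "(\<Sum>i=1..n. (l * c i)\<^sup>2) = 2 * real q"
    using \<sigma> unfolding power_mult_distrib power2_minus l2 sum_distrib_left[symmetric] \<sigma>_def[symmetric] by simp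
  also have "(\<Sum>i=1..n. (- l * c i)\<^sup>2) = 2 * real q"
    using \<sigma> unfolding power_mult_distrib power2_minus l2 sum_distrib_left[symmetric] \<sigma>_def[symmetric] by simp
  also have "fact (2 * q) * (2 ^ n * exp (2 * real q / 2) + 2 ^ n * exp (2 * real q / 2)) = 2 ^ n * 2 * exp (real q) * fact (2 * q)"
    by simp
  also have "\<dots> \<le> 2 ^ n * 2 * exp (real q) * real ((2 * q) ^ (2 * q))"
    by (intro mult_left_mono fact_le_power) auto
  also have "real ((2 * q) ^ (2 * q)) = (2 * real q) ^ q * (2 * real q) ^ q"
  proof -
    have "(2 * real q) ^ (2 * q) = (2 * real q) ^ q * (2 * real q) ^ q" by (metis mult_2 power_add)
    then show ?thesis by simp
  qed
  also have "exp (real q) = exp 1 ^ q" by (metis exp_of_nat_mult mult.right_neutral)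
  finally have "(\<Sum>\<epsilon>\<in>signs n. (l * ?S \<epsilon>) ^ (2 * q)) \<le> 2 ^ n * 2 * exp 1 ^ q * ((2 * real q) ^ q * (2 * real q) ^ q)" .
  moreover have "(\<Sum>\<epsilon>\<in>signs n. (l * ?S \<epsilon>) ^ (2 * q)) = (2 * real q / \<sigma>) ^ q * (\<Sum>\<epsilon>\<in>signs n. ?S \<epsilon> ^ (2 * q))"
  proof -
    have "l ^ (2 * q) = (2 * real q / \<sigma>) ^ q" by (simp only: power_mult l2)
    then have "(l * ?S \<epsilon>) ^ (2 * q) = (2 * real q / \<sigma>) ^ q * ?S \<epsilon> ^ (2 * q)" for \<epsilon>
      by (simp only: power_mult_distrib)
    then show ?thesis
      by (subst sum_distrib_left[of "(2 * real q / \<sigma>) ^ q"]) (rule sum.cong[OF refl])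
  qed
  ultimately have bnd: "(2 * real q / \<sigma>) ^ q * (\<Sum>\<epsilon>\<in>signs n. ?S \<epsilon> ^ (2 * q)) \<le> 2 ^ n * 2 * exp 1 ^ q * ((2 * real q) ^ q * (2 * real q) ^ q)"
    by simp
  have "(2 * real q / \<sigma>) ^ q * (\<Sum>\<epsilon>\<in>signs n. ?S \<epsilon> ^ (2 * q)) \<le> (2 * real q / \<sigma>) ^ q * (2 ^ n * 2 * (2 * exp 1 * real q) ^ q * \<sigma> ^ q)"
  proof -
    have "(2 * real q / \<sigma>) ^ q * \<sigma> ^ q = (2 * real q) ^ q"
      using \<sigma> by (subst power_mult_distrib[symmetric]) simp
    moreover have "(2 * exp 1 * real q) ^ q = exp 1 ^ q * (2 * real q) ^ q"
      by (simp add: power_mult_distrib)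
    moreover have "(2 * real q / \<sigma>) ^ q * (2 ^ n * 2 * (2 * exp 1 * real q) ^ q * \<sigma> ^ q)
        = 2 ^ n * 2 * (2 * exp 1 * real q) ^ q * ((2 * real q / \<sigma>) ^ q * \<sigma> ^ q)"
      by (rule mult.left_commute)
    ultimately have "(2 * real q / \<sigma>) ^ q * (2 ^ n * 2 * (2 * exp 1 * real q) ^ q * \<sigma> ^ q)
        = 2 ^ n * 2 * exp 1 ^ q * ((2 * real q) ^ q * (2 * real q) ^ q)"
      by (simp only: mult.assoc)
    then show ?thesis using bnd by (simp only:)
  qed
  then show ?thesis
    unfolding \<sigma>_def[symmetric] by (rule mult_left_le_imp_le) (use \<sigma> q in simp)
qed

text \<open>Jensen's inequality for x^q with free weights. It stands in for the triangle inequality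
  in L^q: weights proportional to the expected sizes of the terms lose nothing.\<close>

lemma sum_power_le_weighted:
  fixes x w :: "'i \<Rightarrow> real"
  assumes I: "finite I" and x: "\<And>i. i \<in> I \<Longrightarrow> x i \<ge> 0" and w: "\<And>i. i \<in> I \<Longrightarrow> w i > 0" "(\<Sum>i\<in>I. w i) = 1"
  shows "(\<Sum>i\<in>I. x i) ^ q \<le> (\<Sum>i\<in>I. w i * (x i / w i) ^ q)"
proof -
  have "I \<noteq> {}" using w(2) by auto
  have "convex_on {0..} (\<lambda>x::real. x ^ q)" 
    by (cases "even q") (auto intro: convex_power_odd convex_on_subset[OF convex_power_even])
  then have "(\<Sum>i\<in>I. w i *\<^sub>R (x i / w i)) ^ q \<le> (\<Sum>i\<in>I. w i * (x i / w i) ^ q)"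
    using I \<open>I \<noteq> {}\<close> w x by (intro convex_on_sum) (auto intro: less_imp_le divide_nonneg_pos)
  also have "(\<Sum>i\<in>I. w i *\<^sub>R (x i / w i)) = (\<Sum>i\<in>I. x i)"
    using w(1) by (intro sum.cong) (force)+
  finally show ?thesis .
qed

text \<open>Khintchine is applied twice: to the signs \<epsilon> for fixed \<epsilon>', and then to
  each row sum \<open>c \<epsilon>' i\<close>. In between, the q-th power of the sum of squared row
  sums is opened by weighted Jensen with weights \<open>\<beta> i / \<beta>s\<close>, after which
  the factors \<open>\<beta> i ^ q\<close> cancel and exactly \<open>\<beta>s ^ q\<close>
  remains.\<close>

lemma sum_signs_bilinear_power_le:
  assumes q: "q \<ge> 1"
  shows "(\<Sum>\<epsilon>'\<in>signs n. \<Sum>\<epsilon>\<in>signs n. (\<Sum>i=1..n. \<Sum>j=1..n. b i j * \<epsilon> i * \<epsilon>' j) ^ (2 * q))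
    \<le> 4 ^ n * 4 * (2 * exp 1 * real q) ^ (2 * q) * (\<Sum>i=1..n. \<Sum>j=1..n. (b i j)\<^sup>2) ^ q"
proof -
  let ?M = "2 ^ n * 2 * (2 * exp 1 * real q) ^ q :: real"
  define c where "c \<epsilon>' i = (\<Sum>j=1..n. b i j * \<epsilon>' j)" for \<epsilon>' i
  define \<beta> where "\<beta> i = (\<Sum>j=1..n. (b i j)\<^sup>2)" for i
  define \<beta>s where "\<beta>s = (\<Sum>i=1..n. \<beta> i)"
  have \<beta>0: "\<beta> i \<ge> 0" for i unfolding \<beta>_def by (rule sum_nonneg) simp
  have c0: "c \<epsilon>' i = 0" if "\<beta> i = 0" for \<epsilon>' i
  proof -
    have "\<forall>j\<in>{1..n}. (b i j)\<^sup>2 = 0" using that unfolding \<beta>_def by (subst (asm) sum_nonneg_eq_0_iff) auto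
    then show ?thesis unfolding c_def by (intro sum.neutral) auto
  qed
  \<comment> \<open>Rows that vanish identically would get weight 0 in the Jensen step.\<close>
  define I where "I = {i\<in>{1..n}. \<beta> i > 0}"
  have I: "finite I" by (simp add: I_def)
  have \<beta>I: "(\<Sum>i\<in>I. \<beta> i) = \<beta>s"
    unfolding \<beta>s_def I_def using \<beta>0 by (intro sum.mono_neutral_left) (auto simp: not_less intro: antisym)
  have sumc: "(\<Sum>i\<in>I. (c \<epsilon>' i)\<^sup>2) = (\<Sum>i=1..n. (c \<epsilon>' i)\<^sup>2)" for \<epsilon>'
    unfolding I_def using \<beta>0 by (intro sum.mono_neutral_left) (auto simp: not_less intro!: c0 antisym)
  have cq: "(\<Sum>\<epsilon>'\<in>signs n. (c \<epsilon>' i) ^ (2 * q)) \<le> ?M * \<beta> i ^ q" for i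
    unfolding c_def \<beta>_def by (rule sum_signs_power_le[OF q])
  have key: "(\<Sum>\<epsilon>'\<in>signs n. (\<Sum>i=1..n. (c \<epsilon>' i)\<^sup>2) ^ q) \<le> ?M * \<beta>s ^ q"
  proof (cases "I = {}")
    case True
    then have "\<beta>s = 0" using \<beta>I by simp
    have "(\<Sum>i=1..n. (c \<epsilon>' i)\<^sup>2) ^ q = 0" for \<epsilon>'
      unfolding sumc[symmetric] True using q by simp
    then show ?thesis using \<open>\<beta>s = 0\<close> by (simp only: sum.neutral_const) simp
  next
    case False
    then have pos: "\<beta>s > 0" unfolding \<beta>I[symmetric] using I by (intro sum_pos) (auto simp: I_def)
    have "(\<Sum>i\<in>I. (c \<epsilon>' i)\<^sup>2) ^ q \<le> (\<Sum>i\<in>I. \<beta> i / \<beta>s * ((c \<epsilon>' i)\<^sup>2 / (\<beta> i / \<beta>s)) ^ q)" for \<epsilon>'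
      by (rule sum_power_le_weighted)
        (use I pos in \<open>auto simp: \<beta>I sum_divide_distrib[symmetric], auto simp: I_def\<close>)
    then have "(\<Sum>\<epsilon>'\<in>signs n. (\<Sum>i=1..n. (c \<epsilon>' i)\<^sup>2) ^ q) \<le> (\<Sum>\<epsilon>'\<in>signs n. \<Sum>i\<in>I. \<beta> i / \<beta>s * ((c \<epsilon>' i)\<^sup>2 / (\<beta> i / \<beta>s)) ^ q)"
      unfolding sumc[symmetric] by (rule sum_mono)
    also have "\<dots> = (\<Sum>i\<in>I. (\<Sum>\<epsilon>'\<in>signs n. (c \<epsilon>' i) ^ (2 * q)) * (\<beta> i / \<beta>s * (\<beta>s / \<beta> i) ^ q))"
    proof -
      have "\<beta> i / \<beta>s * ((c \<epsilon>' i)\<^sup>2 / (\<beta> i / \<beta>s)) ^ q = (c \<epsilon>' i) ^ (2 * q) * (\<beta> i / \<beta>s * (\<beta>s / \<beta> i) ^ q)" for \<epsilon>' i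
      proof -
        have "(c \<epsilon>' i)\<^sup>2 / (\<beta> i / \<beta>s) = (c \<epsilon>' i)\<^sup>2 * (\<beta>s / \<beta> i)" by simp
        then show ?thesis unfolding power_mult by (simp only: power_mult_distrib mult_ac)
      qed
      then show ?thesis unfolding sum_distrib_right by (simp only:) (rule sum.swap)
    qed
    also have "\<dots> \<le> (\<Sum>i\<in>I. (?M * \<beta> i ^ q) * (\<beta> i / \<beta>s * (\<beta>s / \<beta> i) ^ q))"
      using pos \<beta>0 by (intro sum_mono mult_right_mono cq) auto
    also have "\<dots> = (\<Sum>i\<in>I. ?M * \<beta>s ^ q * (\<beta> i / \<beta>s))"
      by (intro sum.cong refl) (auto simp: I_def power_divide)
    also have "\<dots> = ?M * \<beta>s ^ q"
      using pos by (simp add: sum_distrib_left[symmetric] sum_divide_distrib[symmetric] \<beta>I)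
    finally show ?thesis .
  qed
  have "(\<Sum>\<epsilon>'\<in>signs n. \<Sum>\<epsilon>\<in>signs n. (\<Sum>i=1..n. \<Sum>j=1..n. b i j * \<epsilon> i * \<epsilon>' j) ^ (2 * q))
      = (\<Sum>\<epsilon>'\<in>signs n. \<Sum>\<epsilon>\<in>signs n. (\<Sum>i=1..n. c \<epsilon>' i * \<epsilon> i) ^ (2 * q))"
    unfolding c_def sum_distrib_right by (simp add: mult_ac)
  also have "\<dots> \<le> (\<Sum>\<epsilon>'\<in>signs n. ?M * (\<Sum>i=1..n. (c \<epsilon>' i)\<^sup>2) ^ q)"
    by (intro sum_mono sum_signs_power_le q)
  also have "\<dots> \<le> ?M * (?M * \<beta>s ^ q)"
    unfolding sum_distrib_left[symmetric] by (intro mult_left_mono key) auto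
  also have "\<dots> = 4 ^ n * 4 * (2 * exp 1 * real q) ^ (2 * q) * \<beta>s ^ q"
  proof -
    have "(2::real) ^ n * 2 ^ n = 4 ^ n" by (simp add: power_mult_distrib[symmetric])
    moreover have "(2 * exp 1 * real q) ^ (2 * q) = (2 * exp 1 * real q) ^ q * (2 * exp 1 * real q) ^ q"
      by (metis mult_2 power_add)
    ultimately show ?thesis by (simp only: mult_ac) simp
  qed
  finally show ?thesis unfolding \<beta>s_def \<beta>_def .
qed

text \<open>A union bound in the 2q-th moment. The level \<open>t\<close> is e times the moment
  bound of a single chaos, so each index contributes at most 4 t e^(-2q) beyond t on average, and at
  most e^(2q) indices contribute 4 t together. The function \<open>m\<close> is only required to be
  dominated by some chaos, so an empty index set causes no trouble.\<close>

theorem rademacher_chaos_maximal: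
  fixes b :: "'r \<Rightarrow> nat \<Rightarrow> nat \<Rightarrow> real" and m :: "(nat \<Rightarrow> real) \<Rightarrow> (nat \<Rightarrow> real) \<Rightarrow> real"
  assumes R: "finite R" and q: "q \<ge> 1" "real (card R) \<le> exp (2 * real q)" and B: "B \<ge> 0"
    and b: "\<And>r. r \<in> R \<Longrightarrow> (\<Sum>i=1..n. \<Sum>j=1..n. (b r i j)\<^sup>2) \<le> B\<^sup>2"
    and m: "\<And>\<epsilon> \<epsilon>'. m \<epsilon> \<epsilon>' \<le> 0 \<or> (\<exists>r\<in>R. m \<epsilon> \<epsilon>' \<le> \<bar>\<Sum>i=1..n. \<Sum>j=1..n. b r i j * \<epsilon> i * \<epsilon>' j\<bar>)"
  shows "(\<Sum>\<epsilon>'\<in>signs n. \<Sum>\<epsilon>\<in>signs n. m \<epsilon> \<epsilon>') \<le> 4 ^ n * (10 * (exp 1)\<^sup>2 * real q * B)"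
proof (cases "B = 0")
  case True
  have "b r i j = 0" if "r \<in> R" "i \<in> {1..n}" "j \<in> {1..n}" for r i j
  proof -
    have "(b r i j)\<^sup>2 \<le> (\<Sum>j=1..n. (b r i j)\<^sup>2)" using that by (intro member_le_sum) auto
    also have "\<dots> \<le> (\<Sum>i=1..n. \<Sum>j=1..n. (b r i j)\<^sup>2)"
      using that by (intro member_le_sum[of i "{1..n}" "\<lambda>i. \<Sum>j=1..n. (b r i j)\<^sup>2"] sum_nonneg) auto
    also have "\<dots> \<le> 0" using b[OF that(1)] True by simp
    finally show ?thesis by simp
  qed
  then have "(\<Sum>i=1..n. \<Sum>j=1..n. b r i j * \<epsilon> i * \<epsilon>' j) = 0" if "r \<in> R" for r \<epsilon> \<epsilon>'
    using that by simp
  then have "m \<epsilon> \<epsilon>' \<le> 0" for \<epsilon> \<epsilon>' using m[of \<epsilon> \<epsilon>'] by fastforce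
  then have "(\<Sum>\<epsilon>'\<in>signs n. \<Sum>\<epsilon>\<in>signs n. m \<epsilon> \<epsilon>') \<le> 0" by (intro sum_nonpos) auto
  then show ?thesis using True by simp
next
  case False
  let ?W = "\<lambda>r \<epsilon> \<epsilon>'. \<Sum>i=1..n. \<Sum>j=1..n. b r i j * \<epsilon> i * \<epsilon>' j"
  define t where "t = 2 * (exp 1)\<^sup>2 * real q * B"
  have t: "t > 0" using q B False by (simp add: t_def)
  have t2: "t = 2 * exp 1 * real q * B * exp 1" by (simp add: t_def power2_eq_square)
  \<comment> \<open>For w > t one has w \<le> t (w/t)^(2q); summing this over all of
    \<open>R\<close> avoids knowing which index attains the maximum.\<close>
  have pt: "m \<epsilon> \<epsilon>' \<le> t + (\<Sum>r\<in>R. ?W r \<epsilon> \<epsilon>' ^ (2 * q)) * (t / t ^ (2 * q))" for \<epsilon> \<epsilon>'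
  proof -
    have nn: "(\<Sum>r\<in>R. ?W r \<epsilon> \<epsilon>' ^ (2 * q)) * (t / t ^ (2 * q)) \<ge> 0"
      using t by (intro mult_nonneg_nonneg sum_nonneg) auto
    show ?thesis
    proof (cases "m \<epsilon> \<epsilon>' \<le> t")
      case False
      then obtain r where r: "r \<in> R" "m \<epsilon> \<epsilon>' \<le> \<bar>?W r \<epsilon> \<epsilon>'\<bar>" using m[of \<epsilon> \<epsilon>'] t by auto
      define w where "w = \<bar>?W r \<epsilon> \<epsilon>'\<bar>"
      have w: "w > t" using False r unfolding w_def by linarith
      have "w / t \<le> (w / t) ^ (2 * q)" using w t q by (intro self_le_power) auto
      then have "w \<le> w ^ (2 * q) * (t / t ^ (2 * q))" using t by (simp add: power_divide field_simps)
      also have "w ^ (2 * q) = ?W r \<epsilon> \<epsilon>' ^ (2 * q)" unfolding w_def by (simp add: power_even_abs)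
      also have "?W r \<epsilon> \<epsilon>' ^ (2 * q) * (t / t ^ (2 * q)) \<le> (\<Sum>r\<in>R. ?W r \<epsilon> \<epsilon>' ^ (2 * q)) * (t / t ^ (2 * q))"
        using t R r by (intro mult_right_mono member_le_sum) auto
      finally show ?thesis using r(2) t unfolding w_def by linarith
    qed (use nn in linarith)
  qed
  have "(\<Sum>\<epsilon>'\<in>signs n. \<Sum>\<epsilon>\<in>signs n. m \<epsilon> \<epsilon>') \<le> (\<Sum>\<epsilon>'\<in>signs n. \<Sum>\<epsilon>\<in>signs n. t + (\<Sum>r\<in>R. ?W r \<epsilon> \<epsilon>' ^ (2 * q)) * (t / t ^ (2 * q)))"
    by (intro sum_mono pt)
  also have "\<dots> = 4 ^ n * t + (\<Sum>r\<in>R. \<Sum>\<epsilon>'\<in>signs n. \<Sum>\<epsilon>\<in>signs n. ?W r \<epsilon> \<epsilon>' ^ (2 * q)) * (t / t ^ (2 * q))"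
  proof -
    have "(\<Sum>\<epsilon>'\<in>signs n. \<Sum>\<epsilon>\<in>signs n. \<Sum>r\<in>R. ?W r \<epsilon> \<epsilon>' ^ (2 * q)) = (\<Sum>r\<in>R. \<Sum>\<epsilon>'\<in>signs n. \<Sum>\<epsilon>\<in>signs n. ?W r \<epsilon> \<epsilon>' ^ (2 * q))"
      by (subst sum.swap[of _ R "signs n"]) (subst (2) sum.swap, rule refl)
    moreover have "real (card (signs n)) * (real (card (signs n)) * t) = 4 ^ n * t"
      by (simp add: card_signs mult.assoc[symmetric] power_mult_distrib[symmetric])
    ultimately show ?thesis
      by (simp only: sum.distrib sum_distrib_right[symmetric] sum_constant)
  qed
  finally have fin: "(\<Sum>\<epsilon>'\<in>signs n. \<Sum>\<epsilon>\<in>signs n. m \<epsilon> \<epsilon>')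
    \<le> 4 ^ n * t + (\<Sum>r\<in>R. \<Sum>\<epsilon>'\<in>signs n. \<Sum>\<epsilon>\<in>signs n. ?W r \<epsilon> \<epsilon>' ^ (2 * q)) * (t / t ^ (2 * q))" .
  have "(\<Sum>r\<in>R. \<Sum>\<epsilon>'\<in>signs n. \<Sum>\<epsilon>\<in>signs n. ?W r \<epsilon> \<epsilon>' ^ (2 * q)) \<le> (\<Sum>r\<in>R. 4 ^ n * 4 * (2 * exp 1 * real q) ^ (2 * q) * (B\<^sup>2) ^ q)"
  proof (rule sum_mono)
    fix r assume "r \<in> R"
    have "(\<Sum>\<epsilon>'\<in>signs n. \<Sum>\<epsilon>\<in>signs n. ?W r \<epsilon> \<epsilon>' ^ (2 * q)) \<le> 4 ^ n * 4 * (2 * exp 1 * real q) ^ (2 * q) * (\<Sum>i=1..n. \<Sum>j=1..n. (b r i j)\<^sup>2) ^ q"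
      by (rule sum_signs_bilinear_power_le[OF q(1)])
    also have "\<dots> \<le> 4 ^ n * 4 * (2 * exp 1 * real q) ^ (2 * q) * (B\<^sup>2) ^ q"
      using b[OF \<open>r \<in> R\<close>] by (intro mult_left_mono power_mono sum_nonneg) auto
    finally show "(\<Sum>\<epsilon>'\<in>signs n. \<Sum>\<epsilon>\<in>signs n. ?W r \<epsilon> \<epsilon>' ^ (2 * q)) \<le> 4 ^ n * 4 * (2 * exp 1 * real q) ^ (2 * q) * (B\<^sup>2) ^ q" .
  qed
  also have "\<dots> = 4 ^ n * 4 * (real (card R) * (t ^ (2 * q) / exp (2 * real q)))"
  proof -
    have "exp (2 * real q) = exp 1 ^ (2 * q)" using exp_of_nat_mult[of "2 * q" "1::real"] by simp
    then have "t ^ (2 * q) / exp (2 * real q) = (2 * exp 1 * real q * B) ^ (2 * q)"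
      unfolding t2 by (simp add: power_mult_distrib)
    then show ?thesis by (simp add: power_mult_distrib power_mult)
  qed
  also have "\<dots> \<le> 4 ^ n * 4 * (exp (2 * real q) * (t ^ (2 * q) / exp (2 * real q)))"
    using q t by (intro mult_left_mono mult_right_mono) auto
  finally have "(\<Sum>r\<in>R. \<Sum>\<epsilon>'\<in>signs n. \<Sum>\<epsilon>\<in>signs n. ?W r \<epsilon> \<epsilon>' ^ (2 * q)) * (t / t ^ (2 * q))
      \<le> 4 ^ n * 4 * (exp (2 * real q) * (t ^ (2 * q) / exp (2 * real q))) * (t / t ^ (2 * q))"
    using t by (intro mult_right_mono) auto
  note add_left_mono[OF this, of "4 ^ n * t"]
  also have "4 ^ n * t + 4 ^ n * 4 * (exp (2 * real q) * (t ^ (2 * q) / exp (2 * real q))) * (t / t ^ (2 * q)) = 4 ^ n * (5 * t)"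
    using t by simp
  also have "5 * t = 10 * (exp 1)\<^sup>2 * real q * B" by (simp add: t_def)
  finally show ?thesis using fin by linarith
qed

section \<open>Centred designs\<close>

text \<open>Each prescribed sign halves the count. This evaluates the probability with which a given
  pair survives the random selection in the symmetrisation argument.\<close>

lemma sum_signs_indicator:
  assumes A: "A \<subseteq> {1..n}" and s: "\<And>k. k \<in> A \<Longrightarrow> s k = 1 \<or> s k = -1"
  shows "(\<Sum>\<delta>\<in>signs n. of_bool (\<forall>k\<in>A. \<delta> k = s k)) = (2 ^ n * (1 / 2) ^ card A :: real)"
proof -
  let ?w = "\<lambda>k x. if k \<in> A then of_bool (x = s k) else 1 :: real"
  have "of_bool (\<forall>k\<in>A. \<delta> k = s k) = (\<Prod>k\<in>{1..n}. ?w k (\<delta> k))" for \<delta> :: "nat \<Rightarrow> real"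
  proof (cases "\<forall>k\<in>A. \<delta> k = s k")
    case True
    then have "(\<Prod>k\<in>{1..n}. ?w k (\<delta> k)) = 1" by (intro prod.neutral) simp
    then show ?thesis using True by simp
  next
    case False
    then obtain k where "k \<in> A" "\<delta> k \<noteq> s k" by blast
    then have "(\<Prod>k\<in>{1..n}. ?w k (\<delta> k)) = 0" using A by (intro prod_zero) (auto intro!: bexI[of _ k])
    moreover have "of_bool (\<forall>k\<in>A. \<delta> k = s k) = (0 :: real)" using False by simp
    ultimately show ?thesis by (simp only:)
  qed
  then have "(\<Sum>\<delta>\<in>signs n. of_bool (\<forall>k\<in>A. \<delta> k = s k)) = (\<Sum>\<delta>\<in>signs n. \<Prod>k\<in>{1..n}. ?w k (\<delta> k))"
    by simp
  also have "\<dots> = (\<Prod>k\<in>{1..n}. \<Sum>x\<in>{-1, 1}. ?w k x)"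
    unfolding signs_def by (rule prod_sum_PiE[symmetric]) auto
  also have "\<dots> = (\<Prod>k\<in>{1..n}. 2 * (if k \<in> A then 1 / 2 else 1))"
  proof (rule prod.cong[OF refl])
    fix k assume "k \<in> {1..n}"
    show "(\<Sum>x\<in>{-1, 1}. ?w k x) = 2 * (if k \<in> A then 1 / 2 else 1)"
      using s[of k] by (cases "k \<in> A") auto
  qed
  also have "\<dots> = 2 ^ n * (\<Prod>k\<in>{1..n}. if k \<in> A then 1 / 2 else 1)"
    by (simp add: prod.distrib)
  also have "(\<Prod>k\<in>{1..n}. if k \<in> A then 1 / 2 else 1 :: real) = (\<Prod>k\<in>A. 1 / 2)"
    using A by (intro prod.mono_neutral_cong_right) auto
  finally show ?thesis by simp
qed

text \<open>Pointwise substitute for measurability with respect to all covariates and all noises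
  except the i-th. Only the noise is varied and the covariate \<open>b\<close> is kept, because
  ranks depend on every covariate.\<close>

definition unaffected :: "nat \<Rightarrow> ((nat \<Rightarrow> 'h \<times> 'x) \<Rightarrow> 'b) \<Rightarrow> bool" where
  "unaffected i f \<longleftrightarrow> (\<forall>\<xi> a a' b. f (\<xi>(i := (a, b))) = f (\<xi>(i := (a', b))))"

lemma unaffected_const [intro, simp]: "unaffected i (\<lambda>_. c)"
  by (simp add: unaffected_def)

lemma unaffected_snd [intro, simp]: "unaffected i (\<lambda>\<xi>. snd (\<xi> j))"
  by (simp add: unaffected_def)

lemma unaffected_fst [intro]: "j \<noteq> i \<Longrightarrow> unaffected i (\<lambda>\<xi>. fst (\<xi> j))"
  by (simp add: unaffected_def)

lemma unaffected_comp1: "unaffected i f \<Longrightarrow> unaffected i (\<lambda>\<xi>. F (f \<xi>))"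
  unfolding unaffected_def by metis

lemma unaffected_comp2: "unaffected i f \<Longrightarrow> unaffected i g \<Longrightarrow> unaffected i (\<lambda>\<xi>. F (f \<xi>) (g \<xi>))"
  unfolding unaffected_def by metis

lemma unaffected_family: "(\<And>k. unaffected i (f k)) \<Longrightarrow> unaffected i (\<lambda>\<xi>. F (\<lambda>k. f k \<xi>))"
  unfolding unaffected_def by (intro allI arg_cong[where f = F] ext) blast

lemma unaffected_sum: "(\<And>k. k \<in> K \<Longrightarrow> unaffected i (f k)) \<Longrightarrow> unaffected i (\<lambda>\<xi>. \<Sum>k\<in>K. f k \<xi>)"
  unfolding unaffected_def by (intro allI sum.cong) auto

text \<open>Choosing the first maximiser makes the choice unique, so that its indicator is defined
  by finitely many comparisons and is measurable.\<close>

lemma ex_unique_first_max: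
  fixes v :: "nat \<Rightarrow> real"
  assumes "m > 0"
  obtains k where "k < m" "\<forall>l<m. v l \<le> v k" "\<forall>l<k. v l < v k"
    "\<And>k'. k' < m \<Longrightarrow> \<forall>l<m. v l \<le> v k' \<Longrightarrow> \<forall>l<k'. v l < v k' \<Longrightarrow> k' = k"
proof -
  let ?Q = "\<lambda>k. k < m \<and> (\<forall>l<m. v l \<le> v k)"
  have "Max (v ` {..<m}) \<in> v ` {..<m}" using assms by (intro Max_in) auto
  then obtain k where "k < m" "v k = Max (v ` {..<m})" by auto
  then have "?Q k" by simp
  then have Q: "?Q (LEAST k. ?Q k)" by (rule LeastI)
  let ?k = "LEAST k. ?Q k"
  have less: "v l < v ?k" if "l < ?k" for l
  proof (rule ccontr)
    assume "\<not> v l < v ?k"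
    then have "?Q l" using Q that by force
    then show False using not_less_Least[OF that] by blast
  qed
  show ?thesis
  proof (rule that[of ?k])
    fix k' assume k': "k' < m" "\<forall>l<m. v l \<le> v k'" "\<forall>l<k'. v l < v k'"
    show "k' = ?k"
    proof (rule linorder_cases[of k' ?k])
      assume "k' < ?k" then show ?thesis using less[of k'] k' Q by force
    next
      assume "?k < k'" then show ?thesis using k' Q by force
    qed
  qed (use Q less in auto)
qed

text \<open>\<open>D\<close> is the joint law of noise and covariate. The condition
  \<open>centered\<close> is the weak form of conditional mean zero; it ranges over all measurable
  \<phi>, since an integrand that is not integrable has integral 0 by convention.\<close>

locale centered_design = prob_space D
  for D :: "('h::{real_inner, second_countable_topology} \<times> 'x::topological_space) measure" +
  assumes sets_D [measurable_cong]: "sets D = sets (borel \<Otimes>\<^sub>M borel)"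
    and moment8: "integrable D (\<lambda>z. norm (fst z) ^ 8)"
    and centered: "\<And>\<phi> v. \<phi> \<in> borel_measurable borel \<Longrightarrow> (\<integral>z. \<phi> (snd z) * (fst z \<bullet> v) \<partial>D) = 0"
begin

lemma space_D: "space D = UNIV"
  using sets_eq_imp_space_eq[OF sets_D] by (simp add: space_pair_measure)

lemma fst_D [measurable]: "fst \<in> borel_measurable D"
  by (subst measurable_cong_sets[OF sets_D refl]) measurable

lemma snd_D [measurable]: "snd \<in> D \<rightarrow>\<^sub>M borel"
  by (subst measurable_cong_sets[OF sets_D refl]) measurable

abbreviation P :: "nat \<Rightarrow> (nat \<Rightarrow> 'h \<times> 'x) measure" where
  "P n \<equiv> PiM {1..n} (\<lambda>_. D)"

sublocale PS: product_prob_space "\<lambda>_::nat. D" UNIV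
  by unfold_locales

sublocale P: prob_space "P n" for n
  by (intro prob_space_PiM prob_space_axioms)

text \<open>Points of the product space are extensional, so a coordinate outside
  \<open>{1..n}\<close> is the constant \<open>undefined\<close>. Later measurability proofs thereby
  carry no condition on indices.\<close>

lemma component_measurable [measurable]: "(\<lambda>\<xi>. \<xi> i) \<in> P n \<rightarrow>\<^sub>M D"
proof (cases "i \<in> {1..n}")
  case False
  have "(\<lambda>\<xi>::nat \<Rightarrow> 'h \<times> 'x. undefined) \<in> P n \<rightarrow>\<^sub>M D" by (rule measurable_const) (simp add: space_D)
  moreover have "\<xi> i = undefined" if "\<xi> \<in> space (P n)" for \<xi>
    using that False by (auto simp: space_PiM PiE_def extensional_def)
  ultimately show ?thesis by (subst measurable_cong) auto
qed simp

lemma fst_component [measurable]: "(\<lambda>\<xi>. fst (\<xi> i)) \<in> borel_measurable (P n)"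
  by (rule measurable_compose[OF component_measurable fst_D])

lemma snd_component [measurable]: "(\<lambda>\<xi>. snd (\<xi> i)) \<in> P n \<rightarrow>\<^sub>M borel"
  by (rule measurable_compose[OF component_measurable snd_D])

lemma integral_component:
  fixes f :: "'h \<times> 'x \<Rightarrow> real"
  assumes i: "i \<in> {1..n}" and f: "f \<in> borel_measurable D"
  shows "(\<integral>\<xi>. f (\<xi> i) \<partial>P n) = (\<integral>z. f z \<partial>D)"
    and "integrable D f \<Longrightarrow> integrable (P n) (\<lambda>\<xi>. f (\<xi> i))"
proof -
  have d: "distr (P n) D (\<lambda>\<xi>. \<xi> i) = D"
    using distr_PiM_component[of "{1..n}" "\<lambda>_. D" i] i prob_space_axioms by simp
  show "(\<integral>\<xi>. f (\<xi> i) \<partial>P n) = (\<integral>z. f z \<partial>D)"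
    using integral_distr[OF component_measurable[of i n] f] unfolding d by simp
  assume "integrable D f"
  then show "integrable (P n) (\<lambda>\<xi>. f (\<xi> i))"
    using integrable_distr_eq[OF component_measurable[of i n] f] unfolding d by simp
qed

text \<open>Fubini with coordinate \<open>i\<close> integrated innermost; in the non-integrable case
  the integral is 0 by convention.\<close>

lemma integral_eq_0_single:
  fixes f :: "(nat \<Rightarrow> 'h \<times> 'x) \<Rightarrow> real"
  assumes i: "i \<in> {1..n}"
    and 0: "\<And>\<xi>. \<xi> \<in> space (PiM ({1..n} - {i}) (\<lambda>_. D)) \<Longrightarrow> (\<integral>z. f (\<xi>(i := z)) \<partial>D) = 0"
  shows "(\<integral>\<xi>. f \<xi> \<partial>P n) = 0"
proof (cases "integrable (P n) f")
  case True
  have ins: "insert i ({1..n} - {i}) = {1..n}" using i by auto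
  have "(\<integral>\<xi>. f \<xi> \<partial>P n) = (\<integral>\<xi>. (\<integral>z. f (\<xi>(i := z)) \<partial>D) \<partial>PiM ({1..n} - {i}) (\<lambda>_. D))"
    using PS.product_integral_insert[of "{1..n} - {i}" i f] True unfolding ins by simp
  also have "\<dots> = (\<integral>\<xi>. 0 \<partial>PiM ({1..n} - {i}) (\<lambda>_. D))"
    by (intro Bochner_Integration.integral_cong refl 0)
  finally show ?thesis by simp
qed (rule not_integrable_integral_eq)

text \<open>The same for two coordinates at once. The map \<open>?T\<close> inserts a pair into the
  remaining sample; comparing the measures of boxes shows that it carries the product of the pair
  law and the law of the rest to \<open>P n\<close>.\<close>

lemma integral_eq_0_pair:
  fixes f :: "(nat \<Rightarrow> 'h \<times> 'x) \<Rightarrow> real"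
  assumes ij: "i \<in> {1..n}" "j \<in> {1..n}" "i \<noteq> j"
    and 0: "\<And>\<xi>. \<xi> \<in> space (PiM ({1..n} - {i, j}) (\<lambda>_. D)) \<Longrightarrow>
      (\<integral>zz. f (\<xi>(i := fst zz, j := snd zz)) \<partial>(D \<Otimes>\<^sub>M D)) = 0"
  shows "(\<integral>\<xi>. f \<xi> \<partial>P n) = 0"
proof (cases "integrable (P n) f")
  case True
  let ?K = "{1..n} - {i, j}"
  let ?Q = "(D \<Otimes>\<^sub>M D) \<Otimes>\<^sub>M PiM ?K (\<lambda>_. D)"
  let ?T = "\<lambda>(zz, \<xi>). \<xi>(i := fst zz, j := snd zz)"
  interpret K: prob_space "PiM ?K (\<lambda>_. D)" by (intro prob_space_PiM prob_space_axioms)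
  interpret DD: pair_prob_space D D by unfold_locales
  interpret Q: pair_sigma_finite "D \<Otimes>\<^sub>M D" "PiM ?K (\<lambda>_. D)" by unfold_locales
  have T: "?T \<in> ?Q \<rightarrow>\<^sub>M P n"
  proof (rule measurable_PiM_single')
    show "(\<lambda>w. ?T w k) \<in> ?Q \<rightarrow>\<^sub>M D" if k: "k \<in> {1..n}" for k
    proof -
      consider "k = i" "k \<noteq> j" | "k = j" | "k \<in> ?K" using k by blast
      then show ?thesis
      proof cases
        case 3
        then have eq: "(\<lambda>w. ?T w k) = (\<lambda>w. snd w k)" by (auto simp: fun_eq_iff)
        show ?thesis unfolding eq
          by (rule measurable_compose[OF measurable_snd measurable_component_singleton]) fact
      qed (simp_all add: case_prod_unfold)
    qed
    show "?T \<in> space ?Q \<rightarrow> {1..n} \<rightarrow>\<^sub>E space D"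
      using ij by (auto simp: space_pair_measure space_PiM space_D PiE_def extensional_def)
  qed
  have "distr ?Q (P n) ?T = P n"
  proof (rule PS.PiM_eqI)
    fix A assume A: "\<And>k. k \<in> {1..n} \<Longrightarrow> A k \<in> sets D"
    have "?T -` PiE {1..n} A \<inter> space ?Q = (A i \<times> A j) \<times> PiE ?K A"
    proof (intro equalityI subsetI)
      fix w assume w: "w \<in> ?T -` PiE {1..n} A \<inter> space ?Q"
      obtain z z' \<xi> where w': "w = ((z, z'), \<xi>)" by (metis prod.exhaust)
      have mem: "\<xi>(i := z, j := z') \<in> PiE {1..n} A" and sp: "\<xi> \<in> space (PiM ?K (\<lambda>_. D))"
        using w unfolding w' by (auto simp: space_pair_measure)
      have "z \<in> A i" "z' \<in> A j"
        using PiE_mem[OF mem, of i] PiE_mem[OF mem, of j] ij by auto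
      moreover have "\<xi> k \<in> A k" if "k \<in> ?K" for k using PiE_mem[OF mem, of k] that by auto
      ultimately show "w \<in> (A i \<times> A j) \<times> PiE ?K A"
        using sp unfolding w' by (auto simp: space_PiM PiE_def)
    next
      fix w assume "w \<in> (A i \<times> A j) \<times> PiE ?K A"
      then obtain z z' \<xi> where w': "w = ((z, z'), \<xi>)" and zz: "z \<in> A i" "z' \<in> A j" and \<xi>: "\<xi> \<in> PiE ?K A" by auto
      have "(\<xi>(i := z, j := z')) k \<in> A k" if "k \<in> {1..n}" for k
        using zz PiE_mem[OF \<xi>, of k] that by auto
      moreover have "(\<xi>(i := z, j := z')) k = undefined" if "k \<notin> {1..n}" for k
        using PiE_arb[OF \<xi>, of k] ij that by auto
      ultimately have "\<xi>(i := z, j := z') \<in> PiE {1..n} A" by (rule PiE_I)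
      moreover have "\<xi> \<in> space (PiM ?K (\<lambda>_. D))" using \<xi> by (auto simp: space_PiM space_D PiE_def)
      ultimately show "w \<in> ?T -` PiE {1..n} A \<inter> space ?Q"
        unfolding w' by (auto simp: space_pair_measure space_D)
    qed
    moreover have meas: "PiE {1..n} A \<in> sets (P n)" using A by (intro sets_PiM_I_finite) auto
    ultimately have "emeasure (distr ?Q (P n) ?T) (PiE {1..n} A) = emeasure ?Q ((A i \<times> A j) \<times> PiE ?K A)"
      using emeasure_distr[OF T meas] by simp
    also have "\<dots> = emeasure (D \<Otimes>\<^sub>M D) (A i \<times> A j) * emeasure (PiM ?K (\<lambda>_. D)) (PiE ?K A)"
      using A ij by (intro K.emeasure_pair_measure_Times sets_PiM_I_finite pair_measureI) auto
    also have "emeasure (D \<Otimes>\<^sub>M D) (A i \<times> A j) = emeasure D (A i) * emeasure D (A j)"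
      using A ij by (intro emeasure_pair_measure_Times) auto
    also have "emeasure (PiM ?K (\<lambda>_. D)) (PiE ?K A) = (\<Prod>k\<in>?K. emeasure D (A k))"
      using A by (intro PS.emeasure_PiM) auto
    also have "emeasure D (A i) * emeasure D (A j) * (\<Prod>k\<in>?K. emeasure D (A k)) = (\<Prod>k\<in>{1..n}. emeasure D (A k))"
    proof -
      have "{1..n} - {i} - {j} = ?K" by auto
      then show ?thesis
        using prod.remove[of "{1..n}" i "\<lambda>k. emeasure D (A k)"] prod.remove[of "{1..n} - {i}" j "\<lambda>k. emeasure D (A k)"] ij
        by (simp add: mult.assoc)
    qed
    finally show "emeasure (distr ?Q (P n) ?T) (PiE {1..n} A) = (\<Prod>k\<in>{1..n}. emeasure D (A k))" .
  qed simp_all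
  then have eq: "distr ?Q (P n) ?T = P n" .
  have int: "integrable (distr ?Q (P n) ?T) f" unfolding eq by (rule True)
  have "(\<integral>\<xi>. f \<xi> \<partial>P n) = (\<integral>\<xi>. f \<xi> \<partial>distr ?Q (P n) ?T)" unfolding eq ..
  also have "(\<integral>\<xi>. f \<xi> \<partial>distr ?Q (P n) ?T) = (\<integral>w. f (?T w) \<partial>?Q)"
    using True by (intro integral_distr T) auto
  also have "\<dots> = (\<integral>\<xi>. (\<integral>zz. f (\<xi>(i := fst zz, j := snd zz)) \<partial>(D \<Otimes>\<^sub>M D)) \<partial>PiM ?K (\<lambda>_. D))"
  proof -
    have "integrable ?Q (\<lambda>w. f (?T w))" using int T by (rule integrable_distr[rotated])
    then show ?thesis
      using Q.integral_snd[of "\<lambda>zz \<xi>. f (\<xi>(i := fst zz, j := snd zz))"] by (simp add: case_prod_unfold)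
  qed
  also have "\<dots> = (\<integral>\<xi>. 0 \<partial>PiM ?K (\<lambda>_. D))"
    by (intro Bochner_Integration.integral_cong refl 0)
  finally show ?thesis by simp
qed (rule not_integrable_integral_eq)

lemma update_measurable:
  assumes i: "i \<in> {1..n}" and \<xi>: "\<xi> \<in> space (PiM ({1..n} - {i}) (\<lambda>_. D))"
  shows "(\<lambda>z. \<xi>(i := z)) \<in> D \<rightarrow>\<^sub>M P n"
proof -
  have ins: "insert i ({1..n} - {i}) = {1..n}" using i by auto
  show ?thesis using measurable_component_update[OF \<xi>, of i] unfolding ins by simp
qed

text \<open>The basic cancellation. With everything but observation \<open>i\<close> frozen, \<phi>
  is a function of the i-th covariate alone and the inner product is linear in the i-th
  noise.\<close>

lemma zero_mean_term:
  assumes i: "i \<in> {1..n}" "i \<noteq> j" and \<phi>: "\<phi> \<in> borel_measurable (P n)" "unaffected i \<phi>"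
  shows "(\<integral>\<xi>. \<phi> \<xi> * (fst (\<xi> i) \<bullet> fst (\<xi> j)) \<partial>P n) = 0"
proof (rule integral_eq_0_single[OF i(1)])
  fix \<xi> assume \<xi>: "\<xi> \<in> space (PiM ({1..n} - {i}) (\<lambda>_. D))"
  have "Pair 0 \<in> borel \<rightarrow>\<^sub>M D" by (subst measurable_cong_sets[OF refl sets_D]) measurable
  then have m: "(\<lambda>b. \<phi> (\<xi>(i := (0, b)))) \<in> borel_measurable borel"
    using measurable_compose[OF measurable_compose[OF _ update_measurable[OF i(1) \<xi>]] \<phi>(1)] by blast
  \<comment> \<open>The noise 0 is an arbitrary stand-in.\<close>
  have "\<phi> (\<xi>(i := z)) = \<phi> (\<xi>(i := (0, snd z)))" for z
    using \<phi>(2) unfolding unaffected_def by (metis prod.collapse)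
  then have "(\<integral>z. \<phi> (\<xi>(i := z)) * (fst ((\<xi>(i := z)) i) \<bullet> fst ((\<xi>(i := z)) j)) \<partial>D) =
      (\<integral>z. \<phi> (\<xi>(i := (0, snd z))) * (fst z \<bullet> fst (\<xi> j)) \<partial>D)"
    using i(2) by simp
  also have "\<dots> = 0" using m by (rule centered)
  finally show "(\<integral>z. \<phi> (\<xi>(i := z)) * (fst ((\<xi>(i := z)) i) \<bullet> fst ((\<xi>(i := z)) j)) \<partial>D) = 0" .
qed

lemma zero_mean_term':
  assumes "j \<in> {1..n}" "i \<noteq> j" "\<phi> \<in> borel_measurable (P n)" "unaffected j \<phi>"
  shows "(\<integral>\<xi>. \<phi> \<xi> * (fst (\<xi> i) \<bullet> fst (\<xi> j)) \<partial>P n) = 0"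
  using zero_mean_term[of j n i \<phi>] assms by (simp add: inner_commute)

lemma integrable_norm_power_D:
  assumes "k \<le> 8" shows "integrable D (\<lambda>z. norm (fst z) ^ k)"
proof (rule Bochner_Integration.integrable_bound)
  show "integrable D (\<lambda>z. 1 + norm (fst z) ^ 8)" using moment8 by simp
  have "norm (norm u ^ k) \<le> norm (1 + norm u ^ 8)" for u :: 'h
  proof (cases "norm u \<le> 1")
    case True
    then have "norm u ^ k \<le> 1" by (intro power_le_one) auto
    also have "\<dots> \<le> 1 + norm u ^ 8" by simp
    finally show ?thesis by simp
  next
    case False
    then have "norm u ^ k \<le> norm u ^ 8" using assms by (intro power_increasing) auto
    then show ?thesis by simp
  qed
  then show "AE z in D. norm (norm (fst z) ^ k) \<le> norm (1 + norm (fst z) ^ 8)" by (intro AE_I2)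
qed measurable

text \<open>The summand 1 makes powers of the envelope increase with the exponent, so every
  polynomial of degree at most 8 in the norms of the noises is dominated by a multiple of the
  integrable eighth power.\<close>

definition envelope :: "nat \<Rightarrow> (nat \<Rightarrow> 'h \<times> 'x) \<Rightarrow> real" where
  "envelope n \<xi> = 1 + (\<Sum>i=1..n. norm (fst (\<xi> i)))"

lemma envelope_measurable [measurable]: "envelope n \<in> borel_measurable (P m)"
  unfolding envelope_def by measurable

lemma envelope_ge_1: "envelope n \<xi> \<ge> 1"
  unfolding envelope_def by (simp add: sum_nonneg)

lemma norm_le_envelope: "i \<in> {1..n} \<Longrightarrow> norm (fst (\<xi> i)) \<le> envelope n \<xi>"
  unfolding envelope_def by (rule order.trans[OF member_le_sum[of i "{1..n}" "\<lambda>i. norm (fst (\<xi> i))"]]) auto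

lemma inner_le_envelope:
  assumes "i \<in> {1..n}" "j \<in> {1..n}"
  shows "\<bar>fst (\<xi> i) \<bullet> fst (\<xi> j)\<bar> \<le> envelope n \<xi> ^ 2"
proof -
  have "\<bar>fst (\<xi> i) \<bullet> fst (\<xi> j)\<bar> \<le> norm (fst (\<xi> i)) * norm (fst (\<xi> j))" by (rule Cauchy_Schwarz_ineq2)
  also have "\<dots> \<le> envelope n \<xi> * envelope n \<xi>"
    using norm_le_envelope assms envelope_ge_1[of n \<xi>] by (intro mult_mono) auto
  finally show ?thesis by (simp add: power2_eq_square)
qed

lemma integrable_envelope8: "integrable (P n) (\<lambda>\<xi>. envelope n \<xi> ^ 8)"
proof (rule Bochner_Integration.integrable_bound)
  have "integrable (P n) (\<lambda>\<xi>. norm (fst (\<xi> i)) ^ 8)" if "i \<in> {1..n}" for i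
    using integral_component(2)[OF that _ moment8] by simp
  then show "integrable (P n) (\<lambda>\<xi>. real (n + 1) ^ 8 * (1 + (\<Sum>i=1..n. norm (fst (\<xi> i)) ^ 8)))"
    by (intro integrable_mult_right Bochner_Integration.integrable_add Bochner_Integration.integrable_sum P.integrable_const)
  have "envelope n \<xi> ^ 8 \<le> real (n + 1) ^ 8 * (1 + (\<Sum>i=1..n. norm (fst (\<xi> i)) ^ 8))" for \<xi>
  proof -
    \<comment> \<open>The envelope is at most n + 1 times this maximum, and the eighth power of the
      maximum is one of the summands on the right.\<close>
    define m where "m = Max (insert 1 ((\<lambda>i. norm (fst (\<xi> i))) ` {1..n}))"
    have m: "norm (fst (\<xi> i)) \<le> m" if "i \<in> {1..n}" for i unfolding m_def using that by (intro Max_ge) auto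
    have m1: "1 \<le> m" unfolding m_def by (intro Max_ge) auto
    have "envelope n \<xi> \<le> m + (\<Sum>i=1..n. m)" unfolding envelope_def using m m1 by (intro add_mono sum_mono) auto
    then have "envelope n \<xi> \<le> real (n + 1) * m" by (simp add: algebra_simps)
    then have "envelope n \<xi> ^ 8 \<le> (real (n + 1) * m) ^ 8"
      using envelope_ge_1[of n \<xi>] by (intro power_mono) auto
    also have "\<dots> = real (n + 1) ^ 8 * m ^ 8" by (rule power_mult_distrib)
    also have "m ^ 8 \<le> 1 + (\<Sum>i=1..n. norm (fst (\<xi> i)) ^ 8)"
    proof -
      have "m \<in> insert 1 ((\<lambda>i. norm (fst (\<xi> i))) ` {1..n})" unfolding m_def by (intro Max_in) auto
      then consider "m = 1" | i where "i \<in> {1..n}" "m = norm (fst (\<xi> i))" by blast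
      then show ?thesis
      proof cases
        case 1 then show ?thesis by (simp add: sum_nonneg)
      next
        case 2
        have "norm (fst (\<xi> i)) ^ 8 \<le> (\<Sum>i=1..n. norm (fst (\<xi> i)) ^ 8)"
          using 2 by (intro member_le_sum) auto
        then show ?thesis unfolding 2(2) by simp
      qed
    qed
    finally show ?thesis by (simp add: mult_left_mono)
  qed
  then show "AE \<xi> in P n. norm (envelope n \<xi> ^ 8) \<le> norm (real (n + 1) ^ 8 * (1 + (\<Sum>i=1..n. norm (fst (\<xi> i)) ^ 8)))"
    by (intro AE_I2) (simp add: abs_mult sum_nonneg)
qed measurable

lemma integrable_envelope_bound:
  fixes f :: "(nat \<Rightarrow> 'h \<times> 'x) \<Rightarrow> real"
  assumes "f \<in> borel_measurable (P n)" "k \<le> 8" "\<And>\<xi>. \<bar>f \<xi>\<bar> \<le> C * envelope n \<xi> ^ k"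
  shows "integrable (P n) f"
proof (rule Bochner_Integration.integrable_bound)
  show "integrable (P n) (\<lambda>\<xi>. \<bar>C\<bar> * envelope n \<xi> ^ 8)" by (intro integrable_mult_right integrable_envelope8)
  have "\<bar>f \<xi>\<bar> \<le> \<bar>C\<bar> * envelope n \<xi> ^ 8" for \<xi>
  proof -
    have "\<bar>f \<xi>\<bar> \<le> \<bar>C\<bar> * envelope n \<xi> ^ k"
      using assms(3)[of \<xi>] envelope_ge_1[of n \<xi>] abs_ge_self[of C]
      by (meson mult_right_mono order.trans zero_le_power zero_le_one)
    also have "\<dots> \<le> \<bar>C\<bar> * envelope n \<xi> ^ 8"
      using envelope_ge_1[of n \<xi>] assms(2) by (intro mult_left_mono power_increasing) auto
    finally show ?thesis .
  qed
  then show "AE \<xi> in P n. norm (f \<xi>) \<le> norm (\<bar>C\<bar> * envelope n \<xi> ^ 8)"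
    using envelope_ge_1[of n] by (intro AE_I2) (simp add: abs_mult)
qed fact

end

section \<open>Symmetrisation\<close>

lemma sum_triple_product:
  fixes f :: "'a \<Rightarrow> 'd::comm_semiring_0"
  shows "(\<Sum>a\<in>A. \<Sum>b\<in>B. \<Sum>c\<in>C. f a * (g b * h c)) = (\<Sum>a\<in>A. f a) * ((\<Sum>b\<in>B. g b) * (\<Sum>c\<in>C. h c))"
  by (simp only: sum_distrib_left[symmetric] sum_distrib_right[symmetric])

lemma pred_first_max:
  fixes v :: "nat \<Rightarrow> 'a \<Rightarrow> real"
  assumes v: "\<And>r. v r \<in> borel_measurable M"
  shows "Measurable.pred M (\<lambda>x. (\<forall>l<m. v l x \<le> v k x) \<and> (\<forall>l<k. v l x < v k x))"
proof -
  note v [measurable]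
  have 1: "Measurable.pred M (\<lambda>x. \<forall>l<m. v l x \<le> v k x)" by measurable
  have 2: "Measurable.pred M (\<lambda>x. \<forall>l<k. v l x < v k x)" by measurable
  show ?thesis using 1 2 by measurable
qed

lemma borel_measurable_gated_sign:
  fixes f :: "'a \<Rightarrow> real"
  assumes [measurable]: "Measurable.pred M s" "Measurable.pred M e" "f \<in> borel_measurable M"
  shows "(\<lambda>x. if s x \<and> e x then if f x \<ge> 0 then 1 else -1 else 0 :: real) \<in> borel_measurable M"
  by measurable

lemma borel_measurable_gated_abs:
  fixes f :: "'a \<Rightarrow> real"
  assumes [measurable]: "Measurable.pred M e" "f \<in> borel_measurable M"
  shows "(\<lambda>x. if e x then \<bar>f x\<bar> else 0) \<in> borel_measurable M"
  by measurable

context centered_design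
begin

definition chaos :: "(nat \<Rightarrow> nat \<Rightarrow> real) \<Rightarrow> (nat \<times> nat) set \<Rightarrow> (nat \<Rightarrow> 'h \<times> 'x) \<Rightarrow> real" where
  "chaos c S \<xi> = (\<Sum>(i, j)\<in>S. c i j * (fst (\<xi> i) \<bullet> fst (\<xi> j)))"

text \<open>The index set \<open>{..<m}\<close> is deterministic and may be huge;
  \<open>\<eta>\<close> switches on the indices that matter for the given sample. Switched-off
  indices contribute 0, which never exceeds an absolute value.\<close>

definition max_chaos :: "nat \<Rightarrow> (nat \<Rightarrow> (nat \<Rightarrow> 'h \<times> 'x) \<Rightarrow> bool) \<Rightarrow> (nat \<Rightarrow> nat \<Rightarrow> nat \<Rightarrow> real) \<Rightarrow>
    (nat \<times> nat) set \<Rightarrow> (nat \<Rightarrow> 'h \<times> 'x) \<Rightarrow> real" where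
  "max_chaos m \<eta> c S \<xi> = Max ((\<lambda>r. if \<eta> r \<xi> then \<bar>chaos (c r) S \<xi>\<bar> else 0) ` {..<m})"

lemma chaos_measurable [measurable]: "chaos c S \<in> borel_measurable (P n)"
  unfolding chaos_def case_prod_beta by measurable

lemma integrable_inner:
  assumes "i \<in> {1..n}" "j \<in> {1..n}"
  shows "integrable (P n) (\<lambda>\<xi>. fst (\<xi> i) \<bullet> fst (\<xi> j))"
proof (rule integrable_envelope_bound[where k = 2 and C = 1])
  show "(\<lambda>\<xi>. fst (\<xi> i) \<bullet> fst (\<xi> j)) \<in> borel_measurable (P n)" by measurable
qed (use inner_le_envelope[OF assms] in simp_all)

lemma integrable_chaos:
  assumes "S \<subseteq> {1..n} \<times> {1..n}"
  shows "integrable (P n) (chaos c S)"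
  unfolding chaos_def case_prod_beta
  by (intro Bochner_Integration.integrable_sum integrable_mult_right integrable_inner) (use assms in auto)

lemma max_chaos_ge: "r < m \<Longrightarrow> \<eta> r \<xi> \<Longrightarrow> \<bar>chaos (c r) S \<xi>\<bar> \<le> max_chaos m \<eta> c S \<xi>"
  unfolding max_chaos_def by (rule Max_ge) (auto intro!: image_eqI[of _ _ r])

lemma max_chaos_attained:
  assumes "m > 0"
  obtains r where "r < m" "max_chaos m \<eta> c S \<xi> = (if \<eta> r \<xi> then \<bar>chaos (c r) S \<xi>\<bar> else 0)"
proof -
  have "max_chaos m \<eta> c S \<xi> \<in> (\<lambda>r. if \<eta> r \<xi> then \<bar>chaos (c r) S \<xi>\<bar> else 0) ` {..<m}"
    unfolding max_chaos_def using assms by (intro Max_in) auto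
  then show ?thesis using that by blast
qed

lemma max_chaos_nonneg: "m > 0 \<Longrightarrow> max_chaos m \<eta> c S \<xi> \<ge> 0"
  by (rule max_chaos_attained[of m \<eta> c S \<xi>]) auto

lemma max_chaos_measurable:
  assumes [measurable]: "\<And>r. Measurable.pred (P n) (\<eta> r)"
  shows "max_chaos m \<eta> c S \<in> borel_measurable (P n)"
  unfolding max_chaos_def
  by (intro borel_measurable_Max borel_measurable_gated_abs assms chaos_measurable finite_lessThan)

lemma integrable_max_chaos:
  assumes m: "m > 0" and [measurable]: "\<And>r. Measurable.pred (P n) (\<eta> r)" and S: "S \<subseteq> {1..n} \<times> {1..n}"
  shows "integrable (P n) (max_chaos m \<eta> c S)"
proof (rule Bochner_Integration.integrable_bound)
  show "integrable (P n) (\<lambda>\<xi>. \<Sum>r<m. \<bar>chaos (c r) S \<xi>\<bar>)"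
    by (intro Bochner_Integration.integrable_sum integrable_abs integrable_chaos S)
  show "max_chaos m \<eta> c S \<in> borel_measurable (P n)" by (rule max_chaos_measurable) fact
  have "max_chaos m \<eta> c S \<xi> \<le> (\<Sum>r<m. \<bar>chaos (c r) S \<xi>\<bar>)" for \<xi>
  proof -
    obtain r where r: "r < m" "max_chaos m \<eta> c S \<xi> = (if \<eta> r \<xi> then \<bar>chaos (c r) S \<xi>\<bar> else 0)"
      using max_chaos_attained[OF m] by blast
    then have "max_chaos m \<eta> c S \<xi> \<le> \<bar>chaos (c r) S \<xi>\<bar>" by simp
    also have "\<dots> \<le> (\<Sum>r<m. \<bar>chaos (c r) S \<xi>\<bar>)" using r(1) by (intro member_le_sum) auto
    finally show ?thesis .
  qed
  then show "AE \<xi> in P n. norm (max_chaos m \<eta> c S \<xi>) \<le> norm (\<Sum>r<m. \<bar>chaos (c r) S \<xi>\<bar>)"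
    using max_chaos_nonneg[OF m] by (intro AE_I2) (simp add: sum_nonneg)
qed

lemma unaffected_chaos:
  assumes "i \<notin> fst ` S \<union> snd ` S"
  shows "unaffected i (chaos c S)"
proof -
  have "unaffected i (\<lambda>\<xi>. \<Sum>p\<in>S. c (fst p) (snd p) * (fst (\<xi> (fst p)) \<bullet> fst (\<xi> (snd p))))"
  proof (rule unaffected_sum)
    fix p assume "p \<in> S"
    then have "fst p \<noteq> i" "snd p \<noteq> i" using assms by auto
    then show "unaffected i (\<lambda>\<xi>. c (fst p) (snd p) * (fst (\<xi> (fst p)) \<bullet> fst (\<xi> (snd p))))"
      by (intro unaffected_comp1[where F = "\<lambda>x. c (fst p) (snd p) * x"] unaffected_comp2[where F = inner] unaffected_fst)
  qed
  then show ?thesis unfolding chaos_def case_prod_beta .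
qed

text \<open>Conditionally on the covariates and on the noise entering the sum over \<open>S\<close>, the additional
  terms have mean zero; the maximum being convex, they can only increase the expectation. The
  conditional Jensen inequality is realised by a measurable selection of the maximising index.\<close>

lemma expectation_max_chaos_mono:
  assumes m: "m > 0" and \<eta> [measurable]: "\<And>r. Measurable.pred (P n) (\<eta> r)" and \<eta>u: "\<And>r i. unaffected i (\<eta> r)"
    and ST: "S \<subseteq> T" "T \<subseteq> {1..n} \<times> {1..n}"
    and new: "\<And>i j. (i, j) \<in> T - S \<Longrightarrow> i \<noteq> j \<and> (i \<notin> fst ` S \<union> snd ` S \<or> j \<notin> fst ` S \<union> snd ` S)"
  shows "(\<integral>\<xi>. max_chaos m \<eta> c S \<xi> \<partial>P n) \<le> (\<integral>\<xi>. max_chaos m \<eta> c T \<xi> \<partial>P n)"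
proof -
  have S: "S \<subseteq> {1..n} \<times> {1..n}" and finT: "finite T"
    using ST by (auto intro: finite_subset)
  define v where "v r \<xi> = (if \<eta> r \<xi> then \<bar>chaos (c r) S \<xi>\<bar> else 0)" for r \<xi>
  have v [measurable]: "v r \<in> borel_measurable (P n)" for r
    unfolding v_def by (intro borel_measurable_gated_abs \<eta> chaos_measurable)
  define Sel where "Sel k \<xi> \<longleftrightarrow> (\<forall>l<m. v l \<xi> \<le> v k \<xi>) \<and> (\<forall>l<k. v l \<xi> < v k \<xi>)" for k \<xi>
  have Sel [measurable]: "Measurable.pred (P n) (Sel k)" for k
    unfolding Sel_def by (intro pred_first_max v)
  \<comment> \<open>The sign of the chaos at the first maximiser, and 0 at every other index. Paired
    with the chaoses over \<open>S\<close> these weights give the maximum exactly; paired with those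
    over \<open>T\<close> they give at most the maximum.\<close>
  define w where "w k \<xi> = (if Sel k \<xi> \<and> \<eta> k \<xi> then if chaos (c k) S \<xi> \<ge> 0 then 1 else -1 else 0 :: real)" for k \<xi>
  have w [measurable]: "w k \<in> borel_measurable (P n)" for k
    unfolding w_def by (intro borel_measurable_gated_sign Sel \<eta> chaos_measurable)
  have uw: "unaffected i (w k)" if "i \<notin> fst ` S \<union> snd ` S" for i k
  proof -
    have uc: "unaffected i (chaos (c r) S)" for r using that by (rule unaffected_chaos)
    show ?thesis
      unfolding unaffected_def
    proof (intro allI)
      fix \<xi> :: "nat \<Rightarrow> 'h \<times> 'x" and a a' b
      have "\<eta> r (\<xi>(i := (a, b))) = \<eta> r (\<xi>(i := (a', b)))" for r
        using \<eta>u unfolding unaffected_def by blast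
      moreover have "chaos (c r) S (\<xi>(i := (a, b))) = chaos (c r) S (\<xi>(i := (a', b)))" for r
        using uc unfolding unaffected_def by blast
      ultimately show "w k (\<xi>(i := (a, b))) = w k (\<xi>(i := (a', b)))"
        unfolding w_def Sel_def v_def by (simp only:)
    qed
  qed
  have wb: "\<bar>w k \<xi>\<bar> \<le> 1" for k \<xi> unfolding w_def by simp
  have pick: "\<exists>k<m. (\<forall>k'<m. k' \<noteq> k \<longrightarrow> w k' \<xi> = 0) \<and> (\<eta> k \<xi> \<longrightarrow> w k \<xi> * chaos (c k) S \<xi> = \<bar>chaos (c k) S \<xi>\<bar>) \<and> (\<not> \<eta> k \<xi> \<longrightarrow> w k \<xi> = 0)
      \<and> max_chaos m \<eta> c S \<xi> = v k \<xi>" for \<xi>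
  proof -
    obtain k where k: "k < m" "\<forall>l<m. v l \<xi> \<le> v k \<xi>" "\<forall>l<k. v l \<xi> < v k \<xi>"
      "\<And>k'. k' < m \<Longrightarrow> \<forall>l<m. v l \<xi> \<le> v k' \<xi> \<Longrightarrow> \<forall>l<k'. v l \<xi> < v k' \<xi> \<Longrightarrow> k' = k"
      by (rule ex_unique_first_max[OF m, of "\<lambda>l. v l \<xi>"]) blast
    have Selk: "Sel k \<xi>" using k(2,3) unfolding Sel_def by (rule conjI)
    have nSel: "w k' \<xi> = 0" if "k' < m" "k' \<noteq> k" for k'
    proof -
      have "\<not> Sel k' \<xi>"
      proof
        assume "Sel k' \<xi>"
        then have "k' = k" unfolding Sel_def by (elim conjE) (rule k(4)[OF that(1)])
        then show False using that(2) by simp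
      qed
      then show ?thesis unfolding w_def by simp
    qed
    have mx: "max_chaos m \<eta> c S \<xi> = v k \<xi>"
      unfolding max_chaos_def v_def[symmetric]
    proof (rule Max_eqI)
      show "y \<le> v k \<xi>" if "y \<in> (\<lambda>r. v r \<xi>) ` {..<m}" for y using that k(2) by auto
      show "v k \<xi> \<in> (\<lambda>r. v r \<xi>) ` {..<m}" using k(1) by simp
    qed simp
    have "w k \<xi> * chaos (c k) S \<xi> = \<bar>chaos (c k) S \<xi>\<bar>" if "\<eta> k \<xi>"
      using Selk that unfolding w_def by (simp add: abs_if)
    moreover have "w k \<xi> = 0" if "\<not> \<eta> k \<xi>" using that unfolding w_def by simp
    ultimately show ?thesis using k(1) nSel mx by blast
  qed
  have eqS: "max_chaos m \<eta> c S \<xi> = (\<Sum>k<m. w k \<xi> * chaos (c k) S \<xi>)" for \<xi>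
  proof -
    obtain k where k: "k < m" "\<forall>k'<m. k' \<noteq> k \<longrightarrow> w k' \<xi> = 0" "\<eta> k \<xi> \<longrightarrow> w k \<xi> * chaos (c k) S \<xi> = \<bar>chaos (c k) S \<xi>\<bar>"
      "\<not> \<eta> k \<xi> \<longrightarrow> w k \<xi> = 0" "max_chaos m \<eta> c S \<xi> = v k \<xi>"
      using pick[of \<xi>] by blast
    have "(\<Sum>k<m. w k \<xi> * chaos (c k) S \<xi>) = (\<Sum>k'\<in>{k}. w k' \<xi> * chaos (c k') S \<xi>)"
      using k by (intro sum.mono_neutral_right) auto
    then show ?thesis using k by (simp add: v_def)
  qed
  have leT: "(\<Sum>k<m. w k \<xi> * chaos (c k) T \<xi>) \<le> max_chaos m \<eta> c T \<xi>" for \<xi>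
  proof -
    obtain k where k: "k < m" "\<forall>k'<m. k' \<noteq> k \<longrightarrow> w k' \<xi> = 0" "\<not> \<eta> k \<xi> \<longrightarrow> w k \<xi> = 0"
      using pick[of \<xi>] by blast
    have "(\<Sum>k<m. w k \<xi> * chaos (c k) T \<xi>) = (\<Sum>k'\<in>{k}. w k' \<xi> * chaos (c k') T \<xi>)"
      using k by (intro sum.mono_neutral_right) auto
    also have "\<dots> \<le> max_chaos m \<eta> c T \<xi>"
    proof (cases "\<eta> k \<xi>")
      case True
      have "w k \<xi> * chaos (c k) T \<xi> \<le> \<bar>w k \<xi>\<bar> * \<bar>chaos (c k) T \<xi>\<bar>"
        by (metis abs_ge_self abs_mult)
      also have "\<dots> \<le> 1 * \<bar>chaos (c k) T \<xi>\<bar>" by (intro mult_right_mono wb) simp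
      finally show ?thesis using max_chaos_ge[where \<eta> = \<eta> and \<xi> = \<xi> and c = c and S = T, OF k(1) True] by simp
    qed (use k max_chaos_nonneg[OF m] in simp)
    finally show ?thesis .
  qed
  have int: "integrable (P n) (\<lambda>\<xi>. w k \<xi> * f \<xi>)" if "integrable (P n) f" for k f
  proof (rule Bochner_Integration.integrable_bound[OF that])
    show "(\<lambda>\<xi>. w k \<xi> * f \<xi>) \<in> borel_measurable (P n)" using that by measurable
    show "AE \<xi> in P n. norm (w k \<xi> * f \<xi>) \<le> norm (f \<xi>)"
      by (intro AE_I2) (simp add: abs_mult mult_left_le_one_le wb)
  qed
  have split: "chaos (c k) T \<xi> = chaos (c k) S \<xi> + chaos (c k) (T - S) \<xi>" for k \<xi>
    unfolding chaos_def using sum.subset_diff[OF ST(1) finT] by (simp add: add.commute)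
  \<comment> \<open>Every added pair has an index outside the support of \<open>S\<close>, and the
    weights do not see the noise at that index.\<close>
  have zero: "(\<integral>\<xi>. w k \<xi> * chaos (c k) (T - S) \<xi> \<partial>P n) = 0" for k
  proof -
    have ii: "integrable (P n) (\<lambda>\<xi>. w k \<xi> * (c k (fst p) (snd p) * (fst (\<xi> (fst p)) \<bullet> fst (\<xi> (snd p)))))" if "p \<in> T - S" for p
      using that ST by (intro int integrable_mult_right integrable_inner) auto
    have "(\<integral>\<xi>. w k \<xi> * chaos (c k) (T - S) \<xi> \<partial>P n) =
        (\<integral>\<xi>. (\<Sum>p\<in>T - S. w k \<xi> * (c k (fst p) (snd p) * (fst (\<xi> (fst p)) \<bullet> fst (\<xi> (snd p))))) \<partial>P n)"
      unfolding chaos_def case_prod_beta sum_distrib_left ..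
    also have "\<dots> = (\<Sum>p\<in>T - S. \<integral>\<xi>. w k \<xi> * (c k (fst p) (snd p) * (fst (\<xi> (fst p)) \<bullet> fst (\<xi> (snd p)))) \<partial>P n)"
      by (rule Bochner_Integration.integral_sum) (rule ii)
    also have "\<dots> = 0"
    proof (rule sum.neutral, rule ballI)
      fix p assume p: "p \<in> T - S"
      obtain i j where ij: "p = (i, j)" by (metis prod.exhaust)
      have ijn: "i \<in> {1..n}" "j \<in> {1..n}" using p ST ij by auto
      have nij: "i \<noteq> j" "i \<notin> fst ` S \<union> snd ` S \<or> j \<notin> fst ` S \<union> snd ` S" using new p unfolding ij by blast+
      have u: "unaffected l (\<lambda>\<xi>. w k \<xi> * c k i j)" if "l \<notin> fst ` S \<union> snd ` S" for l
        by (rule unaffected_comp1[where F = "\<lambda>x. x * c k i j", OF uw[OF that]])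
      have "(\<integral>\<xi>. (w k \<xi> * c k i j) * (fst (\<xi> i) \<bullet> fst (\<xi> j)) \<partial>P n) = 0"
        using nij(2)
      proof
        assume "i \<notin> fst ` S \<union> snd ` S"
        then show ?thesis by (intro zero_mean_term ijn nij(1) u) measurable
      next
        assume "j \<notin> fst ` S \<union> snd ` S"
        then show ?thesis by (intro zero_mean_term' ijn nij(1) u) measurable
      qed
      then show "(\<integral>\<xi>. w k \<xi> * (c k (fst p) (snd p) * (fst (\<xi> (fst p)) \<bullet> fst (\<xi> (snd p)))) \<partial>P n) = 0"
        unfolding ij by (simp add: mult.assoc)
    qed
    finally show ?thesis .
  qed
  have iS: "integrable (P n) (\<lambda>\<xi>. w k \<xi> * chaos (c k) S \<xi>)" for k by (intro int integrable_chaos S)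
  have iT: "integrable (P n) (\<lambda>\<xi>. w k \<xi> * chaos (c k) T \<xi>)" for k by (intro int integrable_chaos ST)
  have "T - S \<subseteq> {1..n} \<times> {1..n}" using ST by blast
  then have iTS: "integrable (P n) (\<lambda>\<xi>. w k \<xi> * chaos (c k) (T - S) \<xi>)" for k by (intro int integrable_chaos)
  have "(\<integral>\<xi>. max_chaos m \<eta> c S \<xi> \<partial>P n) = (\<Sum>k<m. \<integral>\<xi>. w k \<xi> * chaos (c k) S \<xi> \<partial>P n)"
    unfolding eqS by (rule Bochner_Integration.integral_sum) (rule iS)
  also have "\<dots> = (\<Sum>k<m. \<integral>\<xi>. w k \<xi> * chaos (c k) T \<xi> \<partial>P n)"
  proof (rule sum.cong[OF refl])
    fix k
    have "(\<integral>\<xi>. w k \<xi> * chaos (c k) T \<xi> \<partial>P n) = (\<integral>\<xi>. w k \<xi> * chaos (c k) S \<xi> + w k \<xi> * chaos (c k) (T - S) \<xi> \<partial>P n)"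
      unfolding split distrib_left ..
    also have "\<dots> = (\<integral>\<xi>. w k \<xi> * chaos (c k) S \<xi> \<partial>P n) + (\<integral>\<xi>. w k \<xi> * chaos (c k) (T - S) \<xi> \<partial>P n)"
      by (rule Bochner_Integration.integral_add[OF iS iTS])
    finally show "(\<integral>\<xi>. w k \<xi> * chaos (c k) S \<xi> \<partial>P n) = (\<integral>\<xi>. w k \<xi> * chaos (c k) T \<xi> \<partial>P n)"
      unfolding zero by simp
  qed
  also have "\<dots> = (\<integral>\<xi>. (\<Sum>k<m. w k \<xi> * chaos (c k) T \<xi>) \<partial>P n)"
    by (rule Bochner_Integration.integral_sum[symmetric]) (rule iT)
  also have "\<dots> \<le> (\<integral>\<xi>. max_chaos m \<eta> c T \<xi> \<partial>P n)"
    by (intro integral_mono leT Bochner_Integration.integrable_sum iT integrable_max_chaos m ST \<eta>)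
  finally show ?thesis .
qed

definition off_diagonal :: "nat \<Rightarrow> (nat \<times> nat) set" where
  "off_diagonal n = {(i, j). i \<in> {1..n} \<and> j \<in> {1..n} \<and> i \<noteq> j}"

lemma off_diagonal_subset: "off_diagonal n \<subseteq> {1..n} \<times> {1..n}"
  by (auto simp: off_diagonal_def)

lemma finite_off_diagonal [simp]: "finite (off_diagonal n)"
  by (rule finite_subset[OF off_diagonal_subset]) simp

text \<open>Decoupling and symmetrisation by random subsets, without an independent copy of the
  sample. Signs \<delta> split the indices into rows and columns; signs \<epsilon> and \<epsilon>'
  thin out rows and columns. A pair survives in \<open>S w\<close> with probability 1/16, so the
  full chaos is 16 times the average over \<open>w\<close>. On \<open>S w\<close> the coefficients
  may be multiplied by the signs, all of which are 1 there; enlarging \<open>S w\<close> to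
  \<open>T \<delta>\<close> then restores the pairs with the other signs and only increases the
  expected maximum. What results is a Rademacher chaos for each fixed sample. The constant 160 is 16
  times 10.\<close>

theorem expectation_max_chaos_le:
  assumes m: "m > 0" and \<eta> [measurable]: "\<And>r. Measurable.pred (P n) (\<eta> r)" and \<eta>u: "\<And>r i. unaffected i (\<eta> r)"
    and B: "integrable (P n) B" "\<And>\<xi>. B \<xi> \<ge> 0"
    and bound: "\<And>\<xi> r. r < m \<Longrightarrow> \<eta> r \<xi> \<Longrightarrow> (\<Sum>i=1..n. \<Sum>j=1..n. (a r i j * (fst (\<xi> i) \<bullet> fst (\<xi> j)))\<^sup>2) \<le> (B \<xi>)\<^sup>2"
    and q: "q \<ge> 1" "\<And>\<xi>. real (card {r\<in>{..<m}. \<eta> r \<xi>}) \<le> exp (2 * real q)"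
  shows "(\<integral>\<xi>. max_chaos m \<eta> a (off_diagonal n) \<xi> \<partial>P n) \<le> 160 * (exp 1)\<^sup>2 * real q * (\<integral>\<xi>. B \<xi> \<partial>P n)"
proof -
  define T where "T \<delta> = {(i, j) \<in> off_diagonal n. \<delta> i = 1 \<and> \<delta> j = -1}" for \<delta> :: "nat \<Rightarrow> real"
  define S where "S w = {(i, j) \<in> off_diagonal n. fst w i = 1 \<and> fst w j = -1 \<and> fst (snd w) j = 1 \<and> snd (snd w) i = 1}"
    for w :: "(nat \<Rightarrow> real) \<times> (nat \<Rightarrow> real) \<times> (nat \<Rightarrow> real)"
  define c where "c w r i j = snd (snd w) i * fst (snd w) j * a r i j" for w :: "(nat \<Rightarrow> real) \<times> (nat \<Rightarrow> real) \<times> (nat \<Rightarrow> real)" and r i j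
  let ?W = "signs n \<times> signs n \<times> signs n"
  have S_sub: "S w \<subseteq> {1..n} \<times> {1..n}" for w using off_diagonal_subset unfolding S_def by blast
  have T_sub: "T \<delta> \<subseteq> {1..n} \<times> {1..n}" for \<delta> using off_diagonal_subset unfolding T_def by blast
  \<comment> \<open>Averaging over \<open>w\<close>: two signs \<delta> and one sign each of
    \<epsilon>' and \<epsilon> are prescribed, whence 8^n / 16.\<close>
  have split: "(\<Sum>w\<in>?W. \<Sum>p\<in>S w. g p) = 8 ^ n / 16 * (\<Sum>p\<in>off_diagonal n. g p)" for g :: "nat \<times> nat \<Rightarrow> real"
  proof -
    let ?I = "\<lambda>w p. of_bool (\<forall>k\<in>{fst p, snd p}. fst w k = (if k = fst p then 1 else -1)) *
      (of_bool (\<forall>k\<in>{snd p}. fst (snd w) k = 1) * of_bool (\<forall>k\<in>{fst p}. snd (snd w) k = 1)) :: real"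
    have "(\<Sum>p\<in>S w. g p) = (\<Sum>p\<in>off_diagonal n. ?I w p * g p)" for w
      by (rule sum.mono_neutral_cong_left[OF finite_off_diagonal]) (auto simp: S_def off_diagonal_def)
    then have "(\<Sum>w\<in>?W. \<Sum>p\<in>S w. g p) = (\<Sum>p\<in>off_diagonal n. (\<Sum>w\<in>?W. ?I w p) * g p)"
      unfolding sum_distrib_right by (simp only:) (rule sum.swap)
    also have "\<dots> = (\<Sum>p\<in>off_diagonal n. 8 ^ n / 16 * g p)"
    proof (rule sum.cong[OF refl])
      fix p assume "p \<in> off_diagonal n"
      then have p: "fst p \<in> {1..n}" "snd p \<in> {1..n}" "fst p \<noteq> snd p" by (auto simp: off_diagonal_def)
      have "(\<Sum>w\<in>?W. ?I w p) = (\<Sum>\<delta>\<in>signs n. \<Sum>\<epsilon>'\<in>signs n. \<Sum>\<epsilon>\<in>signs n. ?I (\<delta>, \<epsilon>', \<epsilon>) p)"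
        by (simp only: sum.cartesian_product case_prod_unfold prod.collapse)
      also have "\<dots> = (\<Sum>\<delta>\<in>signs n. of_bool (\<forall>k\<in>{fst p, snd p}. \<delta> k = (if k = fst p then 1 else -1))) *
          ((\<Sum>\<epsilon>'\<in>signs n. of_bool (\<forall>k\<in>{snd p}. \<epsilon>' k = 1)) * (\<Sum>\<epsilon>\<in>signs n. of_bool (\<forall>k\<in>{fst p}. \<epsilon> k = 1)))"
        unfolding fst_conv snd_conv by (rule sum_triple_product)
      also have "(\<Sum>\<delta>\<in>signs n. of_bool (\<forall>k\<in>{fst p, snd p}. \<delta> k = (if k = fst p then 1 else -1))) = (2 ^ n * (1 / 2) ^ card {fst p, snd p} :: real)"
        using p by (intro sum_signs_indicator) auto
      also have "(\<Sum>\<epsilon>'\<in>signs n. of_bool (\<forall>k\<in>{snd p}. \<epsilon>' k = 1)) = (2 ^ n * (1 / 2) ^ card {snd p} :: real)"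
        using p by (intro sum_signs_indicator) auto
      also have "(\<Sum>\<epsilon>\<in>signs n. of_bool (\<forall>k\<in>{fst p}. \<epsilon> k = 1)) = (2 ^ n * (1 / 2) ^ card {fst p} :: real)"
        using p by (intro sum_signs_indicator) auto
      also have "2 ^ n * (1 / 2) ^ card {fst p, snd p} * (2 ^ n * (1 / 2) ^ card {snd p} * (2 ^ n * (1 / 2) ^ card {fst p})) = (8 ^ n / 16 :: real)"
      proof -
        have "(2::real) ^ n * (2 ^ n * 2 ^ n) = 8 ^ n" by (simp flip: power_mult_distrib)
        then show ?thesis using p by (simp add: power2_eq_square)
      qed
      finally show "(\<Sum>w\<in>?W. ?I w p) * g p = 8 ^ n / 16 * g p" by simp
    qed
    finally show ?thesis by (simp add: sum_distrib_left)
  qed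
  have step1: "8 ^ n / 16 * max_chaos m \<eta> a (off_diagonal n) \<xi> \<le> (\<Sum>w\<in>?W. max_chaos m \<eta> (c w) (S w) \<xi>)" for \<xi>
  proof -
    obtain r where r: "r < m" "max_chaos m \<eta> a (off_diagonal n) \<xi> = (if \<eta> r \<xi> then \<bar>chaos (a r) (off_diagonal n) \<xi>\<bar> else 0)"
      using max_chaos_attained[OF m] by blast
    have nn: "(\<Sum>w\<in>?W. max_chaos m \<eta> (c w) (S w) \<xi>) \<ge> 0" by (intro sum_nonneg max_chaos_nonneg m)
    show ?thesis
    proof (cases "\<eta> r \<xi>")
      case True
      have "8 ^ n / 16 * \<bar>chaos (a r) (off_diagonal n) \<xi>\<bar> = \<bar>\<Sum>w\<in>?W. chaos (a r) (S w) \<xi>\<bar>"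
        unfolding chaos_def split by (simp add: abs_mult)
      also have "\<dots> \<le> (\<Sum>w\<in>?W. \<bar>chaos (a r) (S w) \<xi>\<bar>)" by (rule sum_abs)
      also have "\<dots> \<le> (\<Sum>w\<in>?W. max_chaos m \<eta> (c w) (S w) \<xi>)"
      proof (rule sum_mono)
        fix w
        have "chaos (a r) (S w) \<xi> = chaos (c w r) (S w) \<xi>"
          unfolding chaos_def by (intro sum.cong) (auto simp: S_def c_def)
        then show "\<bar>chaos (a r) (S w) \<xi>\<bar> \<le> max_chaos m \<eta> (c w) (S w) \<xi>"
          using max_chaos_ge[OF r(1), of \<eta> \<xi> "c w" "S w"] True by simp
      qed
      finally show ?thesis using r(2) True by simp
    qed (use r(2) nn in simp)
  qed
  \<comment> \<open>A pair added to \<open>S w\<close> has \<epsilon> = -1 at its row or \<epsilon>'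
    = -1 at its column. As \<delta> separates rows from columns, that index occurs nowhere in
    \<open>S w\<close>.\<close>
  have step2: "(\<integral>\<xi>. max_chaos m \<eta> (c w) (S w) \<xi> \<partial>P n) \<le> (\<integral>\<xi>. max_chaos m \<eta> (c w) (T (fst w)) \<xi> \<partial>P n)" for w
  proof (rule expectation_max_chaos_mono[OF m \<eta> \<eta>u])
    show "S w \<subseteq> T (fst w)" by (auto simp: S_def T_def)
    fix i j assume ij: "(i, j) \<in> T (fst w) - S w"
    then have "i \<noteq> j" "fst w i = 1" "fst w j = -1" "snd (snd w) i \<noteq> 1 \<or> fst (snd w) j \<noteq> 1"
      by (auto simp: T_def S_def off_diagonal_def)
    moreover have "snd (snd w) k = 1 \<and> fst w k = 1" if "k \<in> fst ` S w" for k using that by (auto simp: S_def)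
    moreover have "fst (snd w) k = 1 \<and> fst w k = -1" if "k \<in> snd ` S w" for k using that by (auto simp: S_def)
    ultimately show "i \<noteq> j \<and> (i \<notin> fst ` S w \<union> snd ` S w \<or> j \<notin> fst ` S w \<union> snd ` S w)" by fastforce
  qed (rule T_sub)
  have step3: "(\<Sum>w\<in>?W. max_chaos m \<eta> (c w) (T (fst w)) \<xi>) \<le> 8 ^ n * (10 * (exp 1)\<^sup>2 * real q * B \<xi>)" for \<xi>
  proof -
    have "(\<Sum>\<epsilon>'\<in>signs n. \<Sum>\<epsilon>\<in>signs n. max_chaos m \<eta> (c (\<delta>, \<epsilon>', \<epsilon>)) (T \<delta>) \<xi>) \<le> 4 ^ n * (10 * (exp 1)\<^sup>2 * real q * B \<xi>)" for \<delta>
    proof (rule rademacher_chaos_maximal)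
      let ?b = "\<lambda>r i j. of_bool (i \<noteq> j \<and> \<delta> i = 1 \<and> \<delta> j = -1) * (a r i j * (fst (\<xi> i) \<bullet> fst (\<xi> j)))"
      show "finite {r\<in>{..<m}. \<eta> r \<xi>}" by simp
      show "(\<Sum>i=1..n. \<Sum>j=1..n. (?b r i j)\<^sup>2) \<le> (B \<xi>)\<^sup>2" if "r \<in> {r\<in>{..<m}. \<eta> r \<xi>}" for r
      proof -
        have "(\<Sum>i=1..n. \<Sum>j=1..n. (?b r i j)\<^sup>2) \<le> (\<Sum>i=1..n. \<Sum>j=1..n. (a r i j * (fst (\<xi> i) \<bullet> fst (\<xi> j)))\<^sup>2)"
          by (intro sum_mono) (auto simp: of_bool_def)
        also have "\<dots> \<le> (B \<xi>)\<^sup>2" using that bound by simp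
        finally show ?thesis .
      qed
      fix \<epsilon> \<epsilon>' :: "nat \<Rightarrow> real"
      obtain r where r: "r < m" "max_chaos m \<eta> (c (\<delta>, \<epsilon>', \<epsilon>)) (T \<delta>) \<xi> = (if \<eta> r \<xi> then \<bar>chaos (c (\<delta>, \<epsilon>', \<epsilon>) r) (T \<delta>) \<xi>\<bar> else 0)"
        using max_chaos_attained[OF m] by blast
      have "chaos (c (\<delta>, \<epsilon>', \<epsilon>) r) (T \<delta>) \<xi> = (\<Sum>p\<in>{1..n} \<times> {1..n}. ?b r (fst p) (snd p) * \<epsilon> (fst p) * \<epsilon>' (snd p))"
        unfolding chaos_def case_prod_beta
        by (intro sum.mono_neutral_cong_left) (auto simp: T_def off_diagonal_def c_def)
      also have "\<dots> = (\<Sum>i=1..n. \<Sum>j=1..n. ?b r i j * \<epsilon> i * \<epsilon>' j)"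
        by (simp only: sum.cartesian_product case_prod_unfold)
      finally have "max_chaos m \<eta> (c (\<delta>, \<epsilon>', \<epsilon>)) (T \<delta>) \<xi> = (if \<eta> r \<xi> then \<bar>\<Sum>i=1..n. \<Sum>j=1..n. ?b r i j * \<epsilon> i * \<epsilon>' j\<bar> else 0)"
        using r(2) by simp
      then show "max_chaos m \<eta> (c (\<delta>, \<epsilon>', \<epsilon>)) (T \<delta>) \<xi> \<le> 0 \<or>
          (\<exists>r\<in>{r\<in>{..<m}. \<eta> r \<xi>}. max_chaos m \<eta> (c (\<delta>, \<epsilon>', \<epsilon>)) (T \<delta>) \<xi> \<le> \<bar>\<Sum>i=1..n. \<Sum>j=1..n. ?b r i j * \<epsilon> i * \<epsilon>' j\<bar>)"
        using r(1) by (cases "\<eta> r \<xi>") auto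
    qed (use q B in auto)
    then have "(\<Sum>\<delta>\<in>signs n. \<Sum>\<epsilon>'\<in>signs n. \<Sum>\<epsilon>\<in>signs n. max_chaos m \<eta> (c (\<delta>, \<epsilon>', \<epsilon>)) (T \<delta>) \<xi>) \<le> (\<Sum>\<delta>\<in>signs n. 4 ^ n * (10 * (exp 1)\<^sup>2 * real q * B \<xi>))"
      by (rule sum_mono)
    also have "\<dots> = 8 ^ n * (10 * (exp 1)\<^sup>2 * real q * B \<xi>)"
    proof -
      have "(2::real) ^ n * 4 ^ n = 8 ^ n" by (simp flip: power_mult_distrib)
      then show ?thesis by (simp add: card_signs mult.assoc[symmetric])
    qed
    finally show ?thesis by (simp only: sum.cartesian_product case_prod_unfold prod.collapse)
  qed
  have iS: "integrable (P n) (max_chaos m \<eta> (c w) (S w))" for w by (intro integrable_max_chaos m \<eta> S_sub)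
  have iT: "integrable (P n) (max_chaos m \<eta> (c w) (T (fst w)))" for w by (intro integrable_max_chaos m \<eta> T_sub)
  have "8 ^ n / 16 * (\<integral>\<xi>. max_chaos m \<eta> a (off_diagonal n) \<xi> \<partial>P n) = (\<integral>\<xi>. 8 ^ n / 16 * max_chaos m \<eta> a (off_diagonal n) \<xi> \<partial>P n)"
    by simp
  also have "\<dots> \<le> (\<integral>\<xi>. (\<Sum>w\<in>?W. max_chaos m \<eta> (c w) (S w) \<xi>) \<partial>P n)"
    by (intro integral_mono step1 Bochner_Integration.integrable_sum iS integrable_mult_right integrable_max_chaos m \<eta> off_diagonal_subset)
  also have "\<dots> = (\<Sum>w\<in>?W. \<integral>\<xi>. max_chaos m \<eta> (c w) (S w) \<xi> \<partial>P n)"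
    by (rule Bochner_Integration.integral_sum) (rule iS)
  also have "\<dots> \<le> (\<Sum>w\<in>?W. \<integral>\<xi>. max_chaos m \<eta> (c w) (T (fst w)) \<xi> \<partial>P n)"
    by (intro sum_mono step2)
  also have "\<dots> = (\<integral>\<xi>. (\<Sum>w\<in>?W. max_chaos m \<eta> (c w) (T (fst w)) \<xi>) \<partial>P n)"
    by (rule Bochner_Integration.integral_sum[symmetric]) (rule iT)
  also have "\<dots> \<le> (\<integral>\<xi>. 8 ^ n * (10 * (exp 1)\<^sup>2 * real q * B \<xi>) \<partial>P n)"
    by (intro integral_mono step3 Bochner_Integration.integrable_sum iT integrable_mult_right B)
  also have "\<dots> = 8 ^ n / 16 * (160 * (exp 1)\<^sup>2 * real q * (\<integral>\<xi>. B \<xi> \<partial>P n))"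
    by simp
  finally show ?thesis by (rule mult_left_le_imp_le) simp
qed

end

section \<open>A martingale central limit theorem\<close>

lemma abs_exp_minus_diff_le:
  fixes u v :: real
  assumes "u \<ge> 0" "v \<ge> 0"
  shows "\<bar>exp (- u) - exp (- v)\<bar> \<le> \<bar>u - v\<bar>"
proof -
  have *: "exp (- a) - exp (- b) \<le> b - a" if "0 \<le> a" "a \<le> b" for a b :: real
  proof -
    have "exp (- a) - exp (- b) = exp (- a) * (1 - exp (- (b - a)))" by (simp add: algebra_simps exp_add[symmetric])
    also have "\<dots> \<le> 1 * (1 - exp (- (b - a)))" using that by (intro mult_right_mono) auto
    also have "\<dots> \<le> b - a" unfolding mult_1 using exp_ge_add_one_self[of "- (b - a)"] by linarith
    finally show ?thesis .
  qed
  show ?thesis using *[of u v] *[of v u] assms by (cases "u \<le> v") (auto simp: abs_if)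
qed

text \<open>The product (1 + a + a^2/2)(1 - a + a^2/2) is at least 1, so the quadratic lower bound
  for exp a turns into the upper bound for exp (-a).\<close>

lemma exp_minus_quadratic_approx:
  fixes a :: real
  assumes "a \<ge> 0"
  shows "\<bar>exp (- a) - (1 - a)\<bar> \<le> a\<^sup>2 / 2"
proof -
  have "1 + a + a\<^sup>2 / 2 \<le> exp a" using assms by (rule exp_lower_Taylor_quadratic)
  have "(1 + a + a\<^sup>2 / 2) * (1 - a + a\<^sup>2 / 2) = 1 + (a\<^sup>2 / 2)\<^sup>2"
    by (simp add: algebra_simps power2_eq_square)
  then have "1 \<le> (1 + a + a\<^sup>2 / 2) * (1 - a + a\<^sup>2 / 2)" by simp
  also have "\<dots> \<le> exp a * (1 - a + a\<^sup>2 / 2)"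
  proof (rule mult_right_mono)
    have "0 \<le> (1 - a)\<^sup>2 + 1" by simp
    then show "0 \<le> 1 - a + a\<^sup>2 / 2" by (simp add: power2_eq_square algebra_simps)
  qed fact
  finally have "exp (- a) \<le> 1 - a + a\<^sup>2 / 2" by (simp add: exp_minus field_simps)
  moreover have "1 - a \<le> exp (- a)" using exp_ge_add_one_self[of "- a"] by simp
  ultimately show ?thesis by (simp add: abs_if)
qed

lemma cmod_one_plus_ii: "cmod (1 + \<i> * of_real y) = sqrt (1 + y\<^sup>2)"
  by (simp add: cmod_def)

lemma cmod_one_plus_ii_le: "cmod (1 + \<i> * of_real y) \<le> exp (y\<^sup>2 / 2)"
proof -
  have "sqrt (1 + y\<^sup>2) \<le> sqrt (exp (y\<^sup>2))" using exp_ge_add_one_self[of "y\<^sup>2"] by simp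
  also have "sqrt (exp (y\<^sup>2)) = exp (y\<^sup>2 / 2)"
    by (rule real_sqrt_unique) (simp_all add: power2_eq_square exp_add[symmetric])
  finally show ?thesis unfolding cmod_one_plus_ii .
qed

text \<open>McLeish's factorisation of exp(iy). Both expressions agree with 1 + iy - y^2/2 up to
  third order, and for |y| > 1 both have modulus at most 1.\<close>

lemma iexp_approx_product:
  "cmod (iexp y - (1 + \<i> * of_real y) * of_real (exp (- (y\<^sup>2 / 2)))) \<le> 2 * \<bar>y\<bar> ^ 3"
proof (cases "\<bar>y\<bar> \<le> 1")
  case True
  define p where "p = 1 + \<i> * of_real y - of_real (y\<^sup>2 / 2)"
  define r where "r = exp (- (y\<^sup>2 / 2)) - (1 - y\<^sup>2 / 2)"
  have "(\<Sum>k\<le>2. (\<i> * complex_of_real y) ^ k / fact k) = p"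
    unfolding p_def by (simp add: numeral_2_eq_2 power2_eq_square complex_eq_iff)
  then have 1: "cmod (iexp y - p) \<le> \<bar>y\<bar> ^ 3 / 6"
    using iexp_approx1[of y 2] by (simp add: numeral_3_eq_3 fact_numeral)
  have "(1 + \<i> * of_real y) * of_real (exp (- (y\<^sup>2 / 2))) - p = - (\<i> * of_real (y ^ 3 / 2)) + (1 + \<i> * of_real y) * of_real r"
    unfolding r_def p_def by (simp add: algebra_simps power2_eq_square power3_eq_cube)
  then have "cmod ((1 + \<i> * of_real y) * of_real (exp (- (y\<^sup>2 / 2))) - p) \<le> cmod (\<i> * of_real (y ^ 3 / 2)) + cmod ((1 + \<i> * of_real y) * of_real r)"
    by (metis norm_minus_cancel norm_triangle_ineq)
  also have "cmod (\<i> * of_real (y ^ 3 / 2)) = \<bar>y\<bar> ^ 3 / 2" by (simp add: norm_mult norm_divide norm_power)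
  also have "cmod ((1 + \<i> * of_real y) * of_real r) \<le> 2 * (\<bar>y\<bar> ^ 3 / 8)"
    unfolding norm_mult
  proof (rule mult_mono)
    show "cmod (1 + \<i> * of_real y) \<le> 2"
      using norm_triangle_ineq[of 1 "\<i> * complex_of_real y"] True by (simp add: norm_mult)
    have "\<bar>r\<bar> \<le> (y\<^sup>2 / 2)\<^sup>2 / 2" unfolding r_def by (rule exp_minus_quadratic_approx) simp
    also have "\<dots> = \<bar>y\<bar> ^ 4 / 8" by (simp add: power2_eq_square power4_eq_xxxx)
    also have "\<bar>y\<bar> ^ 4 \<le> \<bar>y\<bar> ^ 3" using True by (intro power_decreasing) auto
    finally show "cmod (of_real r) \<le> \<bar>y\<bar> ^ 3 / 8" by simp
  qed auto
  finally have 2: "cmod ((1 + \<i> * of_real y) * of_real (exp (- (y\<^sup>2 / 2))) - p) \<le> \<bar>y\<bar> ^ 3 / 2 + 2 * (\<bar>y\<bar> ^ 3 / 8)" by simp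
  have "cmod (iexp y - (1 + \<i> * of_real y) * of_real (exp (- (y\<^sup>2 / 2)))) \<le>
      cmod (iexp y - p) + cmod ((1 + \<i> * of_real y) * of_real (exp (- (y\<^sup>2 / 2))) - p)"
    by (metis dist_norm dist_triangle2)
  also have "\<dots> \<le> \<bar>y\<bar> ^ 3 / 6 + (\<bar>y\<bar> ^ 3 / 2 + 2 * (\<bar>y\<bar> ^ 3 / 8))" using 1 2 by (rule add_mono)
  also have "\<dots> \<le> 2 * \<bar>y\<bar> ^ 3" by simp
  finally show ?thesis .
next
  case False
  have "cmod ((1 + \<i> * of_real y) * of_real (exp (- (y\<^sup>2 / 2)))) \<le> exp (y\<^sup>2 / 2) * exp (- (y\<^sup>2 / 2))"
    unfolding norm_mult by (intro mult_mono cmod_one_plus_ii_le) auto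
  also have "\<dots> = 1" by (simp add: exp_add[symmetric])
  finally have "cmod (iexp y - (1 + \<i> * of_real y) * of_real (exp (- (y\<^sup>2 / 2)))) \<le> 2"
    using norm_triangle_ineq4[of "iexp y" "(1 + \<i> * of_real y) * of_real (exp (- (y\<^sup>2 / 2)))"] by simp
  also have "\<dots> \<le> 2 * \<bar>y\<bar> ^ 3" using False one_le_power[of "\<bar>y\<bar>" 3] by simp
  finally show ?thesis .
qed

text \<open>The martingale property is expressed without a filtration: a function that factors through
  \<open>X 1, \<dots>, X (j - 1)\<close> is orthogonal to \<open>X j\<close>.\<close>

locale martingale_differences = prob_space M for M :: "'a measure" +
  fixes X :: "nat \<Rightarrow> 'a \<Rightarrow> real" and n :: nat
  assumes X_measurable [measurable]: "\<And>k. X k \<in> borel_measurable M"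
    and X4: "\<And>k. k \<in> {1..n} \<Longrightarrow> integrable M (\<lambda>x. X k x ^ 4)"
    and orthogonal_past: "\<And>j \<phi> C. j \<in> {1..n} \<Longrightarrow> \<phi> \<in> borel_measurable M \<Longrightarrow> (\<And>x. \<bar>\<phi> x\<bar> \<le> C) \<Longrightarrow>
      (\<And>x y. (\<And>k. k \<in> {1..<j} \<Longrightarrow> X k x = X k y) \<Longrightarrow> \<phi> x = \<phi> y) \<Longrightarrow> (\<integral>x. \<phi> x * X j x \<partial>M) = 0"
begin

text \<open>Predictable truncation: the decision about increment \<open>k\<close> looks at earlier
  increments only. The level 2 leaves room for a deviation of up to 1 of the sum of squares from its
  limit 1.\<close>

definition active :: "nat \<Rightarrow> 'a \<Rightarrow> bool" where
  "active k x \<longleftrightarrow> (\<Sum>l\<in>{1..<k}. (X l x)\<^sup>2) \<le> 2"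

definition Y :: "nat \<Rightarrow> 'a \<Rightarrow> real" where
  "Y k x = (if active k x then X k x else 0)"

text \<open>McLeish's product. It has mean 1, and on the event where the sum of squares is near 1 it
  is close to exp(t^2/2) times exp(it times the sum), provided that the fourth powers are
  small.\<close>

definition Tm :: "real \<Rightarrow> nat \<Rightarrow> 'a \<Rightarrow> complex" where
  "Tm t m x = (\<Prod>k\<in>{1..m}. 1 + \<i> * of_real (t * Y k x))"

text \<open>The Lyapunov sum; it controls both the largest increment and the remainder of third
  order.\<close>

definition L :: "'a \<Rightarrow> real" where
  "L x = (\<Sum>k=1..n. X k x ^ 4)"

lemma active_measurable [measurable]: "Measurable.pred M (active k)"
  unfolding active_def by measurable

lemma Y_measurable [measurable]: "Y k \<in> borel_measurable M"
  unfolding Y_def by measurable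

lemma Tm_measurable [measurable]: "Tm t m \<in> borel_measurable M"
  unfolding Tm_def by measurable

lemma L_measurable [measurable]: "L \<in> borel_measurable M"
  unfolding L_def by measurable

lemma L_nonneg: "L x \<ge> 0"
  unfolding L_def by (intro sum_nonneg) simp

lemma integrable_L: "integrable M L"
  unfolding L_def by (intro Bochner_Integration.integrable_sum X4)

lemma integrable_sqrt_L: "integrable M (\<lambda>x. sqrt (L x))"
proof (rule Bochner_Integration.integrable_bound)
  show "integrable M (\<lambda>x. 1 + L x)" by (intro Bochner_Integration.integrable_add integrable_L) simp
  have "sqrt (L x) \<le> 1 + L x" for x
    using L_nonneg[of x] by (intro real_le_lsqrt) (auto simp: power2_eq_square algebra_simps)
  then show "AE x in M. norm (sqrt (L x)) \<le> norm (1 + L x)"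
    using L_nonneg by (intro AE_I2) simp
qed measurable

text \<open>AM-GM at the level \<Lambda> gives Jensen's inequality for the square root, with
  \<Lambda> already in place of the expectation.\<close>

lemma expectation_sqrt_L_le:
  assumes "expectation L \<le> \<Lambda>" "\<Lambda> > 0"
  shows "(\<integral>x. sqrt (L x) \<partial>M) \<le> sqrt \<Lambda>"
proof -
  have "sqrt (L x) \<le> (L x / sqrt \<Lambda> + sqrt \<Lambda>) / 2" for x
  proof -
    have "0 \<le> (sqrt (L x) - sqrt \<Lambda>)\<^sup>2" by simp
    then have "2 * (sqrt (L x) * sqrt \<Lambda>) \<le> L x + sqrt \<Lambda> * sqrt \<Lambda>"
      using L_nonneg[of x] assms(2) by (simp add: power2_eq_square algebra_simps)
    then show ?thesis using assms(2) by (simp add: field_simps)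
  qed
  then have "(\<integral>x. sqrt (L x) \<partial>M) \<le> (\<integral>x. (L x / sqrt \<Lambda> + sqrt \<Lambda>) / 2 \<partial>M)"
    by (intro integral_mono integrable_sqrt_L) (auto intro!: integrable_L Bochner_Integration.integrable_add integrable_divide)
  also have "\<dots> = (expectation L / sqrt \<Lambda> + sqrt \<Lambda>) / 2"
    using integrable_L by (simp add: prob_space)
  also have "\<dots> \<le> (\<Lambda> / sqrt \<Lambda> + sqrt \<Lambda>) / 2"
    using assms by (intro divide_right_mono add_right_mono) auto
  also have "\<dots> = sqrt \<Lambda>" using assms(2) by (simp add: real_div_sqrt)
  finally show ?thesis .
qed

lemma abs_X_le: 
  assumes "k \<in> {1..n}"
  shows "\<bar>X k x\<bar> \<le> 1 + sqrt (L x)"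
proof -
  have "X k x ^ 4 \<le> L x" unfolding L_def using assms by (intro member_le_sum) auto
  then have "((X k x)\<^sup>2)\<^sup>2 \<le> L x" by (simp add: power_mult[symmetric])
  then have "(X k x)\<^sup>2 \<le> sqrt (L x)" by (rule real_le_rsqrt)
  moreover have "\<bar>X k x\<bar> \<le> 1 + (X k x)\<^sup>2"
  proof -
    have "0 \<le> (\<bar>X k x\<bar> - 1)\<^sup>2" by simp
    then have "2 * \<bar>X k x\<bar> \<le> 1 + (X k x)\<^sup>2" by (simp add: power2_eq_square algebra_simps)
    then show ?thesis by simp
  qed
  ultimately show ?thesis by linarith
qed

lemma cmod_Tm_le_exp: "cmod (Tm t m x) \<le> exp (t\<^sup>2 / 2 * (\<Sum>k\<in>{1..m}. (Y k x)\<^sup>2))"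
proof -
  have "cmod (Tm t m x) \<le> (\<Prod>k\<in>{1..m}. exp ((t * Y k x)\<^sup>2 / 2))"
    unfolding Tm_def prod_norm[symmetric] by (intro prod_mono conjI norm_ge_zero cmod_one_plus_ii_le)
  also have "\<dots> = exp (t\<^sup>2 / 2 * (\<Sum>k\<in>{1..m}. (Y k x)\<^sup>2))"
    by (simp add: exp_sum[symmetric] sum_distrib_left power_mult_distrib)
  finally show ?thesis .
qed

lemma cmod_Tm_active:
  assumes "active (Suc m) x"
  shows "cmod (Tm t m x) \<le> exp (t\<^sup>2)"
proof -
  have "(\<Sum>k\<in>{1..m}. (Y k x)\<^sup>2) \<le> (\<Sum>k\<in>{1..<Suc m}. (X k x)\<^sup>2)"
    unfolding atLeastLessThanSuc_atLeastAtMost by (intro sum_mono) (simp add: Y_def)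
  also have "\<dots> \<le> 2" using assms unfolding active_def .
  finally have "t\<^sup>2 / 2 * (\<Sum>k\<in>{1..m}. (Y k x)\<^sup>2) \<le> t\<^sup>2 / 2 * 2" by (intro mult_left_mono) auto
  then show ?thesis using cmod_Tm_le_exp[of t m x] by (smt (verit) exp_le_cancel_iff field_sum_of_halves mult_2_right)
qed

text \<open>While the next index is active, the product so far is at most exp(t^2). Only the factor
  that crosses the level can exceed this control; it costs one term in sqrt L, and all later factors
  are 1.\<close>

lemma cmod_Tm_le:
  assumes "m \<le> n"
  shows "cmod (Tm t m x) \<le> exp (t\<^sup>2) * (1 + \<bar>t\<bar> * (1 + sqrt (L x)))"
  using assms
proof (induction m)
  case 0
  have "1 * 1 \<le> exp (t\<^sup>2) * (1 + \<bar>t\<bar> * (1 + sqrt (L x)))"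
    using L_nonneg[of x] by (intro mult_mono) auto
  then show ?case by (simp add: Tm_def)
next
  case (Suc m)
  have T: "Tm t (Suc m) x = Tm t m x * (1 + \<i> * of_real (t * Y (Suc m) x))" by (simp add: Tm_def)
  show ?case
  proof (cases "active (Suc m) x")
    case True
    have "cmod (1 + \<i> * of_real (t * Y (Suc m) x)) \<le> 1 + \<bar>t\<bar> * \<bar>X (Suc m) x\<bar>"
      using norm_triangle_ineq[of 1 "\<i> * complex_of_real (t * Y (Suc m) x)"] True by (simp add: Y_def norm_mult)
    also have "\<dots> \<le> 1 + \<bar>t\<bar> * (1 + sqrt (L x))"
      using Suc.prems by (intro add_left_mono mult_left_mono abs_X_le) auto
    finally show ?thesis
      unfolding T norm_mult by (intro mult_mono cmod_Tm_active[OF True]) auto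
  next
    case False
    then show ?thesis using Suc by (simp add: T Y_def)
  qed
qed

lemma integrable_Tm:
  assumes "m \<le> n" shows "integrable M (Tm t m)"
proof (rule Bochner_Integration.integrable_bound)
  show "integrable M (\<lambda>x. exp (t\<^sup>2) * (1 + \<bar>t\<bar> * (1 + sqrt (L x))))"
    by (intro integrable_mult_right Bochner_Integration.integrable_add integrable_sqrt_L integrable_const)
  show "AE x in M. norm (Tm t m x) \<le> norm (exp (t\<^sup>2) * (1 + \<bar>t\<bar> * (1 + sqrt (L x))))"
    using cmod_Tm_le[OF assms] L_nonneg by (intro AE_I2) (simp add: abs_mult)
qed measurable

lemma integrable_X: "k \<in> {1..n} \<Longrightarrow> integrable M (X k)"
proof (rule Bochner_Integration.integrable_bound)
  assume "k \<in> {1..n}"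
  then show "AE x in M. norm (X k x) \<le> norm (1 + sqrt (L x))"
    using abs_X_le L_nonneg by (intro AE_I2) simp
  show "integrable M (\<lambda>x. 1 + sqrt (L x))" by (intro Bochner_Integration.integrable_add integrable_sqrt_L integrable_const)
qed measurable

text \<open>Each factor has conditional mean 1 given the past, so appending it leaves the integral
  unchanged.\<close>

lemma expectation_Tm: "m \<le> n \<Longrightarrow> (\<integral>x. Tm t m x \<partial>M) = 1"
proof (induction m)
  case 0
  then show ?case by (simp add: Tm_def prob_space)
next
  case (Suc m)
  \<comment> \<open>The activity indicator is moved from the increment to the product. This makes
    the multiplier bounded, as \<open>orthogonal_past\<close> demands, and it remains a function of
    the past. Real and imaginary parts are treated separately.\<close>
  define W where "W x = (if active (Suc m) x then Tm t m x else 0)" for x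
  have [measurable]: "W \<in> borel_measurable M" unfolding W_def by measurable
  have Wb: "cmod (W x) \<le> exp (t\<^sup>2)" for x using cmod_Tm_active[of m x t] by (simp add: W_def)
  have past: "W x = W y" if same: "\<And>k. k \<in> {1..<Suc m} \<Longrightarrow> X k x = X k y" for x y
  proof -
    have a: "active k x = active k y" if k: "k \<le> Suc m" for k
    proof -
      have "(\<Sum>l\<in>{1..<k}. (X l x)\<^sup>2) = (\<Sum>l\<in>{1..<k}. (X l y)\<^sup>2)"
        by (rule sum.cong[OF refl]) (use same k in auto)
      then show ?thesis unfolding active_def by simp
    qed
    have "Tm t m x = Tm t m y"
      unfolding Tm_def by (rule prod.cong[OF refl]) (use a same in \<open>auto simp: Y_def\<close>)
    then show ?thesis using a[of "Suc m"] by (simp add: W_def)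
  qed
  have m1: "Suc m \<in> {1..n}" using Suc.prems by auto
  have Reb: "\<bar>Re (W x)\<bar> \<le> exp (t\<^sup>2)" and Imb: "\<bar>Im (W x)\<bar> \<le> exp (t\<^sup>2)" for x
    by (rule order.trans[OF abs_Re_le_cmod Wb], rule order.trans[OF abs_Im_le_cmod Wb])
  have Rem: "(\<lambda>x. Re (W x)) \<in> borel_measurable M" and Imm: "(\<lambda>x. Im (W x)) \<in> borel_measurable M"
    by measurable
  have Re0: "(\<integral>x. Re (W x) * X (Suc m) x \<partial>M) = 0"
    by (rule orthogonal_past[OF m1 Rem Reb]) (rule arg_cong[where f = Re, OF past])
  have Im0: "(\<integral>x. Im (W x) * X (Suc m) x \<partial>M) = 0"
    by (rule orthogonal_past[OF m1 Imm Imb]) (rule arg_cong[where f = Im, OF past])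
  have int: "integrable M (\<lambda>x. g x * X (Suc m) x)" if "g \<in> borel_measurable M" "\<And>x. \<bar>g x\<bar> \<le> exp (t\<^sup>2)" for g :: "'a \<Rightarrow> real"
  proof (rule Bochner_Integration.integrable_bound)
    show "integrable M (\<lambda>x. exp (t\<^sup>2) * \<bar>X (Suc m) x\<bar>)" by (intro integrable_mult_right integrable_abs integrable_X m1)
    show "(\<lambda>x. g x * X (Suc m) x) \<in> borel_measurable M" using that(1) by measurable
    show "AE x in M. norm (g x * X (Suc m) x) \<le> norm (exp (t\<^sup>2) * \<bar>X (Suc m) x\<bar>)"
      using that(2) by (intro AE_I2) (simp add: abs_mult mult_right_mono)
  qed
  have iRe: "integrable M (\<lambda>x. Re (W x) * X (Suc m) x)"
    by (rule int[OF Rem Reb])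
  have iIm: "integrable M (\<lambda>x. Im (W x) * X (Suc m) x)"
    by (rule int[OF Imm Imb])
  have decomp: "Tm t (Suc m) x = Tm t m x + (\<i> * of_real t * of_real (Re (W x) * X (Suc m) x) - of_real t * of_real (Im (W x) * X (Suc m) x))" for x
  proof -
    have "Tm t (Suc m) x = Tm t m x + \<i> * of_real t * (W x * of_real (X (Suc m) x))"
      by (simp add: Tm_def W_def Y_def algebra_simps)
    also have "W x * of_real (X (Suc m) x) = of_real (Re (W x) * X (Suc m) x) + \<i> * of_real (Im (W x) * X (Suc m) x)"
      by (simp add: complex_eq_iff)
    finally show ?thesis by (simp add: algebra_simps)
  qed
  have i1: "integrable M (\<lambda>x. \<i> * of_real t * complex_of_real (Re (W x) * X (Suc m) x))"
    by (intro integrable_mult_right integrable_of_real iRe)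
  have i2: "integrable M (\<lambda>x. of_real t * complex_of_real (Im (W x) * X (Suc m) x))"
    by (intro integrable_mult_right integrable_of_real iIm)
  have "(\<integral>x. Tm t (Suc m) x \<partial>M) = (\<integral>x. Tm t m x \<partial>M) +
      ((\<integral>x. \<i> * of_real t * complex_of_real (Re (W x) * X (Suc m) x) \<partial>M) - (\<integral>x. of_real t * complex_of_real (Im (W x) * X (Suc m) x) \<partial>M))"
    unfolding decomp using Suc.prems i1 i2
    by (subst Bochner_Integration.integral_add[OF integrable_Tm Bochner_Integration.integrable_diff])
      (simp_all only: Bochner_Integration.integral_diff Suc_leD)
  also have "(\<integral>x. \<i> * of_real t * complex_of_real (Re (W x) * X (Suc m) x) \<partial>M) = 0"
    unfolding integral_mult_right_zero integral_complex_of_real Re0 by simp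
  also have "(\<integral>x. of_real t * complex_of_real (Im (W x) * X (Suc m) x) \<partial>M) = 0"
    unfolding integral_mult_right_zero integral_complex_of_real Im0 by simp
  finally show ?case using Suc by simp
qed

text \<open>On this event no increment is truncated. Comparing the two products factor by factor
  costs the sum of |X|^3, which is at most the root of the sum of squares times \<open>L\<close>;
  replacing exp(-t^2 S / 2) for the sum of squares S by its limit costs \<delta>.\<close>

lemma characteristic_difference_pointwise:
  assumes \<delta>: "0 \<le> \<delta>" "\<delta> \<le> 1" and G: "\<bar>(\<Sum>k=1..n. (X k x)\<^sup>2) - 1\<bar> \<le> \<delta>"
  shows "cmod (iexp (t * (\<Sum>k=1..n. X k x)) - Tm t n x * of_real (exp (- (t\<^sup>2 / 2)))) \<le>
    4 * \<bar>t\<bar> ^ 3 * sqrt (L x) + exp (t\<^sup>2) * (1 + \<bar>t\<bar> * (1 + sqrt (L x))) * (t\<^sup>2 / 2 * \<delta>)"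
proof -
  let ?S = "\<Sum>k=1..n. (X k x)\<^sup>2"
  have S2: "?S \<le> 2" using G \<delta> by linarith
  have Y: "Y k x = X k x" if "k \<in> {1..n}" for k
  proof -
    have "(\<Sum>l\<in>{1..<k}. (X l x)\<^sup>2) \<le> ?S" using that by (intro sum_mono2) auto
    then show ?thesis using S2 by (simp add: Y_def active_def)
  qed
  define a where "a k = iexp (t * X k x)" for k
  define b where "b k = (1 + \<i> * of_real (t * X k x)) * of_real (exp (- ((t * X k x)\<^sup>2 / 2)))" for k
  have prod_a: "(\<Prod>k\<in>{1..n}. a k) = iexp (t * (\<Sum>k=1..n. X k x))"
    unfolding a_def by (simp add: exp_sum[symmetric] sum_distrib_left of_real_sum)
  have prod_b: "(\<Prod>k\<in>{1..n}. b k) = Tm t n x * of_real (exp (- (t\<^sup>2 / 2 * ?S)))"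
  proof -
    have "(\<Prod>k\<in>{1..n}. b k) = (\<Prod>k\<in>{1..n}. 1 + \<i> * of_real (t * X k x)) * (\<Prod>k\<in>{1..n}. of_real (exp (- ((t * X k x)\<^sup>2 / 2))))"
      unfolding b_def by (rule prod.distrib)
    also have "(\<Prod>k\<in>{1..n}. 1 + \<i> * of_real (t * X k x)) = Tm t n x"
      unfolding Tm_def using Y by (intro prod.cong) auto
    also have "(\<Prod>k\<in>{1..n}. of_real (exp (- ((t * X k x)\<^sup>2 / 2)))) = (of_real (exp (- (t\<^sup>2 / 2 * ?S))) :: complex)"
    proof -
      have "(\<Prod>k\<in>{1..n}. exp (- ((t * X k x)\<^sup>2 / 2))) = exp (- (t\<^sup>2 / 2 * ?S))"
        by (simp add: exp_sum[symmetric] sum_negf[symmetric] sum_distrib_left power_mult_distrib)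
      then show ?thesis by (simp only: of_real_prod[symmetric])
    qed
    finally show ?thesis .
  qed
  have b1: "cmod (b k) \<le> 1" for k
  proof -
    have "cmod (b k) \<le> exp ((t * X k x)\<^sup>2 / 2) * exp (- ((t * X k x)\<^sup>2 / 2))"
      unfolding b_def norm_mult by (intro mult_mono cmod_one_plus_ii_le) auto
    also have "\<dots> = 1" by (simp add: exp_add[symmetric])
    finally show ?thesis .
  qed
  have a1: "cmod (a k) \<le> 1" for k unfolding a_def by simp
  have "cmod ((\<Prod>k\<in>{1..n}. a k) - (\<Prod>k\<in>{1..n}. b k)) \<le> (\<Sum>k\<in>{1..n}. cmod (a k - b k))"
    by (intro norm_prod_diff a1 b1)
  also have "\<dots> \<le> (\<Sum>k=1..n. 2 * \<bar>t * X k x\<bar> ^ 3)"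
    unfolding a_def b_def by (intro sum_mono iexp_approx_product)
  also have "\<dots> = 2 * \<bar>t\<bar> ^ 3 * (\<Sum>k=1..n. \<bar>X k x\<bar> ^ 3)"
    by (simp add: sum_distrib_left abs_mult power_mult_distrib mult.assoc)
  also have "(\<Sum>k=1..n. \<bar>X k x\<bar> ^ 3) \<le> 2 * sqrt (L x)"
  proof (rule power2_le_imp_le)
    have "(\<Sum>k=1..n. \<bar>X k x\<bar> ^ 3) = (\<Sum>k=1..n. \<bar>X k x\<bar> * (X k x)\<^sup>2)"
      by (intro sum.cong refl) (simp add: power3_eq_cube power2_eq_square abs_mult_self)
    then have "(\<Sum>k=1..n. \<bar>X k x\<bar> ^ 3)\<^sup>2 \<le> (\<Sum>k=1..n. \<bar>X k x\<bar>\<^sup>2) * (\<Sum>k=1..n. ((X k x)\<^sup>2)\<^sup>2)"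
      by (simp only: Cauchy_Schwarz_ineq_sum)
    also have "(\<Sum>k=1..n. \<bar>X k x\<bar>\<^sup>2) = ?S" by simp
    also have "(\<Sum>k=1..n. ((X k x)\<^sup>2)\<^sup>2) = L x" unfolding L_def by (simp add: power_mult[symmetric])
    also have "?S * L x \<le> 2 * L x" using S2 L_nonneg by (intro mult_right_mono) auto
    also have "2 * L x \<le> (2 * sqrt (L x))\<^sup>2" using L_nonneg[of x] by (simp add: power_mult_distrib)
    finally show "(\<Sum>k=1..n. \<bar>X k x\<bar> ^ 3)\<^sup>2 \<le> (2 * sqrt (L x))\<^sup>2" .
  qed (simp add: L_nonneg)
  finally have 1: "cmod (iexp (t * (\<Sum>k=1..n. X k x)) - Tm t n x * of_real (exp (- (t\<^sup>2 / 2 * ?S)))) \<le> 4 * \<bar>t\<bar> ^ 3 * sqrt (L x)"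
    unfolding prod_a prod_b by (simp add: mult_left_mono)
  have "cmod (Tm t n x * of_real (exp (- (t\<^sup>2 / 2 * ?S))) - Tm t n x * of_real (exp (- (t\<^sup>2 / 2)))) =
      cmod (Tm t n x) * \<bar>exp (- (t\<^sup>2 / 2 * ?S)) - exp (- (t\<^sup>2 / 2))\<bar>"
    by (simp only: right_diff_distrib[symmetric] norm_mult of_real_diff[symmetric] norm_of_real)
  also have "\<dots> \<le> (exp (t\<^sup>2) * (1 + \<bar>t\<bar> * (1 + sqrt (L x)))) * (t\<^sup>2 / 2 * \<delta>)"
  proof (intro mult_mono cmod_Tm_le order_refl)
    have "\<bar>exp (- (t\<^sup>2 / 2 * ?S)) - exp (- (t\<^sup>2 / 2))\<bar> \<le> \<bar>t\<^sup>2 / 2 * ?S - t\<^sup>2 / 2\<bar>"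
      by (intro abs_exp_minus_diff_le mult_nonneg_nonneg sum_nonneg) auto
    also have "t\<^sup>2 / 2 * ?S - t\<^sup>2 / 2 = t\<^sup>2 / 2 * (?S - 1)" by (simp add: algebra_simps)
    also have "\<bar>\<dots>\<bar> \<le> t\<^sup>2 / 2 * \<delta>" unfolding abs_mult using G by (intro mult_mono) auto
    finally show "\<bar>exp (- (t\<^sup>2 / 2 * ?S)) - exp (- (t\<^sup>2 / 2))\<bar> \<le> t\<^sup>2 / 2 * \<delta>" .
  qed (use L_nonneg[of x] in auto)
  finally have 2: "cmod (Tm t n x * of_real (exp (- (t\<^sup>2 / 2 * ?S))) - Tm t n x * of_real (exp (- (t\<^sup>2 / 2)))) \<le>
      exp (t\<^sup>2) * (1 + \<bar>t\<bar> * (1 + sqrt (L x))) * (t\<^sup>2 / 2 * \<delta>)" .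
  from norm_triangle_mono[OF 1 2] show ?thesis by simp
qed

text \<open>Since the product has mean 1, the target exp(-t^2/2) is itself the expectation of
  \<open>Tm t n\<close> times exp(-t^2/2), and the two integrands can be compared pointwise. Off the
  exceptional event the previous lemma applies; on it both moduli are bounded crudely. The constant
  \<open>?K\<close> is a common majorant for both cases.\<close>

theorem characteristic_function_close_to_normal:
  assumes \<delta>: "0 \<le> \<delta>" "\<delta> \<le> 1" and \<Lambda>: "expectation L \<le> \<Lambda>" "\<Lambda> > 0"
  shows "cmod ((\<integral>x. iexp (t * (\<Sum>k=1..n. X k x)) \<partial>M) - of_real (exp (- (t\<^sup>2 / 2)))) \<le>
    (4 * \<bar>t\<bar> ^ 3 + exp (t\<^sup>2) * (1 + t\<^sup>2) * (1 + \<bar>t\<bar>) + 1) *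
    (sqrt \<Lambda> + \<delta> + \<delta> * sqrt \<Lambda> + prob {x \<in> space M. \<delta> < \<bar>(\<Sum>k=1..n. (X k x)\<^sup>2) - 1\<bar>})"
proof -
  let ?K = "4 * \<bar>t\<bar> ^ 3 + exp (t\<^sup>2) * (1 + t\<^sup>2) * (1 + \<bar>t\<bar>) + 1"
  let ?W = "\<lambda>x. \<Sum>k=1..n. X k x"
  define B where "B = {x \<in> space M. \<delta> < \<bar>(\<Sum>k=1..n. (X k x)\<^sup>2) - 1\<bar>}"
  have B [measurable]: "B \<in> sets M" unfolding B_def by measurable
  let ?H = "\<lambda>x. iexp (t * ?W x) - Tm t n x * of_real (exp (- (t\<^sup>2 / 2)))"
  have c0: "0 \<le> 4 * \<bar>t\<bar> ^ 3" by simp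
  have pt: "cmod (?H x) \<le> ?K * (sqrt (L x) + \<delta> + \<delta> * sqrt (L x) + indicator B x)" if x: "x \<in> space M" for x
  proof (cases "x \<in> B")
    case False
    then have "\<bar>(\<Sum>k=1..n. (X k x)\<^sup>2) - 1\<bar> \<le> \<delta>" using x unfolding B_def by auto
    from characteristic_difference_pointwise[OF \<delta> this]
    have "cmod (?H x) \<le> 4 * \<bar>t\<bar> ^ 3 * sqrt (L x) + exp (t\<^sup>2) * (1 + \<bar>t\<bar> * (1 + sqrt (L x))) * (t\<^sup>2 / 2 * \<delta>)" .
    also have "\<dots> \<le> ?K * sqrt (L x) + ?K * (\<delta> + \<delta> * sqrt (L x))"
    proof (rule add_mono)
      show "4 * \<bar>t\<bar> ^ 3 * sqrt (L x) \<le> ?K * sqrt (L x)" using L_nonneg[of x] by (intro mult_right_mono) auto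
      have "exp (t\<^sup>2) * (1 + \<bar>t\<bar> * (1 + sqrt (L x))) * (t\<^sup>2 / 2 * \<delta>) \<le> exp (t\<^sup>2) * ((1 + \<bar>t\<bar>) * (1 + sqrt (L x))) * ((1 + t\<^sup>2) * \<delta>)"
        using L_nonneg[of x] \<delta> by (intro mult_mono) (auto simp: algebra_simps)
      also have "\<dots> = exp (t\<^sup>2) * (1 + t\<^sup>2) * (1 + \<bar>t\<bar>) * (\<delta> + \<delta> * sqrt (L x))" by (simp add: algebra_simps)
      also have "\<dots> \<le> ?K * (\<delta> + \<delta> * sqrt (L x))" using L_nonneg[of x] \<delta> by (intro mult_right_mono) auto
      finally show "exp (t\<^sup>2) * (1 + \<bar>t\<bar> * (1 + sqrt (L x))) * (t\<^sup>2 / 2 * \<delta>) \<le> ?K * (\<delta> + \<delta> * sqrt (L x))" .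
    qed
    finally show ?thesis using False by (simp add: algebra_simps)
  next
    case True
    have "cmod (?H x) \<le> cmod (iexp (t * ?W x)) + cmod (Tm t n x * of_real (exp (- (t\<^sup>2 / 2))))" by (rule norm_triangle_ineq4)
    also have "\<dots> \<le> 1 + exp (t\<^sup>2) * (1 + \<bar>t\<bar> * (1 + sqrt (L x))) * 1"
      unfolding norm_mult[of "Tm t n x"] by (intro add_mono mult_mono cmod_Tm_le) (use L_nonneg[of x] in auto)
    also have "\<dots> = (1 + exp (t\<^sup>2) * (1 + \<bar>t\<bar>)) + exp (t\<^sup>2) * \<bar>t\<bar> * sqrt (L x)" by (simp add: algebra_simps)
    also have "\<dots> \<le> ?K + ?K * sqrt (L x)"
    proof (rule add_mono)
      have "exp (t\<^sup>2) * (1 + \<bar>t\<bar>) \<le> exp (t\<^sup>2) * (1 + t\<^sup>2) * (1 + \<bar>t\<bar>)" by (intro mult_right_mono) auto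
      then show "1 + exp (t\<^sup>2) * (1 + \<bar>t\<bar>) \<le> ?K" using c0 by linarith
      have "exp (t\<^sup>2) * \<bar>t\<bar> \<le> exp (t\<^sup>2) * (1 + t\<^sup>2) * (1 + \<bar>t\<bar>)" by (intro mult_mono) auto
      then have "exp (t\<^sup>2) * \<bar>t\<bar> \<le> ?K" using c0 by linarith
      then show "exp (t\<^sup>2) * \<bar>t\<bar> * sqrt (L x) \<le> ?K * sqrt (L x)" by (rule mult_right_mono) (simp add: L_nonneg)
    qed
    also have "\<dots> \<le> ?K * (sqrt (L x) + \<delta> + \<delta> * sqrt (L x) + indicator B x)"
    proof -
      have "0 \<le> ?K" by simp
      then have "0 \<le> ?K * (\<delta> + \<delta> * sqrt (L x))" using \<delta> L_nonneg[of x] by (intro mult_nonneg_nonneg) auto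
      then show ?thesis using True by (simp add: algebra_simps)
    qed
    finally show ?thesis .
  qed
  have iB: "integrable M (indicator B :: 'a \<Rightarrow> real)"
    by (rule integrable_real_indicator) (simp_all add: emeasure_eq_measure)
  have iT: "integrable M (\<lambda>x. Tm t n x * of_real (exp (- (t\<^sup>2 / 2))))" by (intro integrable_mult_left integrable_Tm order_refl)
  have iI: "integrable M (\<lambda>x. iexp (t * ?W x))" by (intro integrable_iexp) measurable
  have "(\<integral>x. iexp (t * ?W x) \<partial>M) - of_real (exp (- (t\<^sup>2 / 2))) = (\<integral>x. ?H x \<partial>M)"
    by (subst Bochner_Integration.integral_diff[OF iI iT]) (simp add: expectation_Tm)
  then have "cmod ((\<integral>x. iexp (t * ?W x) \<partial>M) - of_real (exp (- (t\<^sup>2 / 2)))) \<le> (\<integral>x. cmod (?H x) \<partial>M)"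
    by (simp add: integral_norm_bound)
  also have "\<dots> \<le> (\<integral>x. ?K * (sqrt (L x) + \<delta> + \<delta> * sqrt (L x) + indicator B x) \<partial>M)"
  proof (rule integral_mono)
    show "integrable M (\<lambda>x. cmod (?H x))" by (intro integrable_norm Bochner_Integration.integrable_diff iI iT)
    show "integrable M (\<lambda>x. ?K * (sqrt (L x) + \<delta> + \<delta> * sqrt (L x) + indicator B x))"
      by (intro integrable_mult_right Bochner_Integration.integrable_add integrable_sqrt_L integrable_const iB)
  qed (rule pt)
  also have "\<dots> = ?K * ((\<integral>x. sqrt (L x) \<partial>M) + \<delta> + \<delta> * (\<integral>x. sqrt (L x) \<partial>M) + prob B)"
  proof -
    have "(\<integral>x. sqrt (L x) + \<delta> + \<delta> * sqrt (L x) + indicator B x \<partial>M) =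
        (\<integral>x. sqrt (L x) \<partial>M) + \<delta> + \<delta> * (\<integral>x. sqrt (L x) \<partial>M) + prob B"
      using integrable_sqrt_L iB B by (simp add: prob_space sets.Int_space_eq2)
    then show ?thesis by (simp only: integral_mult_right_zero)
  qed
  also have "\<dots> \<le> ?K * (sqrt \<Lambda> + \<delta> + \<delta> * sqrt \<Lambda> + prob B)"
    using expectation_sqrt_L_le[OF \<Lambda>] \<delta> by (intro mult_left_mono add_mono) auto
  finally show ?thesis unfolding B_def .
qed

end

section \<open>Quadratic forms with covariate-dependent weights\<close>

declare One_nat_def [simp del]

lemma sum_pairs: "(\<Sum>p\<in>S \<times> T. F (fst p) (snd p)) = (\<Sum>i\<in>S. \<Sum>j\<in>T. F i j)"
  by (simp add: sum.cartesian_product case_prod_unfold)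

lemma integral_sum_sum:
  fixes f :: "'i \<Rightarrow> 'j \<Rightarrow> 'a \<Rightarrow> real"
  assumes "\<And>p q. p \<in> S \<Longrightarrow> q \<in> T \<Longrightarrow> integrable M (f p q)"
  shows "(\<integral>x. (\<Sum>p\<in>S. \<Sum>q\<in>T. f p q x) \<partial>M) = (\<Sum>p\<in>S. \<Sum>q\<in>T. \<integral>x. f p q x \<partial>M)"
proof -
  have "(\<integral>x. (\<Sum>p\<in>S. \<Sum>q\<in>T. f p q x) \<partial>M) = (\<Sum>p\<in>S. \<integral>x. (\<Sum>q\<in>T. f p q x) \<partial>M)"
    by (rule Bochner_Integration.integral_sum) (intro Bochner_Integration.integrable_sum assms)
  also have "\<dots> = (\<Sum>p\<in>S. \<Sum>q\<in>T. \<integral>x. f p q x \<partial>M)"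
    by (intro sum.cong refl Bochner_Integration.integral_sum assms)
  finally show ?thesis .
qed

lemma sum_square_expand:
  fixes z :: "nat \<Rightarrow> real"
  shows "(\<Sum>i=1..n. z i)\<^sup>2 = (\<Sum>i=1..n. (z i)\<^sup>2) + 2 * (\<Sum>i=1..n. \<Sum>j=1..n. of_bool (i < j) * (z i * z j))"
proof -
  have "(\<Sum>i=1..n. z i)\<^sup>2 = (\<Sum>i=1..n. \<Sum>j=1..n. z i * z j)"
    by (simp only: power2_eq_square sum_product)
  also have "\<dots> = (\<Sum>i=1..n. \<Sum>j=1..n. of_bool (i = j) * (z i * z j) + (of_bool (i < j) * (z i * z j) + of_bool (j < i) * (z i * z j)))"
    by (intro sum.cong refl) (auto simp: of_bool_def)
  also have "\<dots> = (\<Sum>i=1..n. \<Sum>j=1..n. of_bool (i = j) * (z i * z j)) + ((\<Sum>i=1..n. \<Sum>j=1..n. of_bool (i < j) * (z i * z j)) + (\<Sum>i=1..n. \<Sum>j=1..n. of_bool (j < i) * (z i * z j)))"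
    by (simp only: sum.distrib)
  also have "(\<Sum>i=1..n. \<Sum>j=1..n. of_bool (j < i) * (z i * z j)) = (\<Sum>i=1..n. \<Sum>j=1..n. of_bool (i < j) * (z i * z j))"
    by (subst sum.swap) (intro sum.cong refl, simp)
  also have "(\<Sum>i=1..n. \<Sum>j=1..n. of_bool (i = j) * (z i * z j)) = (\<Sum>i=1..n. (z i)\<^sup>2)"
  proof (rule sum.cong[OF refl])
    fix i assume "i \<in> {1..n}"
    then have "(\<Sum>j=1..n. of_bool (i = j) * (z i * z j)) = (\<Sum>j\<in>{i}. of_bool (i = j) * (z i * z j))"
      by (intro sum.mono_neutral_right) auto
    then show "(\<Sum>j=1..n. of_bool (i = j) * (z i * z j)) = (z i)\<^sup>2" by (simp add: power2_eq_square)
  qed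
  finally show ?thesis by simp
qed

text \<open>Summing a product of weights along a path over an end vertex costs a factor
  \<open>R\<close>. Hence a path with k edges and a nonnegative mass at one of its vertices sums to
  at most R^k times the total mass; the lemmas below treat one, two and three edges, with the mass
  at each possible vertex.\<close>

locale symmetric_weights =
  fixes n :: nat and a :: "nat \<Rightarrow> nat \<Rightarrow> real" and R :: real
  assumes a_nonneg: "\<And>i j. 0 \<le> a i j"
    and a_sym: "\<And>i j. a i j = a j i"
    and a_row: "\<And>i. i \<in> {1..n} \<Longrightarrow> (\<Sum>j=1..n. a i j) \<le> R"
    and R_nonneg: "0 \<le> R"
begin

lemma path2_le:
  assumes x: "\<And>i. 0 \<le> x i"
  shows "(\<Sum>i=1..n. \<Sum>j=1..n. a i j * x i) \<le> R * (\<Sum>i=1..n. x i)"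
    and "(\<Sum>i=1..n. \<Sum>j=1..n. a i j * x j) \<le> R * (\<Sum>i=1..n. x i)"
proof -
  show *: "(\<Sum>i=1..n. \<Sum>j=1..n. a i j * x i) \<le> R * (\<Sum>i=1..n. x i)"
    unfolding sum_distrib_right[symmetric] sum_distrib_left using x by (intro sum_mono mult_right_mono a_row) auto
  have "(\<Sum>i=1..n. \<Sum>j=1..n. a i j * x j) = (\<Sum>i=1..n. \<Sum>j=1..n. a i j * x i)"
    by (subst sum.swap) (simp only: a_sym)
  then show "(\<Sum>i=1..n. \<Sum>j=1..n. a i j * x j) \<le> R * (\<Sum>i=1..n. x i)" using * by simp
qed

lemma path3_le:
  assumes x: "\<And>i. 0 \<le> x i"
  shows "(\<Sum>i=1..n. \<Sum>j=1..n. \<Sum>k=1..n. a i j * a j k * x i) \<le> R\<^sup>2 * (\<Sum>i=1..n. x i)"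
    and "(\<Sum>i=1..n. \<Sum>j=1..n. \<Sum>k=1..n. a i j * a j k * x j) \<le> R\<^sup>2 * (\<Sum>i=1..n. x i)"
    and "(\<Sum>i=1..n. \<Sum>j=1..n. \<Sum>k=1..n. a i j * a j k * x k) \<le> R\<^sup>2 * (\<Sum>i=1..n. x i)"
proof -
  have last: "(\<Sum>k=1..n. a i j * a j k * y) \<le> R * (a i j * y)" if "j \<in> {1..n}" "0 \<le> y" for i j y
  proof -
    have "(\<Sum>k=1..n. a i j * a j k * y) = (\<Sum>k=1..n. a j k) * (a i j * y)"
      unfolding sum_distrib_right by (intro sum.cong refl) (simp add: mult_ac)
    also have "\<dots> \<le> R * (a i j * y)" using that a_nonneg by (intro mult_right_mono a_row) auto
    finally show ?thesis .
  qed
  show *: "(\<Sum>i=1..n. \<Sum>j=1..n. \<Sum>k=1..n. a i j * a j k * x i) \<le> R\<^sup>2 * (\<Sum>i=1..n. x i)"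
  proof -
    have "(\<Sum>i=1..n. \<Sum>j=1..n. \<Sum>k=1..n. a i j * a j k * x i) \<le> (\<Sum>i=1..n. \<Sum>j=1..n. R * (a i j * x i))"
      by (intro sum_mono last x)
    also have "\<dots> \<le> R * (R * (\<Sum>i=1..n. x i))"
      unfolding sum_distrib_left[symmetric] using R_nonneg by (intro mult_left_mono path2_le x) auto
    finally show ?thesis by (simp add: power2_eq_square)
  qed
  show "(\<Sum>i=1..n. \<Sum>j=1..n. \<Sum>k=1..n. a i j * a j k * x j) \<le> R\<^sup>2 * (\<Sum>i=1..n. x i)"
  proof -
    have "(\<Sum>i=1..n. \<Sum>j=1..n. \<Sum>k=1..n. a i j * a j k * x j) \<le> (\<Sum>i=1..n. \<Sum>j=1..n. R * (a i j * x j))"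
      by (intro sum_mono last x)
    also have "\<dots> \<le> R * (R * (\<Sum>i=1..n. x i))"
      unfolding sum_distrib_left[symmetric] using R_nonneg by (intro mult_left_mono path2_le x) auto
    finally show ?thesis by (simp add: power2_eq_square)
  qed
  have "(\<Sum>i=1..n. \<Sum>j=1..n. \<Sum>k=1..n. a i j * a j k * x k) = (\<Sum>k=1..n. \<Sum>i=1..n. \<Sum>j=1..n. a i j * a j k * x k)"
    by (rule sum_swap_triple)
  also have "\<dots> = (\<Sum>k=1..n. \<Sum>j=1..n. \<Sum>i=1..n. a k j * a j i * x k)"
    by (intro sum.cong[OF refl] trans[OF sum.swap]) (simp add: a_sym mult_ac)
  also note *
  finally show "(\<Sum>i=1..n. \<Sum>j=1..n. \<Sum>k=1..n. a i j * a j k * x k) \<le> R\<^sup>2 * (\<Sum>i=1..n. x i)" .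
qed

lemma path4_le:
  assumes x: "\<And>i. 0 \<le> x i"
  shows "(\<Sum>i=1..n. \<Sum>j=1..n. \<Sum>k=1..n. \<Sum>l=1..n. a i j * a j k * a k l * (x i + x j + x k + x l)) \<le> 4 * R ^ 3 * (\<Sum>i=1..n. x i)"
proof -
  have last: "(\<Sum>l=1..n. a i j * a j k * a k l * y) \<le> R * (a i j * a j k * y)" if "k \<in> {1..n}" "0 \<le> y" for i j k y
  proof -
    have "(\<Sum>l=1..n. a i j * a j k * a k l * y) = (\<Sum>l=1..n. a k l) * (a i j * a j k * y)"
      unfolding sum_distrib_right by (intro sum.cong refl) (simp add: mult_ac)
    also have "\<dots> \<le> R * (a i j * a j k * y)" using that a_nonneg by (intro mult_right_mono a_row) auto
    finally show ?thesis .
  qed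
  have R3: "R * (R\<^sup>2 * y) = R ^ 3 * y" for y by (simp add: power3_eq_cube power2_eq_square)
  have 1: "(\<Sum>i=1..n. \<Sum>j=1..n. \<Sum>k=1..n. \<Sum>l=1..n. a i j * a j k * a k l * x i) \<le> R ^ 3 * (\<Sum>i=1..n. x i)"
  proof -
    have "(\<Sum>i=1..n. \<Sum>j=1..n. \<Sum>k=1..n. \<Sum>l=1..n. a i j * a j k * a k l * x i) \<le> (\<Sum>i=1..n. \<Sum>j=1..n. \<Sum>k=1..n. R * (a i j * a j k * x i))"
      by (intro sum_mono last x)
    also have "\<dots> \<le> R * (R\<^sup>2 * (\<Sum>i=1..n. x i))"
      unfolding sum_distrib_left[symmetric] using R_nonneg by (intro mult_left_mono path3_le x) auto
    finally show ?thesis unfolding R3 .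
  qed
  have 2: "(\<Sum>i=1..n. \<Sum>j=1..n. \<Sum>k=1..n. \<Sum>l=1..n. a i j * a j k * a k l * x j) \<le> R ^ 3 * (\<Sum>i=1..n. x i)"
  proof -
    have "(\<Sum>i=1..n. \<Sum>j=1..n. \<Sum>k=1..n. \<Sum>l=1..n. a i j * a j k * a k l * x j) \<le> (\<Sum>i=1..n. \<Sum>j=1..n. \<Sum>k=1..n. R * (a i j * a j k * x j))"
      by (intro sum_mono last x)
    also have "\<dots> \<le> R * (R\<^sup>2 * (\<Sum>i=1..n. x i))"
      unfolding sum_distrib_left[symmetric] using R_nonneg by (intro mult_left_mono path3_le x) auto
    finally show ?thesis unfolding R3 .
  qed
  have rev: "(\<Sum>i=1..n. \<Sum>j=1..n. \<Sum>k=1..n. \<Sum>l=1..n. f i j k l) = (\<Sum>l=1..n. \<Sum>k=1..n. \<Sum>j=1..n. \<Sum>i=1..n. f i j k l)"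
    for f :: "nat \<Rightarrow> nat \<Rightarrow> nat \<Rightarrow> nat \<Rightarrow> real"
  proof -
    have "(\<Sum>i=1..n. \<Sum>j=1..n. \<Sum>k=1..n. \<Sum>l=1..n. f i j k l) = (\<Sum>i=1..n. \<Sum>l=1..n. \<Sum>j=1..n. \<Sum>k=1..n. f i j k l)"
      by (intro sum.cong refl sum_swap_triple)
    also have "\<dots> = (\<Sum>l=1..n. \<Sum>i=1..n. \<Sum>j=1..n. \<Sum>k=1..n. f i j k l)" by (rule sum.swap)
    also have "\<dots> = (\<Sum>l=1..n. \<Sum>k=1..n. \<Sum>i=1..n. \<Sum>j=1..n. f i j k l)" by (intro sum.cong refl sum_swap_triple)
    also have "\<dots> = (\<Sum>l=1..n. \<Sum>k=1..n. \<Sum>j=1..n. \<Sum>i=1..n. f i j k l)" by (intro sum.cong refl sum.swap)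
    finally show ?thesis .
  qed
  have 3: "(\<Sum>i=1..n. \<Sum>j=1..n. \<Sum>k=1..n. \<Sum>l=1..n. a i j * a j k * a k l * x k) \<le> R ^ 3 * (\<Sum>i=1..n. x i)"
  proof -
    have "(\<Sum>i=1..n. \<Sum>j=1..n. \<Sum>k=1..n. \<Sum>l=1..n. a i j * a j k * a k l * x k) = (\<Sum>l=1..n. \<Sum>k=1..n. \<Sum>j=1..n. \<Sum>i=1..n. a l k * a k j * a j i * x k)"
      by (subst rev) (intro sum.cong refl, simp add: a_sym mult_ac)
    then show ?thesis using 2 by simp
  qed
  have 4: "(\<Sum>i=1..n. \<Sum>j=1..n. \<Sum>k=1..n. \<Sum>l=1..n. a i j * a j k * a k l * x l) \<le> R ^ 3 * (\<Sum>i=1..n. x i)"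
  proof -
    have "(\<Sum>i=1..n. \<Sum>j=1..n. \<Sum>k=1..n. \<Sum>l=1..n. a i j * a j k * a k l * x l) = (\<Sum>l=1..n. \<Sum>k=1..n. \<Sum>j=1..n. \<Sum>i=1..n. a l k * a k j * a j i * x l)"
      by (subst rev) (intro sum.cong refl, simp add: a_sym mult_ac)
    then show ?thesis using 1 by simp
  qed
  have "(\<Sum>i=1..n. \<Sum>j=1..n. \<Sum>k=1..n. \<Sum>l=1..n. a i j * a j k * a k l * (x i + x j + x k + x l)) =
      (\<Sum>i=1..n. \<Sum>j=1..n. \<Sum>k=1..n. \<Sum>l=1..n. a i j * a j k * a k l * x i) + (\<Sum>i=1..n. \<Sum>j=1..n. \<Sum>k=1..n. \<Sum>l=1..n. a i j * a j k * a k l * x j) +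
      (\<Sum>i=1..n. \<Sum>j=1..n. \<Sum>k=1..n. \<Sum>l=1..n. a i j * a j k * a k l * x k) + (\<Sum>i=1..n. \<Sum>j=1..n. \<Sum>k=1..n. \<Sum>l=1..n. a i j * a j k * a k l * x l)"
    by (simp only: distrib_left sum.distrib)
  then show ?thesis using 1 2 3 4 by linarith
qed

end

lemma mult_le_half_squares: "x * y \<le> (x\<^sup>2 + y\<^sup>2) / 2" for x y :: real
  using sum_squares_bound[of x y] by simp

text \<open>Turns a product over four vertices into masses at single vertices, as the path bounds
  require, with exactly the eighth moments that are available.\<close>

lemma young_four: 
  fixes p q r s :: real
  assumes "0 \<le> p" "0 \<le> q" "0 \<le> r" "0 \<le> s"
  shows "p\<^sup>2 * q\<^sup>2 * r\<^sup>2 * s\<^sup>2 \<le> (p ^ 8 + q ^ 8 + r ^ 8 + s ^ 8) / 4"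
proof -
  have 8: "(x ^ 4)\<^sup>2 = x ^ 8" for x :: real by (simp flip: power_mult)
  have 4: "(x\<^sup>2 * y\<^sup>2)\<^sup>2 = x ^ 4 * y ^ 4" for x y :: real by (simp add: power_mult_distrib flip: power_mult)
  have "(p\<^sup>2 * q\<^sup>2) * (r\<^sup>2 * s\<^sup>2) \<le> (p ^ 4 * q ^ 4 + r ^ 4 * s ^ 4) / 2"
    using mult_le_half_squares[of "p\<^sup>2 * q\<^sup>2" "r\<^sup>2 * s\<^sup>2"] unfolding 4 .
  moreover have "p ^ 4 * q ^ 4 \<le> (p ^ 8 + q ^ 8) / 2" using mult_le_half_squares[of "p ^ 4" "q ^ 4"] unfolding 8 .
  moreover have "r ^ 4 * s ^ 4 \<le> (r ^ 8 + s ^ 8) / 2" using mult_le_half_squares[of "r ^ 4" "s ^ 4"] unfolding 8 .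
  ultimately show ?thesis by (simp add: mult.assoc)
qed

lemma unaffected_mult:
  fixes f g :: "(nat \<Rightarrow> 'h \<times> 'x) \<Rightarrow> real"
  shows "unaffected i f \<Longrightarrow> unaffected i g \<Longrightarrow> unaffected i (\<lambda>\<xi>. f \<xi> * g \<xi>)"
  by (rule unaffected_comp2)

lemma unaffected_inner:
  fixes i j k :: nat
  shows "j \<noteq> i \<Longrightarrow> k \<noteq> i \<Longrightarrow> unaffected i (\<lambda>\<xi> :: nat \<Rightarrow> 'h::real_inner \<times> 'x. fst (\<xi> j) \<bullet> fst (\<xi> k))"
  by (intro unaffected_comp2[where F = inner] unaffected_fst)

text \<open>Kernel weights of a ranking in one fixed direction, reduced to what the moment bounds
  use: entries at most \<kappa> and row sums at most \<open>R\<close>. For the kernel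
  \<open>R\<close> is of order n h, which records that only a fraction h of the pairs
  interacts.\<close>

locale weighted_design = centered_design D
  for D :: "('h::{real_inner, second_countable_topology} \<times> 'x::topological_space) measure" +
  fixes n :: nat and a :: "nat \<Rightarrow> nat \<Rightarrow> (nat \<Rightarrow> 'h \<times> 'x) \<Rightarrow> real" and \<kappa> R :: real
  assumes a_measurable [measurable]: "\<And>i j. a i j \<in> borel_measurable (P n)"
    and a_unaffected: "\<And>i j k. unaffected k (a i j)"
    and a_nonneg: "\<And>i j \<xi>. 0 \<le> a i j \<xi>"
    and a_le: "\<And>i j \<xi>. a i j \<xi> \<le> \<kappa>"
    and a_sym: "\<And>i j \<xi>. a i j \<xi> = a j i \<xi>"
    and a_row: "\<And>i \<xi>. i \<in> {1..n} \<Longrightarrow> (\<Sum>j=1..n. a i j \<xi>) \<le> R"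
    and R_nonneg: "0 \<le> R"
begin

lemma kappa_nonneg: "0 \<le> \<kappa>"
  using a_nonneg[of 0 0] a_le[of 0 0] by (rule order.trans)

lemma weights: "symmetric_weights n (\<lambda>i j. a i j \<xi>) R"
  by unfold_locales (fact a_nonneg a_sym a_row R_nonneg)+

definition g :: "nat \<Rightarrow> nat \<Rightarrow> (nat \<Rightarrow> 'h \<times> 'x) \<Rightarrow> real" where
  "g i j \<xi> = fst (\<xi> i) \<bullet> fst (\<xi> j)"

definition A :: "nat \<Rightarrow> nat \<Rightarrow> (nat \<Rightarrow> 'h \<times> 'x) \<Rightarrow> real" where
  "A i j \<xi> = (if i < j then a i j \<xi> else 0)"

text \<open>The terms of the quadratic form whose larger index is \<open>j\<close>. They are linear
  in the j-th noise with coefficients built from earlier noises; the factor 2 stands for the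
  mirrored pair.\<close>

definition increment :: "nat \<Rightarrow> (nat \<Rightarrow> 'h \<times> 'x) \<Rightarrow> real" where
  "increment j \<xi> = 2 * (\<Sum>i=1..n. A i j \<xi> * g i j \<xi>)"

definition V :: "(nat \<Rightarrow> 'h \<times> 'x) \<Rightarrow> real" where
  "V \<xi> = 4 * (\<Sum>j=1..n. \<Sum>i=1..n. (A i j \<xi> * g i j \<xi>)\<^sup>2)"

definition cross_term :: "nat \<Rightarrow> nat \<Rightarrow> nat \<Rightarrow> (nat \<Rightarrow> 'h \<times> 'x) \<Rightarrow> real" where
  "cross_term i i' j \<xi> = of_bool (i < i') * ((A i j \<xi> * g i j \<xi>) * (A i' j \<xi> * g i' j \<xi>))"

text \<open>The off-diagonal part of the sum of the squared increments, whose diagonal part is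
  \<open>V\<close>. The factor 8 is 2^2 from the increments times 2 for the unordered pairs i <
  i'.\<close>

definition cross :: "(nat \<Rightarrow> 'h \<times> 'x) \<Rightarrow> real" where
  "cross \<xi> = 8 * (\<Sum>j=1..n. \<Sum>i=1..n. \<Sum>i'=1..n. cross_term i i' j \<xi>)"

definition m8 :: real where "m8 = (\<integral>z. norm (fst z) ^ 8 \<partial>D)"

lemma g_measurable [measurable]: "g i j \<in> borel_measurable (P m)"
  unfolding g_def by measurable

lemma A_measurable [measurable]: "A i j \<in> borel_measurable (P n)"
  unfolding A_def by measurable

lemma increment_measurable [measurable]: "increment j \<in> borel_measurable (P n)"
  unfolding increment_def by measurable

lemma V_measurable [measurable]: "V \<in> borel_measurable (P n)"
  unfolding V_def by measurable

lemma cross_term_measurable [measurable]: "cross_term i i' j \<in> borel_measurable (P n)"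
  unfolding cross_term_def by measurable

lemma cross_measurable [measurable]: "cross \<in> borel_measurable (P n)"
  unfolding cross_def by measurable

lemma A_bounds: "0 \<le> A i j \<xi>" "A i j \<xi> \<le> a i j \<xi>" "A i j \<xi> \<le> \<kappa>"
  unfolding A_def using a_nonneg a_le kappa_nonneg by auto

lemma abs_g_le: "\<bar>g i j \<xi>\<bar> \<le> norm (fst (\<xi> i)) * norm (fst (\<xi> j))"
  unfolding g_def by (rule Cauchy_Schwarz_ineq2)

lemma g_sq_le: "(g i j \<xi>)\<^sup>2 \<le> (norm (fst (\<xi> i)))\<^sup>2 * (norm (fst (\<xi> j)))\<^sup>2"
  using power_mono[OF abs_g_le[of i j \<xi>], of 2] by (simp add: power_mult_distrib)

lemma abs_g_le_envelope: "i \<in> {1..n} \<Longrightarrow> j \<in> {1..n} \<Longrightarrow> \<bar>g i j \<xi>\<bar> \<le> envelope n \<xi> ^ 2"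
  unfolding g_def by (rule inner_le_envelope)

lemma abs_Ag_le_envelope:
  assumes "i \<in> {1..n}" "j \<in> {1..n}"
  shows "\<bar>A i j \<xi> * g i j \<xi>\<bar> \<le> \<kappa> * envelope n \<xi> ^ 2"
  unfolding abs_mult using abs_g_le_envelope[OF assms, of \<xi>] A_bounds[of i j \<xi>] by (intro mult_mono) auto

lemma abs_cross_term_le_envelope:
  assumes "i \<in> {1..n}" "i' \<in> {1..n}" "j \<in> {1..n}"
  shows "\<bar>cross_term i i' j \<xi>\<bar> \<le> \<kappa>\<^sup>2 * envelope n \<xi> ^ 4"
proof -
  have "\<bar>cross_term i i' j \<xi>\<bar> \<le> \<bar>A i j \<xi> * g i j \<xi>\<bar> * \<bar>A i' j \<xi> * g i' j \<xi>\<bar>"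
    unfolding cross_term_def abs_mult by (simp add: of_bool_def)
  also have "\<dots> \<le> (\<kappa> * envelope n \<xi> ^ 2) * (\<kappa> * envelope n \<xi> ^ 2)"
    using kappa_nonneg by (intro mult_mono abs_Ag_le_envelope assms) auto
  also have "\<dots> = \<kappa>\<^sup>2 * envelope n \<xi> ^ 4" by (simp add: power2_eq_square power4_eq_xxxx)
  finally show ?thesis .
qed

lemma integrable_cross_term_product:
  assumes "i \<in> {1..n}" "i' \<in> {1..n}" "j \<in> {1..n}" "l \<in> {1..n}" "l' \<in> {1..n}" "k \<in> {1..n}"
  shows "integrable (P n) (\<lambda>\<xi>. cross_term i i' j \<xi> * cross_term l l' k \<xi>)"
proof (rule integrable_envelope_bound[where k = 8 and C = "\<kappa>\<^sup>2 * \<kappa>\<^sup>2"])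
  fix \<xi>
  have "\<bar>cross_term i i' j \<xi> * cross_term l l' k \<xi>\<bar> \<le> (\<kappa>\<^sup>2 * envelope n \<xi> ^ 4) * (\<kappa>\<^sup>2 * envelope n \<xi> ^ 4)"
    unfolding abs_mult by (intro mult_mono abs_cross_term_le_envelope assms) auto
  also have "\<dots> = \<kappa>\<^sup>2 * \<kappa>\<^sup>2 * envelope n \<xi> ^ 8"
    using power_add[of "envelope n \<xi>" 4 4] by (simp add: mult_ac)
  finally show "\<bar>cross_term i i' j \<xi> * cross_term l l' k \<xi>\<bar> \<le> \<kappa>\<^sup>2 * \<kappa>\<^sup>2 * envelope n \<xi> ^ 8" .
qed (intro borel_measurable_times cross_term_measurable, simp)

lemma sum_increment_sq: "(\<Sum>j=1..n. (increment j \<xi>)\<^sup>2) = V \<xi> + cross \<xi>"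
proof -
  have "(increment j \<xi>)\<^sup>2 = 4 * (\<Sum>i=1..n. (A i j \<xi> * g i j \<xi>)\<^sup>2) + 8 * (\<Sum>i=1..n. \<Sum>i'=1..n. cross_term i i' j \<xi>)" for j
    unfolding increment_def power_mult_distrib[of 2] sum_square_expand cross_term_def by simp
  then show ?thesis by (simp add: V_def cross_def sum.distrib sum_distrib_left)
qed

text \<open>Of two distinct pairs, the lexicographically smaller one contains an index that occurs
  nowhere else among the six: it lies below \<open>j\<close>, \<open>k\<close> and the indices of
  the other pair not shared. Integrating its noise gives 0, whatever \<open>j\<close> and
  \<open>k\<close> are.\<close>

lemma cross_term_orthogonal:
  assumes idx: "i \<in> {1..n}" "i' \<in> {1..n}" "j \<in> {1..n}" "l \<in> {1..n}" "l' \<in> {1..n}" "k \<in> {1..n}"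
    and ne: "(i, i') \<noteq> (l, l')"
  shows "(\<integral>\<xi>. cross_term i i' j \<xi> * cross_term l l' k \<xi> \<partial>P n) = 0"
proof -
  have ordered: "(\<integral>\<xi>. cross_term i i' j \<xi> * cross_term l l' k \<xi> \<partial>P n) = 0"
    if idx: "i \<in> {1..n}" "i' \<in> {1..n}" and lex: "i < l \<or> (i = l \<and> i' < l')" for i i' j l l' k
  proof (cases "i < i' \<and> i' < j \<and> l < l' \<and> l' < k")
    case False
    then have z: "cross_term i i' j \<xi> * cross_term l l' k \<xi> = 0" for \<xi> by (auto simp: cross_term_def A_def)
    show ?thesis unfolding z by simp
  next
    case True
    let ?c = "\<lambda>\<xi>. a i j \<xi> * a i' j \<xi> * a l k \<xi> * a l' k \<xi>"
    have eq: "cross_term i i' j \<xi> * cross_term l l' k \<xi> = ?c \<xi> * (g i j \<xi> * g i' j \<xi> * g l k \<xi> * g l' k \<xi>)" for \<xi>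
      using True by (simp add: cross_term_def A_def mult_ac)
    have uc: "unaffected m ?c" for m by (intro unaffected_mult a_unaffected)
    from lex show ?thesis
    proof
      assume "i < l"
      have "(\<integral>\<xi>. (?c \<xi> * (g i' j \<xi> * g l k \<xi> * g l' k \<xi>)) * (fst (\<xi> i) \<bullet> fst (\<xi> j)) \<partial>P n) = 0"
      proof (rule zero_mean_term)
        show "unaffected i (\<lambda>\<xi>. ?c \<xi> * (g i' j \<xi> * g l k \<xi> * g l' k \<xi>))"
          unfolding g_def by (rule unaffected_mult[OF uc], intro unaffected_mult unaffected_inner) (use True \<open>i < l\<close> in auto)
      qed (use idx True in \<open>auto intro!: borel_measurable_times a_measurable g_measurable\<close>)
      then show ?thesis unfolding eq by (simp add: g_def mult_ac)
    next
      assume il: "i = l \<and> i' < l'"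
      have "(\<integral>\<xi>. (?c \<xi> * (g i j \<xi> * g l k \<xi> * g l' k \<xi>)) * (fst (\<xi> i') \<bullet> fst (\<xi> j)) \<partial>P n) = 0"
      proof (rule zero_mean_term)
        show "unaffected i' (\<lambda>\<xi>. ?c \<xi> * (g i j \<xi> * g l k \<xi> * g l' k \<xi>))"
          unfolding g_def by (rule unaffected_mult[OF uc], intro unaffected_mult unaffected_inner) (use True il in auto)
      qed (use idx True in \<open>auto intro!: borel_measurable_times a_measurable g_measurable\<close>)
      then show ?thesis unfolding eq by (simp add: g_def mult_ac)
    qed
  qed
  consider "i < l \<or> (i = l \<and> i' < l')" | "l < i \<or> (l = i \<and> l' < i')" using ne by force
  then show ?thesis
  proof cases
    case 1 then show ?thesis by (rule ordered[OF idx(1,2)])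
  next
    case 2 from ordered[OF idx(4,5) this, of k j] show ?thesis by (simp add: mult.commute)
  qed
qed

lemma expectation_sum_norm8: "(\<integral>\<xi>. (\<Sum>i=1..n. norm (fst (\<xi> i)) ^ 8) \<partial>P n) = real n * m8"
  "integrable (P n) (\<lambda>\<xi>. \<Sum>i=1..n. norm (fst (\<xi> i)) ^ 8)"
proof -
  have m: "(\<lambda>z. norm (fst z) ^ 8) \<in> borel_measurable D" by measurable
  have i: "integrable (P n) (\<lambda>\<xi>. norm (fst (\<xi> i)) ^ 8)" "(\<integral>\<xi>. norm (fst (\<xi> i)) ^ 8 \<partial>P n) = m8" if "i \<in> {1..n}" for i
    unfolding m8_def by (rule integral_component(2)[OF that m moment8], rule integral_component(1)[OF that m])
  show "(\<integral>\<xi>. (\<Sum>i=1..n. norm (fst (\<xi> i)) ^ 8) \<partial>P n) = real n * m8"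
  proof -
    have "(\<integral>\<xi>. (\<Sum>i=1..n. norm (fst (\<xi> i)) ^ 8) \<partial>P n) = (\<Sum>i=1..n. \<integral>\<xi>. norm (fst (\<xi> i)) ^ 8 \<partial>P n)"
      by (rule Bochner_Integration.integral_sum) (rule i(1))
    also have "\<dots> = (\<Sum>i=1..n. m8)" by (rule sum.cong[OF refl]) (rule i(2))
    finally show ?thesis by simp
  qed
  show "integrable (P n) (\<lambda>\<xi>. \<Sum>i=1..n. norm (fst (\<xi> i)) ^ 8)"
    by (rule Bochner_Integration.integrable_sum) (rule i(1))
qed

text \<open>The sums over \<open>j\<close> and over pairs \<open>i < i'\<close> are interchanged: distinct pairs are orthogonal, which leaves
  a sum over paths of length three in the weights.\<close>

lemma expectation_cross_sq_le:
  "integrable (P n) (\<lambda>\<xi>. (cross \<xi>)\<^sup>2)" "(\<integral>\<xi>. (cross \<xi>)\<^sup>2 \<partial>P n) \<le> 64 * \<kappa> * R ^ 3 * (real n * m8)"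
proof -
  let ?I = "{1..n} \<times> {1..n}"
  define Z where "Z p \<xi> = (\<Sum>j=1..n. cross_term (fst p) (snd p) j \<xi>)" for p \<xi>
  have cross: "cross \<xi> = 8 * (\<Sum>p\<in>?I. Z p \<xi>)" for \<xi>
  proof -
    have "(\<Sum>j=1..n. \<Sum>i=1..n. \<Sum>i'=1..n. cross_term i i' j \<xi>) = (\<Sum>i=1..n. \<Sum>i'=1..n. \<Sum>j=1..n. cross_term i i' j \<xi>)"
      by (rule sum_swap_triple[symmetric])
    also have "\<dots> = (\<Sum>p\<in>?I. Z p \<xi>)" unfolding Z_def by (rule sum_pairs[symmetric])
    finally show ?thesis by (simp add: cross_def)
  qed
  have int: "integrable (P n) (\<lambda>\<xi>. Z p \<xi> * Z q \<xi>)" if "p \<in> ?I" "q \<in> ?I" for p q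
    unfolding Z_def sum_product using that
    by (intro Bochner_Integration.integrable_sum integrable_cross_term_product) auto
  have orth: "(\<integral>\<xi>. Z p \<xi> * Z q \<xi> \<partial>P n) = 0" if pq: "p \<in> ?I" "q \<in> ?I" "p \<noteq> q" for p q
  proof -
    have ct: "integrable (P n) (\<lambda>\<xi>. cross_term (fst p) (snd p) j \<xi> * cross_term (fst q) (snd q) k \<xi>)"
      if "j \<in> {1..n}" "k \<in> {1..n}" for j k using pq that by (intro integrable_cross_term_product) auto
    have "(\<integral>\<xi>. Z p \<xi> * Z q \<xi> \<partial>P n) = (\<Sum>j=1..n. \<Sum>k=1..n. \<integral>\<xi>. cross_term (fst p) (snd p) j \<xi> * cross_term (fst q) (snd q) k \<xi> \<partial>P n)"
      unfolding Z_def sum_product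
      by (rule integral_sum_sum) (rule ct)
    also have "\<dots> = 0"
      using pq by (intro sum.neutral ballI cross_term_orthogonal) (auto simp: prod_eq_iff)
    finally show ?thesis .
  qed
  have sq: "(cross \<xi>)\<^sup>2 = 64 * (\<Sum>p\<in>?I. \<Sum>q\<in>?I. Z p \<xi> * Z q \<xi>)" for \<xi>
    unfolding cross power_mult_distrib by (simp only: power2_eq_square sum_product)
  show "integrable (P n) (\<lambda>\<xi>. (cross \<xi>)\<^sup>2)"
    unfolding sq by (intro integrable_mult_right Bochner_Integration.integrable_sum int)
  have "(\<integral>\<xi>. (cross \<xi>)\<^sup>2 \<partial>P n) = 64 * (\<Sum>p\<in>?I. \<Sum>q\<in>?I. \<integral>\<xi>. Z p \<xi> * Z q \<xi> \<partial>P n)"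
    unfolding sq integral_mult_right_zero
    by (subst integral_sum_sum) (rule int, assumption, assumption, rule refl)
  also have "(\<Sum>p\<in>?I. \<Sum>q\<in>?I. \<integral>\<xi>. Z p \<xi> * Z q \<xi> \<partial>P n) = (\<Sum>p\<in>?I. \<integral>\<xi>. (Z p \<xi>)\<^sup>2 \<partial>P n)"
  proof (rule sum.cong[OF refl])
    fix p assume p: "p \<in> ?I"
    have "(\<Sum>q\<in>?I. \<integral>\<xi>. Z p \<xi> * Z q \<xi> \<partial>P n) = (\<Sum>q\<in>{p}. \<integral>\<xi>. Z p \<xi> * Z q \<xi> \<partial>P n)"
      using p by (intro sum.mono_neutral_right) (auto intro!: orth)
    then show "(\<Sum>q\<in>?I. \<integral>\<xi>. Z p \<xi> * Z q \<xi> \<partial>P n) = (\<integral>\<xi>. (Z p \<xi>)\<^sup>2 \<partial>P n)" by (simp add: power2_eq_square)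
  qed
  also have "\<dots> = (\<integral>\<xi>. (\<Sum>p\<in>?I. (Z p \<xi>)\<^sup>2) \<partial>P n)"
    by (rule Bochner_Integration.integral_sum[symmetric]) (simp add: power2_eq_square int)
  also have "\<dots> \<le> (\<integral>\<xi>. \<kappa> * R ^ 3 * (\<Sum>i=1..n. norm (fst (\<xi> i)) ^ 8) \<partial>P n)"
  proof (rule integral_mono)
    show "integrable (P n) (\<lambda>\<xi>. \<Sum>p\<in>?I. (Z p \<xi>)\<^sup>2)"
      by (intro Bochner_Integration.integrable_sum) (simp add: power2_eq_square int)
    show "integrable (P n) (\<lambda>\<xi>. \<kappa> * R ^ 3 * (\<Sum>i=1..n. norm (fst (\<xi> i)) ^ 8))"
      by (intro integrable_mult_right expectation_sum_norm8)
    fix \<xi>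
    interpret S: symmetric_weights n "\<lambda>i j. a i j \<xi>" R by (rule weights)
    define x where "x i = norm (fst (\<xi> i))" for i
    have x0: "0 \<le> x i" for i unfolding x_def by simp
    have ct: "\<bar>cross_term i i' j \<xi>\<bar> \<le> a i j \<xi> * a i' j \<xi> * (x i * x i' * (x j)\<^sup>2)" for i i' j
    proof -
      have "\<bar>cross_term i i' j \<xi>\<bar> \<le> (A i j \<xi> * \<bar>g i j \<xi>\<bar>) * (A i' j \<xi> * \<bar>g i' j \<xi>\<bar>)"
        using A_bounds(1)[of i j \<xi>] A_bounds(1)[of i' j \<xi>] by (simp add: cross_term_def abs_mult of_bool_def)
      also have "\<dots> \<le> (a i j \<xi> * (x i * x j)) * (a i' j \<xi> * (x i' * x j))"
        unfolding x_def by (intro mult_mono A_bounds abs_g_le mult_nonneg_nonneg a_nonneg norm_ge_zero) auto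
      finally show ?thesis by (simp add: power2_eq_square mult_ac)
    qed
    have "(Z p \<xi>)\<^sup>2 \<le> (\<Sum>j=1..n. \<Sum>k=1..n. \<kappa> * (a (snd p) j \<xi> * a j (fst p) \<xi> * a (fst p) k \<xi> * (x (snd p) ^ 8 + x j ^ 8 + x (fst p) ^ 8 + x k ^ 8) / 4))" for p
    proof -
      have "(Z p \<xi>)\<^sup>2 = (\<Sum>j=1..n. \<Sum>k=1..n. cross_term (fst p) (snd p) j \<xi> * cross_term (fst p) (snd p) k \<xi>)"
        by (simp only: Z_def power2_eq_square sum_product)
      also have "\<dots> \<le> (\<Sum>j=1..n. \<Sum>k=1..n. \<kappa> * (a (snd p) j \<xi> * a j (fst p) \<xi> * a (fst p) k \<xi> * (x (snd p) ^ 8 + x j ^ 8 + x (fst p) ^ 8 + x k ^ 8) / 4))"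
      proof (intro sum_mono)
        fix j k
        let ?i = "fst p" and ?i' = "snd p"
        have "cross_term ?i ?i' j \<xi> * cross_term ?i ?i' k \<xi> \<le> \<bar>cross_term ?i ?i' j \<xi>\<bar> * \<bar>cross_term ?i ?i' k \<xi>\<bar>"
          by (metis abs_ge_self abs_mult)
        also have "\<dots> \<le> (a ?i j \<xi> * a ?i' j \<xi> * (x ?i * x ?i' * (x j)\<^sup>2)) * (a ?i k \<xi> * a ?i' k \<xi> * (x ?i * x ?i' * (x k)\<^sup>2))"
          using x0 by (intro mult_mono ct mult_nonneg_nonneg a_nonneg) auto
        \<comment> \<open>The weights form the 4-cycle i, j, i', k. Bounding the edge i'k by
          \<kappa> leaves the path i', j, i, k of three edges.\<close>
        also have "\<dots> = a ?i' k \<xi> * (a ?i' j \<xi> * a j ?i \<xi> * a ?i k \<xi> * ((x ?i')\<^sup>2 * (x j)\<^sup>2 * (x ?i)\<^sup>2 * (x k)\<^sup>2))"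
          using a_sym[of ?i j \<xi>] by (simp add: power2_eq_square mult_ac)
        also have "\<dots> \<le> \<kappa> * (a ?i' j \<xi> * a j ?i \<xi> * a ?i k \<xi> * ((x ?i' ^ 8 + x j ^ 8 + x ?i ^ 8 + x k ^ 8) / 4))"
          using x0 kappa_nonneg by (intro mult_mono a_le mult_left_mono young_four mult_nonneg_nonneg a_nonneg) auto
        finally show "cross_term ?i ?i' j \<xi> * cross_term ?i ?i' k \<xi> \<le> \<kappa> * (a ?i' j \<xi> * a j ?i \<xi> * a ?i k \<xi> * (x ?i' ^ 8 + x j ^ 8 + x ?i ^ 8 + x k ^ 8) / 4)"
          by simp
      qed
      finally show ?thesis .
    qed
    then have "(\<Sum>p\<in>?I. (Z p \<xi>)\<^sup>2) \<le> (\<Sum>p\<in>?I. \<Sum>j=1..n. \<Sum>k=1..n. \<kappa> * (a (snd p) j \<xi> * a j (fst p) \<xi> * a (fst p) k \<xi> * (x (snd p) ^ 8 + x j ^ 8 + x (fst p) ^ 8 + x k ^ 8) / 4))"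
      by (rule sum_mono)
    also have "\<dots> = (\<Sum>i=1..n. \<Sum>i'=1..n. \<Sum>j=1..n. \<Sum>k=1..n. \<kappa> * (a i' j \<xi> * a j i \<xi> * a i k \<xi> * (x i' ^ 8 + x j ^ 8 + x i ^ 8 + x k ^ 8) / 4))"
      by (rule sum_pairs)
    also have "\<dots> = (\<Sum>i'=1..n. \<Sum>j=1..n. \<Sum>i=1..n. \<Sum>k=1..n. \<kappa> * (a i' j \<xi> * a j i \<xi> * a i k \<xi> * (x i' ^ 8 + x j ^ 8 + x i ^ 8 + x k ^ 8) / 4))"
      by (subst sum.swap) (intro sum.cong refl sum.swap)
    also have "\<dots> = \<kappa> / 4 * (\<Sum>i'=1..n. \<Sum>j=1..n. \<Sum>i=1..n. \<Sum>k=1..n. a i' j \<xi> * a j i \<xi> * a i k \<xi> * (x i' ^ 8 + x j ^ 8 + x i ^ 8 + x k ^ 8))"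
      unfolding sum_distrib_left by (intro sum.cong refl) simp
    also have "\<dots> \<le> \<kappa> / 4 * (4 * R ^ 3 * (\<Sum>i=1..n. x i ^ 8))"
      using kappa_nonneg x0 by (intro mult_left_mono S.path4_le) auto
    finally show "(\<Sum>p\<in>?I. (Z p \<xi>)\<^sup>2) \<le> \<kappa> * R ^ 3 * (\<Sum>i=1..n. norm (fst (\<xi> i)) ^ 8)"
      unfolding x_def by simp
  qed
  also have "\<dots> = \<kappa> * R ^ 3 * (real n * m8)" by (simp only: integral_mult_right_zero expectation_sum_norm8)
  finally show "(\<integral>\<xi>. (cross \<xi>)\<^sup>2 \<partial>P n) \<le> 64 * \<kappa> * R ^ 3 * (real n * m8)" by simp
qed

end

lemma expectation_square_orthogonal_sum:
  fixes Z :: "'i \<Rightarrow> 'a \<Rightarrow> real"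
  assumes S: "finite S" and int: "\<And>p q. p \<in> S \<Longrightarrow> q \<in> S \<Longrightarrow> integrable M (\<lambda>x. Z p x * Z q x)"
    and orth: "\<And>p q. p \<in> S \<Longrightarrow> q \<in> S \<Longrightarrow> p \<noteq> q \<Longrightarrow> (\<integral>x. Z p x * Z q x \<partial>M) = 0"
  shows "integrable M (\<lambda>x. (\<Sum>p\<in>S. Z p x)\<^sup>2)"
    and "(\<integral>x. (\<Sum>p\<in>S. Z p x)\<^sup>2 \<partial>M) = (\<integral>x. (\<Sum>p\<in>S. (Z p x)\<^sup>2) \<partial>M)"
proof -
  have sq: "(\<Sum>p\<in>S. Z p x)\<^sup>2 = (\<Sum>p\<in>S. \<Sum>q\<in>S. Z p x * Z q x)" for x
    by (simp only: power2_eq_square sum_product)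
  show "integrable M (\<lambda>x. (\<Sum>p\<in>S. Z p x)\<^sup>2)"
    unfolding sq by (intro Bochner_Integration.integrable_sum int)
  have "(\<integral>x. (\<Sum>p\<in>S. Z p x)\<^sup>2 \<partial>M) = (\<Sum>p\<in>S. \<Sum>q\<in>S. \<integral>x. Z p x * Z q x \<partial>M)"
    unfolding sq by (rule integral_sum_sum) (rule int)
  also have "\<dots> = (\<Sum>p\<in>S. \<integral>x. (Z p x)\<^sup>2 \<partial>M)"
  proof (rule sum.cong[OF refl])
    fix p assume p: "p \<in> S"
    have "(\<Sum>q\<in>S. \<integral>x. Z p x * Z q x \<partial>M) = (\<Sum>q\<in>{p}. \<integral>x. Z p x * Z q x \<partial>M)"
      using p S by (intro sum.mono_neutral_right) (auto intro!: orth)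
    then show "(\<Sum>q\<in>S. \<integral>x. Z p x * Z q x \<partial>M) = (\<integral>x. (Z p x)\<^sup>2 \<partial>M)" by (simp add: power2_eq_square)
  qed
  also have "\<dots> = (\<integral>x. (\<Sum>p\<in>S. (Z p x)\<^sup>2) \<partial>M)"
    by (rule Bochner_Integration.integral_sum[symmetric]) (simp add: power2_eq_square int)
  finally show "(\<integral>x. (\<Sum>p\<in>S. Z p x)\<^sup>2 \<partial>M) = (\<integral>x. (\<Sum>p\<in>S. (Z p x)\<^sup>2) \<partial>M)" .
qed

lemma integrable_mult_of_squares:
  fixes f g :: "'a \<Rightarrow> real"
  assumes "f \<in> borel_measurable M" "g \<in> borel_measurable M" "integrable M (\<lambda>x. (f x)\<^sup>2)" "integrable M (\<lambda>x. (g x)\<^sup>2)"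
  shows "integrable M (\<lambda>x. f x * g x)"
proof (rule Bochner_Integration.integrable_bound)
  show "integrable M (\<lambda>x. ((f x)\<^sup>2 + (g x)\<^sup>2) / 2)" using assms by (intro integrable_divide Bochner_Integration.integrable_add)
  show "(\<lambda>x. f x * g x) \<in> borel_measurable M" using assms(1,2) by (rule borel_measurable_times)
  have "\<bar>f x * g x\<bar> \<le> ((f x)\<^sup>2 + (g x)\<^sup>2) / 2" for x
    using mult_le_half_squares[of "\<bar>f x\<bar>" "\<bar>g x\<bar>"] by (simp add: abs_mult)
  then show "AE x in M. norm (f x * g x) \<le> norm (((f x)\<^sup>2 + (g x)\<^sup>2) / 2)" by (intro AE_I2) simp
qed

section \<open>Moments of the increments and of their sum\<close>

context weighted_design
begin

definition V_col :: "nat \<Rightarrow> (nat \<Rightarrow> 'h \<times> 'x) \<Rightarrow> real" where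
  "V_col j \<xi> = (\<Sum>i=1..n. (A i j \<xi> * g i j \<xi>)\<^sup>2)"

definition cross_col :: "nat \<Rightarrow> (nat \<Rightarrow> 'h \<times> 'x) \<Rightarrow> real" where
  "cross_col j \<xi> = (\<Sum>p\<in>{1..n} \<times> {1..n}. cross_term (fst p) (snd p) j \<xi>)"

lemma V_col_measurable [measurable]: "V_col j \<in> borel_measurable (P n)"
  unfolding V_col_def by measurable

lemma increment_sq: "(increment j \<xi>)\<^sup>2 = 4 * V_col j \<xi> + 8 * cross_col j \<xi>"
proof -
  have "cross_col j \<xi> = (\<Sum>i=1..n. \<Sum>i'=1..n. cross_term i i' j \<xi>)" unfolding cross_col_def by (rule sum_pairs)
  then show ?thesis
    unfolding increment_def power_mult_distrib[of 2] sum_square_expand cross_term_def V_col_def by simp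
qed

lemma V_col_nonneg: "0 \<le> V_col j \<xi>"
  unfolding V_col_def by (intro sum_nonneg) simp

lemma V_col_le_envelope:
  assumes "j \<in> {1..n}" shows "V_col j \<xi> \<le> real n * \<kappa>\<^sup>2 * envelope n \<xi> ^ 4"
proof -
  have "V_col j \<xi> \<le> (\<Sum>i=1..n. \<kappa>\<^sup>2 * envelope n \<xi> ^ 4)"
    unfolding V_col_def
  proof (rule sum_mono)
    fix i assume "i \<in> {1..n}"
    then have "\<bar>A i j \<xi> * g i j \<xi>\<bar>\<^sup>2 \<le> (\<kappa> * envelope n \<xi> ^ 2)\<^sup>2" using assms by (intro power_mono abs_Ag_le_envelope) auto
    then show "(A i j \<xi> * g i j \<xi>)\<^sup>2 \<le> \<kappa>\<^sup>2 * envelope n \<xi> ^ 4" by (simp add: power_mult_distrib flip: power_mult)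
  qed
  then show ?thesis by simp
qed

lemma integrable_V_col_sq:
  assumes j: "j \<in> {1..n}" shows "integrable (P n) (\<lambda>\<xi>. (V_col j \<xi>)\<^sup>2)"
proof (rule integrable_envelope_bound[where k = 8 and C = "(real n * \<kappa>\<^sup>2)\<^sup>2"])
  fix \<xi>
  have "(V_col j \<xi>)\<^sup>2 \<le> (real n * \<kappa>\<^sup>2 * envelope n \<xi> ^ 4)\<^sup>2" using j by (intro power_mono V_col_le_envelope V_col_nonneg)
  then show "\<bar>(V_col j \<xi>)\<^sup>2\<bar> \<le> (real n * \<kappa>\<^sup>2)\<^sup>2 * envelope n \<xi> ^ 8" by (simp add: power_mult_distrib flip: power_mult)
qed (intro borel_measurable_power V_col_measurable, simp)

text \<open>The squared increment is 4 \<open>V_col\<close> + 8 \<open>cross_col\<close>. Distinct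
  terms of \<open>cross_col\<close> are orthogonal, so its second moment is at most that of
  \<open>V_col\<close>. Squaring gives 32 + 128 = 160.\<close>

lemma expectation_increment4_le:
  assumes j: "j \<in> {1..n}"
  shows "integrable (P n) (\<lambda>\<xi>. increment j \<xi> ^ 4)"
    and "(\<integral>\<xi>. increment j \<xi> ^ 4 \<partial>P n) \<le> 160 * (\<integral>\<xi>. (V_col j \<xi>)\<^sup>2 \<partial>P n)"
proof -
  let ?I = "{1..n} \<times> {1..n}"
  let ?Z = "\<lambda>p \<xi>. cross_term (fst p) (snd p) j \<xi>"
  have int: "integrable (P n) (\<lambda>\<xi>. ?Z p \<xi> * ?Z q \<xi>)" if "p \<in> ?I" "q \<in> ?I" for p q
    using that j by (intro integrable_cross_term_product) auto
  have orth: "(\<integral>\<xi>. ?Z p \<xi> * ?Z q \<xi> \<partial>P n) = 0" if "p \<in> ?I" "q \<in> ?I" "p \<noteq> q" for p q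
    using that j by (intro cross_term_orthogonal) (auto simp: prod_eq_iff)
  have fin: "finite ?I" by simp
  have icc: "integrable (P n) (\<lambda>\<xi>. (cross_col j \<xi>)\<^sup>2)"
    unfolding cross_col_def by (rule expectation_square_orthogonal_sum(1)[OF fin int orth])
  have "(\<integral>\<xi>. (cross_col j \<xi>)\<^sup>2 \<partial>P n) = (\<integral>\<xi>. (\<Sum>p\<in>?I. (?Z p \<xi>)\<^sup>2) \<partial>P n)"
    unfolding cross_col_def by (rule expectation_square_orthogonal_sum(2)[OF fin int orth])
  also have "\<dots> \<le> (\<integral>\<xi>. (V_col j \<xi>)\<^sup>2 \<partial>P n)"
  proof (rule integral_mono)
    show "integrable (P n) (\<lambda>\<xi>. \<Sum>p\<in>?I. (?Z p \<xi>)\<^sup>2)"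
      unfolding power2_eq_square by (intro Bochner_Integration.integrable_sum int)
    fix \<xi>
    have "(\<Sum>p\<in>?I. (?Z p \<xi>)\<^sup>2) \<le> (\<Sum>p\<in>?I. (A (fst p) j \<xi> * g (fst p) j \<xi>)\<^sup>2 * (A (snd p) j \<xi> * g (snd p) j \<xi>)\<^sup>2)"
      by (intro sum_mono) (simp add: cross_term_def of_bool_def power_mult_distrib)
    also have "\<dots> = (\<Sum>i=1..n. \<Sum>i'=1..n. (A i j \<xi> * g i j \<xi>)\<^sup>2 * (A i' j \<xi> * g i' j \<xi>)\<^sup>2)" by (rule sum_pairs)
    also have "\<dots> = (V_col j \<xi>)\<^sup>2" unfolding V_col_def power2_eq_square[of "sum _ _"] sum_product ..
    finally show "(\<Sum>p\<in>?I. (?Z p \<xi>)\<^sup>2) \<le> (V_col j \<xi>)\<^sup>2" .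
  qed (rule integrable_V_col_sq[OF j])
  finally have cc: "(\<integral>\<xi>. (cross_col j \<xi>)\<^sup>2 \<partial>P n) \<le> (\<integral>\<xi>. (V_col j \<xi>)\<^sup>2 \<partial>P n)" .
  have pt: "increment j \<xi> ^ 4 \<le> 32 * (V_col j \<xi>)\<^sup>2 + 128 * (cross_col j \<xi>)\<^sup>2" for \<xi>
  proof -
    have "increment j \<xi> ^ 4 = ((increment j \<xi>)\<^sup>2)\<^sup>2" by (simp flip: power_mult)
    also have "\<dots> = (4 * V_col j \<xi> + 8 * cross_col j \<xi>)\<^sup>2" unfolding increment_sq ..
    also have "\<dots> \<le> 2 * (4 * V_col j \<xi>)\<^sup>2 + 2 * (8 * cross_col j \<xi>)\<^sup>2"
      using sum_squares_bound[of "4 * V_col j \<xi>" "8 * cross_col j \<xi>"] by (simp add: power2_sum)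
    also have "\<dots> = 32 * (V_col j \<xi>)\<^sup>2 + 128 * (cross_col j \<xi>)\<^sup>2" by (simp add: power_mult_distrib)
    finally show ?thesis .
  qed
  have ib: "integrable (P n) (\<lambda>\<xi>. 32 * (V_col j \<xi>)\<^sup>2 + 128 * (cross_col j \<xi>)\<^sup>2)"
    by (intro Bochner_Integration.integrable_add integrable_mult_right icc integrable_V_col_sq j)
  show i4: "integrable (P n) (\<lambda>\<xi>. increment j \<xi> ^ 4)"
  proof (rule Bochner_Integration.integrable_bound[OF ib])
    show "AE \<xi> in P n. norm (increment j \<xi> ^ 4) \<le> norm (32 * (V_col j \<xi>)\<^sup>2 + 128 * (cross_col j \<xi>)\<^sup>2)"
      using pt by (intro AE_I2) simp
  qed (intro borel_measurable_power increment_measurable)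
  have "(\<integral>\<xi>. increment j \<xi> ^ 4 \<partial>P n) \<le> (\<integral>\<xi>. 32 * (V_col j \<xi>)\<^sup>2 + 128 * (cross_col j \<xi>)\<^sup>2 \<partial>P n)"
    by (intro integral_mono i4 ib pt)
  also have "\<dots> = 32 * (\<integral>\<xi>. (V_col j \<xi>)\<^sup>2 \<partial>P n) + 128 * (\<integral>\<xi>. (cross_col j \<xi>)\<^sup>2 \<partial>P n)"
    by (subst Bochner_Integration.integral_add) (intro integrable_mult_right icc integrable_V_col_sq j, simp)+
  finally show "(\<integral>\<xi>. increment j \<xi> ^ 4 \<partial>P n) \<le> 160 * (\<integral>\<xi>. (V_col j \<xi>)\<^sup>2 \<partial>P n)" using cc by linarith
qed

text \<open>The Lyapunov bound. In the square of \<open>V_col\<close> each squared weight is at most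
  \<kappa> times the weight, which leaves paths i, j, i' of two edges.\<close>

lemma sum_expectation_increment4_le:
  "(\<Sum>j=1..n. \<integral>\<xi>. increment j \<xi> ^ 4 \<partial>P n) \<le> 160 * \<kappa>\<^sup>2 * R\<^sup>2 * (real n * m8)"
proof -
  have "(\<Sum>j=1..n. \<integral>\<xi>. increment j \<xi> ^ 4 \<partial>P n) \<le> (\<Sum>j=1..n. 160 * (\<integral>\<xi>. (V_col j \<xi>)\<^sup>2 \<partial>P n))"
    by (intro sum_mono expectation_increment4_le)
  also have "\<dots> = 160 * (\<Sum>j=1..n. \<integral>\<xi>. (V_col j \<xi>)\<^sup>2 \<partial>P n)" by (simp only: sum_distrib_left)
  also have "(\<Sum>j=1..n. \<integral>\<xi>. (V_col j \<xi>)\<^sup>2 \<partial>P n) = (\<integral>\<xi>. (\<Sum>j=1..n. (V_col j \<xi>)\<^sup>2) \<partial>P n)"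
    by (rule Bochner_Integration.integral_sum[symmetric]) (rule integrable_V_col_sq)
  also have "\<dots> \<le> (\<integral>\<xi>. \<kappa>\<^sup>2 * R\<^sup>2 * (\<Sum>i=1..n. norm (fst (\<xi> i)) ^ 8) \<partial>P n)"
  proof (rule integral_mono)
    show "integrable (P n) (\<lambda>\<xi>. \<Sum>j=1..n. (V_col j \<xi>)\<^sup>2)" by (intro Bochner_Integration.integrable_sum integrable_V_col_sq)
    show "integrable (P n) (\<lambda>\<xi>. \<kappa>\<^sup>2 * R\<^sup>2 * (\<Sum>i=1..n. norm (fst (\<xi> i)) ^ 8))"
      by (intro integrable_mult_right expectation_sum_norm8)
    fix \<xi>
    interpret S: symmetric_weights n "\<lambda>i j. a i j \<xi>" R by (rule weights)
    define x where "x i = norm (fst (\<xi> i))" for i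
    have x0: "0 \<le> x i" for i unfolding x_def by simp
    have Ag: "(A i j \<xi> * g i j \<xi>)\<^sup>2 \<le> \<kappa> * a i j \<xi> * ((x i)\<^sup>2 * (x j)\<^sup>2)" for i j
    proof -
      have "(A i j \<xi> * g i j \<xi>)\<^sup>2 = (A i j \<xi> * A i j \<xi>) * (g i j \<xi>)\<^sup>2" by (simp add: power2_eq_square mult_ac)
      also have "\<dots> \<le> (\<kappa> * a i j \<xi>) * ((x i)\<^sup>2 * (x j)\<^sup>2)"
        unfolding x_def using kappa_nonneg by (intro mult_mono g_sq_le A_bounds mult_nonneg_nonneg a_nonneg) auto
      finally show ?thesis .
    qed
    have "(V_col j \<xi>)\<^sup>2 \<le> (\<Sum>i=1..n. \<Sum>i'=1..n. \<kappa>\<^sup>2 / 4 * (a i j \<xi> * a j i' \<xi> * (x i ^ 8 + x i' ^ 8 + x j ^ 8 + x j ^ 8)))" for j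
    proof -
      have "(V_col j \<xi>)\<^sup>2 = (\<Sum>i=1..n. \<Sum>i'=1..n. (A i j \<xi> * g i j \<xi>)\<^sup>2 * (A i' j \<xi> * g i' j \<xi>)\<^sup>2)"
        unfolding V_col_def power2_eq_square[of "sum _ _"] sum_product ..
      also have "\<dots> \<le> (\<Sum>i=1..n. \<Sum>i'=1..n. \<kappa>\<^sup>2 / 4 * (a i j \<xi> * a j i' \<xi> * (x i ^ 8 + x i' ^ 8 + x j ^ 8 + x j ^ 8)))"
      proof (intro sum_mono)
        fix i i'
        have "(A i j \<xi> * g i j \<xi>)\<^sup>2 * (A i' j \<xi> * g i' j \<xi>)\<^sup>2 \<le> (\<kappa> * a i j \<xi> * ((x i)\<^sup>2 * (x j)\<^sup>2)) * (\<kappa> * a i' j \<xi> * ((x i')\<^sup>2 * (x j)\<^sup>2))"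
          using kappa_nonneg by (intro mult_mono Ag mult_nonneg_nonneg a_nonneg) auto
        also have "\<dots> = \<kappa>\<^sup>2 * (a i j \<xi> * a j i' \<xi>) * ((x i)\<^sup>2 * (x i')\<^sup>2 * (x j)\<^sup>2 * (x j)\<^sup>2)"
          using a_sym[of i' j \<xi>] by (simp add: power2_eq_square mult_ac)
        also have "\<dots> \<le> \<kappa>\<^sup>2 * (a i j \<xi> * a j i' \<xi>) * ((x i ^ 8 + x i' ^ 8 + x j ^ 8 + x j ^ 8) / 4)"
          using x0 by (intro mult_left_mono young_four mult_nonneg_nonneg a_nonneg) auto
        finally show "(A i j \<xi> * g i j \<xi>)\<^sup>2 * (A i' j \<xi> * g i' j \<xi>)\<^sup>2 \<le> \<kappa>\<^sup>2 / 4 * (a i j \<xi> * a j i' \<xi> * (x i ^ 8 + x i' ^ 8 + x j ^ 8 + x j ^ 8))"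
          by simp
      qed
      finally show ?thesis .
    qed
    then have "(\<Sum>j=1..n. (V_col j \<xi>)\<^sup>2) \<le> (\<Sum>j=1..n. \<Sum>i=1..n. \<Sum>i'=1..n. \<kappa>\<^sup>2 / 4 * (a i j \<xi> * a j i' \<xi> * (x i ^ 8 + x i' ^ 8 + x j ^ 8 + x j ^ 8)))"
      by (rule sum_mono)
    also have "\<dots> = (\<Sum>i=1..n. \<Sum>j=1..n. \<Sum>i'=1..n. \<kappa>\<^sup>2 / 4 * (a i j \<xi> * a j i' \<xi> * (x i ^ 8 + x i' ^ 8 + x j ^ 8 + x j ^ 8)))"
      by (rule sum.swap)
    also have "\<dots> = \<kappa>\<^sup>2 / 4 * ((\<Sum>i=1..n. \<Sum>j=1..n. \<Sum>k=1..n. a i j \<xi> * a j k \<xi> * x i ^ 8) + (\<Sum>i=1..n. \<Sum>j=1..n. \<Sum>k=1..n. a i j \<xi> * a j k \<xi> * x k ^ 8) +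
        (\<Sum>i=1..n. \<Sum>j=1..n. \<Sum>k=1..n. a i j \<xi> * a j k \<xi> * x j ^ 8) + (\<Sum>i=1..n. \<Sum>j=1..n. \<Sum>k=1..n. a i j \<xi> * a j k \<xi> * x j ^ 8))"
      by (simp only: sum_distrib_left distrib_left sum.distrib)
    also have "\<dots> \<le> \<kappa>\<^sup>2 / 4 * (R\<^sup>2 * (\<Sum>i=1..n. x i ^ 8) + R\<^sup>2 * (\<Sum>i=1..n. x i ^ 8) + R\<^sup>2 * (\<Sum>i=1..n. x i ^ 8) + R\<^sup>2 * (\<Sum>i=1..n. x i ^ 8))"
      using x0 by (intro mult_left_mono add_mono S.path3_le) auto
    finally show "(\<Sum>j=1..n. (V_col j \<xi>)\<^sup>2) \<le> \<kappa>\<^sup>2 * R\<^sup>2 * (\<Sum>i=1..n. norm (fst (\<xi> i)) ^ 8)"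
      unfolding x_def by simp
  qed
  also have "\<dots> = \<kappa>\<^sup>2 * R\<^sup>2 * (real n * m8)" by (simp only: integral_mult_right_zero expectation_sum_norm8)
  finally show ?thesis by (simp add: mult.assoc)
qed

definition W :: "(nat \<Rightarrow> 'h \<times> 'x) \<Rightarrow> real" where
  "W \<xi> = (\<Sum>j=1..n. increment j \<xi>)"

lemma W_measurable [measurable]: "W \<in> borel_measurable (P n)"
  unfolding W_def by measurable

text \<open>Different increasing pairs are orthogonal, because one of the two has an index not in
  the other. The 1 in \<open>m8 + 1\<close> arises from padding the two norms with two factors 1 in
  the eighth-power inequality.\<close>

lemma expectation_W_sq_le:
  "integrable (P n) (\<lambda>\<xi>. (W \<xi>)\<^sup>2)" "(\<integral>\<xi>. (W \<xi>)\<^sup>2 \<partial>P n) \<le> 2 * \<kappa> * R * real n * (m8 + 1)"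
proof -
  let ?I = "{1..n} \<times> {1..n}"
  let ?Z = "\<lambda>p \<xi>. 2 * (A (snd p) (fst p) \<xi> * g (snd p) (fst p) \<xi>)"
  have W: "W \<xi> = (\<Sum>p\<in>?I. ?Z p \<xi>)" for \<xi>
    unfolding W_def increment_def sum_distrib_left by (rule sum_pairs[symmetric])
  have int: "integrable (P n) (\<lambda>\<xi>. ?Z p \<xi> * ?Z q \<xi>)" if "p \<in> ?I" "q \<in> ?I" for p q
  proof (rule integrable_envelope_bound[where k = 4 and C = "4 * \<kappa>\<^sup>2"])
    fix \<xi>
    have "\<bar>?Z p \<xi> * ?Z q \<xi>\<bar> = 4 * (\<bar>A (snd p) (fst p) \<xi> * g (snd p) (fst p) \<xi>\<bar> * \<bar>A (snd q) (fst q) \<xi> * g (snd q) (fst q) \<xi>\<bar>)"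
      by (simp add: abs_mult)
    also have "\<dots> \<le> 4 * ((\<kappa> * envelope n \<xi> ^ 2) * (\<kappa> * envelope n \<xi> ^ 2))"
      using that kappa_nonneg by (intro mult_left_mono mult_mono abs_Ag_le_envelope) auto
    also have "\<dots> = 4 * \<kappa>\<^sup>2 * envelope n \<xi> ^ 4" by (simp add: power2_eq_square power4_eq_xxxx)
    finally show "\<bar>?Z p \<xi> * ?Z q \<xi>\<bar> \<le> 4 * \<kappa>\<^sup>2 * envelope n \<xi> ^ 4" .
  qed (intro borel_measurable_times borel_measurable_const A_measurable g_measurable, simp)
  have orth: "(\<integral>\<xi>. ?Z p \<xi> * ?Z q \<xi> \<partial>P n) = 0" if pq: "p \<in> ?I" "q \<in> ?I" "p \<noteq> q" for p q
  proof (cases "snd p < fst p \<and> snd q < fst q")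
    case False
    then have z: "?Z p \<xi> * ?Z q \<xi> = 0" for \<xi> by (auto simp: A_def)
    show ?thesis unfolding z by simp
  next
    case True
    define i j k l where "i = snd p" "j = fst p" "k = snd q" "l = fst q"
    note defs = this
    have ord: "i < j" "k < l" and idx: "i \<in> {1..n}" "j \<in> {1..n}" using True pq by (auto simp: defs)
    let ?c = "\<lambda>\<xi>. 4 * (a i j \<xi> * a k l \<xi>)"
    have uc: "unaffected m ?c" for m by (rule unaffected_mult[OF unaffected_const unaffected_mult[OF a_unaffected a_unaffected]])
    have eq: "?Z p \<xi> * ?Z q \<xi> = (?c \<xi> * g k l \<xi>) * (fst (\<xi> i) \<bullet> fst (\<xi> j))" for \<xi>
      using True by (simp add: A_def g_def defs mult_ac)
    have "(i \<noteq> k \<and> i \<noteq> l) \<or> (j \<noteq> k \<and> j \<noteq> l)"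
    proof (rule ccontr)
      assume "\<not> ?thesis"
      then have "i = k \<and> j = l" using ord by auto
      then show False using pq(3) by (simp add: defs prod_eq_iff)
    qed
    then have "(\<integral>\<xi>. (?c \<xi> * g k l \<xi>) * (fst (\<xi> i) \<bullet> fst (\<xi> j)) \<partial>P n) = 0"
    proof
      assume ne: "i \<noteq> k \<and> i \<noteq> l"
      show ?thesis
      proof (rule zero_mean_term)
        show "unaffected i (\<lambda>\<xi>. ?c \<xi> * g k l \<xi>)"
          unfolding g_def by (rule unaffected_mult[OF uc unaffected_inner]) (use ne in auto)
      qed (use ord idx in \<open>auto intro!: borel_measurable_times a_measurable g_measurable\<close>)
    next
      assume ne: "j \<noteq> k \<and> j \<noteq> l"
      show ?thesis
      proof (rule zero_mean_term')
        show "unaffected j (\<lambda>\<xi>. ?c \<xi> * g k l \<xi>)"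
          unfolding g_def by (rule unaffected_mult[OF uc unaffected_inner]) (use ne in auto)
      qed (use ord idx in \<open>auto intro!: borel_measurable_times a_measurable g_measurable\<close>)
    qed
    then show ?thesis unfolding eq .
  qed
  have fin: "finite ?I" by simp
  show "integrable (P n) (\<lambda>\<xi>. (W \<xi>)\<^sup>2)"
    unfolding W by (rule expectation_square_orthogonal_sum(1)[OF fin int orth])
  have "(\<integral>\<xi>. (W \<xi>)\<^sup>2 \<partial>P n) = (\<integral>\<xi>. (\<Sum>p\<in>?I. (?Z p \<xi>)\<^sup>2) \<partial>P n)"
    unfolding W by (rule expectation_square_orthogonal_sum(2)[OF fin int orth])
  also have "\<dots> \<le> (\<integral>\<xi>. 2 * \<kappa> * R * (\<Sum>i=1..n. norm (fst (\<xi> i)) ^ 8) + 2 * \<kappa> * R * real n \<partial>P n)"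
  proof (rule integral_mono)
    show "integrable (P n) (\<lambda>\<xi>. \<Sum>p\<in>?I. (?Z p \<xi>)\<^sup>2)"
      unfolding power2_eq_square by (intro Bochner_Integration.integrable_sum int)
    show "integrable (P n) (\<lambda>\<xi>. 2 * \<kappa> * R * (\<Sum>i=1..n. norm (fst (\<xi> i)) ^ 8) + 2 * \<kappa> * R * real n)"
      by (intro Bochner_Integration.integrable_add integrable_mult_right expectation_sum_norm8 P.integrable_const)
    fix \<xi>
    interpret S: symmetric_weights n "\<lambda>i j. a i j \<xi>" R by (rule weights)
    define x where "x i = norm (fst (\<xi> i))" for i
    have x0: "0 \<le> x i" for i unfolding x_def by simp
    have "(?Z p \<xi>)\<^sup>2 \<le> \<kappa> * (a (snd p) (fst p) \<xi> * (x (snd p) ^ 8 + x (fst p) ^ 8 + 1 + 1))" for p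
    proof -
      let ?i = "snd p" and ?j = "fst p"
      have "(?Z p \<xi>)\<^sup>2 = 4 * (A ?i ?j \<xi> * A ?i ?j \<xi>) * (g ?i ?j \<xi>)\<^sup>2" by (simp add: power2_eq_square mult_ac)
      also have "\<dots> \<le> 4 * (\<kappa> * a ?i ?j \<xi>) * ((x ?i)\<^sup>2 * (x ?j)\<^sup>2 * 1\<^sup>2 * 1\<^sup>2)"
        unfolding x_def using kappa_nonneg g_sq_le[of ?i ?j \<xi>] by (intro mult_mono mult_left_mono A_bounds mult_nonneg_nonneg a_nonneg) auto
      also have "\<dots> \<le> 4 * (\<kappa> * a ?i ?j \<xi>) * ((x ?i ^ 8 + x ?j ^ 8 + 1 ^ 8 + 1 ^ 8) / 4)"
        using x0 kappa_nonneg by (intro mult_left_mono young_four mult_nonneg_nonneg a_nonneg) auto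
      finally show ?thesis by (simp add: mult_ac)
    qed
    then have "(\<Sum>p\<in>?I. (?Z p \<xi>)\<^sup>2) \<le> (\<Sum>p\<in>?I. \<kappa> * (a (snd p) (fst p) \<xi> * (x (snd p) ^ 8 + x (fst p) ^ 8 + 1 + 1)))"
      by (rule sum_mono)
    also have "\<dots> = (\<Sum>j=1..n. \<Sum>i=1..n. \<kappa> * (a i j \<xi> * (x i ^ 8 + x j ^ 8 + 1 + 1)))" by (rule sum_pairs)
    also have "\<dots> = \<kappa> * ((\<Sum>j=1..n. \<Sum>i=1..n. a j i \<xi> * x i ^ 8) + (\<Sum>j=1..n. \<Sum>i=1..n. a j i \<xi> * x j ^ 8) + (\<Sum>j=1..n. \<Sum>i=1..n. a j i \<xi> * 1) + (\<Sum>j=1..n. \<Sum>i=1..n. a j i \<xi> * 1))"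
      by (simp only: sum_distrib_left distrib_left sum.distrib a_sym)
    also have "\<dots> \<le> \<kappa> * (R * (\<Sum>i=1..n. x i ^ 8) + R * (\<Sum>i=1..n. x i ^ 8) + R * (\<Sum>i=1..n. 1) + R * (\<Sum>i=1..n. 1))"
      using x0 kappa_nonneg S.path2_le[of "\<lambda>_. 1"] by (intro mult_left_mono add_mono S.path2_le) auto
    finally show "(\<Sum>p\<in>?I. (?Z p \<xi>)\<^sup>2) \<le> 2 * \<kappa> * R * (\<Sum>i=1..n. norm (fst (\<xi> i)) ^ 8) + 2 * \<kappa> * R * real n"
      unfolding x_def by (simp add: algebra_simps)
  qed
  also have "\<dots> = 2 * \<kappa> * R * (real n * m8) + 2 * \<kappa> * R * real n"
    by (subst Bochner_Integration.integral_add[OF integrable_mult_right[OF expectation_sum_norm8(2)] P.integrable_const])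
      (simp only: integral_mult_right_zero expectation_sum_norm8(1), simp add: P.prob_space)
  finally show "(\<integral>\<xi>. (W \<xi>)\<^sup>2 \<partial>P n) \<le> 2 * \<kappa> * R * real n * (m8 + 1)" by (simp add: algebra_simps)
qed

text \<open>In the square of the sum, only pairs of pairs sharing an index contribute; their number is
  controlled by the row sums of the weights.\<close>

lemma expectation_pair_sum_sq_le:
  fixes e :: "nat \<Rightarrow> nat \<Rightarrow> (nat \<Rightarrow> 'h \<times> 'x) \<Rightarrow> real"
  assumes e [measurable]: "\<And>i j. e i j \<in> borel_measurable (P n)"
    and e2: "\<And>i j. i \<in> {1..n} \<Longrightarrow> j \<in> {1..n} \<Longrightarrow> i \<noteq> j \<Longrightarrow> integrable (P n) (\<lambda>\<xi>. (e i j \<xi>)\<^sup>2)"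
    and disjoint: "\<And>i j k l. {i, j, k, l} \<subseteq> {1..n} \<Longrightarrow> i < j \<Longrightarrow> k < l \<Longrightarrow> {i, j} \<inter> {k, l} = {} \<Longrightarrow>
      (\<integral>\<xi>. ((a i j \<xi>)\<^sup>2 * e i j \<xi>) * ((a k l \<xi>)\<^sup>2 * e k l \<xi>) \<partial>P n) = 0"
  shows "integrable (P n) (\<lambda>\<xi>. (\<Sum>i=1..n. \<Sum>j=1..n. (A i j \<xi>)\<^sup>2 * e i j \<xi>)\<^sup>2)"
    and "(\<integral>\<xi>. (\<Sum>i=1..n. \<Sum>j=1..n. (A i j \<xi>)\<^sup>2 * e i j \<xi>)\<^sup>2 \<partial>P n) \<le> 4 * \<kappa>\<^sup>2 * R * (\<integral>\<xi>. (\<Sum>i=1..n. \<Sum>j=1..n. A i j \<xi> * (e i j \<xi>)\<^sup>2) \<partial>P n)"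
proof -
  let ?I = "{1..n} \<times> {1..n}"
  define w where "w p \<xi> = (A (fst p) (snd p) \<xi>)\<^sup>2" for p \<xi>
  define f where "f p = e (fst p) (snd p)" for p
  let ?Z = "\<lambda>p \<xi>. w p \<xi> * f p \<xi>"
  have w_meas [measurable]: "w p \<in> borel_measurable (P n)" for p unfolding w_def by measurable
  have f_meas [measurable]: "f p \<in> borel_measurable (P n)" for p unfolding f_def by (rule e)
  have w0: "0 \<le> w p \<xi>" for p \<xi> unfolding w_def by simp
  have wk: "w p \<xi> \<le> \<kappa> * A (fst p) (snd p) \<xi>" for p \<xi>
    unfolding w_def power2_eq_square using A_bounds by (intro mult_right_mono) auto
  have wk2: "w p \<xi> \<le> \<kappa>\<^sup>2" for p \<xi> unfolding w_def using A_bounds by (intro power_mono) auto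
  have wz: "w p \<xi> = 0" if "\<not> fst p < snd p" for p \<xi> using that by (simp add: w_def A_def)
  have iZ2: "integrable (P n) (\<lambda>\<xi>. (?Z p \<xi>)\<^sup>2)" if p: "p \<in> ?I" for p
  proof (cases "fst p < snd p")
    case True
    have i: "integrable (P n) (\<lambda>\<xi>. (\<kappa>\<^sup>2)\<^sup>2 * (f p \<xi>)\<^sup>2)"
      unfolding f_def using True p by (intro integrable_mult_right e2) auto
    show ?thesis
    proof (rule Bochner_Integration.integrable_bound[OF i])
      show "(\<lambda>\<xi>. (?Z p \<xi>)\<^sup>2) \<in> borel_measurable (P n)" by (intro borel_measurable_power borel_measurable_times w_meas f_meas)
      have "(?Z p \<xi>)\<^sup>2 \<le> (\<kappa>\<^sup>2)\<^sup>2 * (f p \<xi>)\<^sup>2" for \<xi>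
        unfolding power_mult_distrib using w0 wk2 by (intro mult_right_mono power_mono) auto
      then show "AE \<xi> in P n. norm ((?Z p \<xi>)\<^sup>2) \<le> norm ((\<kappa>\<^sup>2)\<^sup>2 * (f p \<xi>)\<^sup>2)" by (intro AE_I2) simp
    qed
  next
    case False
    then show ?thesis by (simp add: wz)
  qed
  have iZZ: "integrable (P n) (\<lambda>\<xi>. ?Z p \<xi> * ?Z q \<xi>)" if "p \<in> ?I" "q \<in> ?I" for p q
    using that by (intro integrable_mult_of_squares iZ2 borel_measurable_times w_meas f_meas)
  have iwf: "integrable (P n) (\<lambda>\<xi>. w p \<xi> * w q \<xi> * (f p \<xi>)\<^sup>2)" if p: "p \<in> ?I" for p q
  proof (cases "fst p < snd p")
    case True
    have i: "integrable (P n) (\<lambda>\<xi>. (\<kappa>\<^sup>2)\<^sup>2 * (f p \<xi>)\<^sup>2)"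
      unfolding f_def using True p by (intro integrable_mult_right e2) auto
    show ?thesis
    proof (rule Bochner_Integration.integrable_bound[OF i])
      show "(\<lambda>\<xi>. w p \<xi> * w q \<xi> * (f p \<xi>)\<^sup>2) \<in> borel_measurable (P n)"
        by (intro borel_measurable_power borel_measurable_times w_meas f_meas)
      have "w p \<xi> * w q \<xi> * (f p \<xi>)\<^sup>2 \<le> \<kappa>\<^sup>2 * \<kappa>\<^sup>2 * (f p \<xi>)\<^sup>2" for \<xi>
        using w0 wk2 by (intro mult_right_mono mult_mono) auto
      then show "AE \<xi> in P n. norm (w p \<xi> * w q \<xi> * (f p \<xi>)\<^sup>2) \<le> norm ((\<kappa>\<^sup>2)\<^sup>2 * (f p \<xi>)\<^sup>2)"
        using w0 by (intro AE_I2) (simp add: abs_mult power2_eq_square[of "\<kappa>\<^sup>2"])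
    qed
  next
    case False
    then show ?thesis by (simp add: wz)
  qed
  \<comment> \<open>The indicator that the two pairs share an index.\<close>
  let ?ov = "\<lambda>p q. of_bool ({fst p, snd p} \<inter> {fst q, snd q} \<noteq> {}) :: real"
  have eqS: "(\<Sum>i=1..n. \<Sum>j=1..n. (A i j \<xi>)\<^sup>2 * e i j \<xi>) = (\<Sum>p\<in>?I. ?Z p \<xi>)" for \<xi>
    unfolding w_def f_def by (rule sum_pairs[symmetric])
  have sq: "(\<Sum>p\<in>?I. ?Z p \<xi>)\<^sup>2 = (\<Sum>p\<in>?I. \<Sum>q\<in>?I. ?Z p \<xi> * ?Z q \<xi>)" for \<xi>
    by (simp only: power2_eq_square sum_product)
  show "integrable (P n) (\<lambda>\<xi>. (\<Sum>i=1..n. \<Sum>j=1..n. (A i j \<xi>)\<^sup>2 * e i j \<xi>)\<^sup>2)"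
    unfolding eqS sq by (intro Bochner_Integration.integrable_sum iZZ)
  \<comment> \<open>AM-GM distributes an overlapping product onto the two squares, so that only one
    error term survives and the other pair can be summed through its weight alone.\<close>
  have summand: "(\<integral>\<xi>. ?Z p \<xi> * ?Z q \<xi> \<partial>P n) \<le> (\<integral>\<xi>. ?ov p q * (w p \<xi> * w q \<xi> * (f p \<xi>)\<^sup>2) \<partial>P n) / 2 + (\<integral>\<xi>. ?ov q p * (w q \<xi> * w p \<xi> * (f q \<xi>)\<^sup>2) \<partial>P n) / 2"
    if pq: "p \<in> ?I" "q \<in> ?I" for p q
  proof (cases "{fst p, snd p} \<inter> {fst q, snd q} = {}")
    case True
    have "(\<integral>\<xi>. ?Z p \<xi> * ?Z q \<xi> \<partial>P n) = 0"
    proof (cases "fst p < snd p \<and> fst q < snd q")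
      case T: True
      then have "?Z p \<xi> * ?Z q \<xi> = ((a (fst p) (snd p) \<xi>)\<^sup>2 * e (fst p) (snd p) \<xi>) * ((a (fst q) (snd q) \<xi>)\<^sup>2 * e (fst q) (snd q) \<xi>)" for \<xi>
        by (simp add: w_def f_def A_def)
      moreover have "(\<integral>\<xi>. ((a (fst p) (snd p) \<xi>)\<^sup>2 * e (fst p) (snd p) \<xi>) * ((a (fst q) (snd q) \<xi>)\<^sup>2 * e (fst q) (snd q) \<xi>) \<partial>P n) = 0"
        by (rule disjoint) (use T True pq in auto)
      ultimately show ?thesis by (simp only:)
    next
      case False
      then have z: "?Z p \<xi> * ?Z q \<xi> = 0" for \<xi> using False wz[of p \<xi>] wz[of q \<xi>] by fastforce
      show ?thesis unfolding z by simp
    qed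
    then show ?thesis using True by (simp add: Int_commute)
  next
    case False
    have "(\<integral>\<xi>. ?Z p \<xi> * ?Z q \<xi> \<partial>P n) \<le> (\<integral>\<xi>. (w p \<xi> * w q \<xi> * (f p \<xi>)\<^sup>2) / 2 + (w q \<xi> * w p \<xi> * (f q \<xi>)\<^sup>2) / 2 \<partial>P n)"
    proof (rule integral_mono)
      fix \<xi>
      have "?Z p \<xi> * ?Z q \<xi> = (w p \<xi> * w q \<xi>) * (f p \<xi> * f q \<xi>)" by (simp add: mult_ac)
      also have "\<dots> \<le> (w p \<xi> * w q \<xi>) * (((f p \<xi>)\<^sup>2 + (f q \<xi>)\<^sup>2) / 2)"
        using w0 by (intro mult_left_mono mult_le_half_squares mult_nonneg_nonneg)
      finally show "?Z p \<xi> * ?Z q \<xi> \<le> (w p \<xi> * w q \<xi> * (f p \<xi>)\<^sup>2) / 2 + (w q \<xi> * w p \<xi> * (f q \<xi>)\<^sup>2) / 2"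
        by (simp add: algebra_simps)
    qed (intro iZZ pq Bochner_Integration.integrable_add integrable_divide iwf)+
    also have "\<dots> = (\<integral>\<xi>. w p \<xi> * w q \<xi> * (f p \<xi>)\<^sup>2 \<partial>P n) / 2 + (\<integral>\<xi>. w q \<xi> * w p \<xi> * (f q \<xi>)\<^sup>2 \<partial>P n) / 2"
      using iwf[OF pq(1), of q] iwf[OF pq(2), of p] by simp
    finally show ?thesis using False by (simp add: Int_commute)
  qed
  have iov: "integrable (P n) (\<lambda>\<xi>. ?ov p q * (w p \<xi> * w q \<xi> * (f p \<xi>)\<^sup>2))" if "p \<in> ?I" for p q
    by (intro integrable_mult_right iwf that)
  have "(\<integral>\<xi>. (\<Sum>i=1..n. \<Sum>j=1..n. (A i j \<xi>)\<^sup>2 * e i j \<xi>)\<^sup>2 \<partial>P n) = (\<Sum>p\<in>?I. \<Sum>q\<in>?I. \<integral>\<xi>. ?Z p \<xi> * ?Z q \<xi> \<partial>P n)"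
    unfolding eqS sq by (rule integral_sum_sum) (rule iZZ)
  also have "\<dots> \<le> (\<Sum>p\<in>?I. \<Sum>q\<in>?I. (\<integral>\<xi>. ?ov p q * (w p \<xi> * w q \<xi> * (f p \<xi>)\<^sup>2) \<partial>P n) / 2 + (\<integral>\<xi>. ?ov q p * (w q \<xi> * w p \<xi> * (f q \<xi>)\<^sup>2) \<partial>P n) / 2)"
    by (intro sum_mono summand)
  also have "\<dots> = (\<Sum>p\<in>?I. \<Sum>q\<in>?I. (\<integral>\<xi>. ?ov p q * (w p \<xi> * w q \<xi> * (f p \<xi>)\<^sup>2) \<partial>P n) / 2) + (\<Sum>p\<in>?I. \<Sum>q\<in>?I. (\<integral>\<xi>. ?ov q p * (w q \<xi> * w p \<xi> * (f q \<xi>)\<^sup>2) \<partial>P n) / 2)"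
    by (simp only: sum.distrib)
  also have "(\<Sum>p\<in>?I. \<Sum>q\<in>?I. (\<integral>\<xi>. ?ov q p * (w q \<xi> * w p \<xi> * (f q \<xi>)\<^sup>2) \<partial>P n) / 2) = (\<Sum>p\<in>?I. \<Sum>q\<in>?I. (\<integral>\<xi>. ?ov p q * (w p \<xi> * w q \<xi> * (f p \<xi>)\<^sup>2) \<partial>P n) / 2)"
    by (rule sum.swap)
  also have "(\<Sum>p\<in>?I. \<Sum>q\<in>?I. (\<integral>\<xi>. ?ov p q * (w p \<xi> * w q \<xi> * (f p \<xi>)\<^sup>2) \<partial>P n) / 2) + (\<Sum>p\<in>?I. \<Sum>q\<in>?I. (\<integral>\<xi>. ?ov p q * (w p \<xi> * w q \<xi> * (f p \<xi>)\<^sup>2) \<partial>P n) / 2)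
      = (\<Sum>p\<in>?I. \<Sum>q\<in>?I. \<integral>\<xi>. ?ov p q * (w p \<xi> * w q \<xi> * (f p \<xi>)\<^sup>2) \<partial>P n)"
    by (simp only: sum.distrib[symmetric] field_sum_of_halves)
  also have "\<dots> = (\<integral>\<xi>. (\<Sum>p\<in>?I. \<Sum>q\<in>?I. ?ov p q * (w p \<xi> * w q \<xi> * (f p \<xi>)\<^sup>2)) \<partial>P n)"
    by (rule integral_sum_sum[symmetric]) (rule iov)
  also have "\<dots> \<le> (\<integral>\<xi>. 4 * \<kappa>\<^sup>2 * R * (\<Sum>i=1..n. \<Sum>j=1..n. A i j \<xi> * (e i j \<xi>)\<^sup>2) \<partial>P n)"
  proof (rule integral_mono)
    show "integrable (P n) (\<lambda>\<xi>. \<Sum>p\<in>?I. \<Sum>q\<in>?I. ?ov p q * (w p \<xi> * w q \<xi> * (f p \<xi>)\<^sup>2))"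
      by (intro Bochner_Integration.integrable_sum iov)
    have iAe: "integrable (P n) (\<lambda>\<xi>. A i j \<xi> * (e i j \<xi>)\<^sup>2)" if ij: "i \<in> {1..n}" "j \<in> {1..n}" for i j
    proof (cases "i < j")
      case True
      have i: "integrable (P n) (\<lambda>\<xi>. \<kappa> * (e i j \<xi>)\<^sup>2)" using True ij by (intro integrable_mult_right e2) auto
      show ?thesis
      proof (rule Bochner_Integration.integrable_bound[OF i])
        show "(\<lambda>\<xi>. A i j \<xi> * (e i j \<xi>)\<^sup>2) \<in> borel_measurable (P n)"
          by (intro borel_measurable_power borel_measurable_times A_measurable e)
        have "A i j \<xi> * (e i j \<xi>)\<^sup>2 \<le> \<kappa> * (e i j \<xi>)\<^sup>2" for \<xi> using A_bounds by (intro mult_right_mono) auto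
        then show "AE \<xi> in P n. norm (A i j \<xi> * (e i j \<xi>)\<^sup>2) \<le> norm (\<kappa> * (e i j \<xi>)\<^sup>2)"
          using A_bounds kappa_nonneg by (intro AE_I2) (simp add: abs_mult)
      qed
    qed (simp add: A_def)
    then show "integrable (P n) (\<lambda>\<xi>. 4 * \<kappa>\<^sup>2 * R * (\<Sum>i=1..n. \<Sum>j=1..n. A i j \<xi> * (e i j \<xi>)\<^sup>2))"
      by (intro integrable_mult_right Bochner_Integration.integrable_sum)
    fix \<xi>
    \<comment> \<open>A pair overlapping p has one of the two indices of p in one of its two places:
      four row or column sums, each at most \<kappa> R.\<close>
    have row: "(\<Sum>q\<in>?I. ?ov p q * w q \<xi>) \<le> 4 * \<kappa> * R" if p: "p \<in> ?I" for p
    proof -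
      let ?i = "fst p" and ?j = "snd p"
      have ij: "?i \<in> {1..n}" "?j \<in> {1..n}" using p by auto
      have "?ov p q * w q \<xi> \<le> (of_bool (fst q = ?i) + of_bool (snd q = ?i) + of_bool (fst q = ?j) + of_bool (snd q = ?j)) * (\<kappa> * a (fst q) (snd q) \<xi>)" for q
      proof -
        have "w q \<xi> \<le> \<kappa> * a (fst q) (snd q) \<xi>"
          by (rule order.trans[OF wk]) (intro mult_left_mono A_bounds kappa_nonneg)
        moreover have "?ov p q \<le> of_bool (fst q = ?i) + of_bool (snd q = ?i) + of_bool (fst q = ?j) + of_bool (snd q = ?j)" by auto
        ultimately show ?thesis using w0 by (intro mult_mono) auto
      qed
      then have "(\<Sum>q\<in>?I. ?ov p q * w q \<xi>) \<le> (\<Sum>q\<in>?I. (of_bool (fst q = ?i) + of_bool (snd q = ?i) + of_bool (fst q = ?j) + of_bool (snd q = ?j)) * (\<kappa> * a (fst q) (snd q) \<xi>))"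
        by (rule sum_mono)
      also have "\<dots> = (\<Sum>k=1..n. \<Sum>l=1..n. (of_bool (k = ?i) + of_bool (l = ?i) + of_bool (k = ?j) + of_bool (l = ?j)) * (\<kappa> * a k l \<xi>))"
        by (rule sum_pairs)
      also have "\<dots> = (\<Sum>k=1..n. \<Sum>l=1..n. of_bool (k = ?i) * (\<kappa> * a k l \<xi>)) + (\<Sum>k=1..n. \<Sum>l=1..n. of_bool (l = ?i) * (\<kappa> * a k l \<xi>)) +
          (\<Sum>k=1..n. \<Sum>l=1..n. of_bool (k = ?j) * (\<kappa> * a k l \<xi>)) + (\<Sum>k=1..n. \<Sum>l=1..n. of_bool (l = ?j) * (\<kappa> * a k l \<xi>))"
        by (simp only: distrib_right sum.distrib)
      also have "\<dots> \<le> \<kappa> * R + \<kappa> * R + \<kappa> * R + \<kappa> * R"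
      proof -
        have 1: "(\<Sum>k=1..n. \<Sum>l=1..n. of_bool (k = m) * (\<kappa> * a k l \<xi>)) \<le> \<kappa> * R" if m: "m \<in> {1..n}" for m
        proof -
          have "(\<Sum>k=1..n. \<Sum>l=1..n. of_bool (k = m) * (\<kappa> * a k l \<xi>)) = (\<Sum>k\<in>{m}. \<Sum>l=1..n. \<kappa> * a k l \<xi>)"
            using m by (intro sum.mono_neutral_cong_right) auto
          also have "\<dots> = \<kappa> * (\<Sum>l=1..n. a m l \<xi>)" by (simp add: sum_distrib_left)
          also have "\<dots> \<le> \<kappa> * R" using m kappa_nonneg by (intro mult_left_mono a_row) auto
          finally show ?thesis .
        qed
        have 2: "(\<Sum>k=1..n. \<Sum>l=1..n. of_bool (l = m) * (\<kappa> * a k l \<xi>)) \<le> \<kappa> * R" if m: "m \<in> {1..n}" for m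
        proof -
          have "(\<Sum>k=1..n. \<Sum>l=1..n. of_bool (l = m) * (\<kappa> * a k l \<xi>)) = (\<Sum>l=1..n. \<Sum>k=1..n. of_bool (l = m) * (\<kappa> * a l k \<xi>))"
            by (subst sum.swap) (intro sum.cong refl, metis a_sym)
          then show ?thesis using 1[OF m] by simp
        qed
        show ?thesis by (intro add_mono 1 2 ij)
      qed
      also have "\<dots> = 4 * \<kappa> * R" by simp
      finally show ?thesis .
    qed
    have "(\<Sum>p\<in>?I. \<Sum>q\<in>?I. ?ov p q * (w p \<xi> * w q \<xi> * (f p \<xi>)\<^sup>2)) = (\<Sum>p\<in>?I. (\<Sum>q\<in>?I. ?ov p q * w q \<xi>) * (w p \<xi> * (f p \<xi>)\<^sup>2))"
      unfolding sum_distrib_right by (intro sum.cong refl) (simp add: mult_ac)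
    also have "\<dots> \<le> (\<Sum>p\<in>?I. (4 * \<kappa> * R) * ((\<kappa> * A (fst p) (snd p) \<xi>) * (f p \<xi>)\<^sup>2))"
      using w0 kappa_nonneg R_nonneg by (intro sum_mono mult_mono mult_right_mono row wk) auto
    also have "\<dots> = 4 * \<kappa>\<^sup>2 * R * (\<Sum>p\<in>?I. A (fst p) (snd p) \<xi> * (e (fst p) (snd p) \<xi>)\<^sup>2)"
      unfolding sum_distrib_left f_def by (intro sum.cong refl) (simp add: power2_eq_square mult_ac)
    also have "(\<Sum>p\<in>?I. A (fst p) (snd p) \<xi> * (e (fst p) (snd p) \<xi>)\<^sup>2) = (\<Sum>i=1..n. \<Sum>j=1..n. A i j \<xi> * (e i j \<xi>)\<^sup>2)"
      by (rule sum_pairs)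
    finally show "(\<Sum>p\<in>?I. \<Sum>q\<in>?I. ?ov p q * (w p \<xi> * w q \<xi> * (f p \<xi>)\<^sup>2)) \<le> 4 * \<kappa>\<^sup>2 * R * (\<Sum>i=1..n. \<Sum>j=1..n. A i j \<xi> * (e i j \<xi>)\<^sup>2)" .
  qed
  finally show "(\<integral>\<xi>. (\<Sum>i=1..n. \<Sum>j=1..n. (A i j \<xi>)\<^sup>2 * e i j \<xi>)\<^sup>2 \<partial>P n) \<le> 4 * \<kappa>\<^sup>2 * R * (\<integral>\<xi>. (\<Sum>i=1..n. \<Sum>j=1..n. A i j \<xi> * (e i j \<xi>)\<^sup>2) \<partial>P n)"
    by (simp only: integral_mult_right_zero)
qed

end

section \<open>Conditional variance given the covariates\<close>

text \<open>Centring is an orthogonal projection for the weighted inner product: by hypothesis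
  E[w (Y - c)^2] = E[w Y (Y - c)], and AM-GM absorbs half of the left side.\<close>

lemma weighted_second_moment_centered_le:
  fixes w Y c :: "'a \<Rightarrow> real"
  assumes w: "w \<in> borel_measurable M" "\<And>x. 0 \<le> w x" "\<And>x. w x \<le> \<kappa>"
    and Y: "Y \<in> borel_measurable M" "integrable M (\<lambda>x. (Y x)\<^sup>2)"
    and c: "c \<in> borel_measurable M" "integrable M (\<lambda>x. (c x)\<^sup>2)"
    and 0: "(\<integral>x. (w x * c x) * (Y x - c x) \<partial>M) = 0"
  shows "(\<integral>x. w x * (Y x - c x)\<^sup>2 \<partial>M) \<le> (\<integral>x. w x * (Y x)\<^sup>2 \<partial>M)"
proof -
  have wi: "integrable M (\<lambda>x. w x * f x)" if "integrable M f" for f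
  proof (rule Bochner_Integration.integrable_bound)
    show "integrable M (\<lambda>x. \<kappa> * f x)" using that by simp
    show "(\<lambda>x. w x * f x) \<in> borel_measurable M" using w(1) that by measurable
    show "AE x in M. norm (w x * f x) \<le> norm (\<kappa> * f x)"
    proof (intro AE_I2)
      fix x show "norm (w x * f x) \<le> norm (\<kappa> * f x)"
        using w(2,3)[of x] by (simp add: abs_mult mult_right_mono)
    qed
  qed
  have d: "(\<lambda>x. Y x - c x) \<in> borel_measurable M" using Y(1) c(1) by (rule borel_measurable_diff)
  have Yc: "integrable M (\<lambda>x. Y x * c x)" by (rule integrable_mult_of_squares[OF Y(1) c(1) Y(2) c(2)])
  have e2: "integrable M (\<lambda>x. (Y x - c x)\<^sup>2)"
  proof -
    have "(Y x - c x)\<^sup>2 = (Y x)\<^sup>2 - 2 * (Y x * c x) + (c x)\<^sup>2" for x by (simp add: power2_diff)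
    then show ?thesis using Y c Yc by simp
  qed
  have Ye: "integrable M (\<lambda>x. Y x * (Y x - c x))" by (rule integrable_mult_of_squares[OF Y(1) d Y(2) e2])
  have ce: "integrable M (\<lambda>x. c x * (Y x - c x))" by (rule integrable_mult_of_squares[OF c(1) d c(2) e2])
  have "(\<integral>x. w x * (Y x - c x)\<^sup>2 \<partial>M) = (\<integral>x. w x * (Y x * (Y x - c x)) - w x * (c x * (Y x - c x)) \<partial>M)"
    by (intro Bochner_Integration.integral_cong refl) (simp add: power2_eq_square algebra_simps)
  also have "\<dots> = (\<integral>x. w x * (Y x * (Y x - c x)) \<partial>M) - (\<integral>x. w x * (c x * (Y x - c x)) \<partial>M)"
    by (rule Bochner_Integration.integral_diff[OF wi[OF Ye] wi[OF ce]])
  also have "(\<integral>x. w x * (c x * (Y x - c x)) \<partial>M) = 0" using 0 by (simp only: mult.assoc)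
  finally have 1: "(\<integral>x. w x * (Y x - c x)\<^sup>2 \<partial>M) = (\<integral>x. w x * (Y x * (Y x - c x)) \<partial>M)" by simp
  also have "\<dots> \<le> (\<integral>x. (w x * (Y x)\<^sup>2) / 2 + (w x * (Y x - c x)\<^sup>2) / 2 \<partial>M)"
  proof (rule integral_mono)
    fix x
    have "w x * (Y x * (Y x - c x)) \<le> w x * (((Y x)\<^sup>2 + (Y x - c x)\<^sup>2) / 2)"
      using w(2) by (intro mult_left_mono mult_le_half_squares)
    then show "w x * (Y x * (Y x - c x)) \<le> (w x * (Y x)\<^sup>2) / 2 + (w x * (Y x - c x)\<^sup>2) / 2" by (simp add: algebra_simps)
  qed (intro wi Ye Bochner_Integration.integrable_add integrable_divide Y e2)+
  also have "\<dots> = (\<integral>x. w x * (Y x)\<^sup>2 \<partial>M) / 2 + (\<integral>x. w x * (Y x - c x)\<^sup>2 \<partial>M) / 2"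
    using wi[OF Y(2)] wi[OF e2] by simp
  finally show ?thesis by simp
qed

text \<open>The level set of \<open>c\<close> through \<open>x\<close> is the preimage of some set
  under \<open>f\<close>, hence contains every \<open>y\<close> with the same image.\<close>

lemma vimage_algebra_measurable_factors:
  assumes c: "c \<in> borel_measurable (vimage_algebra UNIV f N)" and f: "f \<in> UNIV \<rightarrow> space N" and eq: "f x = f y"
  shows "c x = (c y :: real)"
proof -
  have "c -` {c x} \<inter> UNIV \<in> sets (vimage_algebra UNIV f N)"
    using measurable_sets[OF c, of "{c x}"] by simp
  then obtain A where A: "c -` {c x} = f -` A" unfolding sets_vimage_algebra2[OF f] by auto
  have "x \<in> f -` A" unfolding A[symmetric] by simp
  then have "y \<in> c -` {c x}" unfolding A using eq by simp
  then show ?thesis by simp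
qed

section \<open>Conditional second moment of the inner product of two noises\<close>

context centered_design
begin

sublocale DD: pair_prob_space D D
  by unfold_locales

lemma pair_law:
  assumes ij: "i \<in> {1..n}" "j \<in> {1..n}" "i \<noteq> j"
  shows "distr (P n) (D \<Otimes>\<^sub>M D) (\<lambda>\<xi>. (\<xi> i, \<xi> j)) = D \<Otimes>\<^sub>M D"
proof (rule pair_measure_eqI[symmetric])
  show "sigma_finite_measure D" by unfold_locales
  then show "sigma_finite_measure D" .
  show "sets (D \<Otimes>\<^sub>M D) = sets (distr (P n) (D \<Otimes>\<^sub>M D) (\<lambda>\<xi>. (\<xi> i, \<xi> j)))" by simp
  fix S T assume ST: "S \<in> sets D" "T \<in> sets D"
  let ?F = "\<lambda>k. if k = i then S else if k = j then T else space D"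
  have m: "(\<lambda>\<xi>. (\<xi> i, \<xi> j)) \<in> P n \<rightarrow>\<^sub>M D \<Otimes>\<^sub>M D" by (intro measurable_Pair component_measurable)
  have "emeasure (distr (P n) (D \<Otimes>\<^sub>M D) (\<lambda>\<xi>. (\<xi> i, \<xi> j))) (S \<times> T) = emeasure (P n) ((\<lambda>\<xi>. (\<xi> i, \<xi> j)) -` (S \<times> T) \<inter> space (P n))"
    by (rule emeasure_distr[OF m pair_measureI[OF ST]])
  also have "(\<lambda>\<xi>. (\<xi> i, \<xi> j)) -` (S \<times> T) \<inter> space (P n) = PiE {1..n} ?F"
    using ij by (auto simp: space_PiM space_D PiE_def Pi_def)
  also have "emeasure (P n) (PiE {1..n} ?F) = (\<Prod>k\<in>{1..n}. emeasure D (?F k))"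
    using ST by (intro PS.emeasure_PiM) auto
  also have "\<dots> = (\<Prod>k\<in>{i, j}. emeasure D (?F k))"
    using ij by (intro prod.mono_neutral_right) (auto simp: emeasure_space_1)
  also have "\<dots> = emeasure D S * emeasure D T" using ij by simp
  finally show "emeasure D S * emeasure D T = emeasure (distr (P n) (D \<Otimes>\<^sub>M D) (\<lambda>\<xi>. (\<xi> i, \<xi> j))) (S \<times> T)" ..
qed

lemma pair_integral:
  fixes f :: "('h \<times> 'x) \<times> ('h \<times> 'x) \<Rightarrow> real"
  assumes ij: "i \<in> {1..n}" "j \<in> {1..n}" "i \<noteq> j" and f: "f \<in> borel_measurable (D \<Otimes>\<^sub>M D)"
  shows "integrable (P n) (\<lambda>\<xi>. f (\<xi> i, \<xi> j)) \<longleftrightarrow> integrable (D \<Otimes>\<^sub>M D) f"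
    and "(\<integral>\<xi>. f (\<xi> i, \<xi> j) \<partial>P n) = (\<integral>z. f z \<partial>(D \<Otimes>\<^sub>M D))"
proof -
  have m: "(\<lambda>\<xi>. (\<xi> i, \<xi> j)) \<in> P n \<rightarrow>\<^sub>M D \<Otimes>\<^sub>M D" by (intro measurable_Pair component_measurable)
  show "integrable (P n) (\<lambda>\<xi>. f (\<xi> i, \<xi> j)) \<longleftrightarrow> integrable (D \<Otimes>\<^sub>M D) f"
    using integrable_distr_eq[OF m f] unfolding pair_law[OF ij] by simp
  show "(\<integral>\<xi>. f (\<xi> i, \<xi> j) \<partial>P n) = (\<integral>z. f z \<partial>(D \<Otimes>\<^sub>M D))"
    using integral_distr[OF m f] unfolding pair_law[OF ij] by simp
qed

definition sq_inner :: "('h \<times> 'x) \<times> ('h \<times> 'x) \<Rightarrow> real" where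
  "sq_inner z = (fst (fst z) \<bullet> fst (snd z))\<^sup>2"

definition covariates :: "('h \<times> 'x) \<times> ('h \<times> 'x) \<Rightarrow> 'x \<times> 'x" where
  "covariates z = (snd (fst z), snd (snd z))"

definition covariate_algebra :: "(('h \<times> 'x) \<times> ('h \<times> 'x)) measure" where
  "covariate_algebra = vimage_algebra UNIV covariates (borel \<Otimes>\<^sub>M borel)"

definition cond_sq_inner :: "('h \<times> 'x) \<times> ('h \<times> 'x) \<Rightarrow> real" where
  "cond_sq_inner = real_cond_exp (D \<Otimes>\<^sub>M D) covariate_algebra sq_inner"

lemma sq_inner_measurable [measurable]: "sq_inner \<in> borel_measurable (D \<Otimes>\<^sub>M D)"
  unfolding sq_inner_def by measurable

lemma covariates_measurable: "covariates \<in> D \<Otimes>\<^sub>M D \<rightarrow>\<^sub>M borel \<Otimes>\<^sub>M borel"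
  unfolding covariates_def by measurable

lemma space_DD: "space (D \<Otimes>\<^sub>M D) = UNIV"
  by (simp add: space_pair_measure space_D)

lemma covariates_space: "covariates \<in> UNIV \<rightarrow> space (borel \<Otimes>\<^sub>M borel)"
  by (simp add: space_pair_measure)

lemma subalgebra_covariates: "subalgebra (D \<Otimes>\<^sub>M D) covariate_algebra"
  unfolding subalgebra_def
proof
  show "space covariate_algebra = space (D \<Otimes>\<^sub>M D)" by (simp add: covariate_algebra_def space_DD)
  show "sets covariate_algebra \<subseteq> sets (D \<Otimes>\<^sub>M D)"
    unfolding covariate_algebra_def sets_vimage_algebra2[OF covariates_space]
    using measurable_sets[OF covariates_measurable] by (auto simp: space_DD)
qed

sublocale CE: finite_measure_subalgebra "D \<Otimes>\<^sub>M D" covariate_algebra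
  by unfold_locales (rule subalgebra_covariates)

lemma integrable_sq_inner: "integrable (D \<Otimes>\<^sub>M D) sq_inner" "integrable (D \<Otimes>\<^sub>M D) (\<lambda>z. (sq_inner z)\<^sup>2)"
proof -
  have 12: "(1::nat) \<in> {1..2}" "(2::nat) \<in> {1..2}" "(1::nat) \<noteq> 2" by auto
  have b: "\<bar>sq_inner (\<xi> 1, \<xi> 2)\<bar> \<le> envelope 2 \<xi> ^ 4" for \<xi>
  proof -
    have "\<bar>fst (\<xi> 1) \<bullet> fst (\<xi> 2)\<bar>\<^sup>2 \<le> (envelope 2 \<xi> ^ 2)\<^sup>2" by (intro power_mono inner_le_envelope 12) auto
    then show ?thesis by (simp add: sq_inner_def flip: power_mult)
  qed
  have "integrable (P 2) (\<lambda>\<xi>. sq_inner (\<xi> 1, \<xi> 2))"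
  proof (rule integrable_envelope_bound[where k = 4 and C = 1])
    show "(\<lambda>\<xi>. sq_inner (\<xi> 1, \<xi> 2)) \<in> borel_measurable (P 2)" unfolding sq_inner_def fst_conv snd_conv by measurable
  qed (use b in simp_all)
  then show "integrable (D \<Otimes>\<^sub>M D) sq_inner" using pair_integral(1)[OF 12 sq_inner_measurable] by simp
  have "integrable (P 2) (\<lambda>\<xi>. (sq_inner (\<xi> 1, \<xi> 2))\<^sup>2)"
  proof (rule integrable_envelope_bound[where k = 8 and C = 1])
    show "(\<lambda>\<xi>. (sq_inner (\<xi> 1, \<xi> 2))\<^sup>2) \<in> borel_measurable (P 2)" unfolding sq_inner_def fst_conv snd_conv by measurable
    fix \<xi>
    have "\<bar>sq_inner (\<xi> 1, \<xi> 2)\<bar>\<^sup>2 \<le> (envelope 2 \<xi> ^ 4)\<^sup>2" by (intro power_mono b) auto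
    then show "\<bar>(sq_inner (\<xi> 1, \<xi> 2))\<^sup>2\<bar> \<le> 1 * envelope 2 \<xi> ^ 8" by (simp flip: power_mult)
  qed simp
  then show "integrable (D \<Otimes>\<^sub>M D) (\<lambda>z. (sq_inner z)\<^sup>2)"
    using pair_integral(1)[OF 12 borel_measurable_power[OF sq_inner_measurable], of 2] by simp
qed

lemma cond_sq_inner_covariate_measurable: "cond_sq_inner \<in> borel_measurable covariate_algebra"
  unfolding cond_sq_inner_def by (rule borel_measurable_cond_exp)

lemma cond_sq_inner_measurable [measurable]: "cond_sq_inner \<in> borel_measurable (D \<Otimes>\<^sub>M D)"
  by (rule measurable_from_subalg[OF subalgebra_covariates cond_sq_inner_covariate_measurable])

text \<open>The chosen version of the conditional expectation is measurable for the algebra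
  generated by the covariates, so it is a function of them everywhere and not only almost
  everywhere. The pointwise notion \<open>unaffected\<close> relies on this.\<close>

lemma cond_sq_inner_covariates: "cond_sq_inner ((a, b), (a2, b2)) = cond_sq_inner ((a', b), (a2', b2))"
  using cond_sq_inner_covariate_measurable covariates_space
  unfolding covariate_algebra_def by (rule vimage_algebra_measurable_factors) (simp add: covariates_def)

lemma integrable_cond_sq_inner_sq: "integrable (D \<Otimes>\<^sub>M D) (\<lambda>z. (cond_sq_inner z)\<^sup>2)"
proof (rule Bochner_Integration.integrable_bound)
  show "integrable (D \<Otimes>\<^sub>M D) (real_cond_exp (D \<Otimes>\<^sub>M D) covariate_algebra (\<lambda>z. (sq_inner z)\<^sup>2))"
    by (rule CE.real_cond_exp_int(1)[OF integrable_sq_inner(2)])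
  have "AE z in D \<Otimes>\<^sub>M D. (cond_sq_inner z)\<^sup>2 \<le> real_cond_exp (D \<Otimes>\<^sub>M D) covariate_algebra (\<lambda>z. (sq_inner z)\<^sup>2) z"
    unfolding cond_sq_inner_def
    by (rule CE.real_cond_exp_jensens_inequality(2)[where I = UNIV and q = "\<lambda>x. x\<^sup>2"])
      (use integrable_sq_inner convex_power2 in auto)
  then show "AE z in D \<Otimes>\<^sub>M D. norm ((cond_sq_inner z)\<^sup>2) \<le> norm (real_cond_exp (D \<Otimes>\<^sub>M D) covariate_algebra (\<lambda>z. (sq_inner z)\<^sup>2) z)"
    by eventually_elim simp
qed (intro borel_measurable_power cond_sq_inner_measurable)

lemma integral_cond_sq_inner:
  assumes \<psi>: "\<psi> \<in> borel_measurable covariate_algebra"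
  shows "(\<integral>z. \<psi> z * (sq_inner z - cond_sq_inner z) \<partial>(D \<Otimes>\<^sub>M D)) = 0"
proof (cases "integrable (D \<Otimes>\<^sub>M D) (\<lambda>z. \<psi> z * (sq_inner z - cond_sq_inner z))")
  case True
  have m: "(\<lambda>z. sq_inner z - cond_sq_inner z) \<in> borel_measurable (D \<Otimes>\<^sub>M D)" by measurable
  have ic: "integrable (D \<Otimes>\<^sub>M D) cond_sq_inner"
    unfolding cond_sq_inner_def by (rule CE.real_cond_exp_int(1)[OF integrable_sq_inner(1)])
  have "AE z in D \<Otimes>\<^sub>M D. real_cond_exp (D \<Otimes>\<^sub>M D) covariate_algebra (\<lambda>z. sq_inner z - cond_sq_inner z) z =
      real_cond_exp (D \<Otimes>\<^sub>M D) covariate_algebra sq_inner z - real_cond_exp (D \<Otimes>\<^sub>M D) covariate_algebra cond_sq_inner z"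
    by (rule CE.real_cond_exp_diff[OF integrable_sq_inner(1) ic])
  moreover have "AE z in D \<Otimes>\<^sub>M D. real_cond_exp (D \<Otimes>\<^sub>M D) covariate_algebra cond_sq_inner z = cond_sq_inner z"
    by (rule CE.real_cond_exp_F_meas[OF ic cond_sq_inner_covariate_measurable])
  ultimately have z: "AE z in D \<Otimes>\<^sub>M D. \<psi> z * real_cond_exp (D \<Otimes>\<^sub>M D) covariate_algebra (\<lambda>z. sq_inner z - cond_sq_inner z) z = 0"
    by eventually_elim (simp add: cond_sq_inner_def)
  have "(\<integral>z. \<psi> z * (sq_inner z - cond_sq_inner z) \<partial>(D \<Otimes>\<^sub>M D)) =
      (\<integral>z. \<psi> z * real_cond_exp (D \<Otimes>\<^sub>M D) covariate_algebra (\<lambda>z. sq_inner z - cond_sq_inner z) z \<partial>(D \<Otimes>\<^sub>M D))"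
    by (rule CE.real_cond_exp_intg(2)[OF True \<psi> m, symmetric])
  also have "\<dots> = 0" by (rule integral_eq_zero_AE[OF z])
  finally show ?thesis .
qed (rule not_integrable_integral_eq)

lemma pair_update_measurable:
  assumes ij: "i \<in> {1..n}" "j \<in> {1..n}" "i \<noteq> j" and \<xi>: "\<xi> \<in> space (PiM ({1..n} - {i, j}) (\<lambda>_. D))"
  shows "(\<lambda>z. \<xi>(i := fst z, j := snd z)) \<in> D \<Otimes>\<^sub>M D \<rightarrow>\<^sub>M P n"
proof (rule measurable_PiM_single')
  fix k assume k: "k \<in> {1..n}"
  consider "k = i" "k \<noteq> j" | "k = j" | "k \<noteq> i" "k \<noteq> j" by blast
  then show "(\<lambda>z. (\<xi>(i := fst z, j := snd z)) k) \<in> D \<Otimes>\<^sub>M D \<rightarrow>\<^sub>M D"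
    by cases (simp_all add: space_D)
next
  show "(\<lambda>z. \<xi>(i := fst z, j := snd z)) \<in> space (D \<Otimes>\<^sub>M D) \<rightarrow> {1..n} \<rightarrow>\<^sub>E space D"
    using ij \<xi> by (auto simp: space_PiM space_D PiE_def extensional_def)
qed

text \<open>The counterpart of \<open>zero_mean_term\<close> for a pair: with the rest of the sample
  frozen, \<phi> depends on the two covariates only and is orthogonal to the deviation from the
  conditional expectation.\<close>

lemma cond_variance_term:
  assumes ij: "i \<in> {1..n}" "j \<in> {1..n}" "i \<noteq> j"
    and \<phi>: "\<phi> \<in> borel_measurable (P n)" "unaffected i \<phi>" "unaffected j \<phi>"
  shows "(\<integral>\<xi>. \<phi> \<xi> * (sq_inner (\<xi> i, \<xi> j) - cond_sq_inner (\<xi> i, \<xi> j)) \<partial>P n) = 0"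
proof (rule integral_eq_0_pair[OF ij])
  fix \<xi> assume \<xi>: "\<xi> \<in> space (PiM ({1..n} - {i, j}) (\<lambda>_. D))"
  let ?h = "\<lambda>b. \<phi> (\<xi>(i := (0, fst b), j := (0, snd b)))"
  have "(\<lambda>b. (0, fst b)) \<in> borel \<Otimes>\<^sub>M borel \<rightarrow>\<^sub>M D" "(\<lambda>b. (0, snd b)) \<in> borel \<Otimes>\<^sub>M borel \<rightarrow>\<^sub>M D"
    unfolding measurable_cong_sets[OF refl sets_D]
    by (intro measurable_Pair measurable_const measurable_fst measurable_snd; simp)+
  then have "(\<lambda>b. ((0, fst b), (0, snd b))) \<in> borel \<Otimes>\<^sub>M borel \<rightarrow>\<^sub>M D \<Otimes>\<^sub>M D"
    by (rule measurable_Pair)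
  from measurable_compose[OF this measurable_compose[OF pair_update_measurable[OF ij \<xi>] \<phi>(1)]]
  have h: "?h \<in> borel_measurable (borel \<Otimes>\<^sub>M borel)" by simp
  have "covariates \<in> covariate_algebra \<rightarrow>\<^sub>M borel \<Otimes>\<^sub>M borel"
    unfolding covariate_algebra_def by (rule measurable_vimage_algebra1[OF covariates_space])
  from measurable_compose[OF this h]
  have \<psi>: "(\<lambda>z. ?h (covariates z)) \<in> borel_measurable covariate_algebra" .
  have eq: "\<phi> (\<xi>(i := fst z, j := snd z)) = ?h (covariates z)" for z
  proof -
    obtain a b a2 b2 where z: "z = ((a, b), (a2, b2))" by (metis prod.exhaust)
    have "\<phi> (\<xi>(i := (a, b), j := (a2, b2))) = \<phi> ((\<xi>(i := (a, b)))(j := (0, b2)))"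
      using \<phi>(3) unfolding unaffected_def by metis
    also have "\<dots> = \<phi> ((\<xi>(j := (0, b2)))(i := (a, b)))" using ij by (simp add: fun_upd_twist)
    also have "\<dots> = \<phi> ((\<xi>(j := (0, b2)))(i := (0, b)))" using \<phi>(2) unfolding unaffected_def by metis
    also have "\<dots> = \<phi> (\<xi>(i := (0, b), j := (0, b2)))" using ij by (simp add: fun_upd_twist)
    finally show ?thesis by (simp add: z covariates_def)
  qed
  have "(\<integral>z. ?h (covariates z) * (sq_inner z - cond_sq_inner z) \<partial>(D \<Otimes>\<^sub>M D)) = 0"
    by (rule integral_cond_sq_inner[OF \<psi>])
  then show "(\<integral>z. \<phi> (\<xi>(i := fst z, j := snd z)) * (sq_inner ((\<xi>(i := fst z, j := snd z)) i, (\<xi>(i := fst z, j := snd z)) j) -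
      cond_sq_inner ((\<xi>(i := fst z, j := snd z)) i, (\<xi>(i := fst z, j := snd z)) j)) \<partial>(D \<Otimes>\<^sub>M D)) = 0"
    using ij unfolding eq by simp
qed

lemma unaffected_cond_sq_inner: "unaffected k (\<lambda>\<xi>. cond_sq_inner (\<xi> i, \<xi> j))"
  unfolding unaffected_def
proof (intro allI)
  fix \<xi> :: "nat \<Rightarrow> 'h \<times> 'x" and a a' b
  have "cond_sq_inner (z, w) = cond_sq_inner ((0, snd z), (0, snd w))" for z w
    using cond_sq_inner_covariates[of "fst z" "snd z" "fst w" "snd w" 0 0] by simp
  then have "cond_sq_inner ((\<xi>(k := (a, b))) i, (\<xi>(k := (a, b))) j) = cond_sq_inner ((0, snd ((\<xi>(k := (a, b))) i)), (0, snd ((\<xi>(k := (a, b))) j)))"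
    and "cond_sq_inner ((\<xi>(k := (a', b))) i, (\<xi>(k := (a', b))) j) = cond_sq_inner ((0, snd ((\<xi>(k := (a', b))) i)), (0, snd ((\<xi>(k := (a', b))) j)))"
    by blast+
  moreover have "snd ((\<xi>(k := (a, b))) l) = snd ((\<xi>(k := (a', b))) l)" for l by simp
  ultimately show "cond_sq_inner ((\<xi>(k := (a, b))) i, (\<xi>(k := (a, b))) j) = cond_sq_inner ((\<xi>(k := (a', b))) i, (\<xi>(k := (a', b))) j)"
    by (simp only:)
qed

end

context weighted_design
begin

lemma expectation_weighted_sq_le:
  "(\<integral>\<xi>. (\<Sum>i=1..n. \<Sum>j=1..n. A i j \<xi> * (sq_inner (\<xi> i, \<xi> j))\<^sup>2) \<partial>P n) \<le> R * (real n * m8)"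
proof -
  have "(\<integral>\<xi>. (\<Sum>i=1..n. \<Sum>j=1..n. A i j \<xi> * (sq_inner (\<xi> i, \<xi> j))\<^sup>2) \<partial>P n) \<le> (\<integral>\<xi>. R * (\<Sum>i=1..n. norm (fst (\<xi> i)) ^ 8) \<partial>P n)"
  proof (rule integral_mono')
    show "integrable (P n) (\<lambda>\<xi>. R * (\<Sum>i=1..n. norm (fst (\<xi> i)) ^ 8))" by (intro integrable_mult_right expectation_sum_norm8)
    fix \<xi>
    interpret S: symmetric_weights n "\<lambda>i j. a i j \<xi>" R by (rule weights)
    define x where "x i = norm (fst (\<xi> i))" for i
    have x0: "0 \<le> x i" for i unfolding x_def by simp
    have "(\<Sum>i=1..n. \<Sum>j=1..n. A i j \<xi> * (sq_inner (\<xi> i, \<xi> j))\<^sup>2) \<le> (\<Sum>i=1..n. \<Sum>j=1..n. a i j \<xi> * ((x i ^ 8 + x j ^ 8) / 2))"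
    proof (intro sum_mono mult_mono A_bounds)
      fix i j
      have "sq_inner (\<xi> i, \<xi> j) \<le> (x i)\<^sup>2 * (x j)\<^sup>2" using g_sq_le[of i j \<xi>] by (simp add: sq_inner_def g_def x_def)
      then have "(sq_inner (\<xi> i, \<xi> j))\<^sup>2 \<le> ((x i)\<^sup>2 * (x j)\<^sup>2)\<^sup>2" by (intro power_mono) (simp_all add: sq_inner_def)
      also have "\<dots> = x i ^ 4 * x j ^ 4" by (simp add: power_mult_distrib flip: power_mult)
      also have "\<dots> \<le> ((x i ^ 4)\<^sup>2 + (x j ^ 4)\<^sup>2) / 2" by (rule mult_le_half_squares)
      finally show "(sq_inner (\<xi> i, \<xi> j))\<^sup>2 \<le> (x i ^ 8 + x j ^ 8) / 2" by (simp flip: power_mult)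
    qed (auto simp: a_nonneg)
    also have "\<dots> = ((\<Sum>i=1..n. \<Sum>j=1..n. a i j \<xi> * x i ^ 8) + (\<Sum>i=1..n. \<Sum>j=1..n. a i j \<xi> * x j ^ 8)) / 2"
      by (simp only: times_divide_eq_right distrib_left sum.distrib sum_divide_distrib[symmetric])
    also have "\<dots> \<le> (R * (\<Sum>i=1..n. x i ^ 8) + R * (\<Sum>i=1..n. x i ^ 8)) / 2"
      using x0 by (intro divide_right_mono add_mono S.path2_le) auto
    finally show "(\<Sum>i=1..n. \<Sum>j=1..n. A i j \<xi> * (sq_inner (\<xi> i, \<xi> j))\<^sup>2) \<le> R * (\<Sum>i=1..n. norm (fst (\<xi> i)) ^ 8)"
      unfolding x_def by simp
    show "0 \<le> R * (\<Sum>i=1..n. norm (fst (\<xi> i)) ^ 8)" using R_nonneg by (intro mult_nonneg_nonneg sum_nonneg) auto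
  qed
  also have "\<dots> = R * (real n * m8)" by (simp only: integral_mult_right_zero expectation_sum_norm8)
  finally show ?thesis .
qed

text \<open>The centring \<open>c\<close> is left general for two uses: the conditional second
  moment compares \<open>V\<close> with \<open>s2\<close>, and a constant mean gives the law of
  large numbers for the energy of the sample.\<close>

lemma centered_pair_sum_sq_le:
  fixes c :: "('h \<times> 'x) \<times> ('h \<times> 'x) \<Rightarrow> real"
  assumes c: "c \<in> borel_measurable (D \<Otimes>\<^sub>M D)" "integrable (D \<Otimes>\<^sub>M D) (\<lambda>z. (c z)\<^sup>2)"
    and disjoint: "\<And>i j k l. {i, j, k, l} \<subseteq> {1..n} \<Longrightarrow> i < j \<Longrightarrow> k < l \<Longrightarrow> {i, j} \<inter> {k, l} = {} \<Longrightarrow>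
      (\<integral>\<xi>. ((a i j \<xi>)\<^sup>2 * (sq_inner (\<xi> i, \<xi> j) - c (\<xi> i, \<xi> j))) * ((a k l \<xi>)\<^sup>2 * (sq_inner (\<xi> k, \<xi> l) - c (\<xi> k, \<xi> l))) \<partial>P n) = 0"
    and same: "\<And>i j. i \<in> {1..n} \<Longrightarrow> j \<in> {1..n} \<Longrightarrow> i < j \<Longrightarrow>
      (\<integral>\<xi>. (a i j \<xi> * c (\<xi> i, \<xi> j)) * (sq_inner (\<xi> i, \<xi> j) - c (\<xi> i, \<xi> j)) \<partial>P n) = 0"
  shows "integrable (P n) (\<lambda>\<xi>. (\<Sum>i=1..n. \<Sum>j=1..n. (A i j \<xi>)\<^sup>2 * (sq_inner (\<xi> i, \<xi> j) - c (\<xi> i, \<xi> j)))\<^sup>2)"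
    and "(\<integral>\<xi>. (\<Sum>i=1..n. \<Sum>j=1..n. (A i j \<xi>)\<^sup>2 * (sq_inner (\<xi> i, \<xi> j) - c (\<xi> i, \<xi> j)))\<^sup>2 \<partial>P n) \<le> 4 * \<kappa>\<^sup>2 * R\<^sup>2 * (real n * m8)"
proof -
  let ?e = "\<lambda>i j \<xi>. sq_inner (\<xi> i, \<xi> j) - c (\<xi> i, \<xi> j)"
  have pm: "(\<lambda>\<xi>. (\<xi> i, \<xi> j)) \<in> P n \<rightarrow>\<^sub>M D \<Otimes>\<^sub>M D" for i j by (intro measurable_Pair component_measurable)
  have Ym: "(\<lambda>\<xi>. sq_inner (\<xi> i, \<xi> j)) \<in> borel_measurable (P n)" for i j by (rule measurable_compose[OF pm sq_inner_measurable])
  have cm: "(\<lambda>\<xi>. c (\<xi> i, \<xi> j)) \<in> borel_measurable (P n)" for i j by (rule measurable_compose[OF pm c(1)])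
  have em: "?e i j \<in> borel_measurable (P n)" for i j by (rule borel_measurable_diff[OF Ym cm])
  have Y2: "integrable (P n) (\<lambda>\<xi>. (sq_inner (\<xi> i, \<xi> j))\<^sup>2)" and c2: "integrable (P n) (\<lambda>\<xi>. (c (\<xi> i, \<xi> j))\<^sup>2)"
    if ij: "i \<in> {1..n}" "j \<in> {1..n}" "i \<noteq> j" for i j
    using pair_integral(1)[OF ij borel_measurable_power[OF sq_inner_measurable], of 2] integrable_sq_inner(2)
      pair_integral(1)[OF ij borel_measurable_power[OF c(1)], of 2] c(2) by simp_all
  have e2: "integrable (P n) (\<lambda>\<xi>. (?e i j \<xi>)\<^sup>2)" if ij: "i \<in> {1..n}" "j \<in> {1..n}" "i \<noteq> j" for i j
  proof -
    have eq: "(?e i j \<xi>)\<^sup>2 = (sq_inner (\<xi> i, \<xi> j))\<^sup>2 - 2 * (sq_inner (\<xi> i, \<xi> j) * c (\<xi> i, \<xi> j)) + (c (\<xi> i, \<xi> j))\<^sup>2" for \<xi>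
      by (simp add: power2_diff)
    show ?thesis
      unfolding eq by (intro Bochner_Integration.integrable_add Bochner_Integration.integrable_diff integrable_mult_right
        integrable_mult_of_squares Ym cm Y2 c2 ij)
  qed
  show "integrable (P n) (\<lambda>\<xi>. (\<Sum>i=1..n. \<Sum>j=1..n. (A i j \<xi>)\<^sup>2 * ?e i j \<xi>)\<^sup>2)"
    by (rule expectation_pair_sum_sq_le(1)[of ?e]) (fact em e2 disjoint)+
  have "(\<integral>\<xi>. (\<Sum>i=1..n. \<Sum>j=1..n. (A i j \<xi>)\<^sup>2 * ?e i j \<xi>)\<^sup>2 \<partial>P n) \<le> 4 * \<kappa>\<^sup>2 * R * (\<integral>\<xi>. (\<Sum>i=1..n. \<Sum>j=1..n. A i j \<xi> * (?e i j \<xi>)\<^sup>2) \<partial>P n)"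
    by (rule expectation_pair_sum_sq_le(2)[of ?e]) (fact em e2 disjoint)+
  also have "\<dots> \<le> 4 * \<kappa>\<^sup>2 * R * (R * (real n * m8))"
  proof (intro mult_left_mono)
    have wi: "integrable (P n) (\<lambda>\<xi>. A i j \<xi> * (f \<xi>)\<^sup>2)" if ij: "i \<in> {1..n}" "j \<in> {1..n}" and f: "f \<in> borel_measurable (P n)"
      and f2: "i \<noteq> j \<Longrightarrow> integrable (P n) (\<lambda>\<xi>. (f \<xi>)\<^sup>2)" for i j f
    proof (cases "i = j")
      case False
      have i: "integrable (P n) (\<lambda>\<xi>. \<kappa> * (f \<xi>)\<^sup>2)" using f2[OF False] by (rule integrable_mult_right)
      show ?thesis
      proof (rule Bochner_Integration.integrable_bound[OF i])
        show "(\<lambda>\<xi>. A i j \<xi> * (f \<xi>)\<^sup>2) \<in> borel_measurable (P n)" by (intro borel_measurable_times borel_measurable_power A_measurable f)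
        have "A i j \<xi> * (f \<xi>)\<^sup>2 \<le> \<kappa> * (f \<xi>)\<^sup>2" for \<xi> by (intro mult_right_mono A_bounds) simp
        then show "AE \<xi> in P n. norm (A i j \<xi> * (f \<xi>)\<^sup>2) \<le> norm (\<kappa> * (f \<xi>)\<^sup>2)"
          using A_bounds kappa_nonneg by (intro AE_I2) (simp add: abs_mult)
      qed
    qed (simp add: A_def)
    have "(\<integral>\<xi>. (\<Sum>i=1..n. \<Sum>j=1..n. A i j \<xi> * (?e i j \<xi>)\<^sup>2) \<partial>P n) = (\<Sum>i=1..n. \<Sum>j=1..n. \<integral>\<xi>. A i j \<xi> * (?e i j \<xi>)\<^sup>2 \<partial>P n)"
      by (rule integral_sum_sum) (intro wi em e2, assumption+)
    also have "\<dots> \<le> (\<Sum>i=1..n. \<Sum>j=1..n. \<integral>\<xi>. A i j \<xi> * (sq_inner (\<xi> i, \<xi> j))\<^sup>2 \<partial>P n)"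
    proof (intro sum_mono)
      fix i j assume ij: "i \<in> {1..n}" "j \<in> {1..n}"
      show "(\<integral>\<xi>. A i j \<xi> * (?e i j \<xi>)\<^sup>2 \<partial>P n) \<le> (\<integral>\<xi>. A i j \<xi> * (sq_inner (\<xi> i, \<xi> j))\<^sup>2 \<partial>P n)"
      proof (cases "i < j")
        case True
        then have ne: "i \<noteq> j" by simp
        show ?thesis
        proof (rule weighted_second_moment_centered_le[OF A_measurable A_bounds(1,3) Ym Y2[OF ij ne] cm c2[OF ij ne]])
          show "(\<integral>\<xi>. (A i j \<xi> * c (\<xi> i, \<xi> j)) * ?e i j \<xi> \<partial>P n) = 0"
            using same[OF ij True] True by (simp add: A_def)
        qed
      qed (simp add: A_def)
    qed
    also have "\<dots> = (\<integral>\<xi>. (\<Sum>i=1..n. \<Sum>j=1..n. A i j \<xi> * (sq_inner (\<xi> i, \<xi> j))\<^sup>2) \<partial>P n)"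
      by (rule integral_sum_sum[symmetric]) (intro wi Ym Y2, assumption+)
    also note expectation_weighted_sq_le
    finally show "(\<integral>\<xi>. (\<Sum>i=1..n. \<Sum>j=1..n. A i j \<xi> * (?e i j \<xi>)\<^sup>2) \<partial>P n) \<le> R * (real n * m8)" .
  qed (use R_nonneg in simp)
  finally show "(\<integral>\<xi>. (\<Sum>i=1..n. \<Sum>j=1..n. (A i j \<xi>)\<^sup>2 * ?e i j \<xi>)\<^sup>2 \<partial>P n) \<le> 4 * \<kappa>\<^sup>2 * R\<^sup>2 * (real n * m8)"
    by (simp add: power2_eq_square mult_ac)
qed

definition s2 :: "(nat \<Rightarrow> 'h \<times> 'x) \<Rightarrow> real" where
  "s2 \<xi> = 4 * (\<Sum>i=1..n. \<Sum>j=1..n. (A i j \<xi>)\<^sup>2 * cond_sq_inner (\<xi> i, \<xi> j))"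

lemma cond_sq_inner_component [measurable]: "(\<lambda>\<xi>. cond_sq_inner (\<xi> i, \<xi> j)) \<in> borel_measurable (P m)"
  by (rule measurable_compose[OF measurable_Pair[OF component_measurable component_measurable] cond_sq_inner_measurable])

lemma sq_inner_component [measurable]: "(\<lambda>\<xi>. sq_inner (\<xi> i, \<xi> j)) \<in> borel_measurable (P m)"
  by (rule measurable_compose[OF measurable_Pair[OF component_measurable component_measurable] sq_inner_measurable])

lemma s2_measurable [measurable]: "s2 \<in> borel_measurable (P n)"
  unfolding s2_def
  by (intro borel_measurable_times borel_measurable_const borel_measurable_sum borel_measurable_power A_measurable cond_sq_inner_component)

lemma unaffected_A: "unaffected k (A i j)"
  unfolding A_def using a_unaffected by (cases "i < j") simp_all

lemma unaffected_s2: "unaffected k s2"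
proof -
  have "unaffected k (\<lambda>\<xi>. (A i j \<xi>)\<^sup>2 * cond_sq_inner (\<xi> i, \<xi> j))" for i j
    by (rule unaffected_mult[OF unaffected_comp1[OF unaffected_A] unaffected_cond_sq_inner])
  then have "unaffected k (\<lambda>\<xi>. \<Sum>i=1..n. \<Sum>j=1..n. (A i j \<xi>)\<^sup>2 * cond_sq_inner (\<xi> i, \<xi> j))"
    by (intro unaffected_sum)
  then show ?thesis unfolding s2_def by (rule unaffected_comp1)
qed

lemma V_minus_s2: "V \<xi> - s2 \<xi> = 4 * (\<Sum>i=1..n. \<Sum>j=1..n. (A i j \<xi>)\<^sup>2 * (sq_inner (\<xi> i, \<xi> j) - cond_sq_inner (\<xi> i, \<xi> j)))"
proof -
  have "V \<xi> = 4 * (\<Sum>i=1..n. \<Sum>j=1..n. (A i j \<xi>)\<^sup>2 * sq_inner (\<xi> i, \<xi> j))"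
    unfolding V_def by (subst sum.swap) (simp add: g_def sq_inner_def power_mult_distrib)
  then show ?thesis by (simp add: s2_def right_diff_distrib sum_subtractf)
qed

lemma expectation_V_minus_s2_sq_le:
  "integrable (P n) (\<lambda>\<xi>. (V \<xi> - s2 \<xi>)\<^sup>2)" "(\<integral>\<xi>. (V \<xi> - s2 \<xi>)\<^sup>2 \<partial>P n) \<le> 64 * \<kappa>\<^sup>2 * R\<^sup>2 * (real n * m8)"
proof -
  have disjoint: "(\<integral>\<xi>. ((a i j \<xi>)\<^sup>2 * (sq_inner (\<xi> i, \<xi> j) - cond_sq_inner (\<xi> i, \<xi> j))) * ((a k l \<xi>)\<^sup>2 * (sq_inner (\<xi> k, \<xi> l) - cond_sq_inner (\<xi> k, \<xi> l))) \<partial>P n) = 0"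
    if ijkl: "{i, j, k, l} \<subseteq> {1..n}" "i < j" "k < l" "{i, j} \<inter> {k, l} = {}" for i j k l
  proof -
    let ?\<phi> = "\<lambda>\<xi>. (a i j \<xi>)\<^sup>2 * ((a k l \<xi>)\<^sup>2 * (sq_inner (\<xi> k, \<xi> l) - cond_sq_inner (\<xi> k, \<xi> l)))"
    have u: "unaffected m ?\<phi>" if "m \<noteq> k" "m \<noteq> l" for m
    proof -
      have "unaffected m (\<lambda>\<xi>. (sq_inner (\<xi> k, \<xi> l)))"
        unfolding sq_inner_def fst_conv snd_conv by (rule unaffected_comp1[OF unaffected_inner]) (use that in auto)
      from unaffected_comp2[OF this unaffected_cond_sq_inner, of "(-)"]
      have "unaffected m (\<lambda>\<xi>. sq_inner (\<xi> k, \<xi> l) - cond_sq_inner (\<xi> k, \<xi> l))" .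
      then show ?thesis
        by (rule unaffected_mult[OF unaffected_comp1[OF a_unaffected] unaffected_mult[OF unaffected_comp1[OF a_unaffected]]])
    qed
    have "(\<integral>\<xi>. ?\<phi> \<xi> * (sq_inner (\<xi> i, \<xi> j) - cond_sq_inner (\<xi> i, \<xi> j)) \<partial>P n) = 0"
    proof (rule cond_variance_term)
      show "?\<phi> \<in> borel_measurable (P n)"
        by (intro borel_measurable_times borel_measurable_power borel_measurable_diff a_measurable sq_inner_component cond_sq_inner_component)
      show "unaffected i ?\<phi>" "unaffected j ?\<phi>" using ijkl(4) by (auto intro!: u)
    qed (use ijkl in auto)
    then show ?thesis by (simp add: mult_ac)
  qed
  have same: "(\<integral>\<xi>. (a i j \<xi> * cond_sq_inner (\<xi> i, \<xi> j)) * (sq_inner (\<xi> i, \<xi> j) - cond_sq_inner (\<xi> i, \<xi> j)) \<partial>P n) = 0"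
    if "i \<in> {1..n}" "j \<in> {1..n}" "i < j" for i j
    using that by (intro cond_variance_term unaffected_mult a_unaffected unaffected_cond_sq_inner borel_measurable_times a_measurable cond_sq_inner_component) auto
  note b = centered_pair_sum_sq_le[OF cond_sq_inner_measurable integrable_cond_sq_inner_sq disjoint same]
  show "integrable (P n) (\<lambda>\<xi>. (V \<xi> - s2 \<xi>)\<^sup>2)"
    unfolding V_minus_s2 power_mult_distrib by (rule integrable_mult_right[OF b(1)])
  have "(\<integral>\<xi>. (\<Sum>i=1..n. \<Sum>j=1..n. (A i j \<xi>)\<^sup>2 * (sq_inner (\<xi> i, \<xi> j) - cond_sq_inner (\<xi> i, \<xi> j)))\<^sup>2 \<partial>P n) \<le> 4 * \<kappa>\<^sup>2 * R\<^sup>2 * (real n * m8)"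
    by (rule b(2))
  then have "4\<^sup>2 * (\<integral>\<xi>. (\<Sum>i=1..n. \<Sum>j=1..n. (A i j \<xi>)\<^sup>2 * (sq_inner (\<xi> i, \<xi> j) - cond_sq_inner (\<xi> i, \<xi> j)))\<^sup>2 \<partial>P n) \<le> 4\<^sup>2 * (4 * \<kappa>\<^sup>2 * R\<^sup>2 * (real n * m8))"
    by (rule mult_left_mono) simp
  also have "\<dots> = 64 * \<kappa>\<^sup>2 * R\<^sup>2 * (real n * m8)" by simp
  finally show "(\<integral>\<xi>. (V \<xi> - s2 \<xi>)\<^sup>2 \<partial>P n) \<le> 64 * \<kappa>\<^sup>2 * R\<^sup>2 * (real n * m8)"
    unfolding V_minus_s2 power_mult_distrib integral_mult_right_zero .
qed

end

section \<open>The studentised quadratic form\<close>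

lemma abs_sqrt_minus_1_le:
  assumes "0 \<le> y" shows "\<bar>sqrt y - 1\<bar> \<le> \<bar>y - 1\<bar>"
proof -
  have "\<bar>sqrt y - 1\<bar> * 1 \<le> \<bar>sqrt y - 1\<bar> * \<bar>sqrt y + 1\<bar>" using assms by (intro mult_left_mono) auto
  also have "\<dots> = \<bar>(sqrt y - 1) * (sqrt y + 1)\<bar>" by (simp only: abs_mult)
  also have "(sqrt y - 1) * (sqrt y + 1) = y - 1" using assms by (simp add: algebra_simps)
  finally show ?thesis by simp
qed

lemma (in prob_space) second_moment_tail_le:
  assumes f: "f \<in> borel_measurable M" "integrable M (\<lambda>x. (f x)\<^sup>2)" "(\<integral>x. (f x)\<^sup>2 \<partial>M) \<le> b" and c: "0 < c"
  shows "prob {x \<in> space M. c < \<bar>f x\<bar>} \<le> b / c\<^sup>2"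
proof -
  have "prob {x \<in> space M. c < \<bar>f x\<bar>} \<le> prob {x \<in> space M. c \<le> \<bar>f x\<bar>}"
    using f(1) by (intro finite_measure_mono) auto
  also have "\<dots> \<le> (\<integral>x. (f x)\<^sup>2 \<partial>M) / c\<^sup>2"
    using f(1) by (rule second_moment_method) (use f c in auto)
  also have "\<dots> \<le> b / c\<^sup>2" using f(3) by (rule divide_right_mono) simp
  finally show ?thesis .
qed

lemma (in prob_space) expectation_abs_le_sqrt:
  assumes f: "f \<in> borel_measurable M" "integrable M (\<lambda>x. (f x)\<^sup>2)" "(\<integral>x. (f x)\<^sup>2 \<partial>M) \<le> (b :: real)"
  shows "integrable M f" "(\<integral>x. \<bar>f x\<bar> \<partial>M) \<le> sqrt b"
proof -
  show i: "integrable M f" using f(1,2) by (rule square_integrable_imp_integrable)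
  have i2: "integrable M (\<lambda>x. (\<bar>f x\<bar>)\<^sup>2)" using f(2) by simp
  have ia: "integrable M (\<lambda>x. \<bar>f x\<bar>)" using i by simp
  have "0 \<le> variance (\<lambda>x. \<bar>f x\<bar>)" by (intro integral_nonneg_AE) simp
  also have "\<dots> = expectation (\<lambda>x. \<bar>f x\<bar>\<^sup>2) - (expectation (\<lambda>x. \<bar>f x\<bar>))\<^sup>2"
    by (rule variance_eq[OF ia i2])
  finally have "(expectation (\<lambda>x. \<bar>f x\<bar>))\<^sup>2 \<le> b" using f(3) by simp
  then show "(\<integral>x. \<bar>f x\<bar> \<partial>M) \<le> sqrt b" by (rule real_le_rsqrt)
qed

text \<open>The exponential is Lipschitz off the bad event and has modulus 1 on it. The lemma serves
  to exchange the normalisation and, with w = 0, to exchange the selected statistic for the one in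
  the true direction.\<close>

lemma (in prob_space) cmod_expectation_iexp_diff_le:
  assumes [measurable]: "f \<in> borel_measurable M" "g \<in> borel_measurable M" "w \<in> borel_measurable M" "Measurable.pred M bad"
    and w: "integrable M w" "\<And>x. 0 \<le> w x"
    and le: "\<And>x. x \<in> space M \<Longrightarrow> \<not> bad x \<Longrightarrow> \<bar>f x - g x\<bar> \<le> w x"
  shows "cmod ((\<integral>x. iexp (t * f x) \<partial>M) - (\<integral>x. iexp (t * g x) \<partial>M)) \<le> 2 * prob {x \<in> space M. bad x} + \<bar>t\<bar> * (\<integral>x. w x \<partial>M)"
proof -
  have if': "integrable M (\<lambda>x. iexp (t * f x))" "integrable M (\<lambda>x. iexp (t * g x))"
    by (rule integrable_const_bound[where B = 1]; simp)+
  have "cmod ((\<integral>x. iexp (t * f x) \<partial>M) - (\<integral>x. iexp (t * g x) \<partial>M)) = cmod (\<integral>x. (iexp (t * f x) - iexp (t * g x)) \<partial>M)"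
    using if' by simp
  also have "\<dots> \<le> (\<integral>x. cmod (iexp (t * f x) - iexp (t * g x)) \<partial>M)"
    by (rule integral_norm_bound)
  also have "\<dots> \<le> (\<integral>x. 2 * indicator {x \<in> space M. bad x} x + \<bar>t\<bar> * w x \<partial>M)"
  proof (rule integral_mono)
    show "integrable M (\<lambda>x. cmod (iexp (t * f x) - iexp (t * g x)))" using if' by (intro integrable_norm Bochner_Integration.integrable_diff)
    show "integrable M (\<lambda>x. 2 * indicator {x \<in> space M. bad x} x + \<bar>t\<bar> * w x)"
      using w by (intro Bochner_Integration.integrable_add integrable_mult_right integrable_real_indicator) (auto simp: emeasure_eq_measure)
    fix x assume x: "x \<in> space M"
    show "cmod (iexp (t * f x) - iexp (t * g x)) \<le> 2 * indicator {x \<in> space M. bad x} x + \<bar>t\<bar> * w x"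
    proof (cases "bad x")
      case True
      have "cmod (iexp (t * f x) - iexp (t * g x)) \<le> cmod (iexp (t * f x)) + cmod (iexp (t * g x))" by (rule norm_triangle_ineq4)
      also have "\<dots> = 2" by simp
      moreover have "0 \<le> \<bar>t\<bar> * w x" using w(2) by simp
      ultimately show ?thesis using x True by simp
    next
      case False
      have "iexp (t * f x) - iexp (t * g x) = iexp (t * g x) * (iexp (t * (f x - g x)) - 1)"
        by (simp add: right_diff_distrib exp_diff)
      then have "cmod (iexp (t * f x) - iexp (t * g x)) = cmod (iexp (t * (f x - g x)) - 1)"
        by (simp add: norm_mult)
      also have "\<dots> \<le> \<bar>t * (f x - g x)\<bar>" using iexp_approx1[of "t * (f x - g x)" 0] by simp
      also have "\<dots> \<le> \<bar>t\<bar> * w x" unfolding abs_mult using le[OF x False] by (intro mult_left_mono) auto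
      finally show ?thesis using False by simp
    qed
  qed
  also have "\<dots> = 2 * prob {x \<in> space M. bad x} + \<bar>t\<bar> * (\<integral>x. w x \<partial>M)"
  proof (subst Bochner_Integration.integral_add)
    show "integrable M (\<lambda>x. 2 * indicator {x \<in> space M. bad x} x :: real)"
      by (intro integrable_mult_right integrable_real_indicator) (auto simp: emeasure_eq_measure)
  qed (use w in simp_all)
  finally show ?thesis .
qed

context weighted_design
begin

lemma unaffected_increment: "k < j \<Longrightarrow> unaffected j (increment k)"
proof -
  assume kj: "k < j"
  have "unaffected j (\<lambda>\<xi>. A i k \<xi> * g i k \<xi>)" for i
  proof (cases "i < k")
    case True
    then show ?thesis unfolding g_def by (intro unaffected_mult unaffected_A unaffected_inner) (use kj in auto)
  next
    case False
    then show ?thesis by (simp add: A_def)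
  qed
  then have "unaffected j (\<lambda>\<xi>. \<Sum>i=1..n. A i k \<xi> * g i k \<xi>)" by (rule unaffected_sum)
  from unaffected_comp1[OF this, of "\<lambda>s. 2 * s"] show ?thesis
    unfolding increment_def[abs_def] .
qed

text \<open>The clamp keeps the scale away from \<open>0\<close>; like \<open>s2\<close> it is a function of the covariates only, so dividing
  by it preserves the martingale structure.\<close>

definition scale :: "real \<Rightarrow> (nat \<Rightarrow> 'h \<times> 'x) \<Rightarrow> real" where
  "scale s0 \<xi> = sqrt (max (s2 \<xi>) s0)"

lemma scale_measurable [measurable]: "scale s0 \<in> borel_measurable (P n)"
  unfolding scale_def by measurable

lemma unaffected_scale: "unaffected k (scale s0)"
  unfolding scale_def[abs_def] by (rule unaffected_comp1[OF unaffected_s2])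

lemma scale_ge: "0 < s0 \<Longrightarrow> sqrt s0 \<le> scale s0 \<xi>"
  unfolding scale_def by simp

lemma scale_pos: "0 < s0 \<Longrightarrow> 0 < scale s0 \<xi>"
  using scale_ge[of s0 \<xi>] real_sqrt_gt_zero[of s0] by linarith

text \<open>Increments before \<open>j\<close> do not contain the j-th noise and the scale contains
  no noise, so a function of the past is unaffected by noise \<open>j\<close>. It may still depend
  on every covariate, later ones included, which is why no filtration in the order of the
  observations is used.\<close>

lemma martingale_differences_increment:
  assumes s0: "0 < s0"
  shows "martingale_differences (P n) (\<lambda>k \<xi>. increment k \<xi> / scale s0 \<xi>) n"
proof (intro martingale_differences.intro martingale_differences_axioms.intro)
  show "prob_space (P n)" by (rule P.prob_space_axioms)
  show "(\<lambda>\<xi>. increment k \<xi> / scale s0 \<xi>) \<in> borel_measurable (P n)" for k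
    by (intro borel_measurable_divide increment_measurable scale_measurable)
  show "integrable (P n) (\<lambda>\<xi>. (increment k \<xi> / scale s0 \<xi>) ^ 4)" if k: "k \<in> {1..n}" for k
  proof (rule Bochner_Integration.integrable_bound)
    show "integrable (P n) (\<lambda>\<xi>. increment k \<xi> ^ 4 / sqrt s0 ^ 4)"
      by (intro integrable_divide expectation_increment4_le(1) k)
    show "(\<lambda>\<xi>. (increment k \<xi> / scale s0 \<xi>) ^ 4) \<in> borel_measurable (P n)"
      by (intro borel_measurable_power borel_measurable_divide increment_measurable scale_measurable)
    have "(increment k \<xi> / scale s0 \<xi>) ^ 4 \<le> increment k \<xi> ^ 4 / sqrt s0 ^ 4" for \<xi>
      unfolding power_divide using s0 scale_ge[OF s0, of \<xi>] by (intro divide_left_mono power_mono mult_pos_pos zero_less_power scale_pos) auto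
    then show "AE \<xi> in P n. norm ((increment k \<xi> / scale s0 \<xi>) ^ 4) \<le> norm (increment k \<xi> ^ 4 / sqrt s0 ^ 4)"
      by (intro AE_I2) simp
  qed
  fix j \<phi> C
  assume j: "j \<in> {1..n}" and \<phi>: "\<phi> \<in> borel_measurable (P n)" and C: "\<And>x. \<bar>\<phi> x\<bar> \<le> (C::real)"
    and past: "\<And>x y. (\<And>k. k \<in> {1..<j} \<Longrightarrow> increment k x / scale s0 x = increment k y / scale s0 y) \<Longrightarrow> \<phi> x = \<phi> y"
  have u\<phi>: "unaffected j \<phi>"
    unfolding unaffected_def
  proof (intro allI)
    fix \<xi> a a' b
    show "\<phi> (\<xi>(j := (a, b))) = \<phi> (\<xi>(j := (a', b)))"
    proof (rule past)
      fix k assume "k \<in> {1..<j}"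
      then have "unaffected j (increment k)" by (intro unaffected_increment) auto
      then show "increment k (\<xi>(j := (a, b))) / scale s0 (\<xi>(j := (a, b))) = increment k (\<xi>(j := (a', b))) / scale s0 (\<xi>(j := (a', b)))"
        using unaffected_scale[of j s0] unfolding unaffected_def by metis
    qed
  qed
  let ?f = "\<lambda>i \<xi>. \<phi> \<xi> * (2 * A i j \<xi> / scale s0 \<xi>)"
  have m: "?f i \<in> borel_measurable (P n)" for i
    by (intro borel_measurable_times borel_measurable_divide borel_measurable_const \<phi> A_measurable scale_measurable)
  have u: "unaffected j (?f i)" for i
    by (rule unaffected_mult[OF u\<phi>], rule unaffected_comp2[where F = "\<lambda>x y. 2 * x / y", OF unaffected_A unaffected_scale])
  have z: "(\<integral>\<xi>. ?f i \<xi> * g i j \<xi> \<partial>P n) = 0" for i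
  proof (cases "i < j")
    case True
    then show ?thesis unfolding g_def using zero_mean_term'[OF j _ m u] by auto
  next
    case False then show ?thesis by (simp add: A_def)
  qed
  have int: "integrable (P n) (\<lambda>\<xi>. ?f i \<xi> * g i j \<xi>)" if i: "i \<in> {1..n}" for i
  proof (rule integrable_envelope_bound[where k = 2 and C = "C * (2 * \<kappa> / sqrt s0)"])
    show "(\<lambda>\<xi>. ?f i \<xi> * g i j \<xi>) \<in> borel_measurable (P n)" by (intro borel_measurable_times m g_measurable)
    fix \<xi>
    have "\<bar>2 * A i j \<xi> / scale s0 \<xi>\<bar> = 2 * A i j \<xi> / scale s0 \<xi>"
      using A_bounds(1)[of i j \<xi>] scale_pos[OF s0, of \<xi>] by simp
    also have "\<dots> \<le> 2 * \<kappa> / sqrt s0"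
      using A_bounds[of i j \<xi>] s0 scale_ge[OF s0, of \<xi>] kappa_nonneg by (intro frac_le) auto
    finally have "\<bar>2 * A i j \<xi> / scale s0 \<xi>\<bar> \<le> 2 * \<kappa> / sqrt s0" .
    moreover have "0 \<le> C" using C[of \<xi>] by linarith
    ultimately show "\<bar>?f i \<xi> * g i j \<xi>\<bar> \<le> C * (2 * \<kappa> / sqrt s0) * envelope n \<xi> ^ 2"
      unfolding abs_mult[of "?f i \<xi>"] abs_mult[of "\<phi> \<xi>"] using kappa_nonneg s0
      by (intro mult_mono C abs_g_le_envelope i j mult_nonneg_nonneg) auto
  qed simp
  have "(\<integral>\<xi>. \<phi> \<xi> * (increment j \<xi> / scale s0 \<xi>) \<partial>P n) = (\<integral>\<xi>. (\<Sum>i=1..n. ?f i \<xi> * g i j \<xi>) \<partial>P n)"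
    unfolding increment_def times_divide_eq_right sum_distrib_left sum_divide_distrib
    by (intro arg_cong[where f = "integral\<^sup>L (P n)"] ext sum.cong refl) (simp add: mult_ac)
  also have "\<dots> = (\<Sum>i=1..n. \<integral>\<xi>. ?f i \<xi> * g i j \<xi> \<partial>P n)"
    by (rule Bochner_Integration.integral_sum) (rule int)
  also have "\<dots> = 0" by (simp only: z sum.neutral_const)
  finally show "(\<integral>\<xi>. \<phi> \<xi> * (increment j \<xi> / scale s0 \<xi>) \<partial>P n) = 0" .
qed

text \<open>The factor 2 leaves room for the clamp: V \<ge> 2 s0 and a small V - s2 force s2 \<ge>
  s0, so off this event the scale is the true conditional standard deviation.\<close>

definition bad :: "real \<Rightarrow> real \<Rightarrow> (nat \<Rightarrow> 'h \<times> 'x) \<Rightarrow> bool" where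
  "bad s0 \<delta> \<xi> \<longleftrightarrow> V \<xi> < 2 * s0 \<or> \<delta> * s0 / 2 < \<bar>cross \<xi>\<bar> \<or> \<delta> * s0 / 2 < \<bar>V \<xi> - s2 \<xi>\<bar>"

lemma bad_measurable [measurable]: "Measurable.pred (P n) (bad s0 \<delta>)"
  unfolding bad_def by measurable

lemma prob_bad_le:
  assumes s0: "0 < s0" and \<delta>: "0 < \<delta>"
  shows "P.prob n {\<xi> \<in> space (P n). bad s0 \<delta> \<xi>} \<le> P.prob n {\<xi> \<in> space (P n). V \<xi> < 2 * s0} +
    (256 * \<kappa> * R ^ 3 * (real n * m8) + 256 * \<kappa>\<^sup>2 * R\<^sup>2 * (real n * m8)) / (\<delta> * s0)\<^sup>2"
proof -
  let ?A = "{\<xi> \<in> space (P n). V \<xi> < 2 * s0}" and ?B = "{\<xi> \<in> space (P n). \<delta> * s0 / 2 < \<bar>cross \<xi>\<bar>}"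
    and ?C = "{\<xi> \<in> space (P n). \<delta> * s0 / 2 < \<bar>V \<xi> - s2 \<xi>\<bar>}"
  have m: "?A \<in> sets (P n)" "?B \<in> sets (P n)" "?C \<in> sets (P n)" by measurable
  have d: "0 < \<delta> * s0 / 2" using s0 \<delta> by simp
  have "{\<xi> \<in> space (P n). bad s0 \<delta> \<xi>} = ?A \<union> (?B \<union> ?C)" unfolding bad_def by auto
  then have "P.prob n {\<xi> \<in> space (P n). bad s0 \<delta> \<xi>} \<le> P.prob n ?A + (P.prob n ?B + P.prob n ?C)"
    using m by (simp only:) (intro order.trans[OF measure_Un_le] add_left_mono measure_Un_le; simp)
  also have "P.prob n ?B \<le> 64 * \<kappa> * R ^ 3 * (real n * m8) / (\<delta> * s0 / 2)\<^sup>2"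
    by (rule P.second_moment_tail_le[OF cross_measurable expectation_cross_sq_le d])
  also have "P.prob n ?C \<le> 64 * \<kappa>\<^sup>2 * R\<^sup>2 * (real n * m8) / (\<delta> * s0 / 2)\<^sup>2"
    by (rule P.second_moment_tail_le[OF _ expectation_V_minus_s2_sq_le d]) measurable
  finally show ?thesis by (simp add: power_divide add_divide_distrib)
qed

lemma not_bad:
  assumes s0: "0 < s0" and \<delta>: "0 < \<delta>" "\<delta> \<le> 1 / 2" and nb: "\<not> bad s0 \<delta> \<xi>"
  shows "\<bar>(\<Sum>k=1..n. (increment k \<xi> / scale s0 \<xi>)\<^sup>2) - 1\<bar> \<le> \<delta>"
    and "\<bar>scale s0 \<xi> / sqrt (V \<xi>) - 1\<bar> \<le> \<delta>"
    and "0 < V \<xi>"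
proof -
  have b: "2 * s0 \<le> V \<xi>" "\<bar>cross \<xi>\<bar> \<le> \<delta> * s0 / 2" "\<bar>V \<xi> - s2 \<xi>\<bar> \<le> \<delta> * s0 / 2"
    using nb unfolding bad_def by auto
  have "\<delta> * s0 \<le> 1 / 2 * s0" using \<delta> s0 by (intro mult_right_mono) auto
  then have s2: "s0 \<le> s2 \<xi>" using b(1,3) s0 by linarith
  show V: "0 < V \<xi>" using b(1) s0 by linarith
  have sc: "scale s0 \<xi> = sqrt (s2 \<xi>)" unfolding scale_def using s2 by (simp add: max_def)
  have "(\<Sum>k=1..n. (increment k \<xi> / scale s0 \<xi>)\<^sup>2) = (V \<xi> + cross \<xi>) / s2 \<xi>"
    unfolding power_divide sum_divide_distrib[symmetric] sum_increment_sq sc using s2 s0 by simp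
  also have "\<dots> - 1 = (V \<xi> - s2 \<xi> + cross \<xi>) / s2 \<xi>" using s2 s0 by (simp add: field_simps)
  finally have eq: "\<bar>(\<Sum>k=1..n. (increment k \<xi> / scale s0 \<xi>)\<^sup>2) - 1\<bar> = \<bar>V \<xi> - s2 \<xi> + cross \<xi>\<bar> / s2 \<xi>"
    using s2 s0 by simp
  have "\<bar>V \<xi> - s2 \<xi> + cross \<xi>\<bar> \<le> \<delta> * s0" using b(2,3) by linarith
  then have "\<bar>V \<xi> - s2 \<xi> + cross \<xi>\<bar> / s2 \<xi> \<le> (\<delta> * s0) / s0"
    using s2 s0 \<delta> by (intro frac_le) auto
  then show "\<bar>(\<Sum>k=1..n. (increment k \<xi> / scale s0 \<xi>)\<^sup>2) - 1\<bar> \<le> \<delta>" unfolding eq using s0 by simp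
  have "\<bar>scale s0 \<xi> / sqrt (V \<xi>) - 1\<bar> \<le> \<bar>s2 \<xi> / V \<xi> - 1\<bar>"
    unfolding sc real_sqrt_divide[symmetric] using s2 s0 V by (intro abs_sqrt_minus_1_le) auto
  also have "\<dots> = \<bar>V \<xi> - s2 \<xi>\<bar> / V \<xi>" using V by (simp add: field_simps abs_minus_commute)
  also have "\<dots> \<le> (\<delta> * s0) / s0"
  proof (rule frac_le)
    show "0 \<le> \<delta> * s0" using s0 \<delta> by simp
    then show "\<bar>V \<xi> - s2 \<xi>\<bar> \<le> \<delta> * s0" using b(3) by linarith
  qed (use s0 b(1) in auto)
  finally show "\<bar>scale s0 \<xi> / sqrt (V \<xi>) - 1\<bar> \<le> \<delta>" using s0 by simp
qed

text \<open>The martingale theorem handles \<open>W / scale\<close>. Passing to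
  \<open>sqrt V\<close> and inserting the factor \<rho> changes the statistic off the bad event by
  at most (|\<rho> - 1| + \<rho> \<delta>) |W| / sqrt s0, whose mean is bounded through the second
  moment of \<open>W\<close>.\<close>

theorem characteristic_function_studentized:
  assumes s0: "0 < s0" and \<delta>: "0 < \<delta>" "\<delta> \<le> 1 / 2" and \<Lambda>: "160 * \<kappa>\<^sup>2 * R\<^sup>2 * (real n * m8) \<le> \<Lambda> * s0\<^sup>2" "0 < \<Lambda>"
    and \<rho>: "0 \<le> \<rho>" and \<pi>: "P.prob n {\<xi> \<in> space (P n). bad s0 \<delta> \<xi>} \<le> \<pi>'"
  shows "cmod ((\<integral>\<xi>. iexp (t * (\<rho> * W \<xi> / sqrt (V \<xi>))) \<partial>P n) - of_real (exp (- (t\<^sup>2 / 2)))) \<le>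
    (4 * \<bar>t\<bar> ^ 3 + exp (t\<^sup>2) * (1 + t\<^sup>2) * (1 + \<bar>t\<bar>) + 1) * (sqrt \<Lambda> + \<delta> + \<delta> * sqrt \<Lambda> + \<pi>') + 2 * \<pi>' +
    \<bar>t\<bar> * ((\<bar>\<rho> - 1\<bar> + \<rho> * \<delta>) * sqrt (2 * \<kappa> * R * real n * (m8 + 1) / s0))"
proof -
  interpret MD: martingale_differences "P n" "\<lambda>k \<xi>. increment k \<xi> / scale s0 \<xi>" n
    by (rule martingale_differences_increment[OF s0])
  let ?K = "4 * \<bar>t\<bar> ^ 3 + exp (t\<^sup>2) * (1 + t\<^sup>2) * (1 + \<bar>t\<bar>) + 1"
  let ?B = "{\<xi> \<in> space (P n). bad s0 \<delta> \<xi>}"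
  have Bm: "?B \<in> sets (P n)" by measurable
  have L: "(\<integral>\<xi>. MD.L \<xi> \<partial>P n) \<le> \<Lambda>"
  proof -
    have "(\<integral>\<xi>. MD.L \<xi> \<partial>P n) = (\<Sum>k=1..n. \<integral>\<xi>. (increment k \<xi> / scale s0 \<xi>) ^ 4 \<partial>P n)"
      unfolding MD.L_def by (rule Bochner_Integration.integral_sum) (rule MD.X4)
    also have "\<dots> \<le> (\<Sum>k=1..n. (\<integral>\<xi>. increment k \<xi> ^ 4 \<partial>P n) / s0\<^sup>2)"
    proof (rule sum_mono)
      fix k assume k: "k \<in> {1..n}"
      have s4: "sqrt s0 ^ 4 = s0\<^sup>2" using s0 by (simp add: power4_eq_xxxx power2_eq_square)
      have "(\<integral>\<xi>. (increment k \<xi> / scale s0 \<xi>) ^ 4 \<partial>P n) \<le> (\<integral>\<xi>. increment k \<xi> ^ 4 / s0\<^sup>2 \<partial>P n)"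
      proof (rule integral_mono[OF MD.X4[OF k]])
        show "integrable (P n) (\<lambda>\<xi>. increment k \<xi> ^ 4 / s0\<^sup>2)" by (intro integrable_divide expectation_increment4_le(1) k)
        show "(increment k \<xi> / scale s0 \<xi>) ^ 4 \<le> increment k \<xi> ^ 4 / s0\<^sup>2" for \<xi>
          unfolding power_divide s4[symmetric] using s0 scale_ge[OF s0, of \<xi>] by (intro divide_left_mono power_mono mult_pos_pos zero_less_power scale_pos) auto
      qed
      then show "(\<integral>\<xi>. (increment k \<xi> / scale s0 \<xi>) ^ 4 \<partial>P n) \<le> (\<integral>\<xi>. increment k \<xi> ^ 4 \<partial>P n) / s0\<^sup>2" by simp
    qed
    also have "\<dots> = (\<Sum>k=1..n. \<integral>\<xi>. increment k \<xi> ^ 4 \<partial>P n) / s0\<^sup>2" by (simp only: sum_divide_distrib)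
    also have "\<dots> \<le> (\<Lambda> * s0\<^sup>2) / s0\<^sup>2"
      using \<Lambda>(1) sum_expectation_increment4_le by (intro divide_right_mono) auto
    finally show ?thesis using s0 by simp
  qed
  have sumX: "(\<Sum>k=1..n. increment k \<xi> / scale s0 \<xi>) = W \<xi> / scale s0 \<xi>" for \<xi>
    unfolding W_def by (simp only: sum_divide_distrib)
  have "P.prob n {\<xi> \<in> space (P n). \<delta> < \<bar>(\<Sum>k=1..n. (increment k \<xi> / scale s0 \<xi>)\<^sup>2) - 1\<bar>} \<le> P.prob n ?B"
    by (rule P.finite_measure_mono[OF _ Bm]) (use not_bad(1)[OF s0 \<delta>] in \<open>auto simp: not_less[symmetric]\<close>)
  then have pr: "P.prob n {\<xi> \<in> space (P n). \<delta> < \<bar>(\<Sum>k=1..n. (increment k \<xi> / scale s0 \<xi>)\<^sup>2) - 1\<bar>} \<le> \<pi>'" using \<pi> by linarith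
  have K0: "0 \<le> ?K" by simp
  have "cmod ((\<integral>\<xi>. iexp (t * (W \<xi> / scale s0 \<xi>)) \<partial>P n) - of_real (exp (- (t\<^sup>2 / 2)))) \<le>
      ?K * (sqrt \<Lambda> + \<delta> + \<delta> * sqrt \<Lambda> + P.prob n {\<xi> \<in> space (P n). \<delta> < \<bar>(\<Sum>k=1..n. (increment k \<xi> / scale s0 \<xi>)\<^sup>2) - 1\<bar>})"
    using MD.characteristic_function_close_to_normal[OF _ _ L \<Lambda>(2), of \<delta> t] \<delta> unfolding sumX by simp
  also have "\<dots> \<le> ?K * (sqrt \<Lambda> + \<delta> + \<delta> * sqrt \<Lambda> + \<pi>')" using K0 pr by (intro mult_left_mono add_left_mono)
  finally have 1: "cmod ((\<integral>\<xi>. iexp (t * (W \<xi> / scale s0 \<xi>)) \<partial>P n) - of_real (exp (- (t\<^sup>2 / 2)))) \<le> ?K * (sqrt \<Lambda> + \<delta> + \<delta> * sqrt \<Lambda> + \<pi>')" .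
  let ?c = "(\<bar>\<rho> - 1\<bar> + \<rho> * \<delta>) / sqrt s0"
  have c0: "0 \<le> ?c" using \<rho> \<delta> s0 by simp
  note W1 = P.expectation_abs_le_sqrt[OF W_measurable expectation_W_sq_le]
  have "cmod ((\<integral>\<xi>. iexp (t * (\<rho> * W \<xi> / sqrt (V \<xi>))) \<partial>P n) - (\<integral>\<xi>. iexp (t * (W \<xi> / scale s0 \<xi>)) \<partial>P n)) \<le>
      2 * P.prob n ?B + \<bar>t\<bar> * (\<integral>\<xi>. ?c * \<bar>W \<xi>\<bar> \<partial>P n)"
  proof (rule P.cmod_expectation_iexp_diff_le)
    show "integrable (P n) (\<lambda>\<xi>. ?c * \<bar>W \<xi>\<bar>)" by (intro integrable_mult_right integrable_abs W1)
    show "0 \<le> ?c * \<bar>W \<xi>\<bar>" for \<xi> using c0 by (rule mult_nonneg_nonneg) simp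
    fix \<xi> assume "\<not> bad s0 \<delta> \<xi>"
    note nb = not_bad[OF s0 \<delta> this]
    let ?s = "scale s0 \<xi>" let ?r = "?s / sqrt (V \<xi>)"
    have s: "0 < ?s" by (rule scale_pos[OF s0])
    have "\<rho> * W \<xi> / sqrt (V \<xi>) - W \<xi> / ?s = (\<rho> * ?r - 1) * (W \<xi> / ?s)"
      using s nb(3) by (simp add: field_simps)
    then have "\<bar>\<rho> * W \<xi> / sqrt (V \<xi>) - W \<xi> / ?s\<bar> = \<bar>\<rho> * ?r - 1\<bar> * (\<bar>W \<xi>\<bar> / ?s)"
      using s by (simp only: abs_mult abs_divide abs_of_pos)
    also have "\<dots> \<le> (\<bar>\<rho> - 1\<bar> + \<rho> * \<delta>) * (\<bar>W \<xi>\<bar> / sqrt s0)"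
    proof (rule mult_mono)
      have "\<rho> * ?r - 1 = (\<rho> - 1) + \<rho> * (?r - 1)" by (simp add: algebra_simps)
      then have "\<bar>\<rho> * ?r - 1\<bar> \<le> \<bar>\<rho> - 1\<bar> + \<rho> * \<bar>?r - 1\<bar>"
        using abs_triangle_ineq[of "\<rho> - 1" "\<rho> * (?r - 1)"] \<rho> by (simp add: abs_mult)
      also have "\<rho> * \<bar>?r - 1\<bar> \<le> \<rho> * \<delta>" using \<rho> by (intro mult_left_mono nb)
      finally show "\<bar>\<rho> * ?r - 1\<bar> \<le> \<bar>\<rho> - 1\<bar> + \<rho> * \<delta>" by simp
      show "\<bar>W \<xi>\<bar> / ?s \<le> \<bar>W \<xi>\<bar> / sqrt s0"
        using s0 s by (intro divide_left_mono scale_ge mult_pos_pos) auto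
    qed (use \<rho> \<delta> s in auto)
    also have "\<dots> = ?c * \<bar>W \<xi>\<bar>" by simp
    finally show "\<bar>\<rho> * W \<xi> / sqrt (V \<xi>) - W \<xi> / ?s\<bar> \<le> ?c * \<bar>W \<xi>\<bar>" .
  qed measurable
  also have "(\<integral>\<xi>. ?c * \<bar>W \<xi>\<bar> \<partial>P n) = ?c * (\<integral>\<xi>. \<bar>W \<xi>\<bar> \<partial>P n)" by (rule integral_mult_right_zero)
  also have "2 * P.prob n ?B + \<bar>t\<bar> * (?c * (\<integral>\<xi>. \<bar>W \<xi>\<bar> \<partial>P n)) \<le> 2 * \<pi>' + \<bar>t\<bar> * (?c * sqrt (2 * \<kappa> * R * real n * (m8 + 1)))"
    using c0 \<pi> by (intro add_mono mult_left_mono W1) auto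
  also have "?c * sqrt (2 * \<kappa> * R * real n * (m8 + 1)) = (\<bar>\<rho> - 1\<bar> + \<rho> * \<delta>) * sqrt (2 * \<kappa> * R * real n * (m8 + 1) / s0)"
    unfolding real_sqrt_divide by simp
  finally have 2: "cmod ((\<integral>\<xi>. iexp (t * (\<rho> * W \<xi> / sqrt (V \<xi>))) \<partial>P n) - (\<integral>\<xi>. iexp (t * (W \<xi> / scale s0 \<xi>)) \<partial>P n)) \<le>
      2 * \<pi>' + \<bar>t\<bar> * ((\<bar>\<rho> - 1\<bar> + \<rho> * \<delta>) * sqrt (2 * \<kappa> * R * real n * (m8 + 1) / s0))" .
  have "cmod (x - z) \<le> cmod (x - y) + cmod (y - z)" for x y z by (rule norm_diff_triangle_ineq[where a=x and b=y and c=y and d=z, simplified])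
  from this[of "\<integral>\<xi>. iexp (t * (\<rho> * W \<xi> / sqrt (V \<xi>))) \<partial>P n" "of_real (exp (- (t\<^sup>2 / 2)))" "\<integral>\<xi>. iexp (t * (W \<xi> / scale s0 \<xi>)) \<partial>P n"]
  show ?thesis using 1 2 by linarith
qed

end

section \<open>Kernel weights of rankings\<close>

locale unimodal_kernel =
  fixes K :: "real \<Rightarrow> real"
  assumes K_nonneg: "\<And>x. 0 \<le> K x"
    and K_integrable: "integrable lborel K"
    and K_integral: "(\<integral>x. K x \<partial>lborel) = 1"
    and K_continuous: "continuous_on UNIV K"
    and K_even: "\<And>x. K (- x) = K x"
    and K_antimono: "antimono_on {0..} K"
begin

lemma K_abs: "K \<bar>x\<bar> = K x"
  using K_even[of x] by (simp add: abs_if)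

lemma K_le: "\<bar>x\<bar> \<le> \<bar>y\<bar> \<Longrightarrow> K y \<le> K x"
  using monotone_onD[OF K_antimono, of "\<bar>x\<bar>" "\<bar>y\<bar>"] by (simp add: K_abs)

lemma K_le_0: "K x \<le> K 0"
  by (rule K_le) simp

lemma K_0_pos: "0 < K 0"
proof (rule ccontr)
  assume "\<not> 0 < K 0"
  then have "K x = 0" for x using K_nonneg[of x] K_le_0[of x] by linarith
  then show False using K_integral by simp
qed

lemma K_measurable [measurable]: "K \<in> borel_measurable borel"
  by (rule borel_measurable_continuous_onI[OF K_continuous])

lemma ex_K_ge_half: "\<exists>d>0. \<forall>x. \<bar>x\<bar> \<le> d \<longrightarrow> K 0 / 2 \<le> K x"
proof -
  have "isCont K 0" using K_continuous by (simp add: continuous_on_eq_continuous_at)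
  then obtain d where d: "d > 0" "\<And>x. \<bar>x - 0\<bar> < d \<Longrightarrow> \<bar>K x - K 0\<bar> < K 0 / 2"
    unfolding continuous_at_eps_delta dist_real_def using K_0_pos half_gt_zero by metis
  show ?thesis
  proof (intro exI[of _ "d / 2"] conjI allI impI)
    fix x assume "\<bar>x\<bar> \<le> d / 2"
    then have "\<bar>K x - K 0\<bar> < K 0 / 2" using d(1) by (intro d(2)) auto
    then show "K 0 / 2 \<le> K x" by arith
  qed (use d in simp)
qed

text \<open>Away from \<open>0\<close>, each term is at most the integral of \<open>K\<close> over the adjacent cell towards the origin.\<close>

lemma sum_lattice_le:
  fixes T :: "int set"
  assumes T: "finite T" and w: "0 < w"
  shows "(\<Sum>m\<in>T. K (w * of_int m)) \<le> K 0 + 1 / w"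
proof -
  define I where "I m = (if m > 0 then {w * (of_int m - 1)<..w * of_int m} else {w * of_int m..<w * (of_int m + 1)})" for m :: int
  have I_meas: "I m \<in> sets lborel" for m unfolding I_def by simp
  have I_len: "measure lborel (I m) = w" for m unfolding I_def using w by (simp add: algebra_simps)
  have I_fin: "emeasure lborel (I m) < \<infinity>" for m unfolding I_def using w by simp
  \<comment> \<open>The only nonzero lattice index whose cell can contain x; thus at each point at
    most one term of the sum of step functions is nonzero.\<close>
  define c where "c x = (if 0 < x then \<lceil>x / w\<rceil> else \<lfloor>x / w\<rfloor>)" for x
  have cell: "m = c x \<and> \<bar>x\<bar> \<le> \<bar>w * of_int m\<bar>" if m: "m \<noteq> 0" and x: "x \<in> I m" for m x
  proof (cases "m > 0")
    case True
    then have x': "w * (of_int m - 1) < x" "x \<le> w * of_int m" using x by (auto simp: I_def)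
    have "0 \<le> w * (of_int m - 1)" using True w by (intro mult_nonneg_nonneg) auto
    then have "0 < x" using x' by linarith
    moreover have "\<lceil>x / w\<rceil> = m" using x' w by (intro ceiling_unique) (auto simp: field_simps)
    ultimately show ?thesis using x' by (simp add: c_def)
  next
    case False
    then have m': "m \<le> -1" using m by simp
    then have x': "w * of_int m \<le> x" "x < w * (of_int m + 1)" using x by (auto simp: I_def)
    have "real_of_int m \<le> -1" using m' by linarith
    then have "w * (of_int m + 1) \<le> 0" using w by (intro mult_nonneg_nonpos) auto
    then have "x < 0" using x' by linarith
    moreover have "\<lfloor>x / w\<rfloor> = m" using x' w by (intro floor_unique) (auto simp: field_simps)
    ultimately show ?thesis using x' by (simp add: c_def)
  qed
  let ?T = "T - {0}"
  have i: "integrable lborel (\<lambda>x. K (w * of_int m) * indicator (I m) x :: real)" for m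
    using I_meas I_fin by (intro integrable_mult_right integrable_real_indicator) auto
  have "w * (\<Sum>m\<in>?T. K (w * of_int m)) = (\<Sum>m\<in>?T. \<integral>x. K (w * of_int m) * indicator (I m) x \<partial>lborel)"
    unfolding sum_distrib_left using I_meas I_len by (intro sum.cong refl) (simp add: mult.commute)
  also have "\<dots> = (\<integral>x. (\<Sum>m\<in>?T. K (w * of_int m) * indicator (I m) x) \<partial>lborel)"
    by (rule Bochner_Integration.integral_sum[symmetric]) (rule i)
  also have "\<dots> \<le> (\<integral>x. K x \<partial>lborel)"
  proof (rule integral_mono)
    show "integrable lborel (\<lambda>x. \<Sum>m\<in>?T. K (w * of_int m) * indicator (I m) x)"
      by (rule Bochner_Integration.integrable_sum) (rule i)
    show "integrable lborel K" by (rule K_integrable)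
    fix x
    have "(\<Sum>m\<in>?T. K (w * of_int m) * indicator (I m) x) \<le> (\<Sum>m\<in>?T. if m = c x then K x else 0)"
    proof (rule sum_mono)
      fix m assume "m \<in> ?T"
      then show "K (w * of_int m) * indicator (I m) x \<le> (if m = c x then K x else 0)"
        using cell[of m x] K_nonneg[of x] by (cases "x \<in> I m") (auto intro: K_le)
    qed
    also have "\<dots> \<le> K x" using T K_nonneg[of x] by (simp add: sum.delta)
    finally show "(\<Sum>m\<in>?T. K (w * of_int m) * indicator (I m) x) \<le> K x" .
  qed
  also note K_integral
  finally have "(\<Sum>m\<in>?T. K (w * of_int m)) \<le> 1 / w" using w by (simp add: field_simps)
  moreover have "(\<Sum>m\<in>T. K (w * of_int m)) \<le> K 0 + (\<Sum>m\<in>?T. K (w * of_int m))"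
    using T K_nonneg[of 0] by (cases "0 \<in> T") (simp_all add: sum.remove[of T 0])
  ultimately show ?thesis by linarith
qed

definition rank_weight :: "nat \<Rightarrow> real \<Rightarrow> (nat \<Rightarrow> nat) \<Rightarrow> nat \<Rightarrow> nat \<Rightarrow> real" where
  "rank_weight n h r i j = K ((real (r i) / real n - real (r j) / real n) / h)"

lemma rank_weight_bounds: "0 \<le> rank_weight n h r i j" "rank_weight n h r i j \<le> K 0"
  unfolding rank_weight_def by (rule K_nonneg, rule K_le_0)

lemma rank_weight_sym: "rank_weight n h r i j = rank_weight n h r j i"
proof -
  have "(real (r i) / real n - real (r j) / real n) / h = - ((real (r j) / real n - real (r i) / real n) / h)"
    by (simp add: diff_divide_distrib)
  then show ?thesis unfolding rank_weight_def by (simp only: K_even)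
qed

text \<open>Ranks are distinct, so the differences to a fixed rank are distinct integers and a row
  is part of a lattice sum of \<open>K\<close> with mesh 1/(n h).\<close>

lemma rank_weight_row_le:
  assumes r: "inj_on r {1..n}" and n: "1 \<le> n" and h: "0 < h"
  shows "(\<Sum>j=1..n. rank_weight n h r i j) \<le> K 0 + real n * h"
proof -
  let ?d = "\<lambda>j. int (r i) - int (r j)"
  let ?w = "1 / (real n * h)"
  have inj: "inj_on ?d {1..n}" 
  proof (rule inj_onI)
    fix x y assume "x \<in> {1..n}" "y \<in> {1..n}" and "?d x = ?d y"
    then show "x = y" using inj_onD[OF r, of x y] by simp
  qed
  have "(\<Sum>j=1..n. rank_weight n h r i j) = (\<Sum>j=1..n. K (?w * of_int (?d j)))"
  proof (rule sum.cong[OF refl])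
    fix j
    have "(real (r i) / real n - real (r j) / real n) / h = (real (r i) - real (r j)) / (real n * h)"
      by (simp only: diff_divide_distrib[symmetric] divide_divide_eq_left)
    then show "rank_weight n h r i j = K (?w * of_int (?d j))" unfolding rank_weight_def by simp
  qed
  also have "\<dots> = (\<Sum>m\<in>?d ` {1..n}. K (?w * of_int m))" by (simp only: sum.reindex[OF inj] comp_def)
  also have "\<dots> \<le> K 0 + 1 / ?w" using n h by (intro sum_lattice_le) auto
  finally show ?thesis by simp
qed

lemma symmetric_weights_rank_weight:
  assumes "inj_on r {1..n}" "1 \<le> n" "0 < h"
  shows "symmetric_weights n (rank_weight n h r) (K 0 + real n * h)"
  using assms K_0_pos
  by unfold_locales (auto intro: rank_weight_bounds rank_weight_sym rank_weight_row_le add_nonneg_nonneg)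

text \<open>The squared coefficient norm of the chaos belonging to a ranking. The bound does not
  involve the ranking, so one random variable serves all of them in the maximal inequality.\<close>

lemma sum_rank_weight_inner_sq_le:
  fixes u :: "nat \<Rightarrow> 'h::real_inner"
  assumes "inj_on r {1..n}" "1 \<le> n" "0 < h"
  shows "(\<Sum>i=1..n. \<Sum>j=1..n. (rank_weight n h r i j * (u i \<bullet> u j))\<^sup>2) \<le> K 0 * (K 0 + real n * h) * (\<Sum>i=1..n. norm (u i) ^ 4)"
proof -
  interpret symmetric_weights n "rank_weight n h r" "K 0 + real n * h" by (rule symmetric_weights_rank_weight[OF assms])
  have "(rank_weight n h r i j * (u i \<bullet> u j))\<^sup>2 \<le> K 0 / 2 * (rank_weight n h r i j * norm (u i) ^ 4 + rank_weight n h r i j * norm (u j) ^ 4)" for i j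
  proof -
    let ?a = "rank_weight n h r i j"
    have "(?a * (u i \<bullet> u j))\<^sup>2 = (?a * ?a) * (u i \<bullet> u j)\<^sup>2" by (simp add: power2_eq_square mult_ac)
    also have "\<dots> \<le> (K 0 * ?a) * ((norm (u i))\<^sup>2 * (norm (u j))\<^sup>2)"
    proof (intro mult_mono mult_nonneg_nonneg)
      have "\<bar>u i \<bullet> u j\<bar>\<^sup>2 \<le> (norm (u i) * norm (u j))\<^sup>2" by (rule power_mono[OF Cauchy_Schwarz_ineq2]) simp
      then show "(u i \<bullet> u j)\<^sup>2 \<le> (norm (u i))\<^sup>2 * (norm (u j))\<^sup>2" by (simp add: power_mult_distrib)
    qed (use K_0_pos in \<open>auto intro: rank_weight_bounds\<close>)
    also have "\<dots> \<le> (K 0 * ?a) * ((norm (u i) ^ 4 + norm (u j) ^ 4) / 2)"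
      using mult_le_half_squares[of "(norm (u i))\<^sup>2" "(norm (u j))\<^sup>2"] K_0_pos rank_weight_bounds[of n h r i j]
      by (intro mult_left_mono) (simp_all flip: power_mult)
    also have "\<dots> = K 0 / 2 * (?a * norm (u i) ^ 4 + ?a * norm (u j) ^ 4)" by (simp add: algebra_simps)
    finally show ?thesis .
  qed
  then have "(\<Sum>i=1..n. \<Sum>j=1..n. (rank_weight n h r i j * (u i \<bullet> u j))\<^sup>2) \<le>
      (\<Sum>i=1..n. \<Sum>j=1..n. K 0 / 2 * (rank_weight n h r i j * norm (u i) ^ 4 + rank_weight n h r i j * norm (u j) ^ 4))"
    by (intro sum_mono)
  also have "\<dots> = K 0 / 2 * ((\<Sum>i=1..n. \<Sum>j=1..n. rank_weight n h r i j * norm (u i) ^ 4) + (\<Sum>i=1..n. \<Sum>j=1..n. rank_weight n h r i j * norm (u j) ^ 4))"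
    by (simp only: sum_distrib_left[symmetric] sum.distrib)
  also have "\<dots> \<le> K 0 / 2 * ((K 0 + real n * h) * (\<Sum>i=1..n. norm (u i) ^ 4) + (K 0 + real n * h) * (\<Sum>i=1..n. norm (u i) ^ 4))"
    using K_0_pos by (intro mult_left_mono add_mono path2_le) auto
  also have "\<dots> = K 0 * (K 0 + real n * h) * (\<Sum>i=1..n. norm (u i) ^ 4)" by simp
  finally show ?thesis .
qed

text \<open>Indices whose ranks fall into the same cell of length \<open>d h n\<close> carry weight at least \<open>K 0 / 2\<close>, and
  there are at most \<open>2 / (d h)\<close> cells.\<close>

lemma sum_off_diagonal_ge:
  fixes u :: "nat \<Rightarrow> 'h::real_inner"
  assumes d: "0 < d" "\<And>x. \<bar>x\<bar> \<le> d \<Longrightarrow> K 0 / 2 \<le> K x" and n: "1 \<le> n" and h: "0 < h" "d * h \<le> 1"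
    and r: "r ` {1..n} \<subseteq> {1..n}"
  shows "(K 0)\<^sup>2 / 4 * (d * h / 2 * (\<Sum>i=1..n. \<Sum>j=1..n. (u i \<bullet> u j)\<^sup>2) - (\<Sum>i=1..n. norm (u i) ^ 4)) \<le>
    (\<Sum>i=1..n. \<Sum>j=1..n. of_bool (i \<noteq> j) * ((rank_weight n h r i j)\<^sup>2 * (u i \<bullet> u j)\<^sup>2))"
proof -
  have dh: "0 < d * h" using d h by simp
  define \<beta> where "\<beta> i = \<lfloor>real (r i) / real n / (d * h)\<rfloor>" for i
  let ?B = "{0..\<lfloor>1 / (d * h)\<rfloor>}"
  have \<beta>B: "\<beta> ` {1..n} \<subseteq> ?B"
  proof (rule image_subsetI)
    fix i assume "i \<in> {1..n}"
    then have "r i \<in> {1..n}" using r by blast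
    then have "r i \<le> n" by simp
    then have "real (r i) / real n \<le> 1" using n by (simp add: divide_le_eq)
    then have "real (r i) / real n / (d * h) \<le> 1 / (d * h)" using dh by (intro divide_right_mono) auto
    moreover have "0 \<le> real (r i) / real n / (d * h)" using dh by simp
    ultimately show "\<beta> i \<in> ?B" unfolding \<beta>_def by (simp add: floor_mono)
  qed
  have cardB: "real (card ?B) \<le> 2 / (d * h)"
  proof -
    have "0 \<le> \<lfloor>1 / (d * h)\<rfloor>" using dh by simp
    then have "real (card ?B) = of_int \<lfloor>1 / (d * h)\<rfloor> + 1" by simp
    also have "\<dots> \<le> 1 / (d * h) + 1 / (d * h)"
      using h(2) dh by (intro add_mono of_int_floor_le) (simp add: field_simps)
    finally show ?thesis by simp
  qed
  have near: "K 0 / 2 \<le> rank_weight n h r i j" if "\<beta> i = \<beta> j" for i j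
  proof -
    let ?x = "real (r i) / real n / (d * h)" and ?y = "real (r j) / real n / (d * h)"
    have "\<bar>?x - ?y\<bar> \<le> 1" using that floor_correct[of ?x] floor_correct[of ?y] unfolding \<beta>_def by linarith
    then have "d * \<bar>?x - ?y\<bar> \<le> d" using d(1) by simp
    moreover have "d * \<bar>?x - ?y\<bar> = \<bar>d * (?x - ?y)\<bar>" using d(1) by (simp add: abs_mult)
    moreover have "d * (?x - ?y) = (real (r i) / real n - real (r j) / real n) / h"
      using d(1) h(1) by (simp add: right_diff_distrib diff_divide_distrib)
    ultimately show ?thesis unfolding rank_weight_def by (intro d(2)) simp
  qed
  let ?S = "\<Sum>i=1..n. \<Sum>j=1..n. of_bool (\<beta> i = \<beta> j) * (u i \<bullet> u j)\<^sup>2"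
  have S0: "0 \<le> ?S" by (intro sum_nonneg) simp
  have "(\<Sum>i=1..n. \<Sum>j=1..n. (u i \<bullet> u j)\<^sup>2) \<le> real (card ?B) * ?S"
    by (rule sum_inner_square_blocks[OF _ _ \<beta>B]) simp_all
  also have "\<dots> \<le> 2 / (d * h) * ?S" using cardB S0 by (rule mult_right_mono)
  finally have 1: "d * h / 2 * (\<Sum>i=1..n. \<Sum>j=1..n. (u i \<bullet> u j)\<^sup>2) \<le> ?S"
    using dh by (simp add: field_simps)
  \<comment> \<open>The block sums contain the diagonal, the statistic does not; the fourth powers
    of the norms are subtracted for it.\<close>
  have term_le: "(K 0)\<^sup>2 / 4 * (of_bool (\<beta> i = \<beta> j) * (u i \<bullet> u j)\<^sup>2) \<le>
      of_bool (i \<noteq> j) * ((rank_weight n h r i j)\<^sup>2 * (u i \<bullet> u j)\<^sup>2) + (K 0)\<^sup>2 / 4 * (of_bool (i = j) * norm (u i) ^ 4)" for i j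
  proof (cases "i = j")
    case True
    have "(u i \<bullet> u i)\<^sup>2 = norm (u i) ^ 4" by (simp add: power2_norm_eq_inner[symmetric] flip: power_mult)
    then show ?thesis using True by simp
  next
    case False
    have "(K 0)\<^sup>2 / 4 \<le> (rank_weight n h r i j)\<^sup>2" if "\<beta> i = \<beta> j"
      using power_mono[OF near[OF that], of 2] K_0_pos by (simp add: power_divide)
    then have "\<beta> i = \<beta> j \<Longrightarrow> (K 0)\<^sup>2 / 4 * (u i \<bullet> u j)\<^sup>2 \<le> (rank_weight n h r i j)\<^sup>2 * (u i \<bullet> u j)\<^sup>2"
      by (intro mult_right_mono) auto
    then show ?thesis using False by (cases "\<beta> i = \<beta> j") simp_all
  qed
  have diag: "(\<Sum>j=1..n. of_bool (i = j) * norm (u i) ^ 4) = norm (u i) ^ 4" if "i \<in> {1..n}" for i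
  proof -
    have "(\<Sum>j=1..n. of_bool (i = j) * norm (u i) ^ 4) = (\<Sum>j\<in>{i}. of_bool (i = j) * norm (u i) ^ 4)"
      using that by (intro sum.mono_neutral_right) auto
    then show ?thesis by simp
  qed
  have "(K 0)\<^sup>2 / 4 * ?S \<le> (\<Sum>i=1..n. \<Sum>j=1..n. of_bool (i \<noteq> j) * ((rank_weight n h r i j)\<^sup>2 * (u i \<bullet> u j)\<^sup>2) + (K 0)\<^sup>2 / 4 * (of_bool (i = j) * norm (u i) ^ 4))"
    unfolding sum_distrib_left by (intro sum_mono term_le)
  also have "\<dots> = (\<Sum>i=1..n. \<Sum>j=1..n. of_bool (i \<noteq> j) * ((rank_weight n h r i j)\<^sup>2 * (u i \<bullet> u j)\<^sup>2)) + (K 0)\<^sup>2 / 4 * (\<Sum>i=1..n. \<Sum>j=1..n. of_bool (i = j) * norm (u i) ^ 4)"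
    by (simp only: sum.distrib sum_distrib_left[symmetric])
  also have "(\<Sum>i=1..n. \<Sum>j=1..n. of_bool (i = j) * norm (u i) ^ 4) = (\<Sum>i=1..n. norm (u i) ^ 4)"
    by (rule sum.cong[OF refl diag])
  finally have 2: "(K 0)\<^sup>2 / 4 * ?S - (K 0)\<^sup>2 / 4 * (\<Sum>i=1..n. norm (u i) ^ 4) \<le>
    (\<Sum>i=1..n. \<Sum>j=1..n. of_bool (i \<noteq> j) * ((rank_weight n h r i j)\<^sup>2 * (u i \<bullet> u j)\<^sup>2))" by linarith
  have "(K 0)\<^sup>2 / 4 * (d * h / 2 * (\<Sum>i=1..n. \<Sum>j=1..n. (u i \<bullet> u j)\<^sup>2)) \<le> (K 0)\<^sup>2 / 4 * ?S"
    using 1 by (rule mult_left_mono) simp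
  then show ?thesis using 2 by (simp only: right_diff_distrib)
qed

end

section \<open>Uniformity over directions\<close>

lemma borel_measurable_rank_of:
  assumes y [measurable]: "\<And>k. y k \<in> borel_measurable M"
  shows "(\<lambda>\<xi>. real (rank_of n (\<lambda>k. y k \<xi>) i)) \<in> borel_measurable M"
proof -
  have "real (rank_of n (\<lambda>k. y k \<xi>) i) = (\<Sum>j=1..n. if y j \<xi> < y i \<xi> \<or> (y j \<xi> = y i \<xi> \<and> j \<le> i) then 1 else 0)" for \<xi>
    unfolding rank_of_def by (simp add: sum.If_cases Int_def)
  moreover have "(\<lambda>\<xi>. \<Sum>j=1..n. if y j \<xi> < y i \<xi> \<or> (y j \<xi> = y i \<xi> \<and> j \<le> i) then 1 else 0 :: real) \<in> borel_measurable M"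
    by (intro borel_measurable_sum) measurable
  ultimately show ?thesis by (simp only:)
qed

lemma sum_upper_triangle:
  fixes f :: "nat \<Rightarrow> nat \<Rightarrow> real"
  assumes sym: "\<And>i j. f i j = f j i"
  shows "(\<Sum>i=1..n. \<Sum>j=1..n. of_bool (i \<noteq> j) * f i j) = 2 * (\<Sum>i=1..n. \<Sum>j=1..n. of_bool (i < j) * f i j)"
proof -
  have "(\<Sum>i=1..n. \<Sum>j=1..n. of_bool (i \<noteq> j) * f i j) = (\<Sum>i=1..n. \<Sum>j=1..n. of_bool (i < j) * f i j + of_bool (j < i) * f i j)"
    by (intro sum.cong refl) (auto simp: of_bool_def)
  also have "\<dots> = (\<Sum>i=1..n. \<Sum>j=1..n. of_bool (i < j) * f i j) + (\<Sum>i=1..n. \<Sum>j=1..n. of_bool (j < i) * f i j)"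
    by (simp only: sum.distrib)
  also have "(\<Sum>i=1..n. \<Sum>j=1..n. of_bool (j < i) * f i j) = (\<Sum>j=1..n. \<Sum>i=1..n. of_bool (j < i) * f i j)"
    by (rule sum.swap)
  also have "\<dots> = (\<Sum>i=1..n. \<Sum>j=1..n. of_bool (i < j) * f i j)"
    by (intro sum.cong refl arg_cong2[where f = times] sym)
  finally show ?thesis by simp
qed

lemma sum_upper_triangle_one: "(\<Sum>i=1..n. \<Sum>j=1..n. of_bool (i < j)) = real n * (real n - 1) / 2"
  using sum_square_expand[of "\<lambda>_. 1" n] by (simp add: power2_eq_square algebra_simps)

lemma sum_off_diagonal_pairs:
  fixes f :: "nat \<Rightarrow> nat \<Rightarrow> real"
  shows "(\<Sum>(i, j)\<in>{(i, j). i \<in> {1..n} \<and> j \<in> {1..n} \<and> i \<noteq> j}. f i j) = (\<Sum>i=1..n. \<Sum>j=1..n. of_bool (i \<noteq> j) * f i j)"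
proof -
  have "(\<Sum>(i, j)\<in>{(i, j). i \<in> {1..n} \<and> j \<in> {1..n} \<and> i \<noteq> j}. f i j) = (\<Sum>p\<in>{1..n} \<times> {1..n}. of_bool (fst p \<noteq> snd p) * f (fst p) (snd p))"
    by (rule sum.mono_neutral_cong_left) auto
  then show ?thesis using sum_pairs[of "\<lambda>i j. of_bool (i \<noteq> j) * f i j"] by simp
qed

section \<open>Concentration of the energy of the sample\<close>

context centered_design
begin

lemma expectation_sum_norm4_le:
  "integrable (P n) (\<lambda>\<xi>. \<Sum>i=1..n. norm (fst (\<xi> i)) ^ 4)"
  "(\<integral>\<xi>. (\<Sum>i=1..n. norm (fst (\<xi> i)) ^ 4) \<partial>P n) \<le> real n * ((\<integral>z. norm (fst z) ^ 8 \<partial>D) + 1)"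
proof -
  have i4: "integrable D (\<lambda>z. norm (fst z) ^ 4)" by (rule integrable_norm_power_D) simp
  have m: "(\<lambda>z. norm (fst z) ^ 4) \<in> borel_measurable D" by measurable
  have i: "integrable (P n) (\<lambda>\<xi>. norm (fst (\<xi> i)) ^ 4)" if "i \<in> {1..n}" for i by (rule integral_component(2)[OF that m i4])
  then show "integrable (P n) (\<lambda>\<xi>. \<Sum>i=1..n. norm (fst (\<xi> i)) ^ 4)" by (rule Bochner_Integration.integrable_sum)
  have "(\<integral>z. norm (fst z) ^ 4 \<partial>D) \<le> (\<integral>z. norm (fst z) ^ 8 + 1 \<partial>D)"
  proof (rule integral_mono[OF i4])
    show "integrable D (\<lambda>z. norm (fst z) ^ 8 + 1)" by (intro Bochner_Integration.integrable_add moment8) simp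
    fix z :: "'h \<times> 'x"
    have "norm (fst z) ^ 4 * 2 \<le> norm (fst z) ^ 8 + 1"
      using mult_le_half_squares[of "norm (fst z) ^ 4" 1] by (simp flip: power_mult)
    moreover have "0 \<le> norm (fst z) ^ 8" by simp
    ultimately show "norm (fst z) ^ 4 \<le> norm (fst z) ^ 8 + 1" by linarith
  qed
  also have "\<dots> = (\<integral>z. norm (fst z) ^ 8 \<partial>D) + 1"
    using moment8 by (subst Bochner_Integration.integral_add) (simp_all add: prob_space)
  finally have m4: "(\<integral>z. norm (fst z) ^ 4 \<partial>D) \<le> (\<integral>z. norm (fst z) ^ 8 \<partial>D) + 1" .
  have "(\<integral>\<xi>. (\<Sum>i=1..n. norm (fst (\<xi> i)) ^ 4) \<partial>P n) = (\<Sum>i=1..n. \<integral>\<xi>. norm (fst (\<xi> i)) ^ 4 \<partial>P n)"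
    by (rule Bochner_Integration.integral_sum) (rule i)
  also have "\<dots> = (\<Sum>i=1..n. \<integral>z. norm (fst z) ^ 4 \<partial>D)"
    by (intro sum.cong refl integral_component(1) m)
  also have "\<dots> = real n * (\<integral>z. norm (fst z) ^ 4 \<partial>D)" by simp
  also have "\<dots> \<le> real n * ((\<integral>z. norm (fst z) ^ 8 \<partial>D) + 1)" using m4 by (rule mult_left_mono) simp
  finally show "(\<integral>\<xi>. (\<Sum>i=1..n. norm (fst (\<xi> i)) ^ 4) \<partial>P n) \<le> real n * ((\<integral>z. norm (fst z) ^ 8 \<partial>D) + 1)" .
qed

text \<open>Chebyshev's inequality for the U-statistic of the squared inner products.\<close>

lemma prob_small_energy_le:
  defines "y \<equiv> \<integral>z. sq_inner z \<partial>(D \<Otimes>\<^sub>M D)"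
  assumes n: "2 \<le> n" and y: "0 < y"
  shows "P.prob n {\<xi> \<in> space (P n). (\<Sum>i=1..n. \<Sum>j=1..n. (fst (\<xi> i) \<bullet> fst (\<xi> j))\<^sup>2) < (real n)\<^sup>2 * y / 4} \<le>
    256 * (\<integral>z. norm (fst z) ^ 8 \<partial>D) / (real n * y\<^sup>2)"
proof -
  \<comment> \<open>All weights equal 1, so \<open>R\<close> is n and \<open>A\<close> is the
    indicator of i < j.\<close>
  interpret E: weighted_design D n "\<lambda>_ _ _. 1" 1 "real n"
    by unfold_locales (auto intro: unaffected_const)
  let ?Y = "\<lambda>i j \<xi>. sq_inner (\<xi> i, \<xi> j)"
  define dev where "dev \<xi> = (\<Sum>i=1..n. \<Sum>j=1..n. (E.A i j \<xi>)\<^sup>2 * (?Y i j \<xi> - y))" for \<xi>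
  have mean: "(\<integral>\<xi>. ?Y i j \<xi> - y \<partial>P n) = 0" if "i \<in> {1..n}" "j \<in> {1..n}" "i \<noteq> j" for i j
  proof -
    have i: "integrable (P n) (?Y i j)" using pair_integral(1)[OF that sq_inner_measurable] integrable_sq_inner(1) by simp
    have "(\<integral>\<xi>. ?Y i j \<xi> - y \<partial>P n) = (\<integral>\<xi>. ?Y i j \<xi> \<partial>P n) - (\<integral>\<xi>. y \<partial>P n)"
      by (rule Bochner_Integration.integral_diff[OF i]) simp
    then show ?thesis using pair_integral(2)[OF that sq_inner_measurable] by (simp add: y_def P.prob_space)
  qed
  have disjoint: "(\<integral>\<xi>. (1\<^sup>2 * (?Y i j \<xi> - y)) * (1\<^sup>2 * (?Y k l \<xi> - y)) \<partial>P n) = 0"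
    if ijkl: "{i, j, k, l} \<subseteq> {1..n}" "i < j" "k < l" "{i, j} \<inter> {k, l} = {}" for i j k l
  proof (rule integral_eq_0_pair)
    show ij: "i \<in> {1..n}" "j \<in> {1..n}" "i \<noteq> j" using ijkl by auto
    fix \<xi> :: "nat \<Rightarrow> 'h \<times> 'x"
    have ne: "k \<noteq> i" "k \<noteq> j" "l \<noteq> i" "l \<noteq> j" "i \<noteq> j" using ijkl(2,4) by auto
    have "(\<integral>z. sq_inner z - y \<partial>(D \<Otimes>\<^sub>M D)) = 0"
      using integrable_sq_inner(1) by (subst Bochner_Integration.integral_diff) (simp_all add: y_def DD.prob_space)
    then show "(\<integral>z. (1\<^sup>2 * (?Y i j (\<xi>(i := fst z, j := snd z)) - y)) * (1\<^sup>2 * (?Y k l (\<xi>(i := fst z, j := snd z)) - y)) \<partial>(D \<Otimes>\<^sub>M D)) = 0"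
      using ne by simp
  qed
  have same: "(\<integral>\<xi>. (1 * y) * (?Y i j \<xi> - y) \<partial>P n) = 0" if "i \<in> {1..n}" "j \<in> {1..n}" "i < j" for i j
  proof -
    have "i \<noteq> j" using that by simp
    then show ?thesis using mean[OF that(1,2)] unfolding integral_mult_right_zero by simp
  qed
  have cm: "(\<lambda>z. y) \<in> borel_measurable (D \<Otimes>\<^sub>M D)" by simp
  have ci: "integrable (D \<Otimes>\<^sub>M D) (\<lambda>z. y\<^sup>2)" by simp
  have i2: "integrable (P n) (\<lambda>\<xi>. (dev \<xi>)\<^sup>2)"
    unfolding dev_def by (rule E.centered_pair_sum_sq_le(1)[OF cm ci disjoint same])
  have d2: "(\<integral>\<xi>. (dev \<xi>)\<^sup>2 \<partial>P n) \<le> 4 * 1\<^sup>2 * (real n)\<^sup>2 * (real n * E.m8)"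
    unfolding dev_def by (rule E.centered_pair_sum_sq_le(2)[OF cm ci disjoint same])
  have dm: "dev \<in> borel_measurable (P n)"
    unfolding dev_def by (intro borel_measurable_sum borel_measurable_times borel_measurable_power borel_measurable_diff E.A_measurable E.sq_inner_component borel_measurable_const)
  have small: "(real n)\<^sup>2 * y / 8 < \<bar>dev \<xi>\<bar>"
    if less: "(\<Sum>i=1..n. \<Sum>j=1..n. (fst (\<xi> i) \<bullet> fst (\<xi> j))\<^sup>2) < (real n)\<^sup>2 * y / 4" for \<xi>
  proof -
    let ?f = "\<lambda>i j. (fst (\<xi> i) \<bullet> fst (\<xi> j))\<^sup>2"
    have "dev \<xi> = (\<Sum>i=1..n. \<Sum>j=1..n. of_bool (i < j) * ?f i j - of_bool (i < j) * y)"
      unfolding dev_def by (intro sum.cong refl) (simp add: E.A_def sq_inner_def)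
    also have "\<dots> = (\<Sum>i=1..n. \<Sum>j=1..n. of_bool (i < j) * ?f i j) - real n * (real n - 1) / 2 * y"
      by (simp only: sum_subtractf sum_distrib_right[symmetric] sum_upper_triangle_one)
    finally have dev: "dev \<xi> = (\<Sum>i=1..n. \<Sum>j=1..n. of_bool (i < j) * ?f i j) - real n * (real n - 1) / 2 * y" .
    have "2 * (\<Sum>i=1..n. \<Sum>j=1..n. of_bool (i < j) * ?f i j) = (\<Sum>i=1..n. \<Sum>j=1..n. of_bool (i \<noteq> j) * ?f i j)"
      by (rule sum_upper_triangle[symmetric]) (simp add: inner_commute)
    also have "\<dots> \<le> (\<Sum>i=1..n. \<Sum>j=1..n. ?f i j)" by (intro sum_mono) (simp add: of_bool_def)
    finally have up: "2 * (\<Sum>i=1..n. \<Sum>j=1..n. of_bool (i < j) * ?f i j) < (real n)\<^sup>2 * y / 4" using less by linarith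
    \<comment> \<open>For n \<ge> 2 the mean n(n-1)y/2 of the sum over i < j is at least n^2 y/4,
      while on the event this sum is below n^2 y/8.\<close>
    have "real n * real n \<le> 2 * (real n * (real n - 1))" using n by (simp add: algebra_simps)
    then have "(real n * real n) * y \<le> 2 * (real n * (real n - 1)) * y" using y by (intro mult_right_mono) auto
    then have "(real n)\<^sup>2 * y / 4 \<le> real n * (real n - 1) / 2 * y" by (simp add: power2_eq_square mult_ac)
    then have "dev \<xi> < - ((real n)\<^sup>2 * y / 8)" using up dev by linarith
    then show ?thesis by linarith
  qed
  have c: "0 < (real n)\<^sup>2 * y / 8" using n y by simp
  have "P.prob n {\<xi> \<in> space (P n). (\<Sum>i=1..n. \<Sum>j=1..n. (fst (\<xi> i) \<bullet> fst (\<xi> j))\<^sup>2) < (real n)\<^sup>2 * y / 4} \<le>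
      P.prob n {\<xi> \<in> space (P n). (real n)\<^sup>2 * y / 8 < \<bar>dev \<xi>\<bar>}"
    using small dm by (intro P.finite_measure_mono) auto
  also have "\<dots> \<le> 4 * 1\<^sup>2 * (real n)\<^sup>2 * (real n * E.m8) / ((real n)\<^sup>2 * y / 8)\<^sup>2"
    by (rule P.second_moment_tail_le[OF dm i2 d2 c])
  also have "\<dots> = 256 * E.m8 / (real n * y\<^sup>2)" using n y by (simp add: field_simps power2_eq_square)
  finally show ?thesis unfolding E.m8_def .
qed

end

section \<open>Rankings realised by directions\<close>

locale single_index_design = centered_design D + unimodal_kernel K
  for D :: "(L2 \<times> L2) measure" and K +
  fixes \<psi> :: "nat \<Rightarrow> L2"
begin

definition index :: "nat \<Rightarrow> (nat \<Rightarrow> real) \<Rightarrow> (nat \<Rightarrow> L2 \<times> L2) \<Rightarrow> nat \<Rightarrow> real" where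
  "index p \<gamma> \<xi> k = projection \<psi> p (snd (\<xi> k)) \<gamma>"

definition weight :: "nat \<Rightarrow> real \<Rightarrow> nat \<Rightarrow> (nat \<Rightarrow> real) \<Rightarrow> nat \<Rightarrow> nat \<Rightarrow> (nat \<Rightarrow> L2 \<times> L2) \<Rightarrow> real" where
  "weight n h p \<gamma> i j \<xi> = rank_weight n h (rank_of n (index p \<gamma> \<xi>)) i j"

lemma kernel_weight_eq: "kernel_weight \<psi> K h p n (\<lambda>k. snd (\<xi> k)) \<gamma> i j = weight n h p \<gamma> i j \<xi>"
  unfolding kernel_weight_def scaled_kernel_def empirical_df_def weight_def rank_weight_def rank_of_def index_def ..

lemma inner_snd_measurable: "(\<lambda>\<xi>. snd (\<xi> k) \<bullet> v) \<in> borel_measurable (P n)"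
  using snd_component by measurable

lemma index_measurable: "(\<lambda>\<xi>. index p \<gamma> \<xi> k) \<in> borel_measurable (P n)"
  unfolding index_def projection_def
  by (intro borel_measurable_sum borel_measurable_times inner_snd_measurable borel_measurable_const)

lemma weight_measurable: "weight n h p \<gamma> i j \<in> borel_measurable (P n)"
  unfolding weight_def[abs_def] rank_weight_def
  by (intro measurable_compose[OF _ K_measurable] borel_measurable_divide borel_measurable_diff borel_measurable_const
      borel_measurable_rank_of index_measurable)

lemma unaffected_weight: "unaffected k (weight n h p \<gamma> i j)"
  unfolding weight_def[abs_def] index_def[abs_def]
  by (rule unaffected_family[where f = "\<lambda>k \<xi>. snd (\<xi> k)" and F = "\<lambda>x. rank_weight n h (rank_of n (\<lambda>k. projection \<psi> p (x k) \<gamma>)) i j", OF unaffected_snd])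

lemma weighted_design_weight:
  assumes "1 \<le> n" "0 < h"
  shows "weighted_design D n (weight n h p \<gamma>) (K 0) (K 0 + real n * h)"
proof unfold_locales
  show "weight n h p \<gamma> i j \<in> borel_measurable (P n)" for i j by (rule weight_measurable)
  show "unaffected k (weight n h p \<gamma> i j)" for i j k by (rule unaffected_weight)
  show "0 \<le> weight n h p \<gamma> i j \<xi>" "weight n h p \<gamma> i j \<xi> \<le> K 0" for i j \<xi>
    unfolding weight_def by (rule rank_weight_bounds)+
  show "weight n h p \<gamma> i j \<xi> = weight n h p \<gamma> j i \<xi>" for i j \<xi> unfolding weight_def by (rule rank_weight_sym)
  show "(\<Sum>j=1..n. weight n h p \<gamma> i j \<xi>) \<le> K 0 + real n * h" for i \<xi>
    unfolding weight_def by (rule rank_weight_row_le[OF inj_on_rank_of assms])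
  show "0 \<le> K 0 + real n * h" using assms K_0_pos by simp
qed

text \<open>By \<open>rank_of_perturb\<close>, the countably many tie-free rational directions realise every ranking, and rankings
  are determined by the signs of \<open>n\<^sup>2\<close> linear forms in \<open>p + 1\<close> variables.\<close>

definition realised :: "nat \<Rightarrow> nat \<Rightarrow> (nat \<Rightarrow> nat) \<Rightarrow> (nat \<Rightarrow> L2 \<times> L2) \<Rightarrow> bool" where
  "realised n p r \<xi> \<longleftrightarrow> (\<exists>\<theta>\<in>PiE {0..p} (\<lambda>_. \<rat>). \<forall>i\<in>{1..n}.
     rank_of n (\<lambda>i. (\<Sum>k=1..p. (snd (\<xi> i) \<bullet> \<psi> k) * \<theta> k) + \<theta> 0 * real i) i = r i)"

lemma realised_measurable: "Measurable.pred (P n) (realised n p r)"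
proof -
  have c: "countable (PiE {0..p} (\<lambda>_. \<rat> :: real set))" by (intro countable_PiE) (auto intro: countable_rat)
  have m: "(\<lambda>\<xi>. real (rank_of n (\<lambda>i. (\<Sum>k=1..p. (snd (\<xi> i) \<bullet> \<psi> k) * \<theta> k) + \<theta> 0 * real i) i)) \<in> borel_measurable (P n)"
    for i and \<theta> :: "nat \<Rightarrow> real"
    by (intro borel_measurable_rank_of borel_measurable_add borel_measurable_sum borel_measurable_times inner_snd_measurable borel_measurable_const)
  have "Measurable.pred (P n) (\<lambda>\<xi>. \<exists>\<theta>\<in>PiE {0..p} (\<lambda>_. \<rat>). \<forall>i\<in>{1..n}.
     real (rank_of n (\<lambda>i. (\<Sum>k=1..p. (snd (\<xi> i) \<bullet> \<psi> k) * \<theta> k) + \<theta> 0 * real i) i) = real (r i))"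
    unfolding pred_def
  proof (rule sets.sets_Collect_countable_Ex'[OF _ c])
    fix \<theta> :: "nat \<Rightarrow> real"
    have "Measurable.pred (P n) (\<lambda>\<xi>. \<forall>i\<in>{1..n}. real (rank_of n (\<lambda>i. (\<Sum>k=1..p. (snd (\<xi> i) \<bullet> \<psi> k) * \<theta> k) + \<theta> 0 * real i) i) = real (r i))"
      by (intro pred_intros_finite(3) pred_eq_const1[OF m] finite_atLeastAtMost) auto
    then show "{\<xi> \<in> space (P n). \<forall>i\<in>{1..n}. real (rank_of n (\<lambda>i. (\<Sum>k=1..p. (snd (\<xi> i) \<bullet> \<psi> k) * \<theta> k) + \<theta> 0 * real i) i) = real (r i)} \<in> sets (P n)"
      unfolding pred_def .
  qed
  then show ?thesis unfolding realised_def by simp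
qed

lemma unaffected_realised: "unaffected k (realised n p r)"
  unfolding realised_def[abs_def]
  by (rule unaffected_family[where f = "\<lambda>k \<xi>. snd (\<xi> k)" and F = "\<lambda>x. \<exists>\<theta>\<in>PiE {0..p} (\<lambda>_. \<rat>). \<forall>i\<in>{1..n}.
     rank_of n (\<lambda>i. (\<Sum>k=1..p. (x i \<bullet> \<psi> k) * \<theta> k) + \<theta> 0 * real i) i = r i", OF unaffected_snd])

lemma realised_index:
  obtains r where "realised n p r \<xi>" "r \<in> {1..n} \<rightarrow>\<^sub>E {1..n}" "inj_on r {1..n}" "\<And>i. i \<in> {1..n} \<Longrightarrow> rank_of n (index p \<gamma> \<xi>) i = r i"
proof
  let ?r = "restrict (rank_of n (index p \<gamma> \<xi>)) {1..n}"
  show "realised n p ?r \<xi>"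
  proof -
    obtain \<theta> where \<theta>: "\<theta> \<in> PiE {0..p} (\<lambda>_. \<rat>)" "\<And>i. i \<in> {1..n} \<Longrightarrow>
      rank_of n (\<lambda>i. \<Sum>k=1..p. (snd (\<xi> i) \<bullet> \<psi> k) * \<gamma> k) i = rank_of n (\<lambda>i. (\<Sum>k=1..p. (snd (\<xi> i) \<bullet> \<psi> k) * \<theta> k) + \<theta> 0 * real i) i"
      using rank_of_perturb[of p n "\<lambda>i k. snd (\<xi> i) \<bullet> \<psi> k" \<gamma>] by blast
    then show ?thesis unfolding realised_def index_def[abs_def] projection_def by (intro bexI[OF _ \<theta>(1)]) simp
  qed
  show "?r \<in> {1..n} \<rightarrow>\<^sub>E {1..n}" by (simp only: restrict_PiE_iff) (intro ballI rank_of_in)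
  show "inj_on ?r {1..n}" using inj_on_rank_of by (simp add: inj_on_restrict_eq)
qed simp

text \<open>A ranking is determined by the signs of all differences of perturbed indices. These are
  the linear forms \<open>c\<close> in \<theta>: coordinates 1 to p hold differences of the scores,
  coordinate 0 the difference of the indices from tie breaking. Distinct realised rankings thus have
  distinct sign patterns.\<close>

lemma card_realised_le:
  assumes e: "inj_on e S" "e ` S \<subseteq> {1..n} \<rightarrow>\<^sub>E {1..n}" 
  shows "card {r \<in> S. realised n p (e r) \<xi>} \<le> (2 * n\<^sup>2 + 1) ^ (p + 1)"
proof -
  define c where "c ij k = (if k = 0 then real (fst ij) - real (snd ij) else (snd (\<xi> (fst ij)) - snd (\<xi> (snd ij))) \<bullet> \<psi> k)" for ij :: "nat \<times> nat" and k :: nat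
  let ?J = "{1..n} \<times> {1..n}"
  let ?y = "\<lambda>\<theta> i. (\<Sum>k=1..p. (snd (\<xi> i) \<bullet> \<psi> k) * \<theta> k) + \<theta> 0 * real i"
  have form: "(\<Sum>k\<in>{0..p}. c (i, j) k * \<theta> k) = ?y \<theta> i - ?y \<theta> j" for i j \<theta>
  proof -
    have "(\<Sum>k\<in>{0..p}. c (i, j) k * \<theta> k) = c (i, j) 0 * \<theta> 0 + (\<Sum>k=1..p. c (i, j) k * \<theta> k)"
      by (simp add: sum.atLeast_Suc_atMost One_nat_def)
    also have "(\<Sum>k=1..p. c (i, j) k * \<theta> k) = (\<Sum>k=1..p. (snd (\<xi> i) \<bullet> \<psi> k) * \<theta> k) - (\<Sum>k=1..p. (snd (\<xi> j) \<bullet> \<psi> k) * \<theta> k)"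
      unfolding sum_subtractf[symmetric] by (intro sum.cong refl) (simp add: c_def inner_diff_left left_diff_distrib)
    finally show ?thesis by (simp add: c_def algebra_simps)
  qed
  have sp: "finite (sign_patterns c ?J {0..p})" "card (sign_patterns c ?J {0..p}) \<le> (2 * card ?J + 1) ^ card {0..p}"
    using card_sign_patterns[of ?J "{0..p}" c] by auto
  let ?R = "{r \<in> S. realised n p (e r) \<xi>}"
  have "\<forall>r\<in>?R. \<exists>\<theta>. \<forall>i\<in>{1..n}. rank_of n (?y \<theta>) i = e r i" unfolding realised_def by blast
  then obtain \<theta> where \<theta>: "\<And>r i. r \<in> ?R \<Longrightarrow> i \<in> {1..n} \<Longrightarrow> rank_of n (?y (\<theta> r)) i = e r i"
    unfolding bchoice_iff by blast
  let ?pat = "\<lambda>r. restrict (\<lambda>j. sgn (\<Sum>k\<in>{0..p}. c j k * \<theta> r k)) ?J"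
  have "inj_on ?pat ?R"
  proof (rule inj_onI)
    fix r s assume rs: "r \<in> ?R" "s \<in> ?R" "?pat r = ?pat s"
    have sg: "sgn (?y (\<theta> r) i - ?y (\<theta> r) j) = sgn (?y (\<theta> s) i - ?y (\<theta> s) j)" if "i \<in> {1..n}" "j \<in> {1..n}" for i j
      using fun_cong[OF rs(3), of "(i, j)"] that unfolding form[symmetric] by simp
    have "e r i = e s i" if i: "i \<in> {1..n}" for i
      using rank_of_cong_sgn[OF sg i] \<theta>[OF rs(1) i] \<theta>[OF rs(2) i] by simp
    moreover have "e r \<in> {1..n} \<rightarrow>\<^sub>E {1..n}" "e s \<in> {1..n} \<rightarrow>\<^sub>E {1..n}" using rs e(2) by auto
    ultimately have "e r = e s" by (intro PiE_ext)
    then show "r = s" using inj_onD[OF e(1)] rs by blast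
  qed
  moreover have "?pat ` ?R \<subseteq> sign_patterns c ?J {0..p}" unfolding sign_patterns_def by blast
  ultimately have "card ?R \<le> card (sign_patterns c ?J {0..p})" using sp(1) by (rule card_inj_on_le)
  also note sp(2)
  also have "(2 * card ?J + 1) ^ card {0..p} = (2 * n\<^sup>2 + 1) ^ (p + 1)" by (simp add: power2_eq_square power_add)
  finally show ?thesis .
qed

text \<open>A measurable majorant takes the place of the supremum over directions. It is the maximum
  over all permutations of \<open>{1..n}\<close>, where \<open>realised\<close> switches on those
  attainable for the given covariates; the n! candidates affect only the existence of the maximum,
  the moment order \<open>q\<close> only the number switched on.\<close>

lemma ex_chaos_envelope:
  assumes n: "1 \<le> n" and h: "0 < h" and q: "1 \<le> q" "real ((2 * n\<^sup>2 + 1) ^ (p + 1)) \<le> exp (2 * real q)"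
  shows "\<exists>S. integrable (P n) S \<and> (\<forall>\<xi>. 0 \<le> S \<xi>) \<and>
    (\<integral>\<xi>. S \<xi> \<partial>P n) \<le> 160 * (exp 1)\<^sup>2 * real q * sqrt (K 0 * (K 0 + real n * h) * (real n * ((\<integral>z. norm (fst z) ^ 8 \<partial>D) + 1))) \<and>
    (\<forall>\<gamma> \<xi>. \<bar>\<Sum>i=1..n. \<Sum>j=1..n. of_bool (i \<noteq> j) * (weight n h p \<gamma> i j \<xi> * (fst (\<xi> i) \<bullet> fst (\<xi> j)))\<bar> \<le> S \<xi>)"
proof -
  define \<R> where "\<R> = {r \<in> {1..n} \<rightarrow>\<^sub>E {1..n}. inj_on r {1..n}}"
  have fin: "finite \<R>" unfolding \<R>_def by (intro finite_subset[OF _ finite_PiE[of "{1..n}" "\<lambda>_. {1..n}"]]) auto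
  have "restrict id {1..n} \<in> \<R>" unfolding \<R>_def by (auto simp: inj_on_def)
  then have ne: "0 < card \<R>" using fin by (auto simp: card_gt_0_iff)
  obtain e where e: "bij_betw e {0..<card \<R>} \<R>" using ex_bij_betw_nat_finite[OF fin] by blast
  let ?m = "card \<R>"
  have e\<R>: "e r \<in> \<R>" if "r < ?m" for r using e that by (auto simp: bij_betw_def)
  define a where "a r = rank_weight n h (e r)" for r
  let ?\<eta> = "\<lambda>r. realised n p (e r)"
  let ?X = "\<lambda>\<xi>. K 0 * (K 0 + real n * h) * (\<Sum>i=1..n. norm (fst (\<xi> i)) ^ 4) :: real"
  define B where "B \<xi> = sqrt (?X \<xi>)" for \<xi> :: "nat \<Rightarrow> L2 \<times> L2"
  have X0: "0 \<le> ?X \<xi>" for \<xi> using K_0_pos h by (intro mult_nonneg_nonneg add_nonneg_nonneg sum_nonneg) auto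
  have B2: "(B \<xi>)\<^sup>2 = ?X \<xi>" for \<xi> unfolding B_def using X0 by (rule real_sqrt_pow2)
  have Bm: "B \<in> borel_measurable (P n)" unfolding B_def[abs_def] by measurable
  have B2i: "integrable (P n) (\<lambda>\<xi>. (B \<xi>)\<^sup>2)" unfolding B2 by (intro integrable_mult_right expectation_sum_norm4_le)
  have B2e: "(\<integral>\<xi>. (B \<xi>)\<^sup>2 \<partial>P n) \<le> K 0 * (K 0 + real n * h) * (real n * ((\<integral>z. norm (fst z) ^ 8 \<partial>D) + 1))"
    unfolding B2 integral_mult_right_zero using K_0_pos h by (intro mult_left_mono expectation_sum_norm4_le) auto
  note BE = P.expectation_abs_le_sqrt[OF Bm B2i B2e]
  have B0: "0 \<le> B \<xi>" for \<xi> unfolding B_def using X0 by simp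
  let ?S = "max_chaos ?m ?\<eta> a (off_diagonal n)"
  have bound: "(\<Sum>i=1..n. \<Sum>j=1..n. (a r i j * (fst (\<xi> i) \<bullet> fst (\<xi> j)))\<^sup>2) \<le> (B \<xi>)\<^sup>2" if r: "r < ?m" for r \<xi>
    unfolding B2 a_def by (rule sum_rank_weight_inner_sq_le) (use e\<R>[OF r] n h in \<open>auto simp: \<R>_def\<close>)
  have qb: "real (card {r \<in> {..<?m}. ?\<eta> r \<xi>}) \<le> exp (2 * real q)" for \<xi>
  proof -
    have "card {r \<in> {..<?m}. ?\<eta> r \<xi>} \<le> (2 * n\<^sup>2 + 1) ^ (p + 1)"
      by (rule card_realised_le) (use e in \<open>auto simp: bij_betw_def \<R>_def lessThan_atLeast0\<close>)
    then have "real (card {r \<in> {..<?m}. ?\<eta> r \<xi>}) \<le> real ((2 * n\<^sup>2 + 1) ^ (p + 1))" by (rule of_nat_mono)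
    then show ?thesis using q(2) by linarith
  qed
  have "(\<integral>\<xi>. ?S \<xi> \<partial>P n) \<le> 160 * (exp 1)\<^sup>2 * real q * (\<integral>\<xi>. B \<xi> \<partial>P n)"
    by (rule expectation_max_chaos_le[OF ne realised_measurable unaffected_realised BE(1) B0 bound q(1) qb])
  also have "(\<integral>\<xi>. B \<xi> \<partial>P n) \<le> sqrt (K 0 * (K 0 + real n * h) * (real n * ((\<integral>z. norm (fst z) ^ 8 \<partial>D) + 1)))"
    using BE(2) B0 by simp
  finally have ES: "(\<integral>\<xi>. ?S \<xi> \<partial>P n) \<le> 160 * (exp 1)\<^sup>2 * real q * sqrt (K 0 * (K 0 + real n * h) * (real n * ((\<integral>z. norm (fst z) ^ 8 \<partial>D) + 1)))"
    by (simp add: mult_left_mono)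
  have S_ge: "\<bar>\<Sum>i=1..n. \<Sum>j=1..n. of_bool (i \<noteq> j) * (weight n h p \<gamma> i j \<xi> * (fst (\<xi> i) \<bullet> fst (\<xi> j)))\<bar> \<le> ?S \<xi>" for \<gamma> \<xi>
  proof -
    obtain r where r: "realised n p r \<xi>" "r \<in> {1..n} \<rightarrow>\<^sub>E {1..n}" "inj_on r {1..n}" "\<And>i. i \<in> {1..n} \<Longrightarrow> rank_of n (index p \<gamma> \<xi>) i = r i"
      by (rule realised_index[where n = n and p = p and \<xi> = \<xi> and \<gamma> = \<gamma>]) blast
    then have "r \<in> \<R>" unfolding \<R>_def by blast
    then have "r \<in> e ` {0..<?m}" using e unfolding bij_betw_def by simp
    then obtain k where k: "k < ?m" "e k = r" by auto
    have "\<bar>chaos (a k) (off_diagonal n) \<xi>\<bar> \<le> ?S \<xi>"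
      by (rule max_chaos_ge[where \<eta> = ?\<eta>]) (use k r in auto)
    moreover have "chaos (a k) (off_diagonal n) \<xi> = (\<Sum>i=1..n. \<Sum>j=1..n. of_bool (i \<noteq> j) * (a k i j * (fst (\<xi> i) \<bullet> fst (\<xi> j))))"
      unfolding chaos_def off_diagonal_def by (rule sum_off_diagonal_pairs)
    moreover have "\<dots> = (\<Sum>i=1..n. \<Sum>j=1..n. of_bool (i \<noteq> j) * (weight n h p \<gamma> i j \<xi> * (fst (\<xi> i) \<bullet> fst (\<xi> j))))"
      unfolding a_def weight_def rank_weight_def k(2) by (intro sum.cong refl) (simp add: r(4))
    ultimately show ?thesis by simp
  qed
  have S0: "0 \<le> ?S \<xi>" for \<xi> using S_ge[of _ \<xi>] abs_ge_zero order.trans by blast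
  have "integrable (P n) ?S" by (rule integrable_max_chaos[OF ne realised_measurable off_diagonal_subset])
  then show ?thesis using ES S_ge S0 by blast
qed

end

context weighted_design
begin

lemma W_eq: "W \<xi> = (\<Sum>i=1..n. \<Sum>j=1..n. of_bool (i \<noteq> j) * (a i j \<xi> * (fst (\<xi> i) \<bullet> fst (\<xi> j))))"
proof -
  let ?f = "\<lambda>i j. a i j \<xi> * (fst (\<xi> i) \<bullet> fst (\<xi> j))"
  have "(\<Sum>i=1..n. \<Sum>j=1..n. of_bool (i \<noteq> j) * ?f i j) = 2 * (\<Sum>i=1..n. \<Sum>j=1..n. of_bool (i < j) * ?f i j)"
    by (intro sum_upper_triangle arg_cong2[where f = times] a_sym inner_commute)
  also have "(\<Sum>i=1..n. \<Sum>j=1..n. of_bool (i < j) * ?f i j) = (\<Sum>j=1..n. \<Sum>i=1..n. of_bool (i < j) * ?f i j)" by (rule sum.swap)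
  also have "\<dots> = (\<Sum>j=1..n. \<Sum>i=1..n. A i j \<xi> * g i j \<xi>)" by (intro sum.cong refl) (simp add: A_def g_def)
  finally show ?thesis unfolding W_def increment_def sum_distrib_left[symmetric] ..
qed

lemma V_eq: "V \<xi> = 2 * (\<Sum>i=1..n. \<Sum>j=1..n. of_bool (i \<noteq> j) * ((a i j \<xi>)\<^sup>2 * (fst (\<xi> i) \<bullet> fst (\<xi> j))\<^sup>2))"
proof -
  let ?f = "\<lambda>i j. (a i j \<xi>)\<^sup>2 * (fst (\<xi> i) \<bullet> fst (\<xi> j))\<^sup>2"
  have "(\<Sum>i=1..n. \<Sum>j=1..n. of_bool (i \<noteq> j) * ?f i j) = 2 * (\<Sum>i=1..n. \<Sum>j=1..n. of_bool (i < j) * ?f i j)"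
    by (intro sum_upper_triangle arg_cong2[where f = "\<lambda>x y. x\<^sup>2 * y\<^sup>2"] a_sym inner_commute)
  also have "(\<Sum>i=1..n. \<Sum>j=1..n. of_bool (i < j) * ?f i j) = (\<Sum>j=1..n. \<Sum>i=1..n. of_bool (i < j) * ?f i j)" by (rule sum.swap)
  also have "\<dots> = (\<Sum>j=1..n. \<Sum>i=1..n. (A i j \<xi> * g i j \<xi>)\<^sup>2)" by (intro sum.cong refl) (simp add: A_def g_def power_mult_distrib)
  finally show ?thesis unfolding V_def by simp
qed

end

context single_index_design
begin

text \<open>The quadratic form of a weighted design with the direction as an argument, since an
  instance of that locale fixes the direction.\<close>

definition W_stat :: "nat \<Rightarrow> real \<Rightarrow> nat \<Rightarrow> (nat \<Rightarrow> real) \<Rightarrow> (nat \<Rightarrow> L2 \<times> L2) \<Rightarrow> real" where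
  "W_stat n h p \<gamma> \<xi> = (\<Sum>i=1..n. \<Sum>j=1..n. of_bool (i \<noteq> j) * (weight n h p \<gamma> i j \<xi> * (fst (\<xi> i) \<bullet> fst (\<xi> j))))"

definition V_stat :: "nat \<Rightarrow> real \<Rightarrow> nat \<Rightarrow> (nat \<Rightarrow> real) \<Rightarrow> (nat \<Rightarrow> L2 \<times> L2) \<Rightarrow> real" where
  "V_stat n h p \<gamma> \<xi> = 2 * (\<Sum>i=1..n. \<Sum>j=1..n. of_bool (i \<noteq> j) * ((weight n h p \<gamma> i j \<xi>)\<^sup>2 * (fst (\<xi> i) \<bullet> fst (\<xi> j))\<^sup>2))"

definition studentized :: "nat \<Rightarrow> real \<Rightarrow> nat \<Rightarrow> (nat \<Rightarrow> real) \<Rightarrow> (nat \<Rightarrow> L2 \<times> L2) \<Rightarrow> real" where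
  "studentized n h p \<gamma> \<xi> = sqrt (real n / (real n - 1)) * W_stat n h p \<gamma> \<xi> / sqrt (V_stat n h p \<gamma> \<xi>)"

text \<open>All powers of h cancel and those of n reduce to sqrt(n/(n-1)). The identity includes V =
  0, where both sides are quotients by 0.\<close>

lemma studentized_Q_eq:
  assumes n: "2 \<le> n" and h: "0 < h"
  shows "studentized_Q \<psi> K h p n (\<lambda>k. fst (\<xi> k)) (\<lambda>k. snd (\<xi> k)) \<gamma> = studentized n h p \<gamma> \<xi>"
proof -
  define s a b where "s = sqrt h" and "a = sqrt (real n)" and "b = sqrt (real n - 1)"
  have pos: "0 < s" "0 < a" "0 < b" unfolding s_def a_def b_def using n h by auto
  have sq: "h = s\<^sup>2" "real n = a\<^sup>2" "real n - 1 = b\<^sup>2" unfolding s_def a_def b_def using n h by auto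
  let ?W = "W_stat n h p \<gamma> \<xi>" and ?V = "V_stat n h p \<gamma> \<xi>"
  have Q: "Q_stat \<psi> K h p n (\<lambda>k. fst (\<xi> k)) (\<lambda>k. snd (\<xi> k)) \<gamma> = 1 / (real n * (real n - 1)) * (?W / h)"
    unfolding Q_stat_def kernel_weight_eq sum_off_diagonal_pairs W_stat_def sum_divide_distrib
    by (intro arg_cong2[where f = times] sum.cong refl) (simp add: mult_ac)
  have v: "v2_stat \<psi> K h p n (\<lambda>k. fst (\<xi> k)) (\<lambda>k. snd (\<xi> k)) \<gamma> = ?V / (real n * (real n - 1) * h)"
  proof -
    have "v2_stat \<psi> K h p n (\<lambda>k. fst (\<xi> k)) (\<lambda>k. snd (\<xi> k)) \<gamma> = 2 / (real n * (real n - 1) * h) * (?V / 2)"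
      unfolding v2_stat_def kernel_weight_eq sum_off_diagonal_pairs V_stat_def nonzero_mult_div_cancel_left[OF zero_neq_numeral[symmetric]]
      by (rule arg_cong2[where f = times, OF refl], intro sum.cong refl) (simp add: mult_ac)
    then show ?thesis by simp
  qed
  have r: "sqrt (?V / (real n * (real n - 1) * h)) = sqrt ?V / (a * b * s)"
    unfolding real_sqrt_divide real_sqrt_mult a_def b_def s_def ..
  have "studentized_Q \<psi> K h p n (\<lambda>k. fst (\<xi> k)) (\<lambda>k. snd (\<xi> k)) \<gamma> = real n * s * (1 / (real n * (real n - 1)) * (?W / h)) / (sqrt ?V / (a * b * s))"
    unfolding studentized_Q_def Q v r s_def ..
  also have "\<dots> = a / b * ?W / sqrt ?V"
  proof -
    have "N * s * (1 / (N * M) * (w / H)) / (x / (a * b * s)) = a / b * w / x" if "N = a\<^sup>2" "M = b\<^sup>2" "H = s\<^sup>2" for N M H w x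
      unfolding that using pos by (simp add: power2_eq_square field_simps)
    then show ?thesis using sq by blast
  qed
  also have "a / b = sqrt (real n / (real n - 1))" unfolding a_def b_def by (rule real_sqrt_divide[symmetric])
  finally show ?thesis unfolding studentized_def .
qed

lemma studentized_measurable:
  assumes "1 \<le> n" "0 < h"
  shows "studentized n h p \<gamma> \<in> borel_measurable (P n)"
proof -
  interpret WD: weighted_design D n "weight n h p \<gamma>" "K 0" "K 0 + real n * h" by (rule weighted_design_weight[OF assms])
  have "studentized n h p \<gamma> = (\<lambda>\<xi>. sqrt (real n / (real n - 1)) * WD.W \<xi> / sqrt (WD.V \<xi>))"
    unfolding studentized_def[abs_def] WD.W_eq WD.V_eq W_stat_def V_stat_def ..
  then show ?thesis by simp
qed

text \<open>With c = d h, the block bound yields energy at least d h n^2 y / 8; the second clause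
  limits the loss from the diagonal to half of that.\<close>

definition good :: "nat \<Rightarrow> real \<Rightarrow> real \<Rightarrow> (nat \<Rightarrow> L2 \<times> L2) \<Rightarrow> bool" where
  "good n y c \<xi> \<longleftrightarrow> (real n)\<^sup>2 * y / 4 \<le> (\<Sum>i=1..n. \<Sum>j=1..n. (fst (\<xi> i) \<bullet> fst (\<xi> j))\<^sup>2) \<and>
     (\<Sum>i=1..n. norm (fst (\<xi> i)) ^ 4) < c * (real n)\<^sup>2 * y / 16"

lemma good_measurable: "Measurable.pred (P n) (good n y c)"
  unfolding good_def by measurable

lemma prob_not_good_le:
  defines "y \<equiv> \<integral>z. sq_inner z \<partial>(D \<Otimes>\<^sub>M D)"
  assumes n: "2 \<le> n" and y: "0 < y" and c: "0 < c"
  shows "P.prob n {\<xi> \<in> space (P n). \<not> good n y c \<xi>} \<le>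
    256 * (\<integral>z. norm (fst z) ^ 8 \<partial>D) / (real n * y\<^sup>2) + 16 * ((\<integral>z. norm (fst z) ^ 8 \<partial>D) + 1) / (c * real n * y)"
proof -
  let ?m8 = "\<integral>z. norm (fst z) ^ 8 \<partial>D"
  let ?A = "{\<xi> \<in> space (P n). (\<Sum>i=1..n. \<Sum>j=1..n. (fst (\<xi> i) \<bullet> fst (\<xi> j))\<^sup>2) < (real n)\<^sup>2 * y / 4}"
  let ?B = "{\<xi> \<in> space (P n). c * (real n)\<^sup>2 * y / 16 \<le> (\<Sum>i=1..n. norm (fst (\<xi> i)) ^ 4)}"
  have m: "?A \<in> sets (P n)" "?B \<in> sets (P n)" by measurable
  have t: "0 < c * (real n)\<^sup>2 * y / 16" using n y c by simp
  have "{\<xi> \<in> space (P n). \<not> good n y c \<xi>} = ?A \<union> ?B" unfolding good_def by auto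
  then have "P.prob n {\<xi> \<in> space (P n). \<not> good n y c \<xi>} \<le> P.prob n ?A + P.prob n ?B"
    using m by (simp only: measure_Un_le)
  also have "P.prob n ?A \<le> 256 * ?m8 / (real n * y\<^sup>2)" using prob_small_energy_le[OF n] y unfolding y_def by simp
  also have "P.prob n ?B \<le> (\<integral>\<xi>. (\<Sum>i=1..n. norm (fst (\<xi> i)) ^ 4) \<partial>P n) / (c * (real n)\<^sup>2 * y / 16)"
    by (rule integral_Markov_inequality_measure[OF expectation_sum_norm4_le(1) m(1) _ t]) (intro AE_I2 sum_nonneg, simp)
  also have "\<dots> \<le> real n * (?m8 + 1) / (c * (real n)\<^sup>2 * y / 16)"
    using t expectation_sum_norm4_le(2) by (intro divide_right_mono) auto
  also have "\<dots> = 16 * (?m8 + 1) / (c * real n * y)"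
  proof -
    have "N * X / (c * N\<^sup>2 * y / 16) = 16 * X / (c * N * y)" if "0 < N" for N X :: real
      using that by (simp add: power2_eq_square mult_ac)
    then show ?thesis using n by simp
  qed
  finally show ?thesis by simp
qed

text \<open>A deterministic consequence of an event that does not mention \<gamma>, hence uniform in
  the direction. The form 2 s0 matches the clamp used in \<open>bad\<close>.\<close>

lemma V_stat_ge:
  assumes d: "0 < d" "\<And>x. \<bar>x\<bar> \<le> d \<Longrightarrow> K 0 / 2 \<le> K x" and n: "1 \<le> n" and h: "0 < h" "d * h \<le> 1"
    and good: "good n y (d * h) \<xi>"
  shows "2 * ((K 0)\<^sup>2 * d * y / 64 * ((real n)\<^sup>2 * h)) \<le> V_stat n h p \<gamma> \<xi>"
proof -
  let ?D = "\<Sum>i=1..n. \<Sum>j=1..n. (fst (\<xi> i) \<bullet> fst (\<xi> j))\<^sup>2" and ?M = "\<Sum>i=1..n. norm (fst (\<xi> i)) ^ 4"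
  have g: "(real n)\<^sup>2 * y / 4 \<le> ?D" "?M < d * h * (real n)\<^sup>2 * y / 16" using good unfolding good_def by auto
  have r: "rank_of n (index p \<gamma> \<xi>) ` {1..n} \<subseteq> {1..n}" using rank_of_in by blast
  have "d * h / 2 * ((real n)\<^sup>2 * y / 4) \<le> d * h / 2 * ?D" using d h by (intro mult_left_mono g(1)) auto
  then have "d * h * (real n)\<^sup>2 * y / 16 \<le> d * h / 2 * ?D - ?M" using g(2) by (simp add: field_simps)
  then have "(K 0)\<^sup>2 / 4 * (d * h * (real n)\<^sup>2 * y / 16) \<le> (K 0)\<^sup>2 / 4 * (d * h / 2 * ?D - ?M)" by (rule mult_left_mono) simp
  also have "\<dots> \<le> V_stat n h p \<gamma> \<xi> / 2"
    unfolding V_stat_def weight_def using sum_off_diagonal_ge[OF d n h r, of "\<lambda>i. fst (\<xi> i)"] by simp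
  finally show ?thesis by (simp add: mult_ac)
qed

lemma abs_studentized_le:
  assumes n: "2 \<le> n" and V: "0 < v" "v\<^sup>2 \<le> V_stat n h p \<gamma> \<xi>" and W: "\<bar>W_stat n h p \<gamma> \<xi>\<bar> \<le> S"
  shows "\<bar>studentized n h p \<gamma> \<xi>\<bar> \<le> 2 * S / v"
proof -
  have "real n / (real n - 1) \<le> 2\<^sup>2" using n by (simp add: field_simps)
  then have \<rho>: "sqrt (real n / (real n - 1)) \<le> 2" using real_sqrt_le_mono by fastforce
  have sV: "v \<le> sqrt (V_stat n h p \<gamma> \<xi>)" using V by (intro real_le_rsqrt)
  have "\<bar>studentized n h p \<gamma> \<xi>\<bar> = sqrt (real n / (real n - 1)) * \<bar>W_stat n h p \<gamma> \<xi>\<bar> / sqrt (V_stat n h p \<gamma> \<xi>)"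
  proof -
    have "0 < sqrt (V_stat n h p \<gamma> \<xi>)" using sV V(1) by linarith
    then show ?thesis unfolding studentized_def abs_divide abs_mult using n by simp
  qed
  also have "\<dots> \<le> 2 * S / v" using \<rho> W sV V(1) n by (intro frac_le mult_mono mult_nonneg_nonneg) auto
  finally show ?thesis .
qed

end

section \<open>Asymptotics\<close>

text \<open>Relative to (N^2 H)^2 the two variances are of order H and 1/N, together \<delta>^4.
  Chebyshev at the level \<delta> divides by \<delta>^2 and leaves \<delta>^2, so a single sequence
  serves as tolerance and as probability bound.\<close>

lemma variance_rate_le:
  fixes \<kappa> m \<theta> N H \<delta> :: real
  assumes pos: "0 < \<kappa>" "0 \<le> m" "0 < \<theta>" "0 < N" "0 < H" "0 < \<delta>" and le: "\<kappa> \<le> N * H" and \<delta>: "\<delta> ^ 4 = 1 / N + H"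
  shows "(256 * \<kappa> * (\<kappa> + N * H) ^ 3 * (N * m) + 256 * \<kappa>\<^sup>2 * (\<kappa> + N * H)\<^sup>2 * (N * m)) / (\<delta> * (\<theta> * (N\<^sup>2 * H)))\<^sup>2 \<le>
    (2048 * \<kappa> + 1024 * \<kappa>\<^sup>2) * m / \<theta>\<^sup>2 * \<delta>\<^sup>2"
proof -
  have R: "\<kappa> + N * H \<le> 2 * (N * H)" using le by linarith
  have R0: "0 \<le> \<kappa> + N * H" using pos by simp
  have "256 * \<kappa> * (\<kappa> + N * H) ^ 3 * (N * m) + 256 * \<kappa>\<^sup>2 * (\<kappa> + N * H)\<^sup>2 * (N * m) \<le>
      256 * \<kappa> * (2 * (N * H)) ^ 3 * (N * m) + 256 * \<kappa>\<^sup>2 * (2 * (N * H))\<^sup>2 * (N * m)"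
    using pos R R0 by (intro add_mono mult_right_mono mult_left_mono power_mono) auto
  also have "\<dots> = N ^ 4 * H\<^sup>2 * m * (2048 * \<kappa> * H + 1024 * \<kappa>\<^sup>2 * (1 / N))"
    using pos by (simp add: power2_eq_square power3_eq_cube power4_eq_xxxx algebra_simps)
  also have "\<dots> \<le> N ^ 4 * H\<^sup>2 * m * ((2048 * \<kappa> + 1024 * \<kappa>\<^sup>2) * \<delta> ^ 4)"
  proof (rule mult_left_mono)
    have "2048 * \<kappa> * H + 1024 * \<kappa>\<^sup>2 * (1 / N) \<le> 2048 * \<kappa> * (1 / N + H) + 1024 * \<kappa>\<^sup>2 * (1 / N + H)"
      using pos by (intro add_mono mult_left_mono) auto
    then show "2048 * \<kappa> * H + 1024 * \<kappa>\<^sup>2 * (1 / N) \<le> (2048 * \<kappa> + 1024 * \<kappa>\<^sup>2) * \<delta> ^ 4" unfolding \<delta> by (simp only: distrib_right)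
  qed (use pos in auto)
  finally have "(256 * \<kappa> * (\<kappa> + N * H) ^ 3 * (N * m) + 256 * \<kappa>\<^sup>2 * (\<kappa> + N * H)\<^sup>2 * (N * m)) / (\<delta> * (\<theta> * (N\<^sup>2 * H)))\<^sup>2 \<le>
      N ^ 4 * H\<^sup>2 * m * ((2048 * \<kappa> + 1024 * \<kappa>\<^sup>2) * \<delta> ^ 4) / (\<delta> * (\<theta> * (N\<^sup>2 * H)))\<^sup>2" by (rule divide_right_mono) simp
  also have "\<dots> = (2048 * \<kappa> + 1024 * \<kappa>\<^sup>2) * m / \<theta>\<^sup>2 * \<delta>\<^sup>2"
  proof -
    have "N ^ 4 * H\<^sup>2 * m * (c * \<delta> ^ 4) / (\<delta> * (\<theta> * (N\<^sup>2 * H)))\<^sup>2 = c * m / \<theta>\<^sup>2 * \<delta>\<^sup>2" for c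
      using pos by (simp add: power2_eq_square power4_eq_xxxx field_simps)
    then show ?thesis .
  qed
  finally show ?thesis .
qed

text \<open>The Lyapunov sum is of order 1/N. The added 1 keeps the bound positive even if the
  eighth moment vanishes.\<close>

lemma fourth_moment_rate_le:
  fixes \<kappa> m \<theta> N H :: real
  assumes pos: "0 < \<kappa>" "0 \<le> m" "0 < \<theta>" "0 < N" "0 < H" and le: "\<kappa> \<le> N * H"
  shows "160 * \<kappa>\<^sup>2 * (\<kappa> + N * H)\<^sup>2 * (N * m) \<le> ((640 * \<kappa>\<^sup>2 * m / \<theta>\<^sup>2 + 1) / N) * (\<theta> * (N\<^sup>2 * H))\<^sup>2"
proof -
  have R: "\<kappa> + N * H \<le> 2 * (N * H)" using le by linarith
  have "160 * \<kappa>\<^sup>2 * (\<kappa> + N * H)\<^sup>2 * (N * m) \<le> 160 * \<kappa>\<^sup>2 * (2 * (N * H))\<^sup>2 * (N * m)"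
    using pos R by (intro mult_right_mono mult_left_mono power_mono) auto
  also have "\<dots> = (640 * \<kappa>\<^sup>2 * m / \<theta>\<^sup>2 / N) * (\<theta> * (N\<^sup>2 * H))\<^sup>2"
    using pos by (simp add: power2_eq_square field_simps)
  also have "\<dots> \<le> ((640 * \<kappa>\<^sup>2 * m / \<theta>\<^sup>2 + 1) / N) * (\<theta> * (N\<^sup>2 * H))\<^sup>2"
    using pos by (intro mult_right_mono divide_right_mono) auto
  finally show ?thesis .
qed

lemma second_moment_rate_le:
  fixes \<kappa> m \<theta> N H :: real
  assumes pos: "0 < \<kappa>" "0 \<le> m" "0 < \<theta>" "0 < N" "0 < H" and le: "\<kappa> \<le> N * H"
  shows "2 * \<kappa> * (\<kappa> + N * H) * N * (m + 1) / (\<theta> * (N\<^sup>2 * H)) \<le> 4 * \<kappa> * (m + 1) / \<theta>"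
proof -
  have R: "\<kappa> + N * H \<le> 2 * (N * H)" using le by linarith
  have "2 * \<kappa> * (\<kappa> + N * H) * N * (m + 1) \<le> 2 * \<kappa> * (2 * (N * H)) * N * (m + 1)"
    using pos R by (intro mult_right_mono mult_left_mono) auto
  then have "2 * \<kappa> * (\<kappa> + N * H) * N * (m + 1) / (\<theta> * (N\<^sup>2 * H)) \<le> 2 * \<kappa> * (2 * (N * H)) * N * (m + 1) / (\<theta> * (N\<^sup>2 * H))"
    using pos by (intro divide_right_mono) auto
  also have "\<dots> = 4 * \<kappa> * (m + 1) / \<theta>" using pos by (simp add: power2_eq_square)
  finally show ?thesis .
qed

text \<open>For n \<ge> 2 one has 2n^2 + 1 \<le> n^4, and 4(p + 1) \<le> 8p; hence a moment order of
  4 p ln n suffices.\<close>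

lemma pattern_count_le_exp:
  fixes n p q :: nat
  assumes n: "2 \<le> n" and p: "1 \<le> p" and q: "4 * (real p * ln (real n)) \<le> real q"
  shows "real ((2 * n\<^sup>2 + 1) ^ (p + 1)) \<le> exp (2 * real q)"
proof -
  have x: "4 \<le> n\<^sup>2" using power_mono[OF n, of 2] by simp
  have "2 * n\<^sup>2 + 1 \<le> 4 * n\<^sup>2" using x by simp
  also have "\<dots> \<le> n\<^sup>2 * n\<^sup>2" using x by (rule mult_right_mono) simp
  also have "\<dots> = n ^ 4" by (simp flip: power_add)
  finally have "real ((2 * n\<^sup>2 + 1) ^ (p + 1)) \<le> real ((n ^ 4) ^ (p + 1))" by (intro of_nat_mono power_mono) auto
  also have "\<dots> = real n ^ (4 * (p + 1))" by (simp only: of_nat_power power_mult)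
  also have "\<dots> = exp (real (4 * (p + 1)) * ln (real n))" using n by (simp only: exp_of_nat_mult) simp
  also have "\<dots> \<le> exp (2 * real q)"
  proof (subst exp_le_cancel_iff)
    have "real (4 * (p + 1)) * ln (real n) \<le> (8 * real p) * ln (real n)" using n p by (intro mult_right_mono) auto
    then show "real (4 * (p + 1)) * ln (real n) \<le> 2 * real q" using q by linarith
  qed
  finally show ?thesis .
qed

section \<open>Limits along the sequence of sample sizes\<close>

locale asymptotic_design = single_index_design D K \<psi>
  for D :: "(L2 \<times> L2) measure" and K and \<psi> +
  fixes h \<alpha> :: "nat \<Rightarrow> real" and p :: "nat \<Rightarrow> nat"
  assumes h_pos: "\<And>n. 1 \<le> n \<Longrightarrow> 0 < h n"
    and h_tendsto_0: "h \<longlonglongrightarrow> 0"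
    and nh2_at_top: "filterlim (\<lambda>n. real n * (h n)\<^sup>2) at_top sequentially"
    and p_ge_1: "\<And>n. 1 \<le> n \<Longrightarrow> 1 \<le> p n"
    and \<alpha>_pos: "\<And>n. 1 \<le> n \<Longrightarrow> 0 < \<alpha> n"
    and penalty_at_top: "filterlim (\<lambda>n. \<alpha> n / (real (p n) * ln (real n))) at_top sequentially"
    and energy_pos: "0 < (\<integral>z. sq_inner z \<partial>(D \<Otimes>\<^sub>M D))"
begin

abbreviation energy :: real where "energy \<equiv> \<integral>z. sq_inner z \<partial>(D \<Otimes>\<^sub>M D)"

abbreviation mom8 :: real where "mom8 \<equiv> \<integral>z. norm (fst z) ^ 8 \<partial>D"

abbreviation stat :: "nat \<Rightarrow> (nat \<Rightarrow> real) \<Rightarrow> (nat \<Rightarrow> L2 \<times> L2) \<Rightarrow> real" where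
  "stat n \<gamma> \<equiv> studentized n (h n) (p n) \<gamma>"

lemma mom8_nonneg: "0 \<le> mom8" by simp

lemma nh_at_top: "filterlim (\<lambda>n. real n * h n) at_top sequentially"
proof (rule filterlim_at_top_mono[OF nh2_at_top])
  have "\<forall>\<^sub>F n in sequentially. h n < 1" using h_tendsto_0 by (rule order_tendstoD) simp
  then show "\<forall>\<^sub>F n in sequentially. real n * (h n)\<^sup>2 \<le> real n * h n"
    using eventually_ge_at_top[of 1]
  proof eventually_elim
    fix n :: nat assume "h n < 1" "1 \<le> n"
    then have "h n * h n \<le> h n * 1" using h_pos[of n] by (intro mult_left_mono) auto
    then show "real n * (h n)\<^sup>2 \<le> real n * h n" by (intro mult_left_mono) (auto simp: power2_eq_square)
  qed
qed

lemma eventually_regular: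
  assumes d: "0 < (d :: real)"
  shows "\<forall>\<^sub>F n in sequentially. 3 \<le> n \<and> d * h n \<le> 1 \<and> K 0 \<le> real n * h n"
proof -
  have "(\<lambda>n. d * h n) \<longlonglongrightarrow> d * 0" by (intro tendsto_mult tendsto_const h_tendsto_0)
  then have "(\<lambda>n. d * h n) \<longlonglongrightarrow> 0" by simp
  then have "\<forall>\<^sub>F n in sequentially. d * h n < 1" by (rule order_tendstoD) simp
  moreover have "\<forall>\<^sub>F n in sequentially. K 0 \<le> real n * h n" using nh_at_top unfolding filterlim_at_top by blast
  ultimately show ?thesis using eventually_ge_at_top[of 3] by eventually_elim simp
qed

lemma prob_not_good_rate_tendsto_0:
  "(\<lambda>n. 256 * mom8 / (real n * energy\<^sup>2) + 16 * (mom8 + 1) / (d * h n * real n * energy)) \<longlonglongrightarrow> 0" if d: "0 < d"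
proof -
  have "(\<lambda>n. 256 * mom8 / energy\<^sup>2 * (1 / real n) + 16 * (mom8 + 1) / (d * energy) * (inverse (real n * h n))) \<longlonglongrightarrow> 256 * mom8 / energy\<^sup>2 * 0 + 16 * (mom8 + 1) / (d * energy) * 0"
    by (intro tendsto_add tendsto_mult tendsto_const lim_1_over_n tendsto_inverse_0_at_top nh_at_top)
  moreover have "256 * mom8 / energy\<^sup>2 * (1 / real n) + 16 * (mom8 + 1) / (d * energy) * (inverse (real n * h n)) =
    256 * mom8 / (real n * energy\<^sup>2) + 16 * (mom8 + 1) / (d * h n * real n * energy)" for n
    by (simp add: divide_inverse mult_ac)
  ultimately show ?thesis by simp
qed

text \<open>The directions may vary with n as long as they are not random: the moment bounds depend
  on the weights only through \<kappa> and \<open>R\<close>, which do not involve the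
  direction.\<close>

theorem characteristic_function_stat_tendsto:
  "(\<lambda>n. \<integral>\<xi>. iexp (t * stat n (\<gamma> n) \<xi>) \<partial>P n) \<longlonglongrightarrow> of_real (exp (- (t\<^sup>2 / 2)))"
proof -
  obtain d where d: "0 < d" "\<And>x. \<bar>x\<bar> \<le> d \<Longrightarrow> K 0 / 2 \<le> K x" using ex_K_ge_half by blast
  define \<theta> where "\<theta> = (K 0)\<^sup>2 * d * energy / 64"
  have \<theta>: "0 < \<theta>" unfolding \<theta>_def using K_0_pos d energy_pos by simp
  \<comment> \<open>The fourth root is the choice for which \<open>variance_rate_le\<close> makes
    both the tolerance and the exceptional probability vanish.\<close>
  define \<delta> where "\<delta> n = sqrt (sqrt (1 / real n + h n))" for n
  define \<Lambda> where "\<Lambda> n = (640 * (K 0)\<^sup>2 * mom8 / \<theta>\<^sup>2 + 1) / real n" for n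
  define \<rho> where "\<rho> n = sqrt (real n / (real n - 1))" for n
  define \<pi>' where "\<pi>' n = (256 * mom8 / (real n * energy\<^sup>2) + 16 * (mom8 + 1) / (d * h n * real n * energy)) +
      (2048 * K 0 + 1024 * (K 0)\<^sup>2) * mom8 / \<theta>\<^sup>2 * (\<delta> n)\<^sup>2" for n
  define C where "C = sqrt (4 * K 0 * (mom8 + 1) / \<theta>)"
  define b where "b n = (4 * \<bar>t\<bar> ^ 3 + exp (t\<^sup>2) * (1 + t\<^sup>2) * (1 + \<bar>t\<bar>) + 1) * (sqrt (\<Lambda> n) + \<delta> n + \<delta> n * sqrt (\<Lambda> n) + \<pi>' n) + 2 * \<pi>' n +
    \<bar>t\<bar> * ((\<bar>\<rho> n - 1\<bar> + \<rho> n * \<delta> n) * C)" for n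
  have "(\<lambda>n. sqrt (sqrt (1 / real n + h n))) \<longlonglongrightarrow> sqrt (sqrt (0 + 0))"
    by (intro tendsto_real_sqrt tendsto_add lim_1_over_n h_tendsto_0)
  then have \<delta>_lim: "\<delta> \<longlonglongrightarrow> 0" unfolding \<delta>_def[abs_def] by simp
  have "(\<lambda>n. (640 * (K 0)\<^sup>2 * mom8 / \<theta>\<^sup>2 + 1) * (1 / real n)) \<longlonglongrightarrow> (640 * (K 0)\<^sup>2 * mom8 / \<theta>\<^sup>2 + 1) * 0"
    by (intro tendsto_mult tendsto_const lim_1_over_n)
  then have \<Lambda>_lim: "\<Lambda> \<longlonglongrightarrow> 0" unfolding \<Lambda>_def[abs_def] by simp
  have "(\<lambda>n. real n / (real n - 1)) \<longlonglongrightarrow> 1" by real_asymp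
  from tendsto_real_sqrt[OF this] have \<rho>_lim: "\<rho> \<longlonglongrightarrow> 1" unfolding \<rho>_def[abs_def] by simp
  have "\<pi>' \<longlonglongrightarrow> 0 + (2048 * K 0 + 1024 * (K 0)\<^sup>2) * mom8 / \<theta>\<^sup>2 * 0\<^sup>2"
    unfolding \<pi>'_def[abs_def] by (intro tendsto_add prob_not_good_rate_tendsto_0 d(1) tendsto_mult tendsto_const tendsto_power \<delta>_lim)
  then have \<pi>_lim: "\<pi>' \<longlonglongrightarrow> 0" by simp
  have "b \<longlonglongrightarrow> (4 * \<bar>t\<bar> ^ 3 + exp (t\<^sup>2) * (1 + t\<^sup>2) * (1 + \<bar>t\<bar>) + 1) * (sqrt 0 + 0 + 0 * sqrt 0 + 0) + 2 * 0 + \<bar>t\<bar> * ((\<bar>1 - 1\<bar> + 1 * 0) * C)"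
    unfolding b_def[abs_def] by (intro tendsto_intros \<delta>_lim \<Lambda>_lim \<rho>_lim \<pi>_lim)
  then have b_lim: "b \<longlonglongrightarrow> 0" by simp
  have "\<forall>\<^sub>F n in sequentially. \<delta> n < 1 / 2" using \<delta>_lim by (rule order_tendstoD) simp
  then have "\<forall>\<^sub>F n in sequentially. cmod ((\<integral>\<xi>. iexp (t * stat n (\<gamma> n) \<xi>) \<partial>P n) - of_real (exp (- (t\<^sup>2 / 2)))) \<le> b n"
    using eventually_regular[OF d(1)]
  proof eventually_elim
    fix n assume \<delta>2: "\<delta> n < 1 / 2" and reg: "3 \<le> n \<and> d * h n \<le> 1 \<and> K 0 \<le> real n * h n"
    have n: "1 \<le> n" "2 \<le> n" "0 < real n" using reg by auto
    have hn: "0 < h n" by (rule h_pos[OF n(1)])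
    interpret WD: weighted_design D n "weight n (h n) (p n) (\<gamma> n)" "K 0" "K 0 + real n * h n" by (rule weighted_design_weight[OF n(1) hn])
    have W: "W_stat n (h n) (p n) (\<gamma> n) = WD.W" unfolding W_stat_def[abs_def] WD.W_eq[abs_def] ..
    have V: "V_stat n (h n) (p n) (\<gamma> n) = WD.V" unfolding V_stat_def[abs_def] WD.V_eq[abs_def] ..
    let ?s0 = "\<theta> * ((real n)\<^sup>2 * h n)"
    have s0: "0 < ?s0" using \<theta> n hn by simp
    have e0: "0 < 1 / real n + h n" using n hn by (simp add: add_pos_pos)
    have \<delta>0: "0 < \<delta> n" unfolding \<delta>_def using e0 by simp
    have \<delta>4: "\<delta> n ^ 4 = 1 / real n + h n"
    proof -
      have "\<delta> n ^ 4 = ((\<delta> n)\<^sup>2)\<^sup>2" by (simp flip: power_mult)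
      then show ?thesis unfolding \<delta>_def using e0 by simp
    qed
    have m8: "WD.m8 = mom8" by (rule WD.m8_def)
    have V2: "P.prob n {\<xi> \<in> space (P n). WD.V \<xi> < 2 * ?s0} \<le> P.prob n {\<xi> \<in> space (P n). \<not> good n energy (d * h n) \<xi>}"
    proof (rule P.finite_measure_mono)
      show "{\<xi> \<in> space (P n). WD.V \<xi> < 2 * ?s0} \<subseteq> {\<xi> \<in> space (P n). \<not> good n energy (d * h n) \<xi>}"
      proof (intro subsetI CollectI conjI notI; elim CollectE conjE)
        fix \<xi> assume "WD.V \<xi> < 2 * ?s0" "good n energy (d * h n) \<xi>"
        then show False using V_stat_ge[OF d n(1) hn _ \<open>good n energy (d * h n) \<xi>\<close>, of "p n" "\<gamma> n"] reg unfolding V \<theta>_def by simp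
      qed
      show "{\<xi> \<in> space (P n). \<not> good n energy (d * h n) \<xi>} \<in> sets (P n)" using good_measurable by measurable
    qed
    also have "\<dots> \<le> 256 * mom8 / (real n * energy\<^sup>2) + 16 * (mom8 + 1) / (d * h n * real n * energy)"
      by (rule prob_not_good_le[OF n(2) energy_pos]) (use d hn in simp)
    finally have \<pi>: "P.prob n {\<xi> \<in> space (P n). WD.bad ?s0 (\<delta> n) \<xi>} \<le> \<pi>' n"
      using WD.prob_bad_le[OF s0 \<delta>0] variance_rate_le[OF K_0_pos mom8_nonneg \<theta> n(3) hn \<delta>0 _ \<delta>4] reg
      unfolding \<pi>'_def m8 by linarith
    have \<Lambda>: "160 * (K 0)\<^sup>2 * (K 0 + real n * h n)\<^sup>2 * (real n * WD.m8) \<le> \<Lambda> n * ?s0\<^sup>2"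
      unfolding m8 \<Lambda>_def by (rule fourth_moment_rate_le[OF K_0_pos mom8_nonneg \<theta> n(3) hn]) (use reg in simp)
    have \<Lambda>0: "0 < \<Lambda> n" unfolding \<Lambda>_def using n \<theta> mom8_nonneg K_0_pos by (intro divide_pos_pos add_nonneg_pos divide_nonneg_nonneg) auto
    have \<rho>0: "0 \<le> \<rho> n" unfolding \<rho>_def using n by simp
    have "sqrt (2 * K 0 * (K 0 + real n * h n) * real n * (WD.m8 + 1) / ?s0) \<le> C"
      unfolding C_def m8 by (intro real_sqrt_le_mono second_moment_rate_le K_0_pos mom8_nonneg \<theta> n(3) hn) (use reg in simp)
    then have C: "\<bar>t\<bar> * ((\<bar>\<rho> n - 1\<bar> + \<rho> n * \<delta> n) * sqrt (2 * K 0 * (K 0 + real n * h n) * real n * (WD.m8 + 1) / ?s0)) \<le> \<bar>t\<bar> * ((\<bar>\<rho> n - 1\<bar> + \<rho> n * \<delta> n) * C)"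
      using \<rho>0 \<delta>0 by (intro mult_left_mono) auto
    have st: "stat n (\<gamma> n) \<xi> = \<rho> n * WD.W \<xi> / sqrt (WD.V \<xi>)" for \<xi> unfolding studentized_def W V \<rho>_def ..
    have "cmod ((\<integral>\<xi>. iexp (t * stat n (\<gamma> n) \<xi>) \<partial>P n) - of_real (exp (- (t\<^sup>2 / 2)))) \<le>
      (4 * \<bar>t\<bar> ^ 3 + exp (t\<^sup>2) * (1 + t\<^sup>2) * (1 + \<bar>t\<bar>) + 1) * (sqrt (\<Lambda> n) + \<delta> n + \<delta> n * sqrt (\<Lambda> n) + \<pi>' n) + 2 * \<pi>' n +
      \<bar>t\<bar> * ((\<bar>\<rho> n - 1\<bar> + \<rho> n * \<delta> n) * sqrt (2 * K 0 * (K 0 + real n * h n) * real n * (WD.m8 + 1) / ?s0))"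
      unfolding st using \<delta>2 by (intro WD.characteristic_function_studentized[OF s0 \<delta>0 _ \<Lambda> \<Lambda>0 \<rho>0 \<pi>]) simp
    also have "\<dots> \<le> b n" unfolding b_def using C by (rule add_left_mono)
    finally show "cmod ((\<integral>\<xi>. iexp (t * stat n (\<gamma> n) \<xi>) \<partial>P n) - of_real (exp (- (t\<^sup>2 / 2)))) \<le> b n" .
  qed
  then have "(\<lambda>n. (\<integral>\<xi>. iexp (t * stat n (\<gamma> n) \<xi>) \<partial>P n) - of_real (exp (- (t\<^sup>2 / 2)))) \<longlonglongrightarrow> 0"
    by (rule Lim_null_comparison[OF _ b_lim])
  then show ?thesis by (rule LIM_zero_cancel)
qed

text \<open>The majorant has mean of order q n sqrt h with q of order p ln n, and the denominator is
  at least of order n sqrt h. By Markov's inequality some statistic reaches a fixed fraction of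
  \<alpha> with probability of order p ln n / \<alpha>, which tends to 0 by the growth of the
  penalty.\<close>

theorem ex_exceptional_sets:
  "\<exists>N. (\<forall>\<^sub>F n in sequentially. N n \<in> sets (P n) \<and>
      (\<forall>\<xi>\<in>space (P n) - N n. \<forall>\<gamma> \<gamma>'. stat n \<gamma> \<xi> - stat n \<gamma>' \<xi> < \<alpha> n)) \<and>
    (\<lambda>n. P.prob n (N n)) \<longlonglongrightarrow> 0"
proof -
  obtain d where d: "0 < d" "\<And>x. \<bar>x\<bar> \<le> d \<Longrightarrow> K 0 / 2 \<le> K x" using ex_K_ge_half by blast
  define \<theta> where "\<theta> = (K 0)\<^sup>2 * d * energy / 64"
  have \<theta>: "0 < \<theta>" unfolding \<theta>_def using K_0_pos d energy_pos by simp
  define q where "q n = nat \<lceil>4 * (real (p n) * ln (real n))\<rceil>" for n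
  \<comment> \<open>The square of \<open>v n\<close> is half the uniform lower bound for
    \<open>V_stat\<close>. As statistics are at most 2 S / v in absolute value, S < \<alpha> v / 4
    keeps the difference of any two below \<alpha>.\<close>
  define v where "v n = real n * sqrt (\<theta> * h n)" for n
  have "\<exists>S. 3 \<le> n \<longrightarrow> integrable (P n) S \<and> (\<forall>\<xi>. 0 \<le> S \<xi>) \<and>
    (\<integral>\<xi>. S \<xi> \<partial>P n) \<le> 160 * (exp 1)\<^sup>2 * real (q n) * sqrt (K 0 * (K 0 + real n * h n) * (real n * (mom8 + 1))) \<and>
    (\<forall>\<gamma> \<xi>. \<bar>W_stat n (h n) (p n) \<gamma> \<xi>\<bar> \<le> S \<xi>)" for n
  proof (cases "3 \<le> n")
    case True
    then have n: "1 \<le> n" "2 \<le> n" by auto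
    have q4: "4 * (real (p n) * ln (real n)) \<le> real (q n)" unfolding q_def by (rule real_nat_ceiling_ge)
    have "0 < real (p n) * ln (real n)" using n p_ge_1[OF n(1)] by simp
    then have q1: "1 \<le> q n" using q4 by linarith
    show ?thesis
      using ex_chaos_envelope[OF n(1) h_pos[OF n(1)] q1 pattern_count_le_exp[OF n(2) p_ge_1[OF n(1)] q4]]
      unfolding W_stat_def by blast
  qed blast
  then obtain S where S: "\<And>n. 3 \<le> n \<Longrightarrow> integrable (P n) (S n)" "\<And>n \<xi>. 3 \<le> n \<Longrightarrow> 0 \<le> S n \<xi>"
    "\<And>n. 3 \<le> n \<Longrightarrow> (\<integral>\<xi>. S n \<xi> \<partial>P n) \<le> 160 * (exp 1)\<^sup>2 * real (q n) * sqrt (K 0 * (K 0 + real n * h n) * (real n * (mom8 + 1)))"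
    "\<And>n \<gamma> \<xi>. 3 \<le> n \<Longrightarrow> \<bar>W_stat n (h n) (p n) \<gamma> \<xi>\<bar> \<le> S n \<xi>"
    by metis
  let ?G = "\<lambda>n. {\<xi> \<in> space (P n). \<not> good n energy (d * h n) \<xi>}"
  let ?T = "\<lambda>n. {\<xi> \<in> space (P n). \<alpha> n * v n / 4 \<le> S n \<xi>}"
  define N where "N n = ?G n \<union> ?T n" for n
  define C where "C = 640 * (exp 1)\<^sup>2 * sqrt (2 * K 0 * (mom8 + 1) / \<theta>)"
  define b where "b n = (256 * mom8 / (real n * energy\<^sup>2) + 16 * (mom8 + 1) / (d * h n * real n * energy)) + C * (5 * inverse (\<alpha> n / (real (p n) * ln (real n))))" for n
  have ev: "\<forall>\<^sub>F n in sequentially. (N n \<in> sets (P n) \<and>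
      (\<forall>\<xi>\<in>space (P n) - N n. \<forall>\<gamma> \<gamma>'. stat n \<gamma> \<xi> - stat n \<gamma>' \<xi> < \<alpha> n)) \<and> P.prob n (N n) \<le> b n"
    using eventually_regular[OF d(1)]
  proof eventually_elim
    fix n assume reg: "3 \<le> n \<and> d * h n \<le> 1 \<and> K 0 \<le> real n * h n"
    have n: "1 \<le> n" "2 \<le> n" "0 < real n" "3 \<le> n" using reg by auto
    have hn: "0 < h n" by (rule h_pos[OF n(1)])
    have dh: "d * h n \<le> 1" using reg by blast
    have \<alpha>n: "0 < \<alpha> n" by (rule \<alpha>_pos[OF n(1)])
    have v0: "0 < v n" unfolding v_def using n hn \<theta> by simp
    have Sm: "S n \<in> borel_measurable (P n)" using S(1)[OF n(4)] by (rule borel_measurable_integrable)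
    have m: "?G n \<in> sets (P n)" "?T n \<in> sets (P n)" using good_measurable Sm by measurable
    have Nm: "N n \<in> sets (P n)" unfolding N_def using m by (rule sets.Un)
    have sep: "stat n \<gamma> \<xi> - stat n \<gamma>' \<xi> < \<alpha> n" if \<xi>: "\<xi> \<in> space (P n) - N n" for \<xi> \<gamma> \<gamma>'
    proof -
      have g: "good n energy (d * h n) \<xi>" and s: "S n \<xi> < \<alpha> n * v n / 4" using \<xi> unfolding N_def by auto
      have v2: "(v n)\<^sup>2 \<le> V_stat n (h n) (p n) \<gamma> \<xi>" for \<gamma>
      proof -
        have "(v n)\<^sup>2 = \<theta> * ((real n)\<^sup>2 * h n)" unfolding v_def power_mult_distrib using \<theta> hn by (simp add: mult_ac)
        also have "\<dots> \<le> 2 * (\<theta> * ((real n)\<^sup>2 * h n))" using \<theta> hn by simp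
        also have "\<dots> \<le> V_stat n (h n) (p n) \<gamma> \<xi>" unfolding \<theta>_def by (rule V_stat_ge[OF d n(1) hn dh g])
        finally show ?thesis .
      qed
      have le: "\<bar>stat n \<gamma> \<xi>\<bar> \<le> 2 * S n \<xi> / v n" for \<gamma> by (rule abs_studentized_le[OF n(2) v0 v2 S(4)[OF n(4)]])
      have "stat n \<gamma> \<xi> - stat n \<gamma>' \<xi> \<le> 2 * S n \<xi> / v n + 2 * S n \<xi> / v n" using le[of \<gamma>] le[of \<gamma>'] by linarith
      also have "\<dots> < \<alpha> n" using s v0 by (simp add: field_simps)
      finally show ?thesis .
    qed
    have "P.prob n (N n) \<le> P.prob n (?G n) + P.prob n (?T n)" unfolding N_def using m by (rule measure_Un_le)
    also have "P.prob n (?G n) \<le> 256 * mom8 / (real n * energy\<^sup>2) + 16 * (mom8 + 1) / (d * h n * real n * energy)"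
      by (rule prob_not_good_le[OF n(2) energy_pos]) (use d hn in simp)
    also have "P.prob n (?T n) \<le> C * (5 * inverse (\<alpha> n / (real (p n) * ln (real n))))"
    proof -
      have "P.prob n (?T n) \<le> (\<integral>\<xi>. S n \<xi> \<partial>P n) / (\<alpha> n * v n / 4)"
        by (rule integral_Markov_inequality_measure[OF S(1)[OF n(4)] m(1)]) (use S(2)[OF n(4)] \<alpha>n v0 in auto)
      also have "\<dots> \<le> (160 * (exp 1)\<^sup>2 * real (q n) * (real n * sqrt (h n) * sqrt (2 * K 0 * (mom8 + 1)))) / (\<alpha> n * v n / 4)"
      proof (rule divide_right_mono)
        have "K 0 * (K 0 + real n * h n) * (real n * (mom8 + 1)) \<le> K 0 * (2 * (real n * h n)) * (real n * (mom8 + 1))"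
          using K_0_pos reg mom8_nonneg by (intro mult_right_mono mult_left_mono) auto
        also have "\<dots> = (real n)\<^sup>2 * h n * (2 * K 0 * (mom8 + 1))" by (simp add: power2_eq_square mult_ac)
        finally have "sqrt (K 0 * (K 0 + real n * h n) * (real n * (mom8 + 1))) \<le> sqrt ((real n)\<^sup>2 * h n * (2 * K 0 * (mom8 + 1)))" by (rule real_sqrt_le_mono)
        also have "\<dots> = real n * sqrt (h n) * sqrt (2 * K 0 * (mom8 + 1))" by (simp add: real_sqrt_mult)
        finally show "(\<integral>\<xi>. S n \<xi> \<partial>P n) \<le> 160 * (exp 1)\<^sup>2 * real (q n) * (real n * sqrt (h n) * sqrt (2 * K 0 * (mom8 + 1)))"
          using S(3)[OF n(4)] by (elim order.trans) (intro mult_left_mono, auto)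
      qed (use \<alpha>n v0 in auto)
      also have "\<dots> = C * (real (q n) / \<alpha> n)"
      proof -
        have "160 * e * r * (real n * sqrt (h n) * c) / (\<alpha> n * (real n * (sqrt \<theta> * sqrt (h n))) / 4) = 640 * e * (c / sqrt \<theta>) * (r / \<alpha> n)" for e r c
          using n hn \<alpha>n \<theta> by (simp add: field_simps)
        then show ?thesis unfolding C_def v_def real_sqrt_divide real_sqrt_mult .
      qed
      also have "\<dots> \<le> C * (5 * inverse (\<alpha> n / (real (p n) * ln (real n))))"
      proof (rule mult_left_mono)
        \<comment> \<open>From n \<ge> 3 on, p ln n is at least 1, so the rounding in
          \<open>q\<close> is absorbed: 4x + 1 \<le> 5x.\<close>
        have l: "1 \<le> ln (real n)"
        proof -
          have "exp 1 \<le> real n" using exp_le n(4) by linarith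
          then show ?thesis using n(3) by (simp add: ln_ge_iff)
        qed
        have "1 * 1 \<le> real (p n) * ln (real n)" using l p_ge_1[OF n(1)] by (intro mult_mono) auto
        moreover have "real (q n) \<le> 4 * (real (p n) * ln (real n)) + 1"
          unfolding q_def using calculation by (simp add: of_nat_nat)
        ultimately have "real (q n) \<le> 5 * (real (p n) * ln (real n))" by linarith
        then have "real (q n) / \<alpha> n \<le> 5 * (real (p n) * ln (real n)) / \<alpha> n" using \<alpha>n by (intro divide_right_mono) auto
        then show "real (q n) / \<alpha> n \<le> 5 * inverse (\<alpha> n / (real (p n) * ln (real n)))" by simp
        show "0 \<le> C" unfolding C_def using K_0_pos mom8_nonneg \<theta> by simp
      qed
      finally show ?thesis .
    qed
    finally have "P.prob n (N n) \<le> b n" unfolding b_def by simp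
    then show "(N n \<in> sets (P n) \<and> (\<forall>\<xi>\<in>space (P n) - N n. \<forall>\<gamma> \<gamma>'. stat n \<gamma> \<xi> - stat n \<gamma>' \<xi> < \<alpha> n)) \<and> P.prob n (N n) \<le> b n"
      using Nm sep by blast
  qed
  have "b \<longlonglongrightarrow> 0 + C * (5 * 0)"
    unfolding b_def[abs_def] by (intro tendsto_add prob_not_good_rate_tendsto_0 d(1) tendsto_mult tendsto_const tendsto_inverse_0_at_top penalty_at_top)
  then have b_lim: "b \<longlonglongrightarrow> 0" by simp
  have "(\<lambda>n. P.prob n (N n)) \<longlonglongrightarrow> 0"
    by (rule Lim_null_comparison[OF eventually_mono[OF ev] b_lim]) simp
  moreover have "\<forall>\<^sub>F n in sequentially. N n \<in> sets (P n) \<and> (\<forall>\<xi>\<in>space (P n) - N n. \<forall>\<gamma> \<gamma>'. stat n \<gamma> \<xi> - stat n \<gamma>' \<xi> < \<alpha> n)"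
    using ev by (rule eventually_mono) blast
  ultimately show ?thesis by blast
qed

end

section \<open>The selected statistic\<close>

text \<open>The statistic is specified only from n = 2 on, so convergence is first obtained for the
  shifted sequence.\<close>

lemma weak_conv_m_offset:
  assumes "weak_conv_m (\<lambda>n. \<mu> (n + k)) \<nu>"
  shows "weak_conv_m \<mu> \<nu>"
  unfolding weak_conv_m_def weak_conv_def
proof (intro allI impI)
  fix x assume "isCont (cdf \<nu>) x"
  then have "(\<lambda>n. cdf (\<mu> (n + k)) x) \<longlonglongrightarrow> cdf \<nu> x" using assms unfolding weak_conv_m_def weak_conv_def by blast
  then show "(\<lambda>n. cdf (\<mu> n) x) \<longlonglongrightarrow> cdf \<nu> x" by (rule LIMSEQ_offset)
qed

text \<open>The infimum is attained because the superlevel set of a continuous cdf is closed;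
  approaching it from the left gives the reverse inequality.\<close>

lemma (in real_distribution) cdf_quantile:
  assumes cont: "\<And>x. isCont (cdf M) x" and q: "0 < q" "q < 1"
  shows "cdf M (quantile M q) = q"
proof -
  let ?S = "{x. q \<le> cdf M x}"
  have "\<forall>\<^sub>F x in at_top. q < cdf M x" using cdf_lim_at_top_prob q(2) by (rule order_tendstoD)
  then obtain u where "q < cdf M u" unfolding eventually_at_top_linorder by blast
  then have ne: "?S \<noteq> {}" by (auto intro: less_imp_le)
  have "\<forall>\<^sub>F x in at_bot. cdf M x < q" using cdf_lim_at_bot q(1) by (rule order_tendstoD)
  then obtain l where l: "\<And>x. x \<le> l \<Longrightarrow> cdf M x < q" unfolding eventually_at_bot_linorder by blast
  have below: "l \<le> x" if "x \<in> ?S" for x using l[of x] that by (cases "x \<le> l") auto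
  then have bb: "bdd_below ?S" by (rule bdd_belowI)
  have "continuous_on UNIV (cdf M)" using cont by (simp add: continuous_on_eq_continuous_at)
  then have cl: "closed ?S" by (intro closed_Collect_le continuous_on_const)
  let ?z = "quantile M q"
  have z: "?z = Inf ?S" unfolding quantile_def ..
  have "?z \<in> ?S" unfolding z by (rule closed_contains_Inf[OF ne bb cl])
  moreover have "cdf M ?z \<le> q"
  proof (rule tendsto_upperbound)
    show "(cdf M \<longlongrightarrow> cdf M ?z) (at_left ?z)" using cont[of ?z] unfolding isCont_def by (rule tendsto_within_subset) simp
    show "\<forall>\<^sub>F x in at_left ?z. cdf M x \<le> q"
      unfolding eventually_at_left_field
    proof (intro exI[of _ "?z - 1"] conjI allI impI)
      fix x assume "?z - 1 < x" "x < ?z"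
      then have "x \<notin> ?S" using cInf_lower[OF _ bb, of x] unfolding z by auto
      then show "cdf M x \<le> q" by simp
    qed simp
  qed simp
  ultimately show ?thesis by simp
qed

lemma std_normal_distribution_singleton: "measure std_normal_distribution {x} = 0"
proof -
  have "emeasure std_normal_distribution {x} = (\<integral>\<^sup>+y. ennreal (std_normal_density y) * indicator {x} y \<partial>lborel)"
    by (rule emeasure_density) auto
  also have "\<dots> = 0" by (simp add: nn_integral_indicator_singleton)
  finally show ?thesis by (simp add: measure_def)
qed

text \<open>The closed half line has a single boundary point, which is null under the normal law, so
  weak convergence passes to its measure.\<close>

lemma weak_conv_normal_imp_level:
  assumes \<mu>: "\<And>n. real_distribution (\<mu> n)" and conv: "weak_conv_m \<mu> std_normal_distribution" and a: "0 < a" "a < 1"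
  shows "(\<lambda>n. measure (\<mu> n) {quantile std_normal_distribution (1 - a)..}) \<longlonglongrightarrow> a"
proof -
  interpret N: real_distribution std_normal_distribution by (rule real_dist_normal_dist)
  let ?z = "quantile std_normal_distribution (1 - a)"
  have F: "cdf std_normal_distribution ?z = 1 - a"
    using a by (intro N.cdf_quantile) (simp_all add: N.isCont_cdf std_normal_distribution_singleton)
  have "emeasure std_normal_distribution (frontier {?z..}) = 0"
    by (simp add: N.emeasure_eq_measure std_normal_distribution_singleton)
  from weak_conv_imp_continuity_set_conv[OF \<mu> real_dist_normal_dist conv _ this]
  have "(\<lambda>n. measure (\<mu> n) {?z..}) \<longlonglongrightarrow> measure std_normal_distribution {?z..}" by simp
  moreover have "measure std_normal_distribution {?z..} = a"
  proof -
    have "{?z..} = {?z} \<union> (UNIV - {..?z})" by auto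
    then have "measure std_normal_distribution {?z..} = measure std_normal_distribution {?z} + measure std_normal_distribution (UNIV - {..?z})"
      by (simp only:) (rule N.finite_measure_Union, auto)
    also have "measure std_normal_distribution (UNIV - {..?z}) = 1 - measure std_normal_distribution {..?z}"
      using N.prob_compl[of "{..?z}"] by simp
    finally show ?thesis using F by (simp add: std_normal_distribution_singleton cdf_def)
  qed
  ultimately show ?thesis by simp
qed

text \<open>Restricting the first n draws to \<open>{1..n}\<close> gives an extensional point of the
  product space, and independence with a common law makes its distribution the product measure on
  which all previous estimates live.\<close>

lemma (in prob_space) distr_sample:
  assumes indep: "indep_vars (\<lambda>_. S) Z {1..}" and law: "\<And>i. 1 \<le> i \<Longrightarrow> distr M S (Z i) = D" and n: "1 \<le> (n::nat)"
  shows "(\<lambda>\<omega>. \<lambda>i\<in>{1..n}. Z i \<omega>) \<in> M \<rightarrow>\<^sub>M PiM {1..n} (\<lambda>_. D)"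
    and "distr M (PiM {1..n} (\<lambda>_. D)) (\<lambda>\<omega>. \<lambda>i\<in>{1..n}. Z i \<omega>) = PiM {1..n} (\<lambda>_. D)"
proof -
  have Z: "Z i \<in> M \<rightarrow>\<^sub>M S" if "1 \<le> i" for i using indep that unfolding indep_vars_def by auto
  have sets: "sets D = sets S" using law[OF n] sets_distr[of M S "Z n"] by simp
  have setsP: "sets (PiM {1..n} (\<lambda>_. D)) = sets (PiM {1..n} (\<lambda>_. S))" by (intro sets_PiM_cong refl sets)
  have ZD: "Z i \<in> M \<rightarrow>\<^sub>M D" if "1 \<le> i" for i using Z[OF that] unfolding measurable_cong_sets[OF refl sets] .
  show "(\<lambda>\<omega>. \<lambda>i\<in>{1..n}. Z i \<omega>) \<in> M \<rightarrow>\<^sub>M PiM {1..n} (\<lambda>_. D)"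
    by (rule measurable_restrict) (rule ZD, simp)
  have "indep_vars (\<lambda>_. S) Z {1..n}" by (rule indep_vars_subset[OF indep]) auto
  moreover have "{1..n} \<noteq> {}" using n by simp
  ultimately have "distr M (PiM {1..n} (\<lambda>_. S)) (\<lambda>\<omega>. \<lambda>i\<in>{1..n}. Z i \<omega>) = PiM {1..n} (\<lambda>i. distr M S (Z i))"
    using indep_vars_iff_distr_eq_PiM'[where I = "{1..n}" and M' = "\<lambda>_. S" and X = Z] Z by simp
  moreover have "PiM {1..n} (\<lambda>i. distr M S (Z i)) = PiM {1..n} (\<lambda>_. D)" by (rule PiM_cong) (auto intro: law)
  moreover have "distr M (PiM {1..n} (\<lambda>_. S)) (\<lambda>\<omega>. \<lambda>i\<in>{1..n}. Z i \<omega>) = distr M (PiM {1..n} (\<lambda>_. D)) (\<lambda>\<omega>. \<lambda>i\<in>{1..n}. Z i \<omega>)"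
    by (rule distr_cong) (simp_all add: setsP)
  ultimately show "distr M (PiM {1..n} (\<lambda>_. D)) (\<lambda>\<omega>. \<lambda>i\<in>{1..n}. Z i \<omega>) = PiM {1..n} (\<lambda>_. D)" by simp
qed

text \<open>Pairing with \<open>v\<close> commutes with the Bochner integral over each conditioning
  set, so the vector-valued condition becomes a statement about a real conditional expectation, from
  which \<phi>(X) can be pulled out.\<close>

lemma (in prob_space) expectation_mult_inner_eq_0:
  assumes X: "X \<in> M \<rightarrow>\<^sub>M N" and U: "is_cond_exp M (vimage_algebra (space M) X N) U (\<lambda>_. 0)" and \<phi>: "\<phi> \<in> borel_measurable N"
  shows "(\<integral>\<omega>. \<phi> (X \<omega>) * (U \<omega> \<bullet> v) \<partial>M) = 0"
proof (cases "integrable M (\<lambda>\<omega>. \<phi> (X \<omega>) * (U \<omega> \<bullet> v))")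
  case True
  let ?F = "vimage_algebra (space M) X N"
  have sub: "subalgebra M ?F" and Ui: "integrable M U" and Uz: "\<And>A. A \<in> sets ?F \<Longrightarrow> (\<integral>\<omega>\<in>A. U \<omega> \<partial>M) = 0"
    using U unfolding is_cond_exp_def by auto
  interpret F: finite_measure_subalgebra M ?F by unfold_locales (rule sub)
  have inner: "(\<integral>\<omega>\<in>A. (U \<omega> \<bullet> v) \<partial>M) = (\<integral>\<omega>\<in>A. (0::real) \<partial>M)" if A: "A \<in> sets ?F" for A
  proof -
    have AM: "A \<in> sets M" using A sub unfolding subalgebra_def by auto
    have i: "integrable M (\<lambda>\<omega>. indicat_real A \<omega> *\<^sub>R U \<omega>)" using Ui AM by (intro integrable_mult_indicator)
    have "(\<integral>\<omega>\<in>A. (U \<omega> \<bullet> v) \<partial>M) = (\<integral>\<omega>. (indicat_real A \<omega> *\<^sub>R U \<omega>) \<bullet> v \<partial>M)" unfolding set_lebesgue_integral_def by simp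
    also have "\<dots> = (\<integral>\<omega>. indicat_real A \<omega> *\<^sub>R U \<omega> \<partial>M) \<bullet> v" by (rule integral_inner_left) (rule i)
    finally show ?thesis using Uz[OF A] unfolding set_lebesgue_integral_def by simp
  qed
  have "AE \<omega> in M. real_cond_exp M ?F (\<lambda>\<omega>. U \<omega> \<bullet> v) \<omega> = 0"
    by (rule F.real_cond_exp_charact[OF inner]) (use Ui in auto)
  moreover have \<phi>X: "(\<lambda>\<omega>. \<phi> (X \<omega>)) \<in> borel_measurable ?F"
    using \<phi> by (rule measurable_compose[rotated]) (rule measurable_vimage_algebra1, use measurable_space[OF X] in auto)
  moreover have "(\<lambda>\<omega>. U \<omega> \<bullet> v) \<in> borel_measurable M" using Ui by auto
  note F.real_cond_exp_intg(2)[OF True \<phi>X this]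
  moreover have "(\<integral>\<omega>. \<phi> (X \<omega>) * real_cond_exp M ?F (\<lambda>\<omega>. U \<omega> \<bullet> v) \<omega> \<partial>M) = (\<integral>\<omega>. 0 \<partial>M)"
    by (rule integral_cong_AE) (use calculation(1,2) measurable_from_subalg[OF sub \<phi>X] in \<open>auto elim: eventually_mono\<close>)
  ultimately show ?thesis by simp
qed (rule not_integrable_integral_eq)

lemma studentized_Q_cong:
  assumes U: "\<And>i. i \<in> {1..n} \<Longrightarrow> U i = U' i" and X: "\<And>i. i \<in> {1..n} \<Longrightarrow> X i = X' i"
  shows "studentized_Q \<psi> K h p n U X \<gamma> = studentized_Q \<psi> K h p n U' X' \<gamma>"
proof -
  have df: "empirical_df n (\<lambda>k. projection \<psi> p (X k) \<gamma>) i = empirical_df n (\<lambda>k. projection \<psi> p (X' k) \<gamma>) i" if i: "i \<in> {1..n}" for i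
    unfolding empirical_df_def using X i by (intro arg_cong[where f = "\<lambda>A. real (card A) / real n"] Collect_cong conj_cong) auto
  have kw: "kernel_weight \<psi> K h p n X \<gamma> i j = kernel_weight \<psi> K h p n X' \<gamma> i j" if "i \<in> {1..n}" "j \<in> {1..n}" for i j
    unfolding kernel_weight_def df[OF that(1)] df[OF that(2)] ..
  have "Q_stat \<psi> K h p n U X \<gamma> = Q_stat \<psi> K h p n U' X' \<gamma>"
    unfolding Q_stat_def sum_off_diagonal_pairs by (intro arg_cong2[where f = times, OF refl] sum.cong refl) (simp add: U kw)
  moreover have "v2_stat \<psi> K h p n U X \<gamma> = v2_stat \<psi> K h p n U' X' \<gamma>"
    unfolding v2_stat_def sum_off_diagonal_pairs by (intro arg_cong2[where f = times, OF refl] sum.cong refl) (simp add: U kw)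
  ultimately show ?thesis unfolding studentized_Q_def by simp
qed

theorem theorem5:
  fixes M :: "'a measure"
    and U X :: "'a \<Rightarrow> L2"
    and Us Xs :: "nat \<Rightarrow> 'a \<Rightarrow> L2"
    and \<psi> :: "nat \<Rightarrow> L2"
    and K :: "real \<Rightarrow> real"
    and h \<alpha> :: "nat \<Rightarrow> real"
    and p :: "nat \<Rightarrow> nat"
    and b0 :: "nat \<Rightarrow> real"
    and B :: "nat \<Rightarrow> (nat \<Rightarrow> real) set"
    and \<gamma>hat :: "nat \<Rightarrow> 'a \<Rightarrow> nat \<Rightarrow> real"
    and T :: "nat \<Rightarrow> 'a \<Rightarrow> real"
  assumes prob: "prob_space M"
    and basis: "orthonormal_basis \<psi>"
    and centered: "prob_space.expectation M X = 0"
    and b0: "summable (\<lambda>j. (b0 j)\<^sup>2)" "\<And>n. n \<ge> 1 \<Longrightarrow> (\<Sum>j=1..p n. (b0 j)\<^sup>2) > 0"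
    and random_vector: "U \<in> borel_measurable M" "X \<in> borel_measurable M"
    and independent_draws:
      "prob_space.indep_vars M (\<lambda>_. borel \<Otimes>\<^sub>M borel) (\<lambda>i \<omega>. (Us i \<omega>, Xs i \<omega>)) {1..}"
      "\<And>i. i \<ge> 1 \<Longrightarrow> distr M (borel \<Otimes>\<^sub>M borel) (\<lambda>\<omega>. (Us i \<omega>, Xs i \<omega>)) =
         distr M (borel \<Otimes>\<^sub>M borel) (\<lambda>\<omega>. (U \<omega>, X \<omega>))"
    and moment_U: "integrable M (\<lambda>\<omega>. norm (U \<omega>) ^ 8)"
    and exp_moment_X: "\<exists>\<rho>>0. integrable M (\<lambda>\<omega>. exp (\<rho> * norm (X \<omega>)))"
    and continuous_df: "\<And>q \<gamma>. q \<ge> 1 \<Longrightarrow> \<gamma> \<in> unit_sphere q \<Longrightarrow>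
      continuous_on UNIV (cdf (distr M borel (\<lambda>\<omega>. projection \<psi> q (X \<omega>) \<gamma>)))"
    and cond_variance: "\<exists>\<sigma>2>0. \<exists>C1>0. AE \<omega> in M. \<sigma>2 \<le>
      real_cond_exp M (vimage_algebra (space M) (\<lambda>\<omega>. (Xs 1 \<omega>, Xs 2 \<omega>)) (borel \<Otimes>\<^sub>M borel))
        (\<lambda>\<omega>. (Us 1 \<omega> \<bullet> Us 2 \<omega>)\<^sup>2 * of_bool (\<bar>Us 1 \<omega> \<bullet> Us 2 \<omega>\<bar> \<le> C1)) \<omega>"
    and cond_moment: "\<exists>C2>0. \<exists>\<nu>>2. AE \<omega> in M.
      nn_cond_exp M (vimage_algebra (space M) X borel) (\<lambda>\<omega>. ennreal (norm (U \<omega>) powr \<nu>)) \<omega> \<le> ennreal C2"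
    and directions:
      "\<And>q. q \<ge> 1 \<Longrightarrow> (\<Sum>j=1..q. (b0 j)\<^sup>2) > 0 \<Longrightarrow> normalized_direction b0 q \<in> B q"
      "\<And>q. q \<ge> 1 \<Longrightarrow> openin (top_of_set (unit_sphere q)) (B q)"
      "\<And>q q'. 1 \<le> q \<Longrightarrow> q < q' \<Longrightarrow> B q \<subseteq> B q'"
    and kernel: "\<And>x. K x \<ge> 0" "integrable lborel K" "(\<integral>x. K x \<partial>lborel) = 1"
      "continuous_on UNIV K" "\<And>x. K (- x) = K x" "antimono_on {0..} K"
      "integrable lborel (fourier_transform K)"
    and bandwidth: "\<And>n. n \<ge> 1 \<Longrightarrow> h n > 0" "h \<longlonglongrightarrow> 0"
      "filterlim (\<lambda>n. real n * (h n)\<^sup>2) at_top sequentially"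
    and dimension: "\<And>n. n \<ge> 1 \<Longrightarrow> p n \<ge> 1" "\<And>m n. 1 \<le> m \<Longrightarrow> m \<le> n \<Longrightarrow> p m \<le> p n"
      "filterlim p at_top sequentially"
      "\<exists>l>0. Bseq (\<lambda>n. real (p n) * ln (real n) powr (- l))"
    and penalty: "\<And>n. n \<ge> 1 \<Longrightarrow> \<alpha> n > 0"
      "filterlim (\<lambda>n. \<alpha> n / (real (p n) * ln (real n))) at_top sequentially"
    and selection: "\<And>n \<omega>. n \<ge> 2 \<Longrightarrow> \<omega> \<in> space M \<Longrightarrow>
      is_arg_max
        (\<lambda>\<gamma>. studentized_Q \<psi> K (h n) (p n) n (\<lambda>i. Us i \<omega>) (\<lambda>i. Xs i \<omega>) \<gamma>
             - \<alpha> n * of_bool (\<gamma> \<noteq> normalized_direction b0 (p n)))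
        (\<lambda>\<gamma>. \<gamma> \<in> B (p n)) (\<gamma>hat n \<omega>)"
    and T_eq: "\<And>n \<omega>. n \<ge> 2 \<Longrightarrow> \<omega> \<in> space M \<Longrightarrow>
      T n \<omega> = studentized_Q \<psi> K (h n) (p n) n (\<lambda>i. Us i \<omega>) (\<lambda>i. Xs i \<omega>) (\<gamma>hat n \<omega>)"
    and T_measurable: "\<And>n. n \<ge> 2 \<Longrightarrow> T n \<in> borel_measurable M"
    and null_hypothesis: "is_cond_exp M (vimage_algebra (space M) X borel) U (\<lambda>_. 0)"
  shows "weak_conv_m (\<lambda>n. distr M borel (T n)) std_normal_distribution \<and>
    (\<forall>a. 0 < a \<and> a < 1 \<longrightarrow>
      (\<lambda>n. measure M {\<omega> \<in> space M. T n \<omega> \<ge> quantile std_normal_distribution (1 - a)}) \<longlonglongrightarrow> a)"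
proof -
  interpret prob_space M by (rule prob)
  define Z where "Z i \<omega> = (Us i \<omega>, Xs i \<omega>)" for i \<omega>
  define D where "D = distr M (borel \<Otimes>\<^sub>M borel) (\<lambda>\<omega>. (U \<omega>, X \<omega>))"
  have UX: "(\<lambda>\<omega>. (U \<omega>, X \<omega>)) \<in> M \<rightarrow>\<^sub>M borel \<Otimes>\<^sub>M borel" using random_vector by (rule measurable_Pair)
  have sets_D: "sets D = sets (borel \<Otimes>\<^sub>M borel)" unfolding D_def by simp
  have indep: "indep_vars (\<lambda>_. borel \<Otimes>\<^sub>M borel) Z {1..}" unfolding Z_def using independent_draws(1) .
  have law: "distr M (borel \<Otimes>\<^sub>M borel) (Z i) = D" if "1 \<le> i" for i unfolding Z_def D_def by (rule independent_draws(2)[OF that])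
  define R where "R n \<omega> = (\<lambda>i\<in>{1..n}. Z i \<omega>)" for n \<omega>
  let ?P = "\<lambda>n :: nat. PiM {1..n} (\<lambda>_. D)"
  have Rm: "R n \<in> M \<rightarrow>\<^sub>M ?P n" and R_law: "distr M (?P n) (R n) = ?P n" if "1 \<le> n" for n
    unfolding R_def[abs_def] by (rule distr_sample[OF indep law that], assumption)+
  interpret D: prob_space D unfolding D_def by (rule prob_space_distr[OF UX])
  have norm_m: "(\<lambda>z :: L2 \<times> L2. norm (fst z) ^ 8) \<in> borel_measurable (borel \<Otimes>\<^sub>M borel)" by measurable
  interpret C: centered_design D
  proof
    show "sets D = sets (borel \<Otimes>\<^sub>M borel)" by (rule sets_D)
    show "integrable D (\<lambda>z. norm (fst z) ^ 8)" unfolding D_def integrable_distr_eq[OF UX norm_m] using moment_U by simp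
    fix \<phi> :: "L2 \<Rightarrow> real" and v :: L2 assume \<phi>: "\<phi> \<in> borel_measurable borel"
    then have m: "(\<lambda>z :: L2 \<times> L2. \<phi> (snd z) * (fst z \<bullet> v)) \<in> borel_measurable (borel \<Otimes>\<^sub>M borel)" by measurable
    show "(\<integral>z. \<phi> (snd z) * (fst z \<bullet> v) \<partial>D) = 0"
      unfolding D_def integral_distr[OF UX m] fst_conv snd_conv by (rule expectation_mult_inner_eq_0[OF random_vector(2) null_hypothesis \<phi>])
  qed
  \<comment> \<open>The truncated squared inner product is bounded, hence integrable. Its
    conditional expectation is at least \<open>\<sigma>2\<close>, so integrating and dropping the
    truncation bounds the energy below by \<open>\<sigma>2\<close>.\<close>
  have energy: "0 < (\<integral>z. C.sq_inner z \<partial>(D \<Otimes>\<^sub>M D))"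
  proof -
    obtain \<sigma>2 C1 where \<sigma>: "0 < \<sigma>2" "0 < C1" and cv: "AE \<omega> in M. \<sigma>2 \<le>
      real_cond_exp M (vimage_algebra (space M) (\<lambda>\<omega>. (Xs 1 \<omega>, Xs 2 \<omega>)) (borel \<Otimes>\<^sub>M borel))
        (\<lambda>\<omega>. (Us 1 \<omega> \<bullet> Us 2 \<omega>)\<^sup>2 * of_bool (\<bar>Us 1 \<omega> \<bullet> Us 2 \<omega>\<bar> \<le> C1)) \<omega>" using cond_variance by blast
    let ?F = "vimage_algebra (space M) (\<lambda>\<omega>. (Xs 1 \<omega>, Xs 2 \<omega>)) (borel \<Otimes>\<^sub>M borel)"
    let ?f = "\<lambda>\<omega>. (Us 1 \<omega> \<bullet> Us 2 \<omega>)\<^sup>2 * of_bool (\<bar>Us 1 \<omega> \<bullet> Us 2 \<omega>\<bar> \<le> C1)"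
    have Zm: "Z i \<in> M \<rightarrow>\<^sub>M borel \<Otimes>\<^sub>M borel" if "1 \<le> i" for i using indep that unfolding indep_vars_def by auto
    have Um: "Us i \<in> borel_measurable M" and Xm: "Xs i \<in> borel_measurable M" if "1 \<le> i" for i
      using measurable_compose[OF Zm[OF that] measurable_fst] measurable_compose[OF Zm[OF that] measurable_snd] unfolding Z_def by simp_all
    have XX: "(\<lambda>\<omega>. (Xs 1 \<omega>, Xs 2 \<omega>)) \<in> M \<rightarrow>\<^sub>M borel \<Otimes>\<^sub>M borel" using Xm[of 1] Xm[of 2] by (intro measurable_Pair) auto
    have sub: "subalgebra M ?F"
      unfolding subalgebra_def using sets_vimage_algebra_space[of "space M"] measurable_iff_sets[of "\<lambda>\<omega>. (Xs 1 \<omega>, Xs 2 \<omega>)" M "borel \<Otimes>\<^sub>M borel"] XX by simp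
    interpret F: finite_measure_subalgebra M ?F by unfold_locales (rule sub)
    have gm: "(\<lambda>\<omega>. Us 1 \<omega> \<bullet> Us 2 \<omega>) \<in> borel_measurable M" using Um[of 1] Um[of 2] by simp
    have f_le: "?f \<omega> \<le> C1\<^sup>2" for \<omega>
      using power_mono[of "\<bar>Us 1 \<omega> \<bullet> Us 2 \<omega>\<bar>" C1 2] by (cases "\<bar>Us 1 \<omega> \<bullet> Us 2 \<omega>\<bar> \<le> C1") simp_all
    have fi: "integrable M ?f"
      by (rule integrable_const_bound[where B = "C1\<^sup>2"]) (use gm f_le in auto)
    have "\<sigma>2 = (\<integral>\<omega>. \<sigma>2 \<partial>M)" by (simp add: prob_space)
    also have "\<dots> \<le> (\<integral>\<omega>. real_cond_exp M ?F ?f \<omega> \<partial>M)"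
      using cv F.real_cond_exp_int(1)[OF fi] by (intro integral_mono_AE) auto
    also have "\<dots> = (\<integral>\<omega>. ?f \<omega> \<partial>M)" by (rule F.real_cond_exp_int(2)[OF fi])
    also have "\<dots> \<le> (\<integral>\<omega>. (Us 1 \<omega> \<bullet> Us 2 \<omega>)\<^sup>2 \<partial>M)"
    proof (rule integral_mono[OF fi])
      have "integrable (?P 2) (\<lambda>\<xi>. C.sq_inner (\<xi> 1, \<xi> 2))"
        using C.pair_integral(1)[of 1 2 2, OF _ _ _ C.sq_inner_measurable] C.integrable_sq_inner(1) by simp
      then have "integrable M (\<lambda>\<omega>. C.sq_inner (R 2 \<omega> 1, R 2 \<omega> 2))"
        by (intro integrable_distr[OF Rm[of 2]]) (simp_all add: R_law)
      then show "integrable M (\<lambda>\<omega>. (Us 1 \<omega> \<bullet> Us 2 \<omega>)\<^sup>2)" by (simp add: C.sq_inner_def Z_def R_def)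
    qed (simp add: mult_left_le)
    also have "\<dots> = (\<integral>z. C.sq_inner z \<partial>(D \<Otimes>\<^sub>M D))"
    proof -
      have "(\<integral>z. C.sq_inner z \<partial>(D \<Otimes>\<^sub>M D)) = (\<integral>\<xi>. C.sq_inner (\<xi> 1, \<xi> 2) \<partial>distr M (?P 2) (R 2))"
        using C.pair_integral(2)[of 1 2 2, OF _ _ _ C.sq_inner_measurable] R_law[of 2] by simp
      also have "\<dots> = (\<integral>\<omega>. C.sq_inner (R 2 \<omega> 1, R 2 \<omega> 2) \<partial>M)"
      proof (rule integral_distr)
        show "R 2 \<in> M \<rightarrow>\<^sub>M ?P 2" by (rule Rm) simp
        show "(\<lambda>\<xi>. C.sq_inner (\<xi> 1, \<xi> 2)) \<in> borel_measurable (?P 2)"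
          by (intro measurable_compose[OF _ C.sq_inner_measurable] measurable_Pair C.component_measurable)
      qed
      finally show ?thesis by (simp add: C.sq_inner_def Z_def R_def)
    qed
    finally show ?thesis using \<sigma>(1) by linarith
  qed
  interpret A: asymptotic_design D K \<psi> h \<alpha> p
    by unfold_locales (use kernel bandwidth dimension(1) penalty energy in auto)
  let ?\<gamma>0 = "\<lambda>n. normalized_direction b0 (p n)"
  have stat: "studentized_Q \<psi> K (h n) (p n) n (\<lambda>i. Us i \<omega>) (\<lambda>i. Xs i \<omega>) \<gamma> = A.stat n \<gamma> (R n \<omega>)" if n: "2 \<le> n" for n \<omega> \<gamma>
  proof -
    have "studentized_Q \<psi> K (h n) (p n) n (\<lambda>i. Us i \<omega>) (\<lambda>i. Xs i \<omega>) \<gamma> =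
        studentized_Q \<psi> K (h n) (p n) n (\<lambda>k. fst (R n \<omega> k)) (\<lambda>k. snd (R n \<omega> k)) \<gamma>"
      by (rule studentized_Q_cong) (simp_all add: R_def Z_def)
    also have "\<dots> = A.stat n \<gamma> (R n \<omega>)" using n bandwidth(1)[of n] by (intro A.studentized_Q_eq) auto
    finally show ?thesis .
  qed
  obtain N where N: "\<forall>\<^sub>F n in sequentially. N n \<in> sets (?P n) \<and>
      (\<forall>\<xi>\<in>space (?P n) - N n. \<forall>\<gamma> \<gamma>'. A.stat n \<gamma> \<xi> - A.stat n \<gamma>' \<xi> < \<alpha> n)"
    and N_lim: "(\<lambda>n. measure (?P n) (N n)) \<longlonglongrightarrow> 0" using A.ex_exceptional_sets by blast
  have char_lim: "(\<lambda>n. \<integral>\<omega>. iexp (t * T n \<omega>) \<partial>M) \<longlonglongrightarrow> of_real (exp (- (t\<^sup>2 / 2)))" for t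
  proof -
    have "\<forall>\<^sub>F n in sequentially. cmod ((\<integral>\<omega>. iexp (t * T n \<omega>) \<partial>M) - (\<integral>\<xi>. iexp (t * A.stat n (?\<gamma>0 n) \<xi>) \<partial>?P n)) \<le> 2 * measure (?P n) (N n)"
      using N eventually_ge_at_top[of 2]
    proof eventually_elim
      fix n :: nat
      assume Nn: "N n \<in> sets (?P n) \<and> (\<forall>\<xi>\<in>space (?P n) - N n. \<forall>\<gamma> \<gamma>'. A.stat n \<gamma> \<xi> - A.stat n \<gamma>' \<xi> < \<alpha> n)" and n: "2 \<le> n"
      have n1: "1 \<le> n" using n by simp
      have sm: "A.stat n (?\<gamma>0 n) \<in> borel_measurable (?P n)" by (rule A.studentized_measurable[OF n1 bandwidth(1)[OF n1]])
      have im: "(\<lambda>x. iexp (t * x)) \<in> borel_measurable borel" by measurable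
      have "(\<lambda>\<omega>. A.stat n (?\<gamma>0 n) (R n \<omega>)) \<in> borel_measurable M" by (rule measurable_compose[OF Rm[OF n1] sm])
      moreover have "Measurable.pred M (\<lambda>\<omega>. R n \<omega> \<in> N n)" using Nn by (intro pred_sets2[OF _ Rm[OF n1]]) simp
      \<comment> \<open>Off the exceptional set no direction beats the true one by \<alpha>, so the
        penalty excludes every other maximiser and the statistics coincide. No measurability of the
        selected direction enters.\<close>
      moreover have "\<bar>T n \<omega> - A.stat n (?\<gamma>0 n) (R n \<omega>)\<bar> \<le> 0" if \<omega>: "\<omega> \<in> space M" "R n \<omega> \<notin> N n" for \<omega>
      proof -
        have "?\<gamma>0 n \<in> B (p n)" by (rule directions(1)[OF dimension(1)[OF n1] b0(2)[OF n1]])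
        then have "\<not> (A.stat n (\<gamma>hat n \<omega>) (R n \<omega>) - \<alpha> n * of_bool (\<gamma>hat n \<omega> \<noteq> ?\<gamma>0 n) < A.stat n (?\<gamma>0 n) (R n \<omega>) - \<alpha> n * of_bool (?\<gamma>0 n \<noteq> ?\<gamma>0 n))"
          using selection[OF n \<omega>(1)] unfolding is_arg_max_def stat[OF n] by blast
        moreover have "A.stat n (\<gamma>hat n \<omega>) (R n \<omega>) - A.stat n (?\<gamma>0 n) (R n \<omega>) < \<alpha> n"
          using Nn \<omega>(2) measurable_space[OF Rm[OF n1] \<omega>(1)] by blast
        ultimately have "\<gamma>hat n \<omega> = ?\<gamma>0 n" by (cases "\<gamma>hat n \<omega> = ?\<gamma>0 n") simp_all
        then show ?thesis using T_eq[OF n \<omega>(1)] unfolding stat[OF n] by simp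
      qed
      ultimately have "cmod ((\<integral>\<omega>. iexp (t * T n \<omega>) \<partial>M) - (\<integral>\<omega>. iexp (t * A.stat n (?\<gamma>0 n) (R n \<omega>)) \<partial>M)) \<le>
          2 * prob {\<omega> \<in> space M. R n \<omega> \<in> N n} + \<bar>t\<bar> * (\<integral>\<omega>. 0 \<partial>M)"
        by (intro cmod_expectation_iexp_diff_le T_measurable[OF n]) auto
      also have "prob {\<omega> \<in> space M. R n \<omega> \<in> N n} = measure (distr M (?P n) (R n)) (N n)"
        using Nn by (subst measure_distr[OF Rm[OF n1]]) (auto intro!: arg_cong[where f = prob])
      also have "(\<integral>\<omega>. iexp (t * A.stat n (?\<gamma>0 n) (R n \<omega>)) \<partial>M) = (\<integral>\<xi>. iexp (t * A.stat n (?\<gamma>0 n) \<xi>) \<partial>distr M (?P n) (R n))"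
        by (rule integral_distr[OF Rm[OF n1] measurable_compose[OF sm im], symmetric])
      finally show "cmod ((\<integral>\<omega>. iexp (t * T n \<omega>) \<partial>M) - (\<integral>\<xi>. iexp (t * A.stat n (?\<gamma>0 n) \<xi>) \<partial>?P n)) \<le> 2 * measure (?P n) (N n)"
        unfolding R_law[OF n1] by simp
    qed
    moreover have "(\<lambda>n. 2 * measure (?P n) (N n)) \<longlonglongrightarrow> 0" using tendsto_mult[OF tendsto_const N_lim, of 2] by simp
    ultimately have "(\<lambda>n. (\<integral>\<omega>. iexp (t * T n \<omega>) \<partial>M) - (\<integral>\<xi>. iexp (t * A.stat n (?\<gamma>0 n) \<xi>) \<partial>?P n)) \<longlonglongrightarrow> 0"
      by (rule Lim_null_comparison)
    from tendsto_add[OF this A.characteristic_function_stat_tendsto[of t ?\<gamma>0]] show ?thesis by simp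
  qed
  let ?\<mu> = "\<lambda>n. distr M borel (T n)"
  \<comment> \<open>The shift by 2 skips the sample sizes for which nothing is assumed about
    \<open>T\<close>.\<close>
  have Tm: "T (n + 2) \<in> borel_measurable M" for n by (rule T_measurable) simp
  have rd: "real_distribution (?\<mu> (n + 2))" for n by (rule real_distribution_distr[OF Tm])
  have conv: "weak_conv_m (\<lambda>n. ?\<mu> (n + 2)) std_normal_distribution"
  proof (rule levy_continuity[OF rd real_dist_normal_dist])
    fix t
    have "char (?\<mu> (n + 2)) t = (\<integral>\<omega>. iexp (t * T (n + 2) \<omega>) \<partial>M)" for n
      unfolding char_def by (rule integral_distr[OF Tm]) measurable
    then show "(\<lambda>n. char (?\<mu> (n + 2)) t) \<longlonglongrightarrow> char std_normal_distribution t"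
      using LIMSEQ_ignore_initial_segment[OF char_lim, of t 2] by (simp add: char_std_normal_distribution)
  qed
  show ?thesis
  proof (intro conjI allI impI)
    show "weak_conv_m ?\<mu> std_normal_distribution" by (rule weak_conv_m_offset[OF conv])
    fix a :: real assume a: "0 < a \<and> a < 1"
    let ?z = "quantile std_normal_distribution (1 - a)"
    have "measure (?\<mu> (n + 2)) {?z..} = measure M {\<omega> \<in> space M. ?z \<le> T (n + 2) \<omega>}" for n
      by (subst measure_distr[OF Tm]) (auto intro!: arg_cong[where f = "measure M"])
    moreover have "(\<lambda>n. measure (?\<mu> (n + 2)) {?z..}) \<longlonglongrightarrow> a"
      by (rule weak_conv_normal_imp_level[OF rd conv]) (use a in simp_all)
    ultimately have "(\<lambda>n. measure M {\<omega> \<in> space M. ?z \<le> T (n + 2) \<omega>}) \<longlonglongrightarrow> a" by (simp only:)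
    then show "(\<lambda>n. measure M {\<omega> \<in> space M. T n \<omega> \<ge> ?z}) \<longlonglongrightarrow> a" by (rule LIMSEQ_offset)
  qed
qed

end
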